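(* Let $E\in\mathscr K$ with endpoints $l=\inf E$, $r=\sup E$, $\mu$ a fully supported Radon measure on $E$, and $({\mathscr E},{\mathscr F})$ the Dirichlet form on $L^2(E,\mu)$ associated with a quasidiffusion on $E$: \[ {\mathscr F}=\{f\in L^2(E,\mu)\cap H^1_e(E): f(j)=0 \text{ whenever } j\notin E \text{ and } |j|<\infty \text{ for } j=l \text{ or } r\}, \] \[ {\mathscr E}(f,g)=\frac12\int_E f'(x)g'(x)\,dx+\frac12\sum_{k\ge1}\frac{(f(b_k)-f(a_k))(g(b_k)-g(a_k))}{b_k-a_k}. \] Then $({\mathscr E},{\mathscr F})$ has no proper Fukushima subspaces if and only if $E$ has zero Lebesgue measure.
   Context: $\mathscr K$ is the family of $E\subset\mathbb R$ such that $E\cup\{l,r\}$ is closed in $[-\infty,\infty]$, where $l=\inf E<r=\sup E$. $I$ is the interval with endpoints $l,r$ containing $l$ (resp. $r$) iff it belongs to $E$; $I\setminus E=\bigcup_{k\ge1}(a_k,b_k)$ disjoint open intervals. $H^1_e(E)$ is the set of restrictions to $E$ of absolutely continuous $f$ on $(l,r)$ with $f'\in L^2((l,r))$; $f(j)$ at an endpoint means the limit. A Fukushima subspace of $({\mathscr E},{\mathscr F})$ is a regular Dirichlet form $({\mathscr E}',{\mathscr F}')$ on $L^2(E,\mu)$ with ${\mathscr F}'\subset{\mathscr F}$ and ${\mathscr E}'(f,g)={\mathscr E}(f,g)$ for $f,g\in{\mathscr F}'$; it is proper if ${\mathscr F}'\neq{\mathscr F}$. *)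

theory Defs
  imports "HOL-Analysis.Analysis"
begin

definition lft :: "real set \<Rightarrow> ereal" where "lft E = Inf (ereal ` E)"
definition rgt :: "real set \<Rightarrow> ereal" where "rgt E = Sup (ereal ` E)"

definition class_K :: "real set \<Rightarrow> bool" where
  "class_K E \<longleftrightarrow> lft E < rgt E \<and> closed (ereal ` E \<union> {lft E, rgt E})"

definition open_lr :: "ereal \<Rightarrow> ereal \<Rightarrow> real set" where
  "open_lr l r = {x. l < ereal x \<and> ereal x < r}"

definition Ival :: "real set \<Rightarrow> real set" where
  "Ival E = {x. (lft E < ereal x \<or> x \<in> E) \<and> (ereal x < rgt E \<or> x \<in> E)}"

definition gaps :: "real set \<Rightarrow> (real \<times> real) set" where
  "gaps E = {(a, b). a < b \<and> {a<..<b} \<in> components (Ival E - E)}"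

definition abs_cont_on :: "real set \<Rightarrow> (real \<Rightarrow> real) \<Rightarrow> bool" where
  "abs_cont_on S f \<longleftrightarrow>
    (\<forall>\<epsilon>>0. \<exists>\<delta>>0. \<forall>(n::nat) (a::nat\<Rightarrow>real) b.
       (\<forall>i<n. a i \<le> b i \<and> {a i..b i} \<subseteq> S) \<and>
       (\<forall>i<n. \<forall>j<n. i \<noteq> j \<longrightarrow> {a i<..<b i} \<inter> {a j<..<b j} = {}) \<and>
       (\<Sum>i<n. b i - a i) < \<delta>
       \<longrightarrow> (\<Sum>i<n. \<bar>f (b i) - f (a i)\<bar>) < \<epsilon>)"

definition ac_L2 :: "ereal \<Rightarrow> ereal \<Rightarrow> (real \<Rightarrow> real) \<Rightarrow> (real \<Rightarrow> real) \<Rightarrow> bool" where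
  "ac_L2 l r f h \<longleftrightarrow>
     (\<forall>x y. {x..y} \<subseteq> open_lr l r \<longrightarrow> abs_cont_on {x..y} f) \<and>
     (AE x in lborel. x \<in> open_lr l r \<longrightarrow> (f has_real_derivative h x) (at x)) \<and>
     set_borel_measurable lborel (open_lr l r) h \<and>
     set_integrable lborel (open_lr l r) (\<lambda>x. (h x)\<^sup>2) \<and>
     (\<forall>a. l = ereal a \<longrightarrow> (f \<longlongrightarrow> f a) (at_right a)) \<and>
     (\<forall>b. r = ereal b \<longrightarrow> (f \<longlongrightarrow> f b) (at_left b))"

definition H1e :: "real set \<Rightarrow> (real \<Rightarrow> real) set" where
  "H1e E = {g. \<exists>f h. ac_L2 (lft E) (rgt E) f h \<and> (\<forall>x\<in>E. g x = f x)}"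

section \<open>Measures and L^2 (elements of L^2 represented by functions, up to mu-a.e. equality)\<close>

definition radon_on :: "real set \<Rightarrow> real measure \<Rightarrow> bool" where
  "radon_on E \<mu> \<longleftrightarrow> sets \<mu> = sets borel \<and> emeasure \<mu> (UNIV - E) = 0 \<and>
     (\<forall>K. compact K \<and> K \<subseteq> E \<longrightarrow> emeasure \<mu> K < \<infinity>)"

definition full_support :: "real set \<Rightarrow> real measure \<Rightarrow> bool" where
  "full_support E \<mu> \<longleftrightarrow> (\<forall>x\<in>E. \<forall>U. open U \<and> x \<in> U \<longrightarrow> emeasure \<mu> (U \<inter> E) > 0)"

definition L2 :: "real measure \<Rightarrow> (real \<Rightarrow> real) set" where
  "L2 \<mu> = {f. f \<in> borel_measurable \<mu> \<and> integrable \<mu> (\<lambda>x. (f x)\<^sup>2)}"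

definition E1 :: "real measure \<Rightarrow> ((real \<Rightarrow> real) \<Rightarrow> (real \<Rightarrow> real) \<Rightarrow> real) \<Rightarrow> (real \<Rightarrow> real) \<Rightarrow> real" where
  "E1 \<mu> \<E> f = \<E> f f + (\<integral>x. (f x)\<^sup>2 \<partial>\<mu>)"

definition Cc :: "real set \<Rightarrow> (real \<Rightarrow> real) set" where
  "Cc E = {f. continuous_on E f \<and> (\<exists>K. compact K \<and> K \<subseteq> E \<and> (\<forall>x\<in>E - K. f x = 0))}"

text \<open>A Dirichlet form on L^2(E,mu): domain F is a mu-a.e.-saturated set of L^2 functions
  (i.e. a set of L^2 classes), the form is well defined on classes, symmetric, bilinear,
  nonnegative, densely defined, closed and Markovian (unit contraction operates).\<close>
definition dirichlet_form ::
  "real measure \<Rightarrow> ((real \<Rightarrow> real) \<Rightarrow> (real \<Rightarrow> real) \<Rightarrow> real) \<Rightarrow> (real \<Rightarrow> real) set \<Rightarrow> bool" where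
  "dirichlet_form \<mu> \<E> \<F> \<longleftrightarrow>
     \<F> \<subseteq> L2 \<mu> \<and>
     (\<forall>f\<in>\<F>. \<forall>g\<in>L2 \<mu>. (AE x in \<mu>. f x = g x) \<longrightarrow> g \<in> \<F>) \<and>
     (\<forall>f\<in>\<F>. \<forall>f'\<in>\<F>. \<forall>g\<in>\<F>. (AE x in \<mu>. f x = f' x) \<longrightarrow> \<E> f g = \<E> f' g) \<and>
     (\<lambda>x. 0) \<in> \<F> \<and>
     (\<forall>f\<in>\<F>. \<forall>g\<in>\<F>. (\<lambda>x. f x + g x) \<in> \<F>) \<and>
     (\<forall>f\<in>\<F>. \<forall>c. (\<lambda>x. c * f x) \<in> \<F>) \<and>
     (\<forall>f\<in>\<F>. \<forall>g\<in>\<F>. \<E> f g = \<E> g f) \<and>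
     (\<forall>f\<in>\<F>. \<forall>g\<in>\<F>. \<forall>h\<in>\<F>. \<E> (\<lambda>x. f x + g x) h = \<E> f h + \<E> g h) \<and>
     (\<forall>f\<in>\<F>. \<forall>g\<in>\<F>. \<forall>c. \<E> (\<lambda>x. c * f x) g = c * \<E> f g) \<and>
     (\<forall>f\<in>\<F>. \<E> f f \<ge> 0) \<and>
     (\<forall>f\<in>L2 \<mu>. \<forall>\<epsilon>>0. \<exists>g\<in>\<F>. (\<integral>x. (f x - g x)\<^sup>2 \<partial>\<mu>) < \<epsilon>) \<and>
     (\<forall>u::nat \<Rightarrow> real \<Rightarrow> real. (\<forall>n. u n \<in> \<F>) \<and>
        (\<forall>\<epsilon>>0. \<exists>N. \<forall>n\<ge>N. \<forall>m\<ge>N. E1 \<mu> \<E> (\<lambda>x. u n x - u m x) < \<epsilon>)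
        \<longrightarrow> (\<exists>v\<in>\<F>. (\<lambda>n. E1 \<mu> \<E> (\<lambda>x. u n x - v x)) \<longlonglongrightarrow> 0)) \<and>
     (\<forall>f\<in>\<F>. (\<lambda>x. min 1 (max 0 (f x))) \<in> \<F> \<and>
        \<E> (\<lambda>x. min 1 (max 0 (f x))) (\<lambda>x. min 1 (max 0 (f x))) \<le> \<E> f f)"

definition regular_dirichlet_form ::
  "real set \<Rightarrow> real measure \<Rightarrow> ((real \<Rightarrow> real) \<Rightarrow> (real \<Rightarrow> real) \<Rightarrow> real) \<Rightarrow> (real \<Rightarrow> real) set \<Rightarrow> bool" where
  "regular_dirichlet_form E \<mu> \<E> \<F> \<longleftrightarrow> dirichlet_form \<mu> \<E> \<F> \<and>
     (\<forall>f\<in>\<F>. \<forall>\<epsilon>>0. \<exists>g\<in>\<F> \<inter> Cc E. E1 \<mu> \<E> (\<lambda>x. f x - g x) < \<epsilon>) \<and>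
     (\<forall>f\<in>Cc E. \<forall>\<epsilon>>0. \<exists>g\<in>\<F> \<inter> Cc E. \<forall>x\<in>E. \<bar>f x - g x\<bar> < \<epsilon>)"

definition fukushima_subspace ::
  "real set \<Rightarrow> real measure \<Rightarrow> ((real \<Rightarrow> real) \<Rightarrow> (real \<Rightarrow> real) \<Rightarrow> real) \<Rightarrow> (real \<Rightarrow> real) set
    \<Rightarrow> ((real \<Rightarrow> real) \<Rightarrow> (real \<Rightarrow> real) \<Rightarrow> real) \<Rightarrow> (real \<Rightarrow> real) set \<Rightarrow> bool" where
  "fukushima_subspace E \<mu> \<E> \<F> \<E>' \<F>' \<longleftrightarrow>
     regular_dirichlet_form E \<mu> \<E>' \<F>' \<and> \<F>' \<subseteq> \<F> \<and> (\<forall>f\<in>\<F>'. \<forall>g\<in>\<F>'. \<E>' f g = \<E> f g)"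

definition proper_fukushima_subspace where
  "proper_fukushima_subspace E \<mu> \<E> \<F> \<E>' \<F>' \<longleftrightarrow>
     fukushima_subspace E \<mu> \<E> \<F> \<E>' \<F>' \<and> \<F>' \<noteq> \<F>"

definition qd_domain :: "real set \<Rightarrow> real measure \<Rightarrow> (real \<Rightarrow> real) set" where
  "qd_domain E \<mu> = {f \<in> L2 \<mu>. \<exists>F h. ac_L2 (lft E) (rgt E) F h \<and> (AE x in \<mu>. f x = F x) \<and>
      (\<forall>a. lft E = ereal a \<and> a \<notin> E \<longrightarrow> F a = 0) \<and>
      (\<forall>b. rgt E = ereal b \<and> b \<notin> E \<longrightarrow> F b = 0)}"

definition qd_rep :: "real set \<Rightarrow> real measure \<Rightarrow> (real \<Rightarrow> real) \<Rightarrow> (real \<Rightarrow> real) \<times> (real \<Rightarrow> real)" where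
  "qd_rep E \<mu> f = (SOME (F, h). ac_L2 (lft E) (rgt E) F h \<and> (AE x in \<mu>. f x = F x))"

definition qd_form :: "real set \<Rightarrow> real measure \<Rightarrow> (real \<Rightarrow> real) \<Rightarrow> (real \<Rightarrow> real) \<Rightarrow> real" where
  "qd_form E \<mu> f g =
     (let F = fst (qd_rep E \<mu> f); F' = snd (qd_rep E \<mu> f);
          G = fst (qd_rep E \<mu> g); G' = snd (qd_rep E \<mu> g)
      in (1/2) * (LINT x:E|lborel. F' x * G' x) +
         (1/2) * (\<Sum>\<^sub>\<infinity>p\<in>gaps E. (F (snd p) - F (fst p)) * (G (snd p) - G (fst p)) / (snd p - fst p)))"

end

theory Submission
  imports Defs
begin

text \<open>Suppose \<open>E\<close> is null, and let a Fukushima subspace be given. Truncating a uniform approximant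
  of the indicator of \<open>E \<inter> [c, d]\<close> with \<open>c, d \<notin> E\<close> recovers that indicator exactly, so the subspace
  contains all step functions jumping inside gaps. The form only sees the increments over the gaps,
  so a continuous function in the domain with compact support is the limit, in form and \<open>L\<^sup>2\<close>,
  of step functions jumping over finitely many gaps; cutting off near the ends and closedness then
  give the whole domain. If \<open>E\<close> is not null, remove from \<open>E \<inter> [\<alpha>, \<beta>]\<close> an open dense set of small measure.
  This leaves a set \<open>B\<close> of positive measure whose complement has positive measure in every interval.
  The functions in the domain whose derivative vanishes almost everywhere on \<open>B\<close> form a proper subspace,
  and it is regular because they include a strictly increasing function.\<close>

section \<open>Integrals over intervals\<close>

text \<open>The definitions use epsilon-delta absolute continuity with an almost-everywhere
  derivative, and \<open>qd_form\<close> evaluates a representative picked by \<open>SOME\<close>.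
  The first is traded for \<open>H1_on\<close>, where a function is the integral of its derivative;
  crossing over needs the fundamental theorem of calculus for absolutely continuous functions (a
  gauge argument) one way and Lebesgue differentiation (Vitali covering) the other. The second is
  harmless: by full support all representatives agree on \<open>E\<close>, so their derivatives
  agree almost everywhere on \<open>E\<close>, and only the behaviour inside gaps is free. Making it
  affine there turns the form into half the L2 product of the derivatives, and completeness and
  contraction become statements about L2. The set \<open>B\<close> is kept in a compact interval
  inside (l, r) so that functions can be cut off near the ends along slopes that avoid
  \<open>B\<close> and hence stay in \<open>dom B\<close>. Positive measure off \<open>B\<close> in
  every interval lets the integral of the indicator of the complement of \<open>B\<close> separate
  points, as Stone-Weierstrass requires.\<close>

lemma set_integrable_of_integrable:
  fixes f :: "'a \<Rightarrow> real"
  shows "integrable M f \<Longrightarrow> A \<in> sets M \<Longrightarrow> set_integrable M A f"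
  unfolding set_integrable_def by (rule integrable_mult_indicator)

lemma set_integrable_Icc_of_square:
  fixes h :: "real \<Rightarrow> real"
  assumes [measurable]: "h \<in> borel_measurable borel" and "integrable lborel (\<lambda>x. (h x)\<^sup>2)"
  shows "set_integrable lborel {x..y} h"
proof -
  have "integrable lborel (\<lambda>z. indicator {x..y} z + (h z)\<^sup>2)"
    using assms(2) by (intro Bochner_Integration.integrable_add integrable_real_indicator) (auto simp: emeasure_lborel_Icc_eq)
  then show ?thesis
    unfolding set_integrable_def
  proof (rule Bochner_Integration.integrable_bound)
    have "\<bar>h z\<bar> \<le> 1 + (h z)\<^sup>2" for z
      using sum_squares_bound[of 1 "\<bar>h z\<bar>"] by auto
    then show "AE z in lborel. norm (indicator {x..y} z *\<^sub>R h z) \<le> norm (indicator {x..y} z + (h z)\<^sup>2)"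
      by (auto simp: indicator_def)
  qed auto
qed

lemma set_integral_Icc_add:
  fixes h :: "real \<Rightarrow> real"
  assumes "\<And>x y. set_integrable lborel {x..y} h" "x \<le> y" "y \<le> z"
  shows "(LINT t:{x..z}|lborel. h t) = (LINT t:{x..y}|lborel. h t) + (LINT t:{y..z}|lborel. h t)"
proof -
  have "(LINT t:{x..z}|lborel. h t) = (LINT t:{x..y}|lborel. h t) + (LINT t:{y<..z}|lborel. h t)"
    using assms by (subst set_integral_Un[symmetric]) 
      (auto intro: set_integrable_subset[of lborel "{y..z}"] simp: ivl_disj_un)
  also have "(LINT t:{y<..z}|lborel. h t) = (LINT t:{y..z}|lborel. h t)"
    unfolding set_lebesgue_integral_def
  proof (intro integral_cong_AE)
    show "AE t in lborel. indicat_real {y<..z} t *\<^sub>R h t = indicat_real {y..z} t *\<^sub>R h t"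
      using AE_lborel_singleton[of y] by (auto simp: indicator_def elim!: eventually_mono)
    show "(\<lambda>t. indicat_real {y<..z} t *\<^sub>R h t) \<in> borel_measurable lborel"
      using set_integrable_subset[OF assms(1)[of y z], of "{y<..z}"] greaterThanAtMost_subseteq_atLeastAtMost_iff
      by (auto simp: set_integrable_def subset_eq)
  qed (use assms(1)[of y z] in \<open>auto simp: set_integrable_def\<close>)
  finally show ?thesis .
qed

lemma set_integral_singleton [simp]: "(LINT t:{x::real}|lborel. h t :: real) = 0"
  using AE_lborel_singleton[of x]
  by (auto simp: set_lebesgue_integral_def indicator_def intro!: integral_eq_zero_AE elim!: eventually_mono)

text \<open>Cauchy-Schwarz against the constant 1. Expanding the nonnegative integral of
  \<open>(h t - c)\<^sup>2\<close>, with \<open>c\<close> the mean of \<open>h\<close> over the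
  interval, leaves exactly the defect of the inequality, up to the factor
  \<open>y - x\<close>.\<close>

lemma set_integral_Icc_square_le:
  fixes h :: "real \<Rightarrow> real"
  assumes [measurable]: "h \<in> borel_measurable borel" and h2: "integrable lborel (\<lambda>x. (h x)\<^sup>2)" and "x \<le> y"
  shows "(LINT t:{x..y}|lborel. h t)\<^sup>2 \<le> (y - x) * (LINT t:{x..y}|lborel. (h t)\<^sup>2)"
proof (cases "x = y")
  case False
  then have "x < y" using assms by simp
  define I where "I = (LINT t:{x..y}|lborel. h t)"
  define B where "B = (LINT t:{x..y}|lborel. (h t)\<^sup>2)"
  define c where "c = I / (y - x)"
  have i1: "set_integrable lborel {x..y} h" using set_integrable_Icc_of_square assms by blast
  have i2: "set_integrable lborel {x..y} (\<lambda>t. (h t)\<^sup>2)" using h2 by (rule set_integrable_of_integrable) simp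
  have i3: "set_integrable lborel {x..y} (\<lambda>t. c\<^sup>2)" using integrable_real_indicator[of "{x..y}" lborel] by (simp add: set_integrable_def emeasure_lborel_Icc_eq)
  have "0 \<le> (LINT t:{x..y}|lborel. (h t - c)\<^sup>2)" by (simp add: set_lebesgue_integral_def)
  also have "\<dots> = (LINT t:{x..y}|lborel. (h t)\<^sup>2 - 2 * c * h t + c\<^sup>2)"
    by (simp add: power2_diff algebra_simps)
  also have "\<dots> = B - 2 * c * I + c\<^sup>2 * (y - x)"
    using i1 i2 i3 \<open>x < y\<close> by (simp add: B_def I_def set_integral_add set_integral_diff set_integral_const)
  finally have "0 \<le> (B - 2 * c * I + c\<^sup>2 * (y - x)) * (y - x)" using \<open>x < y\<close> by simp
  also have "\<dots> = B * (y - x) - I\<^sup>2"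
  proof -
    have "c * (y - x) = I" using \<open>x < y\<close> by (simp add: c_def)
    moreover have "(B - 2 * c * I + c\<^sup>2 * (y - x)) * (y - x) = B * (y - x) - 2 * I * (c * (y - x)) + (c * (y - x))\<^sup>2"
      by algebra
    ultimately show ?thesis by (simp add: power2_eq_square)
  qed
  finally show ?thesis by (simp add: I_def B_def mult.commute)
qed simp

lemma set_integral_Icc_eq_Ioo:
  fixes h :: "real \<Rightarrow> real"
  assumes "h \<in> borel_measurable borel"
  shows "(LINT z:{u..v}|lborel. h z) = (LINT z:{u<..<v}|lborel. h z)"
proof (intro set_integral_cong_set)
  show "AE z in lborel. (z \<in> {u<..<v}) = (z \<in> {u..v})"
    using AE_lborel_singleton[of u] AE_lborel_singleton[of v] by eventually_elim auto
qed (use assms in \<open>auto simp: set_borel_measurable_def\<close>)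

lemma nn_integral_set_square:
  fixes h :: "real \<Rightarrow> real"
  assumes "integrable lborel (\<lambda>x. (h x)\<^sup>2)" "A \<in> sets borel"
  shows "(\<integral>\<^sup>+x. ennreal ((h x)\<^sup>2) * indicator A x \<partial>lborel) = ennreal (LINT x:A|lborel. (h x)\<^sup>2)"
proof -
  have "(\<integral>\<^sup>+x. ennreal ((h x)\<^sup>2) * indicator A x \<partial>lborel) = (\<integral>\<^sup>+x. ennreal (indicator A x *\<^sub>R (h x)\<^sup>2) \<partial>lborel)"
    by (intro nn_integral_cong) (auto simp: indicator_def)
  also have "\<dots> = ennreal (LINT x:A|lborel. (h x)\<^sup>2)"
    using set_integrable_of_integrable[OF assms(1), of A] assms(2) unfolding set_lebesgue_integral_def set_integrable_def
    by (intro nn_integral_eq_integral) auto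
  finally show ?thesis .
qed

section \<open>Lebesgue differentiation\<close>

text \<open>Outer regularity of the finite measure with density \<open>k\<close>, for which
  \<open>A\<close> is a null set.\<close>

lemma exists_open_superset_small_integral:
  fixes k :: "real \<Rightarrow> real"
  assumes k: "integrable lborel k" "\<And>x. 0 \<le> k x" and A: "A \<in> sets borel" "\<And>x. x \<in> A \<Longrightarrow> k x = 0" and "\<epsilon> > 0"
  obtains U where "open U" "A \<subseteq> U" "(\<integral>\<^sup>+x. ennreal (k x) * indicator U x \<partial>lborel) < ennreal \<epsilon>"
proof -
  have [measurable]: "k \<in> borel_measurable borel" using k by auto
  define N where "N = density lborel (\<lambda>x. ennreal (k x))"
  have [simp]: "sets N = sets borel" by (simp add: N_def)
  have "emeasure N (space N) \<noteq> \<infinity>"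
    using k by (simp add: N_def emeasure_density nn_integral_eq_integral)
  moreover have "emeasure N A = 0"
    using A(1) by (simp add: N_def emeasure_density nn_integral_0_iff_AE) (use A(2) in \<open>auto simp: indicator_def\<close>)
  ultimately have "(INF U\<in>{U. A \<subseteq> U \<and> open U}. emeasure N U) = 0"
    using outer_regular[of N A] A(1) by simp
  then have "\<exists>U\<in>{U. A \<subseteq> U \<and> open U}. emeasure N U < ennreal \<epsilon>"
    using \<open>\<epsilon> > 0\<close> by (metis (no_types, lifting) INF_less_iff ennreal_less_zero_iff)
  then obtain U where "A \<subseteq> U" "open U" "emeasure N U < ennreal \<epsilon>" by auto
  then show ?thesis using that[of U] by (simp add: N_def emeasure_density)
qed

text \<open>A Vitali argument. Small intervals with an endpoint at \<open>x\<close> on which the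
  mean of \<open>k\<close> exceeds \<open>c\<close> cover the bad set finely. A disjoint subfamily
  inside \<open>U\<close> covers almost all of it, and its total length is at most the integral of
  \<open>k\<close> over \<open>U\<close> divided by \<open>c\<close>, which is below
  \<open>e\<close>.\<close>

lemma negligible_upper_density:
  fixes k :: "real \<Rightarrow> real"
  assumes k: "integrable lborel k" "\<And>x. 0 \<le> k x" and A: "A \<in> sets borel" "\<And>x. x \<in> A \<Longrightarrow> k x = 0" and "c > 0"
  shows "negligible {x\<in>A. \<exists>\<^sub>F y in at x. (LINT t:{min x y..max x y}|lborel. k t) > c * \<bar>y - x\<bar>}" (is "negligible ?S")
proof (rule negligible_outer[THEN iffD2], safe)
  fix e :: real assume "e > 0"
  have [measurable]: "k \<in> borel_measurable borel" using k by auto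
  obtain U where U: "open U" "A \<subseteq> U" "(\<integral>\<^sup>+x. ennreal (k x) * indicator U x \<partial>lborel) < ennreal (c * e)"
    using exists_open_superset_small_integral[OF k A, of "c * e"] \<open>e > 0\<close> \<open>c > 0\<close> by auto
  \<comment> \<open>The interval between \<open>x\<close> and a nearby \<open>y\<close> is the
    closed ball around their midpoint. The covering theorem wants \<open>x\<close> in the ball, not
    at its centre, so one-sided intervals are admissible.\<close>
  define K where "K = {(m, \<rho>). \<rho> > 0 \<and> cball m \<rho> \<subseteq> U \<and> (LINT t:cball m \<rho>|lborel. k t) > c * (2 * \<rho>)}"
  have vit: "\<exists>i. i \<in> K \<and> x \<in> cball (fst i) (snd i) \<and> snd i < d" if "x \<in> ?S" "d > 0" for x d
  proof -
    have "x \<in> U" using U(2) that(1) by auto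
    then obtain d' where d': "d' > 0" "ball x d' \<subseteq> U" using U(1) openE by blast
    have "\<exists>\<^sub>F y in at x. (LINT t:{min x y..max x y}|lborel. k t) > c * \<bar>y - x\<bar>" using that by auto
    moreover have "\<forall>\<^sub>F y in at x. (LINT t:{min x y..max x y}|lborel. k t) > c * \<bar>y - x\<bar> \<longrightarrow>
        (LINT t:{min x y..max x y}|lborel. k t) > c * \<bar>y - x\<bar> \<and> dist y x < min d d' \<and> y \<noteq> x"
      using \<open>d > 0\<close> \<open>d' > 0\<close> by (auto simp: eventually_at intro!: exI[of _ "min d d'"])
    ultimately have "\<exists>\<^sub>F y in at x. (LINT t:{min x y..max x y}|lborel. k t) > c * \<bar>y - x\<bar> \<and> dist y x < min d d' \<and> y \<noteq> x"
      by (rule frequently_rev_mp)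
    then obtain y where y: "(LINT t:{min x y..max x y}|lborel. k t) > c * \<bar>y - x\<bar>" "dist y x < min d d'" "y \<noteq> x"
      using frequently_ex by blast
    have cb: "cball ((x + y)/2) (\<bar>y - x\<bar>/2) = {min x y..max x y}"
      by (auto simp: cball_eq_atLeastAtMost min_def max_def abs_if field_simps)
    have "{min x y..max x y} \<subseteq> ball x d'"
      using y by (auto simp: dist_real_def min_def max_def split: if_splits)
    then have "((x + y)/2, \<bar>y - x\<bar>/2) \<in> K" using y d' by (auto simp: K_def cb)
    then show ?thesis using y(2) by (intro exI[of _ "((x + y)/2, \<bar>y - x\<bar>/2)"]) (auto simp: cb dist_real_def)
  qed
  have pos: "0 < snd i" if "i \<in> K" for i using that by (auto simp: K_def)
  obtain C where C: "countable C" "C \<subseteq> K" 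
     "pairwise (\<lambda>i j. disjnt (cball (fst i) (snd i)) (cball (fst j) (snd j))) C"
     "negligible (?S - (\<Union>i \<in> C. cball (fst i) (snd i)))"
    by (rule Vitali_covering_theorem_cballs[of K snd ?S fst, OF pos vit]) (assumption | rule that)+
  let ?T = "\<Union>i\<in>C. cball (fst i) (snd i)"
  have T[measurable]: "?T \<in> sets borel" using C(1) by (intro sets.countable_UN') auto
  have disj: "disjoint_family_on (\<lambda>i. cball (fst i) (snd i)) C"
    using C(3) by (auto simp: disjoint_family_on_def pairwise_def disjnt_def)
  have "ennreal c * emeasure lborel ?T = ennreal c * (\<integral>\<^sup>+i. emeasure lborel (cball (fst i) (snd i)) \<partial>count_space C)"
    using C(1) disj by (subst emeasure_UN_countable) auto
  also have "\<dots> = (\<integral>\<^sup>+i. ennreal c * emeasure lborel (cball (fst i) (snd i)) \<partial>count_space C)"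
    by (subst nn_integral_cmult) auto
  also have "\<dots> \<le> (\<integral>\<^sup>+i. (\<integral>\<^sup>+x. ennreal (k x) * indicator (cball (fst i) (snd i)) x \<partial>lborel) \<partial>count_space C)"
  proof (rule nn_integral_mono)
    fix i assume "i \<in> space (count_space C)"
    then have "i \<in> K" using C by auto
    then have i: "snd i > 0" "(LINT t:cball (fst i) (snd i)|lborel. k t) > c * (2 * snd i)" by (auto simp: K_def)
    have "(\<integral>\<^sup>+x. ennreal (k x) * indicator (cball (fst i) (snd i)) x \<partial>lborel) 
      = (\<integral>\<^sup>+x. ennreal (indicator (cball (fst i) (snd i)) x *\<^sub>R k x) \<partial>lborel)"
      by (intro nn_integral_cong) (auto simp: indicator_def)
    also have "\<dots> = ennreal (LINT t:cball (fst i) (snd i)|lborel. k t)"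
      unfolding set_lebesgue_integral_def using k
      by (intro nn_integral_eq_integral integrable_mult_indicator) auto
    also have "\<dots> \<ge> ennreal (c * (2 * snd i))" using i by (intro ennreal_leI) auto
    also have "ennreal (c * (2 * snd i)) = ennreal c * emeasure lborel (cball (fst i) (snd i))"
      using i \<open>c > 0\<close> by (simp add: cball_eq_atLeastAtMost ennreal_mult)
    finally show "ennreal c * emeasure lborel (cball (fst i) (snd i)) \<le> (\<integral>\<^sup>+x. ennreal (k x) * indicator (cball (fst i) (snd i)) x \<partial>lborel)" .
  qed
  also have "\<dots> = (\<integral>\<^sup>+i. emeasure (density lborel (\<lambda>x. ennreal (k x))) (cball (fst i) (snd i)) \<partial>count_space C)"
    by (intro nn_integral_cong) (simp add: emeasure_density)
  also have "\<dots> = emeasure (density lborel (\<lambda>x. ennreal (k x))) ?T"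
    using C(1) disj by (subst emeasure_UN_countable) auto
  also have "\<dots> = (\<integral>\<^sup>+x. ennreal (k x) * indicator ?T x \<partial>lborel)" by (simp add: emeasure_density)
  also have "\<dots> \<le> (\<integral>\<^sup>+x. ennreal (k x) * indicator U x \<partial>lborel)"
  proof (intro nn_integral_mono)
    fix x
    have "cball (fst i) (snd i) \<subseteq> U" if "i \<in> C" for i
    proof -
      have "i \<in> K" using C(2) that by (rule subsetD)
      then show ?thesis unfolding K_def by (cases i) simp
    qed
    then have "?T \<subseteq> U" by blast
    then have "indicator ?T x \<le> (indicator U x :: ennreal)"
    proof (cases "x \<in> ?T")
      case True
      then have "x \<in> U" using \<open>?T \<subseteq> U\<close> by (rule rev_subsetD)
      then show ?thesis using True by (simp only: indicator_simps order_refl)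
    next
      case False
      then have "indicator ?T x = (0 :: ennreal)" by (rule indicator_simps(2))
      then show ?thesis by (simp only: zero_le)
    qed
    then show "ennreal (k x) * indicator ?T x \<le> ennreal (k x) * indicator U x"
      by (rule mult_left_mono) simp
  qed
  finally have "ennreal c * emeasure lborel ?T < ennreal (c * e)" using U by auto
  then have lt: "emeasure lborel ?T < ennreal e" 
    using \<open>c > 0\<close> \<open>e > 0\<close> by (simp add: ennreal_mult mult_less_cancel_left_pos ennreal_mult_strict_left_mono flip: not_le)
       (metis ennreal_mult less_imp_le mult_left_mono zero_le)
  let ?N = "?S - ?T"
  have N: "?N \<in> null_sets lebesgue" using C(4) negligible_iff_null_sets by blast
  have Tl: "?T \<in> lmeasurable" using lt T by (auto simp: fmeasurable_def intro: less_trans[OF _ ennreal_less_top])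
  show "\<exists>T. ?S \<subseteq> T \<and> T \<in> lmeasurable \<and> measure lebesgue T < e"
  proof (intro exI conjI)
    show "?S \<subseteq> ?T \<union> ?N" by blast
    show "?T \<union> ?N \<in> lmeasurable" using Tl N by (intro fmeasurable.Un) (auto intro: fmeasurableI_null_sets)
    have "measure lebesgue (?T \<union> ?N) = measure lebesgue ?T" using N T by (intro measure_Un_null_set) auto
    also have "\<dots> = measure lborel ?T" using T by simp
    also have "\<dots> < e"
    proof -
      have nt: "emeasure lborel ?T \<noteq> top" using lt by (metis ennreal_less_top less_irrefl less_trans)
      have "ennreal (measure lborel ?T) < ennreal e" using lt unfolding emeasure_eq_ennreal_measure[OF nt] .
      then show ?thesis by (simp only: ennreal_less_iff measure_nonneg)
    qed
    finally show "measure lebesgue (?T \<union> ?N) < e" .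
  qed
qed

text \<open>Countably many thresholds 1/(n+1) in the density lemma: at almost every zero of
  \<open>k\<close> its one-sided averages tend to 0.\<close>

lemma AE_average_eventually_le:
  fixes k :: "real \<Rightarrow> real"
  assumes k: "integrable lborel k" "\<And>x. 0 \<le> k x"
  shows "AE x in lborel. k x = 0 \<longrightarrow> (\<forall>n::nat. \<forall>\<^sub>F y in at x. (LINT t:{min x y..max x y}|lborel. k t) \<le> 1 / Suc n * \<bar>y - x\<bar>)"
proof -
  have [measurable]: "k \<in> borel_measurable borel" using k by auto
  define A where "A = {x. k x = 0}"
  have A: "A \<in> sets borel" "\<And>x. x \<in> A \<Longrightarrow> k x = 0" unfolding A_def by auto
  define S where "S n = {x\<in>A. \<exists>\<^sub>F y in at x. (LINT t:{min x y..max x y}|lborel. k t) > 1 / Suc n * \<bar>y - x\<bar>}" for n :: nat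
  have "negligible (S n)" for n
    unfolding S_def by (rule negligible_upper_density[OF k A]) auto
  then have "S n \<in> null_sets lebesgue" for n using negligible_iff_null_sets by blast
  then have "(\<Union>n. S n) \<in> null_sets lebesgue" by auto
  then have "AE x in lborel. x \<notin> (\<Union>n. S n)"
    using AE_not_in AE_completion_iff by blast
  then show ?thesis
    by eventually_elim (auto simp: S_def A_def frequently_def not_less)
qed

lemma set_integral_le_of_le_add:
  fixes f :: "real \<Rightarrow> real"
  assumes "set_integrable lborel {x..y} f" "set_integrable lborel {x..y} k" "x \<le> y" "\<And>t. f t \<le> p + k t"
  shows "(LINT t:{x..y}|lborel. f t) \<le> p * (y - x) + (LINT t:{x..y}|lborel. k t)"
proof -
  have p: "set_integrable lborel {x..y} (\<lambda>t. p)"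
    using integrable_real_indicator[of "{x..y}" lborel] by (simp add: set_integrable_def emeasure_lborel_Icc_eq)
  have "(LINT t:{x..y}|lborel. f t) \<le> (LINT t:{x..y}|lborel. p + k t)"
    using assms p by (intro set_integral_mono) auto
  also have "\<dots> = p * (y - x) + (LINT t:{x..y}|lborel. k t)"
    using assms p by (simp add: set_integral_add set_integral_const)
  finally show ?thesis .
qed

text \<open>For a rational \<open>p\<close> slightly above \<open>h x\<close>, \<open>h\<close> is
  at most \<open>p\<close> plus the positive part of \<open>h - p\<close>. That positive part
  vanishes at \<open>x\<close>, so its averages near \<open>x\<close> are negligible, and only
  countably many \<open>p\<close> are involved.\<close>

lemma AE_average_upper:
  fixes h :: "real \<Rightarrow> real"
  assumes h: "integrable lborel h"
  shows "AE x in lborel. \<forall>c>0. \<forall>\<^sub>F y in at x. (LINT t:{min x y..max x y}|lborel. h t) \<le> (h x + c) * \<bar>y - x\<bar>"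
proof -
  have [measurable]: "h \<in> borel_measurable borel" using h by auto
  have loc: "AE x in lborel. x \<in> {-real n<..<real n} \<longrightarrow> (\<forall>c>0. \<forall>\<^sub>F y in at x. (LINT t:{min x y..max x y}|lborel. h t) \<le> (h x + c) * \<bar>y - x\<bar>)" for n
  proof -
    \<comment> \<open>The cutoff to \<open>[-n, n]\<close> restores integrability, which the
      positive part of \<open>h - p\<close> lacks when \<open>p\<close> is negative.\<close>
    define \<kappa> where "\<kappa> p x = indicator {-real n..real n} x * max 0 (h x - p)" for p x
    have int: "integrable lborel (\<kappa> p)" for p
    proof (rule Bochner_Integration.integrable_bound)
      show "integrable lborel (\<lambda>x. \<bar>h x\<bar> + \<bar>p\<bar> * indicator {-real n..real n} x)"
        using h by (intro Bochner_Integration.integrable_add integrable_mult_right integrable_real_indicator) (auto simp: emeasure_lborel_Icc_eq)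
      show "\<kappa> p \<in> borel_measurable lborel" unfolding \<kappa>_def by measurable
    qed (auto simp: \<kappa>_def indicator_def)
    have "AE x in lborel. \<forall>p\<in>\<rat>. \<kappa> p x = 0 \<longrightarrow> (\<forall>m::nat. \<forall>\<^sub>F y in at x. (LINT t:{min x y..max x y}|lborel. \<kappa> p t) \<le> 1 / Suc m * \<bar>y - x\<bar>)"
      by (intro AE_ball_countable[THEN iffD2] ballI AE_average_eventually_le int) (auto simp: \<kappa>_def countable_rat)
    then show ?thesis
    proof eventually_elim
      case (elim x)
      show ?case
      proof (intro impI allI)
        fix c :: real assume x: "x \<in> {-real n<..<real n}" and "c > 0"
        obtain p where p: "p \<in> \<rat>" "h x < p" "p < h x + c/2" using Rats_dense_in_real[of "h x" "h x + c/2"] \<open>c > 0\<close> by auto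
        obtain m where m: "1 / Suc m < c / 2" using \<open>c > 0\<close> by (meson half_gt_zero nat_approx_posE)
        have "\<kappa> p x = 0" using p by (simp add: \<kappa>_def)
        then have "\<forall>\<^sub>F y in at x. (LINT t:{min x y..max x y}|lborel. \<kappa> p t) \<le> 1 / Suc m * \<bar>y - x\<bar>" using elim p by blast
        moreover have "\<forall>\<^sub>F y in at x. y \<in> {-real n<..<real n}"
          using x eventually_at_topological by (metis open_greaterThanLessThan)
        ultimately show "\<forall>\<^sub>F y in at x. (LINT t:{min x y..max x y}|lborel. h t) \<le> (h x + c) * \<bar>y - x\<bar>"
        proof eventually_elim
          case (elim y)
          \<comment> \<open>Setting the function to \<open>p\<close> off \<open>[-n, n]\<close>
            makes it at most \<open>p\<close> plus \<open>\<kappa> p\<close> everywhere; between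
            \<open>x\<close> and \<open>y\<close> it is still \<open>h\<close>.\<close>
          let ?h = "\<lambda>t. indicator {-real n..real n} t * h t + indicator (-{-real n..real n}) t * p"
          have eq: "(LINT t:{min x y..max x y}|lborel. h t) = (LINT t:{min x y..max x y}|lborel. ?h t)"
            by (rule set_lebesgue_integral_cong) (use x elim in \<open>auto simp: indicator_def min_def max_def split: if_splits\<close>)
          have i: "set_integrable lborel {min x y..max x y} h" using h by (rule set_integrable_of_integrable) simp
          then have "set_integrable lborel {min x y..max x y} ?h"
            by (rule set_integrable_cong[THEN iffD1, rotated -1]) (use x elim in \<open>auto simp: indicator_def min_def max_def split: if_splits\<close>)
          moreover have "set_integrable lborel {min x y..max x y} (\<kappa> p)" using int by (rule set_integrable_of_integrable) simp
          ultimately have "(LINT t:{min x y..max x y}|lborel. ?h t) \<le> p * (max x y - min x y) + (LINT t:{min x y..max x y}|lborel. \<kappa> p t)"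
            by (rule set_integral_le_of_le_add) (auto simp: \<kappa>_def indicator_def)
          also have "max x y - min x y = \<bar>y - x\<bar>" by (auto simp: min_def max_def)
          also have "p * \<bar>y - x\<bar> + (LINT t:{min x y..max x y}|lborel. \<kappa> p t) \<le> p * \<bar>y - x\<bar> + 1 / Suc m * \<bar>y - x\<bar>" using elim by simp
          also have "\<dots> = (p + 1 / Suc m) * \<bar>y - x\<bar>" by (simp add: algebra_simps)
          also have "\<dots> \<le> (h x + c) * \<bar>y - x\<bar>" using p m by (intro mult_right_mono) auto
          finally show ?case using eq by simp
        qed
      qed
    qed
  qed
  have "AE x in lborel. \<forall>n::nat. x \<in> {-real n<..<real n} \<longrightarrow> (\<forall>c>0. \<forall>\<^sub>F y in at x. (LINT t:{min x y..max x y}|lborel. h t) \<le> (h x + c) * \<bar>y - x\<bar>)"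
    using loc by (subst AE_all_countable) auto
  then show ?thesis
  proof eventually_elim
    case (elim x)
    obtain n :: nat where "\<bar>x\<bar> < real n" using reals_Archimedean2 by blast
    then have "x \<in> {-real n<..<real n}" by auto
    then show ?case using elim by blast
  qed
qed

text \<open>The upper estimate for \<open>h\<close> and for \<open>- h\<close> traps the difference
  quotient of \<open>F\<close> within \<open>e/2\<close> of \<open>h x\<close>.\<close>

lemma AE_has_real_derivative_of_integral:
  fixes h F :: "real \<Rightarrow> real"
  assumes h: "integrable lborel h" and "open S"
    and F: "\<And>x y. x \<le> y \<Longrightarrow> {x..y} \<subseteq> S \<Longrightarrow> F y - F x = (LINT t:{x..y}|lborel. h t)"
  shows "AE x in lborel. x \<in> S \<longrightarrow> (F has_real_derivative h x) (at x)"
proof -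
  have "AE x in lborel. \<forall>c>0. \<forall>\<^sub>F y in at x. (LINT t:{min x y..max x y}|lborel. - h t) \<le> (- h x + c) * \<bar>y - x\<bar>"
    by (rule AE_average_upper) (use h in auto)
  then show ?thesis using AE_average_upper[OF h]
  proof eventually_elim
    case (elim x)
    show ?case
    proof
      assume "x \<in> S"
      then obtain d where d: "d > 0" "ball x d \<subseteq> S" using \<open>open S\<close> openE by blast
      show "(F has_real_derivative h x) (at x)"
        unfolding has_field_derivative_iff tendsto_iff
      proof (intro allI impI)
        fix e :: real assume "e > 0"
        then have "\<forall>\<^sub>F y in at x. (LINT t:{min x y..max x y}|lborel. - h t) \<le> (- h x + e/2) * \<bar>y - x\<bar>"
          "\<forall>\<^sub>F y in at x. (LINT t:{min x y..max x y}|lborel. h t) \<le> (h x + e/2) * \<bar>y - x\<bar>"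
          using elim by auto
        moreover have "\<forall>\<^sub>F y in at x. y \<in> ball x d \<and> y \<noteq> x"
          using d by (auto simp: eventually_at dist_commute intro!: exI[of _ d])
        ultimately show "\<forall>\<^sub>F y in at x. dist ((F y - F x) / (y - x)) (h x) < e"
        proof eventually_elim
          case (elim y)
          define I where "I = (LINT t:{min x y..max x y}|lborel. h t)"
          have "{min x y..max x y} \<subseteq> ball x d"
            using elim d by (auto simp: dist_real_def min_def max_def split: if_splits)
          then have "F (max x y) - F (min x y) = I" using F[of "min x y" "max x y"] d unfolding I_def by auto
          then have quot: "(F y - F x) / (y - x) = I / \<bar>y - x\<bar>" using elim
            by (cases "x < y") (auto simp: min_def max_def field_simps abs_if split: if_splits)
          have "- I \<le> (- h x + e/2) * \<bar>y - x\<bar>" "I \<le> (h x + e/2) * \<bar>y - x\<bar>"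
            using elim by (auto simp: I_def set_lebesgue_integral_def)
          then have "- (e/2) \<le> I / \<bar>y - x\<bar> - h x" "I / \<bar>y - x\<bar> - h x \<le> e/2"
            using elim by (auto simp: field_simps)
          then show ?case using \<open>e > 0\<close> unfolding quot dist_real_def by linarith
        qed
      qed
    qed
  qed
qed

section \<open>The fundamental theorem of calculus for absolutely continuous functions\<close>

text \<open>Reindexes the definition from initial segments of the naturals to arbitrary finite index
  sets, because the intervals of a tagged division are indexed by pairs of a tag and an
  interval.\<close>

lemma abs_cont_on_sum:
  assumes "abs_cont_on S f" "\<epsilon> > 0"
  shows "\<exists>\<delta>>0. \<forall>(D :: 'i set) a b. finite D \<and> (\<forall>i\<in>D. a i \<le> b i \<and> {a i..b i} \<subseteq> S) \<and>
     (\<forall>i\<in>D. \<forall>j\<in>D. i \<noteq> j \<longrightarrow> {a i<..<b i} \<inter> {a j<..<b j} = {}) \<and>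
     (\<Sum>i\<in>D. b i - a i) < \<delta> \<longrightarrow> (\<Sum>i\<in>D. \<bar>f (b i) - f (a i)\<bar>) < \<epsilon>"
proof -
  obtain \<delta> where \<delta>: "\<delta> > 0" and *: "\<forall>(n::nat) (a::nat\<Rightarrow>real) b.
       (\<forall>i<n. a i \<le> b i \<and> {a i..b i} \<subseteq> S) \<and>
       (\<forall>i<n. \<forall>j<n. i \<noteq> j \<longrightarrow> {a i<..<b i} \<inter> {a j<..<b j} = {}) \<and>
       (\<Sum>i<n. b i - a i) < \<delta> \<longrightarrow> (\<Sum>i<n. \<bar>f (b i) - f (a i)\<bar>) < \<epsilon>"
    using assms(1)[unfolded abs_cont_on_def, THEN spec, THEN mp, OF assms(2)] by (elim exE conjE) (rule that)
  show ?thesis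
  proof (intro exI[of _ \<delta>] conjI allI impI \<delta>; elim conjE)
    fix D :: "'i set" and a b
    assume D: "finite D" "\<forall>i\<in>D. a i \<le> b i \<and> {a i..b i} \<subseteq> S"
      "\<forall>i\<in>D. \<forall>j\<in>D. i \<noteq> j \<longrightarrow> {a i<..<b i} \<inter> {a j<..<b j} = {}" "(\<Sum>i\<in>D. b i - a i) < \<delta>"
    obtain g where g: "bij_betw g {..<card D} D"
      using ex_bij_betw_nat_finite[OF D(1)] by (auto simp: atLeast0LessThan)
    have gD: "g i \<in> D" if "i < card D" for i using g that by (auto simp: bij_betw_def)
    have gi: "g i \<noteq> g j" if "i < card D" "j < card D" "i \<noteq> j" for i j using g that by (auto simp: bij_betw_def inj_on_def)
    have "(\<Sum>i<card D. b (g i) - a (g i)) = (\<Sum>i\<in>D. b i - a i)" by (rule sum.reindex_bij_betw[OF g])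
    then have "(\<Sum>i<card D. \<bar>f (b (g i)) - f (a (g i))\<bar>) < \<epsilon>"
      using D(2,3,4) gD gi by (intro *[rule_format, of "card D" "\<lambda>i. a (g i)" "\<lambda>i. b (g i)"]) simp
    also have "(\<Sum>i<card D. \<bar>f (b (g i)) - f (a (g i))\<bar>) = (\<Sum>i\<in>D. \<bar>f (b i) - f (a i)\<bar>)"
      by (rule sum.reindex_bij_betw[OF g])
    finally show "(\<Sum>i\<in>D. \<bar>f (b i) - f (a i)\<bar>) < \<epsilon>" .
  qed
qed

text \<open>A gauge argument. Intervals tagged in \<open>N\<close> are forced into an open set of
  measure below \<open>\<delta>\<close>, where absolute continuity bounds the sum of the increments
  by \<open>e/2\<close>. Intervals tagged elsewhere contribute an error of at most \<open>e'\<close>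
  times their length, by differentiability at the tag.\<close>

theorem has_integral_of_abs_cont_on:
  fixes F h :: "real \<Rightarrow> real"
  assumes "x \<le> y" and ac: "abs_cont_on {x..y} F" and N: "negligible N"
    and der: "\<And>z. z \<in> {x..y} - N \<Longrightarrow> (F has_real_derivative h z) (at z within {x..y})"
  shows "(h has_integral F y - F x) {x..y}"
proof -
  \<comment> \<open>Zero on \<open>N\<close>: tags there add nothing to the Riemann sum, and only
    the increments of \<open>F\<close> are left to estimate.\<close>
  define g where "g z = (if z \<in> N then 0 else h z)" for z
  have "(g has_integral F y - F x) (cbox x y)"
    unfolding has_integral
  proof (intro allI impI)
    fix e :: real assume "e > 0"
    \<comment> \<open>The added 1 keeps the denominator positive when \<open>x = y\<close>.\<close>
    define e' where "e' = e / (2 * (y - x + 1))"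
    have e': "e' > 0" "e' * (y - x) < e/2" using \<open>e > 0\<close> \<open>x \<le> y\<close> by (auto simp: e'_def field_simps)
    obtain \<delta> where \<delta>: "\<delta> > 0" "\<forall>(D :: (real \<times> real set) set) a b. finite D \<and> (\<forall>i\<in>D. a i \<le> b i \<and> {a i..b i} \<subseteq> {x..y}) \<and>
       (\<forall>i\<in>D. \<forall>j\<in>D. i \<noteq> j \<longrightarrow> {a i<..<b i} \<inter> {a j<..<b j} = {}) \<and>
       (\<Sum>i\<in>D. b i - a i) < \<delta> \<longrightarrow> (\<Sum>i\<in>D. \<bar>F (b i) - F (a i)\<bar>) < e/2"
      using abs_cont_on_sum[OF ac half_gt_zero[OF \<open>e > 0\<close>]] by blast
    obtain U where U: "open U" "N \<subseteq> U" "U \<in> lmeasurable" "measure lebesgue U < \<delta>"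
    proof -
      have Nn: "N \<in> null_sets lebesgue" using N negligible_iff_null_sets by blast
      then obtain U where U: "open U" "N \<subseteq> U" "(U - N) \<in> lmeasurable" "emeasure lebesgue (U - N) < ennreal \<delta>"
        using sets_lebesgue_outer_open[of N \<delta>] \<delta>(1) by auto
      have "emeasure lebesgue U = emeasure lebesgue (U - N)"
        using U Nn by (intro emeasure_Diff_null_set[symmetric]) auto
      then have "emeasure lebesgue U < ennreal \<delta>" using U by simp
      then show ?thesis using that[OF U(1,2)] U(1) \<delta>(1)
        by (auto simp: fmeasurable_def measure_def enn2real_less_iff intro: less_trans[OF _ ennreal_less_top])
    qed
    have "\<exists>d>0. (z \<in> N \<longrightarrow> ball z d \<subseteq> U) \<and> (z \<in> {x..y} - N \<longrightarrow> (\<forall>w\<in>{x..y}. \<bar>w - z\<bar> < d \<longrightarrow> \<bar>F w - F z - (w - z) * g z\<bar> \<le> e' * \<bar>w - z\<bar>))" for z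
    proof (cases "z \<in> N")
      case True
      then show ?thesis using U openE by (metis DiffD2 subsetD)
    next
      case False
      show ?thesis
      proof (cases "z \<in> {x..y}")
        case True
        then have "(F has_derivative (*) (g z)) (at z within {x..y})"
          using der[of z] False by (simp add: g_def has_field_derivative_def)
        then show ?thesis using False e'(1) unfolding has_derivative_within_alt real_norm_def
          by (metis mult.commute)
      qed (use False in \<open>auto intro: exI[of _ 1]\<close>)
    qed
    then obtain d where d: "\<And>z. d z > 0" "\<And>z. z \<in> N \<Longrightarrow> ball z (d z) \<subseteq> U"
      "\<And>z w. z \<in> {x..y} - N \<Longrightarrow> w \<in> {x..y} \<Longrightarrow> \<bar>w - z\<bar> < d z \<Longrightarrow> \<bar>F w - F z - (w - z) * g z\<bar> \<le> e' * \<bar>w - z\<bar>"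
      by metis
    show "\<exists>\<gamma>. gauge \<gamma> \<and> (\<forall>D. D tagged_division_of cbox x y \<and> \<gamma> fine D \<longrightarrow>
      norm ((\<Sum>(x, K)\<in>D. measure lborel K *\<^sub>R g x) - (F y - F x)) < e)"
    proof (intro exI conjI allI impI; (elim conjE)?)
      show "gauge (\<lambda>z. ball z (d z))" using d(1) gauge_ball_dependent by blast
      fix D assume D: "D tagged_division_of cbox x y" and fine: "(\<lambda>z. ball z (d z)) fine D"
      have finD: "finite D" using D by blast
      have DK: "t \<in> K \<and> K \<subseteq> {x..y} \<and> K = {Inf K..Sup K} \<and> Inf K \<le> Sup K \<and> K \<subseteq> ball t (d t)" if tK: "(t, K) \<in> D" for t K
      proof -
        obtain u v where K: "K = cbox u v" using tagged_division_ofD(4)[OF D tK] by blast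
        moreover have "t \<in> K" "K \<subseteq> cbox x y" using tagged_division_ofD(2,3)[OF D tK] .
        moreover have "K \<subseteq> ball t (d t)" using fine tK by (rule fineD)
        ultimately show ?thesis by auto
      qed
      have disj: "{Inf (snd p)<..<Sup (snd p)} \<inter> {Inf (snd q)<..<Sup (snd q)} = {}" if "p \<in> D" "q \<in> D" "p \<noteq> q" for p q
      proof -
        have "(fst p, snd p) \<in> D" "(fst q, snd q) \<in> D" "(fst p, snd p) \<noteq> (fst q, snd q)" using that by auto
        then have "interior (snd p) \<inter> interior (snd q) = {}" by (rule tagged_division_ofD(5)[OF D])
        moreover have "snd p = {Inf (snd p)..Sup (snd p)}" "snd q = {Inf (snd q)..Sup (snd q)}"
          using DK[of "fst p" "snd p"] DK[of "fst q" "snd q"] that by auto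
        ultimately show ?thesis by (metis interior_atLeastAtMost_real)
      qed
      define D1 where "D1 = {p\<in>D. fst p \<in> N}"
      define D2 where "D2 = {p\<in>D. fst p \<notin> N}"
      have fin: "finite D1" "finite D2" "D = D1 \<union> D2" "D1 \<inter> D2 = {}" using finD by (auto simp: D1_def D2_def)
      define err where "err p = (case p of (t, K) \<Rightarrow> measure lborel K *\<^sub>R g t) - (F (Sup (snd p)) - F (Inf (snd p)))" for p
      have content: "measure lborel K = Sup K - Inf K" if "(t, K) \<in> D" for t K
        using DK[OF that] by (metis content_real)
      have F: "F y - F x = (\<Sum>p\<in>D. F (Sup (snd p)) - F (Inf (snd p)))"
        using additive_tagged_division_1[OF \<open>x \<le> y\<close>, of D F] D by (simp add: case_prod_unfold)
      have len: "y - x = (\<Sum>p\<in>D. Sup (snd p) - Inf (snd p))"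
        using additive_tagged_division_1[OF \<open>x \<le> y\<close>, of D "\<lambda>x. x"] D by (simp add: case_prod_unfold)
      have "(\<Sum>p\<in>D1. \<bar>F (Sup (snd p)) - F (Inf (snd p))\<bar>) < e/2"
      proof (rule \<delta>(2)[rule_format], intro conjI fin(1) ballI impI)
        have "D1 tagged_division_of \<Union>(snd ` D1)"
          using tagged_partial_division_of_Union_self[OF tagged_partial_division_subset[of D "cbox x y" D1]] D
          by (simp add: D1_def tagged_division_of_def)
        then have "measure lebesgue (\<Union>(snd ` D1)) = sum (measure lebesgue) (snd ` D1)"
          by (rule content_division[OF division_of_tagged_division, symmetric])
        also have "\<dots> = (\<Sum>(t, K)\<in>D1. measure lebesgue K)"
          using sum.over_tagged_division_lemma[OF \<open>D1 tagged_division_of \<Union>(snd ` D1)\<close>, of "measure lebesgue"] by simp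
        also have "\<dots> = (\<Sum>p\<in>D1. Sup (snd p) - Inf (snd p))"
        proof (intro sum.cong refl)
          fix p assume p: "p \<in> D1"
          obtain t K where pt: "p = (t, K)" by (cases p)
          have "(t, K) \<in> D" using p by (simp add: pt D1_def)
          then have "K = {Inf K..Sup K}" "Inf K \<le> Sup K" using DK by blast+
          then have "measure lebesgue K = Sup K - Inf K"
            by (metis measure_completion measure_lborel_Icc atLeastAtMost_borel sets_lborel)
          then show "(case p of (t, K) \<Rightarrow> measure lebesgue K) = Sup (snd p) - Inf (snd p)" by (simp add: pt)
        qed
        finally have "(\<Sum>p\<in>D1. Sup (snd p) - Inf (snd p)) = measure lebesgue (\<Union>(snd ` D1))" by simp
        also have "\<dots> \<le> measure lebesgue U"
        proof (rule measure_mono_fmeasurable)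
          show "\<Union>(snd ` D1) \<subseteq> U" using DK d(2) unfolding D1_def by fastforce
          show "\<Union>(snd ` D1) \<in> sets lebesgue"
            using fin(1) DK by (intro sets.finite_Union) (auto simp: D1_def, metis atLeastAtMost_borel sets_completionI_sets sets_lborel)
        qed (use U in auto)
        finally show "(\<Sum>p\<in>D1. Sup (snd p) - Inf (snd p)) < \<delta>" using U by simp
        show "Inf (snd p) \<le> Sup (snd p)" "{Inf (snd p)..Sup (snd p)} \<subseteq> {x..y}" if "p \<in> D1" for p
          using DK[of "fst p" "snd p"] that by (auto simp: D1_def)
        show "{Inf (snd p)<..<Sup (snd p)} \<inter> {Inf (snd q)<..<Sup (snd q)} = {}" if "p \<in> D1" "q \<in> D1" "p \<noteq> q" for p q
          using disj that by (auto simp: D1_def)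
      qed
      moreover have "\<bar>sum err D1\<bar> \<le> (\<Sum>p\<in>D1. \<bar>F (Sup (snd p)) - F (Inf (snd p))\<bar>)"
        by (intro order_trans[OF sum_abs] sum_mono) (auto simp: err_def D1_def g_def)
      moreover have "\<bar>sum err D2\<bar> \<le> (\<Sum>p\<in>D2. e' * (Sup (snd p) - Inf (snd p)))"
      proof (intro order_trans[OF sum_abs] sum_mono)
        fix p assume p: "p \<in> D2"
        obtain t K where pt: "p = (t, K)" by (cases p)
        have tK: "(t, K) \<in> D" "t \<notin> N" using p by (auto simp: pt D2_def)
        note DK = DK[OF tK(1)]
        have sub: "Inf K \<in> K" "Sup K \<in> K" using DK by (metis atLeastAtMost_iff order_refl)+
        have t: "t \<in> {x..y} - N" "Inf K \<le> t" "t \<le> Sup K" using DK tK by (blast, metis atLeastAtMost_iff, metis atLeastAtMost_iff)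
        have "\<bar>F (Sup K) - F t - (Sup K - t) * g t\<bar> \<le> e' * \<bar>Sup K - t\<bar>" 
          by (rule d(3)[OF t(1)]) (use sub DK in \<open>auto simp: dist_real_def subset_eq\<close>)
        moreover have "\<bar>F (Inf K) - F t - (Inf K - t) * g t\<bar> \<le> e' * \<bar>Inf K - t\<bar>" 
          by (rule d(3)[OF t(1)]) (use sub DK in \<open>auto simp: dist_real_def subset_eq\<close>)
        moreover have "err p = - (F (Sup K) - F t - (Sup K - t) * g t) + (F (Inf K) - F t - (Inf K - t) * g t)"
          by (simp add: err_def pt content[OF tK(1)] algebra_simps)
        ultimately have "\<bar>err p\<bar> \<le> e' * (Sup K - t) + e' * (t - Inf K)" using t by simp
        then show "\<bar>err p\<bar> \<le> e' * (Sup (snd p) - Inf (snd p))" by (simp add: pt algebra_simps)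
      qed
      moreover have "(\<Sum>p\<in>D2. e' * (Sup (snd p) - Inf (snd p))) \<le> (\<Sum>p\<in>D. e' * (Sup (snd p) - Inf (snd p)))"
      proof (rule sum_mono2[OF finD])
        show "0 \<le> e' * (Sup (snd p) - Inf (snd p))" if "p \<in> D - D2" for p
          using DK[of "fst p" "snd p"] that e'(1) by auto
      qed (auto simp: D2_def)
      moreover have "(\<Sum>p\<in>D. e' * (Sup (snd p) - Inf (snd p))) = e' * (y - x)"
        by (simp add: len sum_distrib_left)
      moreover have "(\<Sum>(x, K)\<in>D. measure lborel K *\<^sub>R g x) - (F y - F x) = sum err D1 + sum err D2"
      proof -
        have "sum err D1 + sum err D2 = sum err D" using sum.union_disjoint[OF fin(1,2,4), of err] fin(3) by simp
        then show ?thesis by (simp add: F err_def sum_subtractf)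
      qed
      ultimately show "norm ((\<Sum>(x, K)\<in>D. measure lborel K *\<^sub>R g x) - (F y - F x)) < e"
        using e'(2) unfolding real_norm_def by linarith
    qed
  qed
  then show ?thesis
    by (intro has_integral_spike[OF N, of "{x..y}" h g]) (auto simp: g_def)
qed

section \<open>Completeness of L2\<close>

lemma square_add_le: "(a + b :: real)\<^sup>2 \<le> 2 * a\<^sup>2 + 2 * b\<^sup>2"
  using sum_squares_bound[of a b] by (simp add: power2_sum)

lemma square_diff_le: "(a - b :: real)\<^sup>2 \<le> 2 * a\<^sup>2 + 2 * b\<^sup>2"
  using square_add_le[of a "-b"] by simp

lemma integrable_square_add:
  fixes f g :: "'a \<Rightarrow> real"
  assumes [measurable]: "f \<in> borel_measurable M" "g \<in> borel_measurable M"
    and "integrable M (\<lambda>x. (f x)\<^sup>2)" "integrable M (\<lambda>x. (g x)\<^sup>2)"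
  shows "integrable M (\<lambda>x. (f x + g x)\<^sup>2)"
proof (rule Bochner_Integration.integrable_bound)
  show "integrable M (\<lambda>x. 2 * (f x)\<^sup>2 + 2 * (g x)\<^sup>2)" using assms by simp
qed (auto simp: square_add_le)

lemma integrable_square_diff:
  fixes f g :: "'a \<Rightarrow> real"
  assumes "f \<in> borel_measurable M" "g \<in> borel_measurable M"
    and "integrable M (\<lambda>x. (f x)\<^sup>2)" "integrable M (\<lambda>x. (g x)\<^sup>2)"
  shows "integrable M (\<lambda>x. (f x - g x)\<^sup>2)"
  using integrable_square_add[of f M "\<lambda>x. - g x"] assms by simp

lemma integrable_square_mult:
  fixes f g :: "'a \<Rightarrow> real"
  assumes [measurable]: "f \<in> borel_measurable M" "g \<in> borel_measurable M"
    and "integrable M (\<lambda>x. (f x)\<^sup>2)" "integrable M (\<lambda>x. (g x)\<^sup>2)"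
  shows "integrable M (\<lambda>x. f x * g x)"
proof (rule Bochner_Integration.integrable_bound)
  show "integrable M (\<lambda>x. (f x)\<^sup>2 + (g x)\<^sup>2)" using assms by simp
  have "\<bar>f x * g x\<bar> \<le> (f x)\<^sup>2 + (g x)\<^sup>2" for x
    using sum_squares_bound[of "f x" "g x"] sum_squares_bound[of "f x" "- g x"] zero_le_power2[of "f x"] zero_le_power2[of "g x"]
    by (simp add: abs_le_iff)
  then show "AE x in M. norm (f x * g x) \<le> norm ((f x)\<^sup>2 + (g x)\<^sup>2)" by simp
qed simp

text \<open>The terms of the weighted series are bounded by some \<open>C\<close>, so
  \<open>\<bar>d k\<bar>\<close> is at most \<open>sqrt C\<close> times 2^-k and a geometric series
  dominates.\<close>

lemma summable_of_weighted_squares: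
  fixes d :: "nat \<Rightarrow> real"
  assumes "(\<Sum>k. ennreal (4 ^ k * (d k)\<^sup>2)) < \<infinity>"
  shows "summable d"
proof -
  have "summable (\<lambda>k. 4 ^ k * (d k)\<^sup>2)"
    using assms by (intro summable_suminf_not_top) (auto simp: top.not_eq_extremum)
  then have "Bseq (\<lambda>k. 4 ^ k * (d k)\<^sup>2)" using summable_LIMSEQ_zero convergentI convergent_imp_Bseq by blast
  then obtain C where C: "C > 0" "\<And>k. \<bar>4 ^ k * (d k)\<^sup>2\<bar> \<le> C" by (auto simp: Bseq_def)
  have bound: "\<bar>d k\<bar> \<le> sqrt C * (1/2) ^ k" for k
  proof -
    have "(2 ^ k * \<bar>d k\<bar>)\<^sup>2 \<le> C" 
    proof -
      have "(2 ^ k)\<^sup>2 = (4::real) ^ k" by (simp add: power2_eq_square flip: power_mult_distrib)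
      then show ?thesis using C(2)[of k] by (simp add: power_mult_distrib abs_mult)
    qed
    then have "2 ^ k * \<bar>d k\<bar> \<le> sqrt C" by (rule real_le_rsqrt)
    then show ?thesis by (simp add: field_simps power_divide)
  qed
  show ?thesis
  proof (rule summable_comparison_test)
    show "\<exists>N. \<forall>n\<ge>N. norm (d n) \<le> sqrt C * (1/2) ^ n" using bound by auto
  qed (intro summable_mult summable_geometric, simp)
qed

text \<open>Riesz-Fischer. A subsequence whose consecutive squared distances are below 8^-k stays
  summable after weighting with 4^k, so it converges almost everywhere; Fatou's lemma then gives
  convergence of the whole sequence in norm. The subsequence is exported because pointwise limits
  have to be identified in \<open>dom_closed\<close>.\<close>

theorem L2_complete:
  fixes u :: "nat \<Rightarrow> 'a \<Rightarrow> real"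
  assumes [measurable]: "\<And>n. u n \<in> borel_measurable M" and u2: "\<And>n. integrable M (\<lambda>x. (u n x)\<^sup>2)"
    and cauchy: "\<And>\<epsilon>. \<epsilon> > 0 \<Longrightarrow> \<exists>N. \<forall>n\<ge>N. \<forall>m\<ge>N. (\<integral>x. (u n x - u m x)\<^sup>2 \<partial>M) < \<epsilon>"
  obtains v \<phi> where "v \<in> borel_measurable M" "integrable M (\<lambda>x. (v x)\<^sup>2)"
    "(\<lambda>n. \<integral>x. (u n x - v x)\<^sup>2 \<partial>M) \<longlonglongrightarrow> 0" "strict_mono (\<phi> :: nat \<Rightarrow> nat)" "AE x in M. (\<lambda>k. u (\<phi> k) x) \<longlonglongrightarrow> v x"
proof -
  have "\<exists>N. \<forall>n\<ge>N. \<forall>m\<ge>N. (\<integral>x. (u n x - u m x)\<^sup>2 \<partial>M) < (1/8) ^ k" for k :: nat by (rule cauchy) simp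
  then obtain N where N: "\<And>k n m. n \<ge> N k \<Longrightarrow> m \<ge> N k \<Longrightarrow> (\<integral>x. (u n x - u m x)\<^sup>2 \<partial>M) < (1/8) ^ k" by metis
  \<comment> \<open>The partial sum dominates \<open>N k\<close>, and adding \<open>k\<close> makes
    the sequence strictly increasing.\<close>
  define \<phi> where "\<phi> k = (\<Sum>i\<le>k. N i) + k" for k
  have \<phi>: "strict_mono \<phi>" by (rule strict_monoI_Suc) (simp add: \<phi>_def)
  have \<phi>N: "\<phi> k \<ge> N k" for k by (simp add: \<phi>_def member_le_sum trans_le_add1)
  have d2: "integrable M (\<lambda>x. (u n x - u m x)\<^sup>2)" for n m by (intro integrable_square_diff u2) auto
  define d where "d k x = u (\<phi> (Suc k)) x - u (\<phi> k) x" for k x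
  have "(\<integral>\<^sup>+x. (\<Sum>k. ennreal (4 ^ k * (d k x)\<^sup>2)) \<partial>M) = (\<Sum>k. \<integral>\<^sup>+x. ennreal (4 ^ k * (d k x)\<^sup>2) \<partial>M)"
    unfolding d_def by (intro nn_integral_suminf) auto
  also have "\<dots> \<le> (\<Sum>k. ennreal ((1/2) ^ k))"
  proof (intro suminf_le)
    fix k
    have "(\<integral>\<^sup>+x. ennreal (4 ^ k * (d k x)\<^sup>2) \<partial>M) = ennreal (4 ^ k * (\<integral>x. (d k x)\<^sup>2 \<partial>M))"
      using d2 by (subst nn_integral_eq_integral) (auto simp: d_def)
    also have "\<dots> \<le> ennreal (4 ^ k * (1/8) ^ k)"
      using N[of k "\<phi> (Suc k)" "\<phi> k"] \<phi>N[of k] strict_monoD[OF \<phi>, of k "Suc k"]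
      by (intro ennreal_leI mult_left_mono) (auto simp: d_def)
    also have "(4::real) ^ k * (1/8) ^ k = (1/2) ^ k" by (simp flip: power_mult_distrib)
    finally show "(\<integral>\<^sup>+x. ennreal (4 ^ k * (d k x)\<^sup>2) \<partial>M) \<le> ennreal ((1/2) ^ k)" .
  qed auto
  also have "\<dots> = ennreal (\<Sum>k. (1/2) ^ k)" by (intro suminf_ennreal2) auto
  finally have "(\<integral>\<^sup>+x. (\<Sum>k. ennreal (4 ^ k * (d k x)\<^sup>2)) \<partial>M) \<noteq> \<infinity>"
    by (auto simp: top_unique)
  then have "AE x in M. (\<Sum>k. ennreal (4 ^ k * (d k x)\<^sup>2)) \<noteq> \<infinity>"
    by (intro nn_integral_PInf_AE) (auto simp: d_def)
  then have conv: "AE x in M. convergent (\<lambda>k. u (\<phi> k) x)"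
  proof eventually_elim
    case (elim x)
    then have "summable (\<lambda>k. d k x)" by (intro summable_of_weighted_squares) (simp add: top.not_eq_extremum)
    then have "convergent (\<lambda>n. \<Sum>k<n. d k x)" by (simp add: summable_iff_convergent)
    moreover have "(\<Sum>k<n. d k x) = u (\<phi> n) x - u (\<phi> 0) x" for n 
      using sum_lessThan_telescope[of "\<lambda>k. u (\<phi> k) x" n] by (simp add: d_def)
    ultimately have "convergent (\<lambda>n. (u (\<phi> n) x - u (\<phi> 0) x) + u (\<phi> 0) x)" by (intro convergent_add) (auto simp: convergent_const)
    then show ?case by simp
  qed
  define v where "v x = lim (\<lambda>k. u (\<phi> k) x)" for x
  have v[measurable]: "v \<in> borel_measurable M" unfolding v_def by measurable
  have lim: "AE x in M. (\<lambda>k. u (\<phi> k) x) \<longlonglongrightarrow> v x"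
    using conv by eventually_elim (simp add: v_def convergent_LIMSEQ_iff)
  have le: "(\<integral>\<^sup>+x. ennreal ((u n x - v x)\<^sup>2) \<partial>M) \<le> ennreal \<epsilon>" if "\<And>k. k \<ge> K \<Longrightarrow> (\<integral>x. (u n x - u (\<phi> k) x)\<^sup>2 \<partial>M) \<le> \<epsilon>" for n K \<epsilon>
  proof -
    have "(\<integral>\<^sup>+x. ennreal ((u n x - v x)\<^sup>2) \<partial>M) = (\<integral>\<^sup>+x. liminf (\<lambda>k. ennreal ((u n x - u (\<phi> k) x)\<^sup>2)) \<partial>M)"
    proof (rule nn_integral_cong_AE)
      show "AE x in M. ennreal ((u n x - v x)\<^sup>2) = liminf (\<lambda>k. ennreal ((u n x - u (\<phi> k) x)\<^sup>2))"
        using lim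
      proof eventually_elim
        case (elim x)
        then have "(\<lambda>k. ennreal ((u n x - u (\<phi> k) x)\<^sup>2)) \<longlonglongrightarrow> ennreal ((u n x - v x)\<^sup>2)"
          by (intro tendsto_ennrealI tendsto_intros)
        then show ?case by (rule lim_imp_Liminf[OF trivial_limit_sequentially, symmetric])
      qed
    qed
    also have "\<dots> \<le> liminf (\<lambda>k. \<integral>\<^sup>+x. ennreal ((u n x - u (\<phi> k) x)\<^sup>2) \<partial>M)"
      by (intro nn_integral_liminf) auto
    also have "\<dots> \<le> ennreal \<epsilon>"
    proof (rule Liminf_le)
      show "\<forall>\<^sub>F k in sequentially. (\<integral>\<^sup>+x. ennreal ((u n x - u (\<phi> k) x)\<^sup>2) \<partial>M) \<le> ennreal \<epsilon>"
        using that d2 by (intro eventually_mono[OF eventually_ge_at_top[of K]]) (simp add: nn_integral_eq_integral ennreal_leI)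
    qed simp
    finally show ?thesis .
  qed
  have dv: "integrable M (\<lambda>x. (u n x - v x)\<^sup>2) \<and> (\<integral>x. (u n x - v x)\<^sup>2 \<partial>M) \<le> \<epsilon>" 
    if "\<And>k. k \<ge> K \<Longrightarrow> (\<integral>x. (u n x - u (\<phi> k) x)\<^sup>2 \<partial>M) \<le> \<epsilon>" for n K \<epsilon>
  proof -
    have "0 \<le> \<epsilon>" using that[of K] by (rule order_trans[rotated]) simp_all
    have "(\<integral>\<^sup>+x. ennreal ((u n x - v x)\<^sup>2) \<partial>M) < \<infinity>"
      using le[of K n \<epsilon>, OF that] by (rule le_less_trans) simp_all
    then have i: "integrable M (\<lambda>x. (u n x - v x)\<^sup>2)" by (intro integrableI_bounded) auto
    then show ?thesis using le[of K n \<epsilon>, OF that] \<open>0 \<le> \<epsilon>\<close> by (simp add: nn_integral_eq_integral)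
  qed
  have \<phi>_ge: "k \<le> \<phi> k" for k using \<phi> by (rule strict_mono_imp_increasing)
  \<comment> \<open>\<open>N 0\<close> is the index from which the Cauchy bound is (1/8)^0 = 1.
    Hence \<open>u (N 0) - v\<close> is square integrable, and with it \<open>v\<close>.\<close>
  have "integrable M (\<lambda>x. (u (N 0) x - v x)\<^sup>2)"
    by (rule dv[THEN conjunct1, of "N 0" _ 1]) (use N[of 0 "N 0", OF order_refl order_trans[OF _ \<phi>_ge]] in \<open>auto intro!: less_imp_le\<close>)
  then have "integrable M (\<lambda>x. (u (N 0) x - (u (N 0) x - v x))\<^sup>2)"
    using integrable_square_diff[of "u (N 0)" M "\<lambda>x. u (N 0) x - v x"] u2 by simp
  then have v2: "integrable M (\<lambda>x. (v x)\<^sup>2)" by simp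
  have "(\<lambda>n. \<integral>x. (u n x - v x)\<^sup>2 \<partial>M) \<longlonglongrightarrow> 0"
  proof (rule LIMSEQ_I)
    fix \<epsilon> :: real assume "\<epsilon> > 0"
    then obtain N where N: "\<forall>n\<ge>N. \<forall>m\<ge>N. (\<integral>x. (u n x - u m x)\<^sup>2 \<partial>M) < \<epsilon> / 2" using cauchy[of "\<epsilon>/2"] by auto
    have "norm ((\<integral>x. (u n x - v x)\<^sup>2 \<partial>M) - 0) < \<epsilon>" if "n \<ge> N" for n
    proof -
      have "(\<integral>x. (u n x - v x)\<^sup>2 \<partial>M) \<le> \<epsilon> / 2"
        by (rule dv[THEN conjunct2, of N]) (use N that order_trans[OF _ \<phi>_ge] in \<open>auto intro!: less_imp_le\<close>)
      moreover have "0 \<le> (\<integral>x. (u n x - v x)\<^sup>2 \<partial>M)" by simp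
      ultimately show ?thesis using \<open>\<epsilon> > 0\<close> unfolding real_norm_def by linarith
    qed
    then show "\<exists>N. \<forall>n\<ge>N. norm ((\<integral>x. (u n x - v x)\<^sup>2 \<partial>M) - 0) < \<epsilon>" by blast
  qed
  then show ?thesis using that v v2 \<phi> lim by blast
qed

section \<open>Absolutely continuous functions with square integrable derivative\<close>

lemma open_open_lr [simp]: "open (open_lr l r)"
proof -
  have "open_lr l r = ereal -` {l<..<r}" by (auto simp: open_lr_def)
  then show ?thesis by (simp add: continuous_open_vimage continuous_at_ereal)
qed

lemma open_lr_borel [measurable]: "open_lr l r \<in> sets borel" by simp

text \<open>Serves both nonlinear operations: the unit contraction, controlled by the increments of
  one function, and the product, controlled by those of two locally bounded factors.\<close>

lemma abs_cont_on_dominated: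
  assumes "abs_cont_on S F1" "abs_cont_on S F2" "M > 0"
    and "\<And>x y. x \<in> S \<Longrightarrow> y \<in> S \<Longrightarrow> \<bar>G y - G x\<bar> \<le> M * (\<bar>F1 y - F1 x\<bar> + \<bar>F2 y - F2 x\<bar>)"
  shows "abs_cont_on S G"
  unfolding abs_cont_on_def
proof (intro allI impI)
  fix \<epsilon> :: real assume "\<epsilon> > 0"
  then have "\<epsilon> / (2 * M) > 0" using \<open>M > 0\<close> by simp
  then have *: "\<exists>d>0. \<forall>(n::nat) (a::nat\<Rightarrow>real) b. (\<forall>i<n. a i \<le> b i \<and> {a i..b i} \<subseteq> S) \<and>
       (\<forall>i<n. \<forall>j<n. i \<noteq> j \<longrightarrow> {a i<..<b i} \<inter> {a j<..<b j} = {}) \<and>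
       (\<Sum>i<n. b i - a i) < d \<longrightarrow> (\<Sum>i<n. \<bar>f (b i) - f (a i)\<bar>) < \<epsilon> / (2 * M)" if "abs_cont_on S f" for f
    using that unfolding abs_cont_on_def by (elim allE impE)
  obtain d1 d2 where d: "d1 > 0" "\<forall>(n::nat) (a::nat\<Rightarrow>real) b. (\<forall>i<n. a i \<le> b i \<and> {a i..b i} \<subseteq> S) \<and>
       (\<forall>i<n. \<forall>j<n. i \<noteq> j \<longrightarrow> {a i<..<b i} \<inter> {a j<..<b j} = {}) \<and>
       (\<Sum>i<n. b i - a i) < d1 \<longrightarrow> (\<Sum>i<n. \<bar>F1 (b i) - F1 (a i)\<bar>) < \<epsilon> / (2 * M)"
     "d2 > 0" "\<forall>(n::nat) (a::nat\<Rightarrow>real) b. (\<forall>i<n. a i \<le> b i \<and> {a i..b i} \<subseteq> S) \<and>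
       (\<forall>i<n. \<forall>j<n. i \<noteq> j \<longrightarrow> {a i<..<b i} \<inter> {a j<..<b j} = {}) \<and>
       (\<Sum>i<n. b i - a i) < d2 \<longrightarrow> (\<Sum>i<n. \<bar>F2 (b i) - F2 (a i)\<bar>) < \<epsilon> / (2 * M)"
    using *[OF assms(1)] *[OF assms(2)] by (elim exE conjE) (rule that)
  show "\<exists>\<delta>>0. \<forall>(n::nat) (a::nat\<Rightarrow>real) b. (\<forall>i<n. a i \<le> b i \<and> {a i..b i} \<subseteq> S) \<and>
       (\<forall>i<n. \<forall>j<n. i \<noteq> j \<longrightarrow> {a i<..<b i} \<inter> {a j<..<b j} = {}) \<and>
       (\<Sum>i<n. b i - a i) < \<delta> \<longrightarrow> (\<Sum>i<n. \<bar>G (b i) - G (a i)\<bar>) < \<epsilon>"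
  proof (intro exI[of _ "min d1 d2"] conjI allI impI)
    fix n :: nat and a b :: "nat \<Rightarrow> real"
    assume *: "(\<forall>i<n. a i \<le> b i \<and> {a i..b i} \<subseteq> S) \<and>
       (\<forall>i<n. \<forall>j<n. i \<noteq> j \<longrightarrow> {a i<..<b i} \<inter> {a j<..<b j} = {}) \<and>
       (\<Sum>i<n. b i - a i) < min d1 d2"
    then have 1: "(\<Sum>i<n. \<bar>F1 (b i) - F1 (a i)\<bar>) < \<epsilon> / (2 * M)" using d(2)[THEN spec, of n, THEN spec, of a, THEN spec, of b] by simp
    have 2: "(\<Sum>i<n. \<bar>F2 (b i) - F2 (a i)\<bar>) < \<epsilon> / (2 * M)" using * d(4)[THEN spec, of n, THEN spec, of a, THEN spec, of b] by simp
    have "(\<Sum>i<n. \<bar>G (b i) - G (a i)\<bar>) \<le> (\<Sum>i<n. M * (\<bar>F1 (b i) - F1 (a i)\<bar> + \<bar>F2 (b i) - F2 (a i)\<bar>))"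
    proof (intro sum_mono assms(4))
      fix i assume "i \<in> {..<n}"
      then have "a i \<le> b i" "{a i..b i} \<subseteq> S" using * by auto
      then show "a i \<in> S" "b i \<in> S" by auto
    qed
    also have "\<dots> = M * ((\<Sum>i<n. \<bar>F1 (b i) - F1 (a i)\<bar>) + (\<Sum>i<n. \<bar>F2 (b i) - F2 (a i)\<bar>))"
      by (simp add: sum_distrib_left sum.distrib algebra_simps)
    also have "\<dots> < M * (\<epsilon> / (2 * M) + \<epsilon> / (2 * M))" using 1 2 \<open>M > 0\<close> by (intro mult_strict_left_mono) auto
    also have "\<dots> = \<epsilon>" using \<open>M > 0\<close> by simp
    finally show "(\<Sum>i<n. \<bar>G (b i) - G (a i)\<bar>) < \<epsilon>" .
  qed (use d in auto)
qed

lemma abs_cont_on_increment: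
  assumes "abs_cont_on S f" "\<epsilon> > 0"
  obtains \<delta> where "\<delta> > 0" "\<And>x y. x \<le> y \<Longrightarrow> {x..y} \<subseteq> S \<Longrightarrow> y - x < \<delta> \<Longrightarrow> \<bar>f y - f x\<bar> < \<epsilon>"
proof -
  obtain \<delta> where \<delta>: "\<delta> > 0" "\<forall>(D :: unit set) a b. finite D \<and> (\<forall>i\<in>D. a i \<le> b i \<and> {a i..b i} \<subseteq> S) \<and>
       (\<forall>i\<in>D. \<forall>j\<in>D. i \<noteq> j \<longrightarrow> {a i<..<b i} \<inter> {a j<..<b j} = {}) \<and>
       (\<Sum>i\<in>D. b i - a i) < \<delta> \<longrightarrow> (\<Sum>i\<in>D. \<bar>f (b i) - f (a i)\<bar>) < \<epsilon>"
    using abs_cont_on_sum[OF assms] by blast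
  show ?thesis
  proof (rule that[OF \<delta>(1)])
    fix x y assume "x \<le> y" "{x..y} \<subseteq> S" "y - x < \<delta>"
    then show "\<bar>f y - f x\<bar> < \<epsilon>"
      using \<delta>(2)[THEN spec, of "{()}", THEN spec, of "\<lambda>_. x", THEN spec, of "\<lambda>_. y"] by simp
  qed
qed

lemma abs_cont_on_imp_continuous_on:
  assumes "abs_cont_on {x..y} f"
  shows "continuous_on {x..y} f"
  unfolding continuous_on_iff
proof (intro ballI allI impI)
  fix z \<epsilon> :: real assume z: "z \<in> {x..y}" and "\<epsilon> > 0"
  then obtain \<delta> where \<delta>: "\<delta> > 0" "\<And>u v. u \<le> v \<Longrightarrow> {u..v} \<subseteq> {x..y} \<Longrightarrow> v - u < \<delta> \<Longrightarrow> \<bar>f v - f u\<bar> < \<epsilon>"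
    using abs_cont_on_increment[OF assms] by metis
  have "dist (f w) (f z) < \<epsilon>" if "w \<in> {x..y}" "dist w z < \<delta>" for w
    using \<delta>(2)[of "min w z" "max w z"] z that by (cases "w \<le> z") (auto simp: dist_real_def abs_minus_commute)
  then show "\<exists>d>0. \<forall>x'\<in>{x..y}. dist x' z < d \<longrightarrow> dist (f x') (f z) < \<epsilon>" using \<delta>(1) by blast
qed

text \<open>Hoelder continuity of exponent 1/2, the modulus that Cauchy-Schwarz gives to a primitive
  of a square-integrable function.\<close>

lemma continuous_on_of_square_increments:
  fixes F :: "real \<Rightarrow> real"
  assumes "\<And>x y. x \<in> S \<Longrightarrow> y \<in> S \<Longrightarrow> x \<le> y \<Longrightarrow> (F y - F x)\<^sup>2 \<le> C * (y - x)"
  shows "continuous_on S F"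
  unfolding continuous_on_iff
proof (intro ballI allI impI)
  fix z \<epsilon> :: real assume z: "z \<in> S" and "\<epsilon> > 0"
  define \<delta> where "\<delta> = \<epsilon>\<^sup>2 / (\<bar>C\<bar> + 1)"
  have "dist (F w) (F z) < \<epsilon>" if "w \<in> S" "dist w z < \<delta>" for w
  proof -
    have "(F w - F z)\<^sup>2 \<le> C * \<bar>w - z\<bar>"
      using assms[of w z] assms[of z w] z that by (cases "w \<le> z") (auto simp: power2_commute abs_if)
    also have "\<dots> \<le> (\<bar>C\<bar> + 1) * \<bar>w - z\<bar>" by (intro mult_right_mono) auto
    also have "\<dots> < (\<bar>C\<bar> + 1) * \<delta>" using that by (intro mult_strict_left_mono) (auto simp: dist_real_def)
    also have "\<dots> = \<epsilon>\<^sup>2" by (simp add: \<delta>_def)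
    finally have "(F w - F z)\<^sup>2 < \<epsilon>\<^sup>2" .
    then show ?thesis using \<open>\<epsilon> > 0\<close> by (metis abs_le_square_iff dist_real_def not_le abs_of_pos)
  qed
  moreover have "\<delta> > 0" using \<open>\<epsilon> > 0\<close> by (simp add: \<delta>_def add_nonneg_pos)
  ultimately show "\<exists>d>0. \<forall>x'\<in>S. dist x' z < d \<longrightarrow> dist (F x') (F z) < \<epsilon>" by blast
qed

text \<open>\<open>h\<close> is the derivative of \<open>F\<close>, normalised to vanish off \<open>(l, r)\<close>. The increment formula extends to
  finite endpoints, so there \<open>F\<close> takes its limit values.\<close>

definition H1_on :: "ereal \<Rightarrow> ereal \<Rightarrow> (real \<Rightarrow> real) \<Rightarrow> (real \<Rightarrow> real) \<Rightarrow> bool" where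
  "H1_on l r F h \<longleftrightarrow> h \<in> borel_measurable borel \<and> (\<forall>x. x \<notin> open_lr l r \<longrightarrow> h x = 0) \<and>
     integrable lborel (\<lambda>x. (h x)\<^sup>2) \<and>
     (\<forall>x y. l \<le> ereal x \<longrightarrow> x \<le> y \<longrightarrow> ereal y \<le> r \<longrightarrow> F y - F x = (LINT t:{x..y}|lborel. h t))"

lemma H1_onD:
  assumes "H1_on l r F h"
  shows "h \<in> borel_measurable borel" "\<And>x. x \<notin> open_lr l r \<Longrightarrow> h x = 0" "integrable lborel (\<lambda>x. (h x)\<^sup>2)"
    "\<And>x y. l \<le> ereal x \<Longrightarrow> x \<le> y \<Longrightarrow> ereal y \<le> r \<Longrightarrow> F y - F x = (LINT t:{x..y}|lborel. h t)"
    "\<And>x y. set_integrable lborel {x..y} h"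
  using assms set_integrable_Icc_of_square[of h] by (auto simp: H1_on_def)

lemma H1_on_increment_le:
  assumes "H1_on l r F h" "l \<le> ereal x" "x \<le> y" "ereal y \<le> r"
  shows "(F y - F x)\<^sup>2 \<le> (y - x) * (LINT t:{x..y}|lborel. (h t)\<^sup>2)"
  using set_integral_Icc_square_le[of h x y] H1_onD[OF assms(1)] assms by simp

lemma set_integral_square_le_integral:
  fixes h :: "'a \<Rightarrow> real"
  assumes "integrable M (\<lambda>x. (h x)\<^sup>2)" "A \<in> sets M"
  shows "(LINT t:A|M. (h t)\<^sup>2) \<le> (\<integral>t. (h t)\<^sup>2 \<partial>M)" "0 \<le> (LINT t:A|M. (h t)\<^sup>2)"
  using assms set_integrable_of_integrable[OF assms] unfolding set_lebesgue_integral_def set_integrable_def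
  by (auto intro!: integral_mono simp: indicator_def)

lemma H1_on_continuous:
  assumes "H1_on l r F h"
  shows "continuous_on {x. l \<le> ereal x \<and> ereal x \<le> r} F"
proof (rule continuous_on_of_square_increments)
  fix x y assume *: "x \<in> {x. l \<le> ereal x \<and> ereal x \<le> r}" "y \<in> {x. l \<le> ereal x \<and> ereal x \<le> r}" "x \<le> y"
  then have "(F y - F x)\<^sup>2 \<le> (y - x) * (LINT t:{x..y}|lborel. (h t)\<^sup>2)"
    using H1_on_increment_le[OF assms, of x y] by auto
  also have "\<dots> \<le> (y - x) * (\<integral>t. (h t)\<^sup>2 \<partial>lborel)"
    using * H1_onD(3)[OF assms] by (intro mult_left_mono set_integral_square_le_integral) auto
  finally show "(F y - F x)\<^sup>2 \<le> (\<integral>t. (h t)\<^sup>2 \<partial>lborel) * (y - x)" by (simp add: mult.commute)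
qed

lemma ac_L2_isCont:
  assumes "ac_L2 l r F h" "l < ereal z" "ereal z < r"
  shows "isCont F z"
proof -
  obtain u v where uv: "l < ereal u" "ereal u < ereal z" "ereal z < ereal v" "ereal v < r"
    using assms ereal_dense2 by metis
  have "{u..v} \<subseteq> open_lr l r"
    using uv by (auto simp: open_lr_def intro: less_le_trans[of l "ereal u"] le_less_trans[of _ "ereal v" r])
  then have "continuous_on {u..v} F" using assms by (auto simp: ac_L2_def intro!: abs_cont_on_imp_continuous_on)
  then show ?thesis using uv by (intro continuous_on_interior[of "{u..v}"]) auto
qed

lemma ac_L2_continuous_on:
  assumes ac: "ac_L2 l r F h" and "l \<le> ereal x" "ereal y \<le> r" "x < y"
  shows "continuous_on {x..y} F"
proof (rule continuous_on_IccI)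
  show "(F \<longlongrightarrow> F x) (at_right x)"
  proof (cases "l = ereal x")
    case False
    then have "isCont F x" using assms less_le_trans[of "ereal x" "ereal y" r] by (intro ac_L2_isCont[OF ac]) auto
    then show ?thesis unfolding isCont_def by (rule tendsto_within_subset) simp
  qed (use ac in \<open>simp add: ac_L2_def\<close>)
  show "(F \<longlongrightarrow> F y) (at_left y)"
  proof (cases "r = ereal y")
    case False
    then have "isCont F y" using assms le_less_trans[of l "ereal x" "ereal y"] by (intro ac_L2_isCont[OF ac]) auto
    then show ?thesis unfolding isCont_def by (rule tendsto_within_subset) simp
  qed (use ac in \<open>simp add: ac_L2_def\<close>)
  show "F \<midarrow>z\<rightarrow> F z" if "x < z" "z < y" for z
  proof -
    have "l < ereal z" "ereal z < r" using that assms by (auto intro: le_less_trans[of l "ereal x"] less_le_trans[of _ "ereal y" r])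
    then show ?thesis using ac_L2_isCont[OF ac] by (simp add: isCont_def)
  qed
qed (fact \<open>x < y\<close>)

lemma ac_L2_interior_increment:
  assumes ac: "ac_L2 l r F h" and g: "g = (\<lambda>x. indicator (open_lr l r) x * h x)" "\<And>x y. set_integrable lborel {x..y} g"
    and "x \<le> y" "{x..y} \<subseteq> open_lr l r"
  shows "F y - F x = (LINT t:{x..y}|lborel. g t)"
proof -
  have "AE x in lborel. x \<in> open_lr l r \<longrightarrow> (F has_real_derivative h x) (at x)" using ac by (simp add: ac_L2_def)
  then obtain N where N: "N \<in> null_sets lborel" "{x. \<not> (x \<in> open_lr l r \<longrightarrow> (F has_real_derivative h x) (at x))} \<subseteq> N"
    unfolding eventually_ae_filter by auto
  have "negligible N" using N(1) by (simp add: negligible_iff_null_sets null_sets_completionI)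
  then have "(g has_integral F y - F x) {x..y}"
  proof (rule has_integral_of_abs_cont_on[OF \<open>x \<le> y\<close>, rotated])
    show "abs_cont_on {x..y} F" using ac assms by (simp add: ac_L2_def)
    show "(F has_real_derivative g z) (at z within {x..y})" if "z \<in> {x..y} - N" for z
    proof -
      have "z \<in> open_lr l r" "z \<notin> N" using that assms by auto
      then have "(F has_real_derivative g z) (at z)" using N(2) by (auto simp: g)
      then show ?thesis by (rule has_field_derivative_at_within)
    qed
  qed
  moreover have "(g has_integral (LINT t:{x..y}|lborel. g t)) {x..y}"
    using set_borel_integral_eq_integral[OF g(2)] has_integral_integral by metis
  ultimately show ?thesis by (rule has_integral_unique)
qed

text \<open>Between interior points the formula is the fundamental theorem of calculus. So
  \<open>F\<close> minus the integral function is constant on the open interval, and since both are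
  continuous up to finite endpoints the constant persists on the closure.\<close>

theorem ac_L2_imp_H1_on:
  assumes ac: "ac_L2 l r F h"
  shows "H1_on l r F (\<lambda>x. indicator (open_lr l r) x * h x)"
proof -
  define g where "g = (\<lambda>x. indicator (open_lr l r) x * h x)"
  have g_meas: "g \<in> borel_measurable borel" using ac by (simp add: ac_L2_def g_def set_borel_measurable_def)
  have "(g x)\<^sup>2 = indicator (open_lr l r) x *\<^sub>R (h x)\<^sup>2" for x by (simp add: g_def indicator_def)
  then have g2: "integrable lborel (\<lambda>x. (g x)\<^sup>2)" using ac by (simp add: ac_L2_def set_integrable_def)
  note gi = set_integrable_Icc_of_square[OF g_meas g2]
  have "F y - F x = (LINT t:{x..y}|lborel. g t)" if xy: "l \<le> ereal x" "x < y" "ereal y \<le> r" for x y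
  proof -
    have inc: "{u..v} \<subseteq> open_lr l r" if "x < u" "v < y" for u v
      using xy that by (auto simp: open_lr_def intro: le_less_trans[of l "ereal x"] less_le_trans[of _ "ereal y" r])
    \<comment> \<open>An interior comparison point: the increment formula is so far available only
      between points of (l, r), and \<open>x\<close> or \<open>y\<close> may be an endpoint.\<close>
    define m where "m = (x + y) / 2"
    define G where "G z = (LINT t:{x..z}|lborel. g t)" for z
    have Gd: "G v - G u = (LINT t:{u..v}|lborel. g t)" if "x \<le> u" "u \<le> v" for u v
      using set_integral_Icc_add[OF gi that] by (simp add: G_def)
    have "continuous_on {x..y} G"
    proof (rule continuous_on_of_square_increments)
      fix u v assume "u \<in> {x..y}" "v \<in> {x..y}" "u \<le> v"
      then have "(G v - G u)\<^sup>2 \<le> (v - u) * (LINT t:{u..v}|lborel. (g t)\<^sup>2)"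
        using Gd[of u v] set_integral_Icc_square_le[OF g_meas g2, of u v] by simp
      also have "\<dots> \<le> (v - u) * (\<integral>t. (g t)\<^sup>2 \<partial>lborel)"
        using \<open>u \<le> v\<close> g2 by (intro mult_left_mono set_integral_square_le_integral) auto
      finally show "(G v - G u)\<^sup>2 \<le> (\<integral>t. (g t)\<^sup>2 \<partial>lborel) * (v - u)" by (simp add: mult.commute)
    qed
    then have cont: "continuous_on (closure {x<..<y}) (\<lambda>z. F z - G z)"
      using ac_L2_continuous_on[OF ac xy(1,3,2)] \<open>x < y\<close> by (auto intro: continuous_on_diff)
    have const: "F z - G z = F m - G m" if "z \<in> {x<..<y}" for z
    proof (cases "z \<le> m")
      case True
      then show ?thesis using ac_L2_interior_increment[OF ac g_def gi True inc] Gd[of z m] that xy by (auto simp: m_def)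
    next
      case False
      then show ?thesis using ac_L2_interior_increment[OF ac g_def gi _ inc, of m z] Gd[of m z] that xy by (auto simp: m_def)
    qed
    have "F z - G z = F m - G m" if "z \<in> closure {x<..<y}" for z
      by (rule continuous_constant_on_closure[OF cont const that])
    from this[of x] this[of y] have "F y - F x = G y - G x" using \<open>x < y\<close> by simp
    then show ?thesis by (simp add: G_def)
  qed
  then have "F y - F x = (LINT t:{x..y}|lborel. g t)" if "l \<le> ereal x" "x \<le> y" "ereal y \<le> r" for x y
    using that by (cases "x = y") auto
  then show ?thesis using g_meas g2 unfolding g_def[symmetric] H1_on_def by (auto simp: g_def)
qed

section \<open>From the increment formula back to absolute continuity\<close>

lemma weighted_AM_GM_integral:
  fixes h :: "real \<Rightarrow> real"
  assumes [measurable]: "h \<in> borel_measurable borel" and h2: "integrable lborel (\<lambda>x. (h x)\<^sup>2)" and "x \<le> y" "t > 0"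
  shows "\<bar>LINT z:{x..y}|lborel. h z\<bar> \<le> t * (y - x) + (LINT z:{x..y}|lborel. (h z)\<^sup>2) / t"
proof -
  let ?I = "LINT z:{x..y}|lborel. h z" and ?B = "LINT z:{x..y}|lborel. (h z)\<^sup>2"
  have B: "0 \<le> ?B" using h2 by (intro set_integral_square_le_integral) auto
  have "?I\<^sup>2 \<le> (y - x) * ?B" by (rule set_integral_Icc_square_le[OF assms(1-3)])
  also have "\<dots> = (t * (y - x)) * (?B / t)" using \<open>t > 0\<close> by simp
  also have "\<dots> \<le> (t * (y - x) + ?B / t)\<^sup>2"
    using B \<open>t > 0\<close> \<open>x \<le> y\<close> by (simp add: power2_sum)
  finally have "\<bar>?I\<bar> \<le> \<bar>t * (y - x) + ?B / t\<bar>" by (simp only: abs_le_square_iff)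
  moreover have "0 \<le> t * (y - x) + ?B / t" using B \<open>t > 0\<close> \<open>x \<le> y\<close> by simp
  ultimately show ?thesis by simp
qed

text \<open>Cauchy-Schwarz on each interval would have to be summed through square roots.
  \<open>weighted_AM_GM_integral\<close> splits the bound into \<open>t\<close> times length plus
  energy over \<open>t\<close>, and both parts are additive: a large \<open>t\<close> makes the
  energy part small, then a small total length handles the other.\<close>

lemma H1_on_abs_cont_on:
  assumes H: "H1_on l r F h" and xy: "{x..y} \<subseteq> open_lr l r"
  shows "abs_cont_on {x..y} F"
  unfolding abs_cont_on_def
proof (intro allI impI)
  note H1 = H1_onD[OF H]
  fix \<epsilon> :: real assume "\<epsilon> > 0"
  define B where "B = (\<integral>t. (h t)\<^sup>2 \<partial>lborel)"
  have "B \<ge> 0" by (simp add: B_def)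
  define t where "t = 2 * (B + 1) / \<epsilon>"
  have t: "t > 0" "B / t < \<epsilon> / 2" using \<open>B \<ge> 0\<close> \<open>\<epsilon> > 0\<close> by (auto simp: t_def field_simps)
  show "\<exists>\<delta>>0. \<forall>(n::nat) (a::nat\<Rightarrow>real) b. (\<forall>i<n. a i \<le> b i \<and> {a i..b i} \<subseteq> {x..y}) \<and>
       (\<forall>i<n. \<forall>j<n. i \<noteq> j \<longrightarrow> {a i<..<b i} \<inter> {a j<..<b j} = {}) \<and>
       (\<Sum>i<n. b i - a i) < \<delta> \<longrightarrow> (\<Sum>i<n. \<bar>F (b i) - F (a i)\<bar>) < \<epsilon>"
  proof (intro exI[of _ "\<epsilon> / (2 * t)"] conjI allI impI; (elim conjE)?)
    fix n :: nat and a b :: "nat \<Rightarrow> real"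
    assume ab: "\<forall>i<n. a i \<le> b i \<and> {a i..b i} \<subseteq> {x..y}"
       and disj: "\<forall>i<n. \<forall>j<n. i \<noteq> j \<longrightarrow> {a i<..<b i} \<inter> {a j<..<b j} = {}"
       and small: "(\<Sum>i<n. b i - a i) < \<epsilon> / (2 * t)"
    have le: "\<bar>F (b i) - F (a i)\<bar> \<le> t * (b i - a i) + (LINT z:{a i..b i}|lborel. (h z)\<^sup>2) / t" if "i < n" for i
    proof -
      have "a i \<le> b i" "a i \<in> open_lr l r" "b i \<in> open_lr l r" using ab xy that by fastforce+
      then have "F (b i) - F (a i) = (LINT t:{a i..b i}|lborel. h t)" by (intro H1(4)) (auto simp: open_lr_def)
      then show ?thesis using weighted_AM_GM_integral[OF H1(1,3) \<open>a i \<le> b i\<close> t(1)] by simp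
    qed
    have Ioo: "(LINT z:{u..v}|lborel. (h z)\<^sup>2) = (LINT z:{u<..<v}|lborel. (h z)\<^sup>2)" for u v
      using H1(1) by (intro set_integral_Icc_eq_Ioo) simp
    have "(\<Sum>i<n. LINT z:{a i..b i}|lborel. (h z)\<^sup>2) = (LINT z:(\<Union>i<n. {a i<..<b i})|lborel. (h z)\<^sup>2)"
      unfolding Ioo
    proof (intro set_integral_finite_UN_AE[symmetric] set_integrable_of_integrable H1(3) AE_I2 impI)
      fix i j z assume "i \<in> {..<n}" "j \<in> {..<n}" and "z \<in> {a i<..<b i} \<and> z \<in> {a j<..<b j}"
      then show "i = j" using disj by blast
    qed auto
    also have "\<dots> \<le> B" unfolding B_def using H1(3) by (intro set_integral_square_le_integral) auto
    finally have sumB: "(\<Sum>i<n. LINT z:{a i..b i}|lborel. (h z)\<^sup>2) \<le> B" .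
    have "(\<Sum>i<n. \<bar>F (b i) - F (a i)\<bar>) \<le> (\<Sum>i<n. t * (b i - a i) + (LINT z:{a i..b i}|lborel. (h z)\<^sup>2) / t)"
      by (intro sum_mono le) auto
    also have "\<dots> = t * (\<Sum>i<n. b i - a i) + (\<Sum>i<n. LINT z:{a i..b i}|lborel. (h z)\<^sup>2) / t"
      by (simp only: sum.distrib sum_distrib_left sum_divide_distrib)
    also have "\<dots> \<le> t * (\<Sum>i<n. b i - a i) + B / t"
      using t(1) sumB by (simp add: divide_right_mono)
    also have "\<dots> < \<epsilon>"
    proof -
      have "t * (\<Sum>i<n. b i - a i) < t * (\<epsilon> / (2 * t))" using small t(1) by (rule mult_strict_left_mono)
      also have "\<dots> = \<epsilon> / 2" using t(1) by simp
      finally show ?thesis using t(2) by linarith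
    qed
    finally show "(\<Sum>i<n. \<bar>F (b i) - F (a i)\<bar>) < \<epsilon>" .
  qed (use \<open>\<epsilon> > 0\<close> t in auto)
qed

text \<open>A square-integrable \<open>h\<close> need not be integrable on the line, so the
  differentiation theorem is applied in each window (-n, n).\<close>

lemma H1_on_has_real_derivative:
  assumes H: "H1_on l r F h"
  shows "AE x in lborel. x \<in> open_lr l r \<longrightarrow> (F has_real_derivative h x) (at x)"
proof -
  note H1 = H1_onD[OF H]
  have "AE x in lborel. \<forall>n::nat. x \<in> open_lr l r \<inter> {-real n<..<real n} \<longrightarrow> (F has_real_derivative indicator {-real n..real n} x * h x) (at x)"
  proof (subst AE_all_countable, intro allI)
    fix n :: nat
    show "AE x in lborel. x \<in> open_lr l r \<inter> {-real n<..<real n} \<longrightarrow> (F has_real_derivative indicator {-real n..real n} x * h x) (at x)"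
    proof (rule AE_has_real_derivative_of_integral)
      show "integrable lborel (\<lambda>x. indicator {-real n..real n} x * h x)" using H1(5)[of "-real n" "real n"] by (simp add: set_integrable_def)
      fix x y assume "x \<le> y" and sub: "{x..y} \<subseteq> open_lr l r \<inter> {-real n<..<real n}"
      then have "x \<in> {x..y}" "y \<in> {x..y}" by auto
      then have "x \<in> open_lr l r" "y \<in> open_lr l r" using sub by blast+
      then have "F y - F x = (LINT t:{x..y}|lborel. h t)" using \<open>x \<le> y\<close> by (intro H1(4)) (auto simp: open_lr_def)
      also have "\<dots> = (LINT t:{x..y}|lborel. indicator {-real n..real n} t * h t)"
        using sub by (intro set_lebesgue_integral_cong) (auto simp: indicator_def)
      finally show "F y - F x = (LINT t:{x..y}|lborel. indicator {-real n..real n} t * h t)" .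
    qed auto
  qed
  then show ?thesis
  proof eventually_elim
    case (elim x)
    obtain n :: nat where "\<bar>x\<bar> < real n" using reals_Archimedean2 by blast
    then show ?case using elim[THEN spec, of n] by (auto simp: abs_less_iff)
  qed
qed

lemma tendsto_at_lower_end:
  assumes "continuous_on {x. l \<le> ereal x \<and> ereal x \<le> r} F" "l < r" "l = ereal a"
  shows "(F \<longlongrightarrow> F a) (at_right a)"
proof -
  obtain b where b: "ereal a < ereal b" "ereal b < r" using ereal_dense2[of l r] assms(2,3) by metis
  then have "{a..b} \<subseteq> {x. l \<le> ereal x \<and> ereal x \<le> r}"
    using assms(3) by (auto intro: order_trans[of _ "ereal b"] less_imp_le)
  then have "continuous_on {a..b} F" using assms(1) continuous_on_subset by blast
  then show ?thesis using b by (intro continuous_on_Icc_at_rightD) auto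
qed

lemma tendsto_at_upper_end:
  assumes "continuous_on {x. l \<le> ereal x \<and> ereal x \<le> r} F" "l < r" "r = ereal b"
  shows "(F \<longlongrightarrow> F b) (at_left b)"
proof -
  obtain a where a: "l < ereal a" "ereal a < ereal b" using ereal_dense2[of l r] assms(2,3) by metis
  then have "{a..b} \<subseteq> {x. l \<le> ereal x \<and> ereal x \<le> r}"
    using assms(3) by (auto intro: order_trans[of _ "ereal a"] less_imp_le)
  then have "continuous_on {a..b} F" using assms(1) continuous_on_subset by blast
  then show ?thesis using a by (intro continuous_on_Icc_at_leftD) auto
qed

lemma H1_on_imp_ac_L2:
  assumes H: "H1_on l r F h" and "l < r"
  shows "ac_L2 l r F h"
  unfolding ac_L2_def
proof (intro conjI allI impI)
  note H1 = H1_onD[OF H]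
  show "abs_cont_on {x..y} F" if "{x..y} \<subseteq> open_lr l r" for x y using H1_on_abs_cont_on[OF H that] .
  show "AE x in lborel. x \<in> open_lr l r \<longrightarrow> (F has_real_derivative h x) (at x)" by (rule H1_on_has_real_derivative[OF H])
  show "set_borel_measurable lborel (open_lr l r) h" using H1(1) by (simp add: set_borel_measurable_def)
  show "set_integrable lborel (open_lr l r) (\<lambda>x. (h x)\<^sup>2)" using H1(3) by (intro set_integrable_of_integrable) auto
qed (use tendsto_at_lower_end[OF H1_on_continuous[OF H] \<open>l < r\<close>] tendsto_at_upper_end[OF H1_on_continuous[OF H] \<open>l < r\<close>] in auto)


text \<open>For functions built nonlinearly from \<open>F1\<close> and \<open>F2\<close> the
  increment formula is not checked directly. Local domination of increments gives absolute
  continuity, the derivative is computed pointwise, and the fundamental theorem of calculus inside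
  \<open>ac_L2_imp_H1_on\<close> returns the formula.\<close>

lemma H1_on_derivI:
  assumes "l < r" "H1_on l r F1 h1" "H1_on l r F2 h2"
    and dom: "\<And>u v. {u..v} \<subseteq> open_lr l r \<Longrightarrow>
       \<exists>M>0. \<forall>x\<in>{u..v}. \<forall>y\<in>{u..v}. \<bar>G y - G x\<bar> \<le> M * (\<bar>F1 y - F1 x\<bar> + \<bar>F2 y - F2 x\<bar>)"
    and k: "k \<in> borel_measurable borel" "\<And>x. x \<notin> open_lr l r \<Longrightarrow> k x = 0" "integrable lborel (\<lambda>x. (k x)\<^sup>2)"
    and der: "AE x in lborel. x \<in> open_lr l r \<longrightarrow> (G has_real_derivative k x) (at x)"
    and cont: "continuous_on {x. l \<le> ereal x \<and> ereal x \<le> r} G"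
  shows "H1_on l r G k"
proof -
  have "ac_L2 l r G k"
    unfolding ac_L2_def
  proof (intro conjI allI impI)
    fix u v assume uv: "{u..v} \<subseteq> open_lr l r"
    obtain M where "M > 0" "\<forall>x\<in>{u..v}. \<forall>y\<in>{u..v}. \<bar>G y - G x\<bar> \<le> M * (\<bar>F1 y - F1 x\<bar> + \<bar>F2 y - F2 x\<bar>)"
      using dom[OF uv] by blast
    then show "abs_cont_on {u..v} G"
      using abs_cont_on_dominated[OF H1_on_abs_cont_on[OF assms(2) uv] H1_on_abs_cont_on[OF assms(3) uv], of M G] by blast
  next
    show "set_integrable lborel (open_lr l r) (\<lambda>x. (k x)\<^sup>2)" using k(3) by (intro set_integrable_of_integrable) auto
    show "set_borel_measurable lborel (open_lr l r) k" using k(1) by (simp add: set_borel_measurable_def)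
  qed (use der tendsto_at_lower_end[OF cont \<open>l < r\<close>] tendsto_at_upper_end[OF cont \<open>l < r\<close>] in auto)
  moreover have "(\<lambda>x. indicator (open_lr l r) x * k x) = k"
    using k(2) by (intro ext) (simp add: indicator_def of_bool_def)
  ultimately show ?thesis using ac_L2_imp_H1_on by metis
qed

section \<open>Linear operations, constants and primitives\<close>

lemma H1_on_add:
  assumes "H1_on l r F h" "H1_on l r G k"
  shows "H1_on l r (\<lambda>x. F x + G x) (\<lambda>x. h x + k x)"
  unfolding H1_on_def
proof (intro conjI allI impI)
  note H = H1_onD[OF assms(1)] and K = H1_onD[OF assms(2)]
  show "(\<lambda>x. h x + k x) \<in> borel_measurable borel" using H(1) K(1) by measurable
  show "integrable lborel (\<lambda>x. (h x + k x)\<^sup>2)" using H K by (intro integrable_square_add) auto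
  fix x y assume "l \<le> ereal x" "x \<le> y" "ereal y \<le> r"
  then show "F y + G y - (F x + G x) = (LINT t:{x..y}|lborel. h t + k t)"
    using H(4)[of x y] K(4)[of x y] set_integral_add(2)[OF H(5) K(5), of x y] by simp
qed (use H1_onD(2)[OF assms(1)] H1_onD(2)[OF assms(2)] in auto)

lemma H1_on_cmult:
  assumes "H1_on l r F h"
  shows "H1_on l r (\<lambda>x. c * F x) (\<lambda>x. c * h x)"
  unfolding H1_on_def
proof (intro conjI allI impI)
  note H = H1_onD[OF assms(1)]
  show "(\<lambda>x. c * h x) \<in> borel_measurable borel" using H(1) by measurable
  show "integrable lborel (\<lambda>x. (c * h x)\<^sup>2)" using H(3) by (simp add: power_mult_distrib)
  fix x y assume "l \<le> ereal x" "x \<le> y" "ereal y \<le> r"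
  then show "c * F y - c * F x = (LINT t:{x..y}|lborel. c * h t)"
    using H(4)[of x y] by (simp flip: right_diff_distrib)
qed (use H1_onD(2)[OF assms(1)] in auto)

lemma H1_on_diff:
  assumes "H1_on l r F h" "H1_on l r G k"
  shows "H1_on l r (\<lambda>x. F x - G x) (\<lambda>x. h x - k x)"
  using H1_on_add[OF assms(1) H1_on_cmult[OF assms(2), of "-1"]] by simp

lemma H1_on_const: "H1_on l r (\<lambda>x. c) (\<lambda>x. 0)"
  by (simp add: H1_on_def)

text \<open>The oriented integral from the base point \<open>a\<close>. The second branch carries
  the sign, since a set integral over a reversed interval would be 0.\<close>

definition primitive :: "real \<Rightarrow> (real \<Rightarrow> real) \<Rightarrow> real \<Rightarrow> real" where
  "primitive a h x = (if a \<le> x then LINT t:{a..x}|lborel. h t else - (LINT t:{x..a}|lborel. h t))"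

lemma primitive_diff:
  assumes "\<And>x y. set_integrable lborel {x..y} h" "x \<le> y"
  shows "primitive a h y - primitive a h x = (LINT t:{x..y}|lborel. h t)"
  using set_integral_Icc_add[OF assms(1), of a x y] set_integral_Icc_add[OF assms(1), of x a y] 
    set_integral_Icc_add[OF assms(1), of x y a] assms(2)
  by (auto simp: primitive_def)

lemma primitive_base [simp]: "primitive a h a = 0"
  by (simp add: primitive_def)

lemma H1_on_primitive:
  assumes h: "h \<in> borel_measurable borel" "\<And>x. x \<notin> open_lr l r \<Longrightarrow> h x = 0" "integrable lborel (\<lambda>x. (h x)\<^sup>2)"
  shows "H1_on l r (\<lambda>x. c + primitive a h x) h"
  using primitive_diff[OF set_integrable_Icc_of_square[OF h(1,3)]] h by (simp add: H1_on_def)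

text \<open>Turns L2 convergence of derivatives into pointwise convergence of primitives with a
  common base point.\<close>

lemma primitive_diff_square_le:
  fixes h k :: "real \<Rightarrow> real"
  assumes h: "h \<in> borel_measurable borel" "integrable lborel (\<lambda>x. (h x)\<^sup>2)"
    and k: "k \<in> borel_measurable borel" "integrable lborel (\<lambda>x. (k x)\<^sup>2)"
  shows "(primitive a h x - primitive a k x)\<^sup>2 \<le> \<bar>x - a\<bar> * (\<integral>t. (h t - k t)\<^sup>2 \<partial>lborel)"
proof -
  let ?d = "\<lambda>t. h t - k t"
  have d: "?d \<in> borel_measurable borel" "integrable lborel (\<lambda>x. (?d x)\<^sup>2)"
    using h k by (auto intro: integrable_square_diff)
  have le: "(LINT t:{u..v}|lborel. ?d t)\<^sup>2 \<le> (v - u) * (\<integral>t. (?d t)\<^sup>2 \<partial>lborel)" if "u \<le> v" for u v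
    by (rule order_trans[OF set_integral_Icc_square_le[OF d that]])
       (use that d(2) in \<open>intro mult_left_mono set_integral_square_le_integral, auto\<close>)
  have eq: "(LINT t:{u..v}|lborel. ?d t) = (LINT t:{u..v}|lborel. h t) - (LINT t:{u..v}|lborel. k t)" for u v
    using set_integrable_Icc_of_square h k by (intro set_integral_diff(2)) auto
  show ?thesis
    using le[of a x] le[of x a] unfolding eq primitive_def by (auto simp: power2_commute abs_if)
qed

lemma tendsto_of_square_le:
  fixes f :: "nat \<Rightarrow> real"
  assumes "\<And>n. (f n - c)\<^sup>2 \<le> g n" "g \<longlonglongrightarrow> 0"
  shows "f \<longlonglongrightarrow> c"
proof -
  have "(\<lambda>n. (f n - c)\<^sup>2) \<longlonglongrightarrow> 0"
    by (rule tendsto_sandwich[OF _ _ tendsto_const assms(2)]) (use assms(1) in auto)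
  then have "(\<lambda>n. \<bar>f n - c\<bar>) \<longlonglongrightarrow> 0" using tendsto_real_sqrt by fastforce
  then show ?thesis by (simp add: LIM_zero_iff tendsto_rabs_zero_iff)
qed

section \<open>Unit contraction and product rule\<close>

lemma countable_isolated_points:
  fixes Z :: "real set"
  shows "countable {x\<in>Z. \<exists>d>0. \<forall>y\<in>Z. y \<noteq> x \<longrightarrow> d \<le> \<bar>y - x\<bar>}" (is "countable ?S")
proof -
  \<comment> \<open>An isolated point is the only point of \<open>Z\<close> in some interval with
    rational endpoints, which yields an injection into pairs of rationals.\<close>
  have *: "\<exists>g. g \<in> \<rat> \<times> \<rat> \<and> fst g < x \<and> x < snd g \<and> Z \<inter> {fst g<..<snd g} = {x}" if "x \<in> ?S" for x
  proof -
    have xZ: "x \<in> Z" using that by blast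
    obtain d where d: "d > 0" "\<And>y. y \<in> Z \<Longrightarrow> y \<noteq> x \<Longrightarrow> d \<le> \<bar>y - x\<bar>" using \<open>x \<in> ?S\<close> by blast
    obtain p where p: "p \<in> \<rat>" "x - d < p" "p < x" using Rats_dense_in_real[of "x - d" x] d by auto
    obtain q where q: "q \<in> \<rat>" "x < q" "q < x + d" using Rats_dense_in_real[of x "x + d"] d by auto
    have eq: "y = x" if "y \<in> Z" "p < y" "y < q" for y
    proof (rule ccontr)
      assume "y \<noteq> x"
      then show False using d(2)[OF that(1)] that p q by linarith
    qed
    have "Z \<inter> {p<..<q} \<subseteq> {x}"
    proof
      fix y assume "y \<in> Z \<inter> {p<..<q}"
      then have "y = x" by (intro eq) simp_all
      then show "y \<in> {x}" by simp
    qed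
    moreover have "x \<in> Z \<inter> {p<..<q}" using p q xZ by simp
    ultimately have "Z \<inter> {p<..<q} = {x}" by blast
    then show ?thesis using p q by (intro exI[of _ "(p, q)"]) auto
  qed
  obtain g where g: "\<forall>x\<in>?S. g x \<in> \<rat> \<times> \<rat> \<and> fst (g x) < x \<and> x < snd (g x) \<and> Z \<inter> {fst (g x)<..<snd (g x)} = {x}"
    using bchoice[OF ballI[OF *]] ..
  have "inj_on g ?S"
  proof (rule inj_onI)
    fix x y assume "x \<in> ?S" "y \<in> ?S" and eq: "g x = g y"
    have "Z \<inter> {fst (g x)<..<snd (g x)} = {x}" using bspec[OF g \<open>x \<in> ?S\<close>] by (elim conjE)
    moreover have "Z \<inter> {fst (g y)<..<snd (g y)} = {y}" using bspec[OF g \<open>y \<in> ?S\<close>] by (elim conjE)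
    ultimately show "x = y" unfolding eq by simp
  qed
  moreover have "countable (g ` ?S)"
    by (rule countable_subset[of _ "\<rat> \<times> \<rat>"]) (use g in \<open>blast, simp add: countable_rat\<close>)
  ultimately show ?thesis by (rule countable_image_inj_on[rotated])
qed

lemma has_real_derivative_nonzero_isolated:
  fixes F :: "real \<Rightarrow> real"
  assumes "(F has_real_derivative D) (at x)" "D \<noteq> 0"
  shows "\<exists>d>0. \<forall>y. F y = F x \<longrightarrow> y \<noteq> x \<longrightarrow> d \<le> \<bar>y - x\<bar>"
proof -
  have "((\<lambda>y. (F y - F x) / (y - x)) \<longlongrightarrow> D) (at x)" using assms by (simp add: has_field_derivative_iff)
  then have "\<forall>\<^sub>F y in at x. (F y - F x) / (y - x) \<noteq> 0" using assms(2) by (rule tendsto_imp_eventually_ne)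
  then obtain d where "d > 0" "\<And>y. y \<noteq> x \<Longrightarrow> dist y x < d \<Longrightarrow> F y \<noteq> F x"
    by (auto simp: eventually_at)
  then show ?thesis by (intro exI[of _ d]) (auto simp: dist_real_def not_less[symmetric])
qed

text \<open>Where \<open>F\<close> takes a prescribed value with non-zero derivative, that value is taken at an
  isolated point; so almost everywhere the kinks of the contraction do no harm.\<close>

lemma AE_derivative_zero_at_level:
  assumes "AE x in lborel. x \<in> S \<longrightarrow> (F has_real_derivative h x) (at x)"
  shows "AE x in lborel. x \<in> S \<longrightarrow> F x = c \<longrightarrow> h x = 0"
proof -
  define Z where "Z = {x. F x = c}"
  have "AE x in lborel. x \<notin> {x\<in>Z. \<exists>d>0. \<forall>y\<in>Z. y \<noteq> x \<longrightarrow> d \<le> \<bar>y - x\<bar>}"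
    by (rule AE_not_in[OF countable_imp_null_set_lborel[OF countable_isolated_points]])
  then show ?thesis using assms
  proof eventually_elim
    case (elim x)
    show ?case
    proof (intro impI, rule ccontr)
      assume "x \<in> S" "F x = c" "h x \<noteq> 0"
      then have "\<exists>d>0. \<forall>y. F y = F x \<longrightarrow> y \<noteq> x \<longrightarrow> d \<le> \<bar>y - x\<bar>"
        using elim has_real_derivative_nonzero_isolated by blast
      then show False using elim \<open>F x = c\<close> by (auto simp: Z_def)
    qed
  qed
qed

theorem H1_on_contraction:
  assumes H: "H1_on l r F h" and "l < r"
  shows "H1_on l r (\<lambda>x. min 1 (max 0 (F x))) (\<lambda>x. if x \<in> open_lr l r \<and> 0 < F x \<and> F x < 1 then h x else 0)"
    (is "H1_on l r ?G ?k")
proof (rule H1_on_derivI[OF \<open>l < r\<close> H H1_on_const[of l r 0]])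
  note H1 = H1_onD[OF H]
  have cont: "continuous_on {x. l \<le> ereal x \<and> ereal x \<le> r} F" by (rule H1_on_continuous[OF H])
  have contF: "continuous_on (open_lr l r) F" by (rule continuous_on_subset[OF cont]) (auto simp: open_lr_def)
  define Q where "Q = {x\<in>open_lr l r. F x \<in> {0<..<1}}"
  have "Q = open_lr l r \<inter> F -` {0<..<1}" by (auto simp: Q_def)
  then have "open Q" using continuous_open_preimage[OF contF, of "{0<..<1}"] by simp
  have k: "?k = (\<lambda>x. indicator Q x * h x)" by (auto simp: Q_def indicator_def)
  show "?k \<in> borel_measurable borel" unfolding k using H1(1) borel_open[OF \<open>open Q\<close>]
    by (intro borel_measurable_times borel_measurable_indicator) auto
  then show "integrable lborel (\<lambda>x. (?k x)\<^sup>2)"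
    by (intro Bochner_Integration.integrable_bound[OF H1(3)]) auto
  show "\<exists>M>0. \<forall>x\<in>{u..v}. \<forall>y\<in>{u..v}. \<bar>?G y - ?G x\<bar> \<le> M * (\<bar>F y - F x\<bar> + \<bar>0 - 0\<bar>)" for u v
    by (intro exI[of _ 1]) (auto simp: min_def max_def abs_if)
  show "continuous_on {x. l \<le> ereal x \<and> ereal x \<le> r} ?G" using cont by (intro continuous_intros)
  have der: "AE x in lborel. x \<in> open_lr l r \<longrightarrow> (F has_real_derivative h x) (at x)" by (rule H1_on_has_real_derivative[OF H])
  show "AE x in lborel. x \<in> open_lr l r \<longrightarrow> (?G has_real_derivative ?k x) (at x)"
    using der AE_derivative_zero_at_level[OF der, of 0] AE_derivative_zero_at_level[OF der, of 1]
  proof eventually_elim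
    case (elim x)
    show ?case
    proof
      assume x: "x \<in> open_lr l r"
      then have D: "(F has_real_derivative h x) (at x)" using elim by blast
      then have "isCont F x" by (rule DERIV_isCont)
      consider "F x < 0" | "F x > 1" | "0 < F x" "F x < 1" | "F x = 0 \<or> F x = 1" by linarith
      then show "(?G has_real_derivative ?k x) (at x)"
      proof cases
        case 1
        have "\<forall>\<^sub>F y in nhds x. F y < 0"
          using 1 \<open>isCont F x\<close> order_tendstoD(2)[of F "F x" "at x" 0] by (simp add: isCont_def eventually_nhds_conv_at)
        then have ev: "\<forall>\<^sub>F y in nhds x. ?G y = 0" by eventually_elim auto
        show ?thesis using 1 DERIV_const by (subst DERIV_cong_ev[OF refl ev refl]) auto
      next
        case 2
        have "\<forall>\<^sub>F y in nhds x. F y > 1"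
          using 2 \<open>isCont F x\<close> order_tendstoD(1)[of F "F x" "at x" 1] by (simp add: isCont_def eventually_nhds_conv_at)
        then have ev: "\<forall>\<^sub>F y in nhds x. ?G y = 1" by eventually_elim auto
        show ?thesis using 2 DERIV_const by (subst DERIV_cong_ev[OF refl ev refl]) auto
      next
        case 3
        have "\<forall>\<^sub>F y in nhds x. F y > 0" "\<forall>\<^sub>F y in nhds x. F y < 1"
          using 3 \<open>isCont F x\<close> order_tendstoD(1)[of F "F x" "at x" 0] order_tendstoD(2)[of F "F x" "at x" 1]
          by (simp_all add: isCont_def eventually_nhds_conv_at)
        then have ev: "\<forall>\<^sub>F y in nhds x. ?G y = F y" by eventually_elim auto
        show ?thesis using 3 x D by (subst DERIV_cong_ev[OF refl ev refl]) auto
      next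
        case 4
        then have "h x = 0" "?k x = 0" using elim x by auto
        \<comment> \<open>At a kink the derivative of \<open>F\<close> is 0, and the contraction
          does not increase distances, so its difference quotients are dominated by those of
          \<open>F\<close>.\<close>
        have "((\<lambda>y. (?G y - ?G x) / (y - x)) \<longlongrightarrow> 0) (at x)"
        proof (rule tendsto_rabs_zero_cancel, rule tendsto_sandwich[OF _ _ tendsto_const])
          show "((\<lambda>y. \<bar>(F y - F x) / (y - x)\<bar>) \<longlongrightarrow> 0) (at x)"
            using D \<open>h x = 0\<close> by (intro tendsto_rabs_zero) (simp add: has_field_derivative_iff)
          have le: "\<bar>?G y - ?G x\<bar> \<le> \<bar>F y - F x\<bar>" for y by (auto simp: min_def max_def abs_if)
          show "\<forall>\<^sub>F y in at x. \<bar>(?G y - ?G x) / (y - x)\<bar> \<le> \<bar>(F y - F x) / (y - x)\<bar>"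
            unfolding abs_divide by (intro always_eventually allI divide_right_mono le abs_ge_zero)
        qed auto
        then show ?thesis unfolding \<open>?k x = 0\<close> by (simp add: has_field_derivative_iff)
      qed
    qed
  qed
qed auto

text \<open>Integrability of the squared product-rule derivative has to be assumed because
  \<open>F\<close> and \<open>G\<close> may be unbounded on (l, r). It is supplied later by bounded
  factors or by the choice of a cutoff.\<close>

theorem H1_on_mult:
  assumes F: "H1_on l r F h" and G: "H1_on l r G k" and "l < r"
    and int: "integrable lborel (\<lambda>x. (h x * G x + F x * k x)\<^sup>2)"
  shows "H1_on l r (\<lambda>x. F x * G x) (\<lambda>x. h x * G x + F x * k x)" (is "H1_on l r ?P ?p")
proof (rule H1_on_derivI[OF \<open>l < r\<close> F G])
  note H1 = H1_onD[OF F] and K1 = H1_onD[OF G]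
  have cont: "continuous_on {x. l \<le> ereal x \<and> ereal x \<le> r} F" "continuous_on {x. l \<le> ereal x \<and> ereal x \<le> r} G"
    using H1_on_continuous F G by auto
  have cont': "continuous_on (open_lr l r) F" "continuous_on (open_lr l r) G"
    by (rule continuous_on_subset[OF cont(1)] continuous_on_subset[OF cont(2)], force simp: open_lr_def)+
  have [measurable]: "(\<lambda>x. indicator (open_lr l r) x * F x) \<in> borel_measurable borel" "(\<lambda>x. indicator (open_lr l r) x * G x) \<in> borel_measurable borel"
    using borel_measurable_continuous_on_indicator[OF _ cont'(1)] borel_measurable_continuous_on_indicator[OF _ cont'(2)] by simp_all
  have [measurable]: "h \<in> borel_measurable borel" "k \<in> borel_measurable borel" using H1 K1 by auto
  have "?p = (\<lambda>x. h x * (indicator (open_lr l r) x * G x) + (indicator (open_lr l r) x * F x) * k x)"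
    using H1(2) K1(2) by (auto simp: indicator_def)
  also have "\<dots> \<in> borel_measurable borel" by measurable
  finally show "?p \<in> borel_measurable borel" .
  show "?p x = 0" if "x \<notin> open_lr l r" for x using that H1(2) K1(2) by simp
  show "continuous_on {x. l \<le> ereal x \<and> ereal x \<le> r} ?P" using cont by (intro continuous_intros)
  show "AE x in lborel. x \<in> open_lr l r \<longrightarrow> (?P has_real_derivative ?p x) (at x)"
    using H1_on_has_real_derivative[OF F] H1_on_has_real_derivative[OF G]
    by eventually_elim (auto intro!: derivative_eq_intros)
  fix u v assume uv: "{u..v} \<subseteq> open_lr l r"
  have "bounded (F ` {u..v})" "bounded (G ` {u..v})"
    using continuous_on_subset[OF cont'(1) uv] continuous_on_subset[OF cont'(2) uv]
    by (intro compact_imp_bounded compact_continuous_image, auto)+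
  then obtain MF MG where M: "\<forall>x\<in>{u..v}. \<bar>F x\<bar> \<le> MF" "\<forall>x\<in>{u..v}. \<bar>G x\<bar> \<le> MG"
    unfolding bounded_iff by auto
  define M where "M = \<bar>MF\<bar> + \<bar>MG\<bar> + 1"
  have "\<bar>?P y - ?P x\<bar> \<le> M * (\<bar>F y - F x\<bar> + \<bar>G y - G x\<bar>)" if "x \<in> {u..v}" "y \<in> {u..v}" for x y
  proof -
    have "?P y - ?P x = (F y - F x) * G y + F x * (G y - G x)" by (simp add: algebra_simps)
    also have "\<bar>\<dots>\<bar> \<le> \<bar>F y - F x\<bar> * \<bar>G y\<bar> + \<bar>F x\<bar> * \<bar>G y - G x\<bar>"
      by (rule order_trans[OF abs_triangle_ineq]) (simp add: abs_mult)
    also have "\<dots> \<le> \<bar>F y - F x\<bar> * M + M * \<bar>G y - G x\<bar>"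
    proof -
      have "\<bar>G y\<bar> \<le> M" "\<bar>F x\<bar> \<le> M" using M(1)[rule_format, OF that(1)] M(2)[rule_format, OF that(2)] by (auto simp: M_def)
      then show ?thesis by (intro add_mono mult_left_mono mult_right_mono) auto
    qed
    finally show ?thesis by (simp add: algebra_simps)
  qed
  then show "\<exists>M>0. \<forall>x\<in>{u..v}. \<forall>y\<in>{u..v}. \<bar>?P y - ?P x\<bar> \<le> M * (\<bar>F y - F x\<bar> + \<bar>G y - G x\<bar>)"
    by (intro exI[of _ M]) (auto simp: M_def)
qed fact

text \<open>The form sums over the unordered set of gaps, whereas countable additivity of the
  integral concerns sequences. An enumeration of \<open>P\<close> bridges the two; the unordered sum
  needs absolute summability, which the integral of \<open>\<bar>f\<bar>\<close> provides.\<close>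

lemma set_integral_countable_has_sum:
  fixes f :: "'a \<Rightarrow> real"
  assumes "countable P" and A: "\<And>p. p \<in> P \<Longrightarrow> A p \<in> sets M" and disj: "disjoint_family_on A P"
    and int: "set_integrable M (\<Union>p\<in>P. A p) f"
  shows "((\<lambda>p. LINT x:A p|M. f x) has_sum (LINT x:(\<Union>p\<in>P. A p)|M. f x)) P"
proof -
  define Q where "Q = to_nat_on P ` P"
  define B where "B n = (if n \<in> Q then A (from_nat_into P n) else {})" for n
  have inj: "inj_on (to_nat_on P) P" using \<open>countable P\<close> by (rule inj_on_to_nat_on)
  have BQ: "B (to_nat_on P p) = A p" if "p \<in> P" for p
    using that \<open>countable P\<close> by (auto simp: B_def Q_def)
  have Bsets: "B n \<in> sets M" for n using A \<open>countable P\<close> by (auto simp: B_def Q_def)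
  have Bdisj: "B m \<inter> B n = {}" if "m \<noteq> n" for m n
  proof (cases "m \<in> Q \<and> n \<in> Q")
    case True
    then obtain p q where "p \<in> P" "q \<in> P" "m = to_nat_on P p" "n = to_nat_on P q" by (auto simp: Q_def)
    then show ?thesis using disj that BQ by (metis disjoint_family_onD)
  qed (auto simp: B_def)
  have UN: "(\<Union>n. B n) = (\<Union>p\<in>P. A p)"
  proof
    show "(\<Union>n. B n) \<subseteq> (\<Union>p\<in>P. A p)" using \<open>countable P\<close> by (auto simp: B_def Q_def split: if_splits)
    show "(\<Union>p\<in>P. A p) \<subseteq> (\<Union>n. B n)" using BQ by blast
  qed
  have intB: "set_integrable M (\<Union>n. B n) f" using int UN by simp
  have intn: "set_integrable M (B n) f" for n using intB Bsets by (rule set_integrable_subset) auto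
  have absint: "set_integrable M (\<Union>n. B n) (\<lambda>x. \<bar>f x\<bar>)" using set_integrable_abs[OF intB] .
  have abs_sum: "summable (\<lambda>n. LINT x:B n|M. \<bar>f x\<bar>)"
  proof (rule summableI_nonneg_bounded)
    show "0 \<le> (LINT x:B n|M. \<bar>f x\<bar>)" for n by (simp add: set_lebesgue_integral_def)
    show "(\<Sum>i<n. LINT x:B i|M. \<bar>f x\<bar>) \<le> (LINT x:(\<Union>n. B n)|M. \<bar>f x\<bar>)" for n
    proof -
      have "(\<Sum>i<n. LINT x:B i|M. \<bar>f x\<bar>) = (LINT x:(\<Union>i<n. B i)|M. \<bar>f x\<bar>)"
        using Bdisj Bsets set_integrable_abs[OF intn]
        by (intro set_integral_finite_UN_AE[symmetric] AE_I2) (auto simp: disjoint_iff)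
      also have "\<dots> \<le> (LINT x:(\<Union>n. B n)|M. \<bar>f x\<bar>)"
        unfolding set_lebesgue_integral_def
      proof (rule integral_mono)
        show "integrable M (\<lambda>x. indicat_real (\<Union>i<n. B i) x *\<^sub>R \<bar>f x\<bar>)"
          using set_integrable_subset[OF absint, of "\<Union>i<n. B i"] Bsets by (simp add: set_integrable_def) blast
      qed (use absint in \<open>auto simp: set_integrable_def indicator_def\<close>)
      finally show ?thesis .
    qed
  qed
  have norm_le: "norm (LINT x:B n|M. f x) \<le> (LINT x:B n|M. \<bar>f x\<bar>)" for n
    using set_integral_norm_bound[OF intn[of n]] by simp
  have norm_sum: "summable (\<lambda>n. norm (LINT x:B n|M. f x))"
    by (rule summable_comparison_test[OF _ abs_sum]) (use norm_le in auto)
  have "(\<lambda>n. LINT x:B n|M. f x) sums (LINT x:(\<Union>n. B n)|M. f x)"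
    using lebesgue_integral_countable_add[OF Bsets Bdisj intB] summable_norm_cancel[OF norm_sum] by (simp add: summable_sums)
  then have "((\<lambda>n. LINT x:B n|M. f x) has_sum (LINT x:(\<Union>n. B n)|M. f x)) UNIV"
    by (rule norm_summable_imp_has_sum[OF norm_sum])
  then have "((\<lambda>n. LINT x:B n|M. f x) has_sum (LINT x:(\<Union>n. B n)|M. f x)) Q"
    by (rule has_sum_cong_neutral[THEN iffD1, rotated -1]) (auto simp: B_def set_lebesgue_integral_def)
  then have "(((\<lambda>n. LINT x:B n|M. f x) \<circ> to_nat_on P) has_sum (LINT x:(\<Union>n. B n)|M. f x)) P"
    unfolding Q_def by (subst has_sum_reindex[OF inj, symmetric])
  then show ?thesis unfolding UN by (rule has_sum_cong[THEN iffD1, rotated]) (simp add: BQ)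
qed

section \<open>Cutting off\<close>

lemma set_integral_tendsto_0:
  fixes f :: "'a \<Rightarrow> real"
  assumes f: "integrable M f" and A: "\<And>n. A n \<in> sets M" and out: "AE x in M. \<forall>\<^sub>F n in sequentially. x \<notin> A n"
  shows "(\<lambda>n. LINT x:A n|M. f x) \<longlonglongrightarrow> 0"
proof -
  have "(\<lambda>n. \<integral>x. indicator (A n) x *\<^sub>R f x \<partial>M) \<longlonglongrightarrow> (\<integral>x. 0 \<partial>M)"
  proof (rule integral_dominated_convergence[where w = "\<lambda>x. norm (f x)"])
    show "AE x in M. (\<lambda>n. indicat_real (A n) x *\<^sub>R f x) \<longlonglongrightarrow> 0"
      using out
    proof eventually_elim
      case (elim x)
      then show ?case by (intro tendsto_eventually) (auto elim: eventually_mono)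
    qed
  qed (use f A in \<open>auto simp: indicator_def\<close>)
  then show ?thesis by (simp add: set_lebesgue_integral_def)
qed

text \<open>Building block for the piecewise affine cutoffs and for the tent function used
  later.\<close>

lemma H1_on_clip:
  assumes "c \<le> d" "{c..d} \<subseteq> open_lr l r"
  shows "H1_on l r (\<lambda>x. max c (min d x)) (indicator {c..d})"
  unfolding H1_on_def
proof (intro conjI allI impI)
  show "integrable lborel (\<lambda>x. (indicator {c..d} x :: real)\<^sup>2)"
  proof -
    have "(\<lambda>x. (indicator {c..d} x :: real)\<^sup>2) = indicator {c..d}" by (auto simp: indicator_def)
    then show ?thesis using integrable_real_indicator[of "{c..d}" lborel] by (simp add: emeasure_lborel_Icc_eq)
  qed
  fix x y :: real assume "x \<le> y"
  have "(LINT t:{x..y}|lborel. indicator {c..d} t) = (\<integral>t. indicator {max x c..min y d} t \<partial>lborel)"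
    unfolding set_lebesgue_integral_def by (intro Bochner_Integration.integral_cong) (auto simp: indicator_def)
  also have "\<dots> = max 0 (min y d - max x c)"
    by (cases "max x c \<le> min y d") auto
  also have "\<dots> = max c (min d y) - max c (min d x)" using \<open>x \<le> y\<close> \<open>c \<le> d\<close> by (auto simp: min_def max_def)
  finally show "max c (min d y) - max c (min d x) = (LINT t:{x..y}|lborel. indicator {c..d} t)" by simp
next
  fix x assume "x \<notin> open_lr l r"
  then have "x \<notin> {c..d}" using assms by blast
  then show "indicator {c..d} x = (0::real)" by simp
qed auto

text \<open>A cutoff of slope 1/(d-c) on [c, d] costs the integral of
  \<open>(F x / (d - c))\<^sup>2\<close>, which the stated bound keeps below
  \<open>\<epsilon>\<close>. Increments of \<open>F\<close> near \<open>r\<close> have square at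
  most a small tail energy times the distance. At a finite end \<open>F\<close> vanishes, so the
  bound holds on an interval whose length is comparable to its distance from the end; at infinity a
  sufficiently long interval absorbs the initial value.\<close>

lemma exists_right_cut_interval:
  assumes F: "H1_on l r F h" and end0: "\<And>b. r = ereal b \<Longrightarrow> F b = 0" and "\<epsilon> > 0" and x1: "l < ereal x1" "ereal x1 < r"
  shows "\<exists>c d. x1 < c \<and> c < d \<and> ereal d < r \<and> (\<forall>x\<in>{c..d}. (F x)\<^sup>2 \<le> \<epsilon> * (d - c))"
proof -
  note H = H1_onD[OF F]
  obtain X where X: "incseq X" "\<And>i. ereal x1 < ereal (X i)" "\<And>i. ereal (X i) < r" "(\<lambda>i. ereal (X i)) \<longlonglongrightarrow> r"
    using ereal_incseq_approx[OF x1(2)] by metis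
  have tail: "(\<lambda>n. LINT x:{X n..} \<inter> open_lr l r|lborel. (h x)\<^sup>2) \<longlonglongrightarrow> 0"
  proof (rule set_integral_tendsto_0[OF H(3)])
    show "AE x in lborel. \<forall>\<^sub>F n in sequentially. x \<notin> {X n..} \<inter> open_lr l r"
    proof (intro AE_I2)
      fix x
      show "\<forall>\<^sub>F n in sequentially. x \<notin> {X n..} \<inter> open_lr l r"
      proof (cases "ereal x < r")
        case True
        then have "\<forall>\<^sub>F n in sequentially. ereal x < ereal (X n)" using X(4) by (rule order_tendstoD(1)[rotated])
        then show ?thesis by eventually_elim auto
      qed (simp add: open_lr_def)
    qed
  qed auto
  have Icc_le: "(LINT t:{u..v}|lborel. (h t)\<^sup>2) \<le> (LINT x:{X n..} \<inter> open_lr l r|lborel. (h x)\<^sup>2)" if "X n \<le> u" for n u v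
    unfolding set_lebesgue_integral_def
  proof (rule integral_mono)
    show "integrable lborel (\<lambda>x. indicat_real {u..v} x *\<^sub>R (h x)\<^sup>2)" "integrable lborel (\<lambda>x. indicat_real ({X n..} \<inter> open_lr l r) x *\<^sub>R (h x)\<^sup>2)"
      using H(3) set_integrable_of_integrable[of lborel "\<lambda>x. (h x)\<^sup>2"] by (auto simp: set_integrable_def)
    show "indicat_real {u..v} x *\<^sub>R (h x)\<^sup>2 \<le> indicat_real ({X n..} \<inter> open_lr l r) x *\<^sub>R (h x)\<^sup>2" for x
      using that H(2)[of x] by (auto simp: indicator_def)
  qed
  define T where "T n = (LINT x:{X n..} \<inter> open_lr l r|lborel. (h x)\<^sup>2)" for n
  have Tnn: "0 \<le> T n" for n unfolding T_def by (simp add: set_lebesgue_integral_def)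
  obtain n where n: "T n < \<epsilon> / 8"
    using order_tendstoD(2)[OF tail, of "\<epsilon>/8"] \<open>\<epsilon> > 0\<close> unfolding T_def by (auto simp: eventually_sequentially)
  have inc: "(F v - F u)\<^sup>2 \<le> (v - u) * T n" if "X n \<le> u" "u \<le> v" "ereal v \<le> r" for u v
  proof -
    have "ereal x1 < ereal u" using X(2)[of n] that(1) by simp
    then have "l \<le> ereal u" using x1(1) by (meson less_imp_le less_trans)
    then have "(F v - F u)\<^sup>2 \<le> (v - u) * (LINT t:{u..v}|lborel. (h t)\<^sup>2)" using H1_on_increment_le[OF F _ that(2,3)] by simp
    also have "\<dots> \<le> (v - u) * T n" using that Icc_le[OF that(1)] unfolding T_def by (intro mult_left_mono) auto
    finally show ?thesis .
  qed
  have Xx: "x1 < X n" using X(2)[of n] by simp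
  show ?thesis
  proof (cases r)
    case (real b)
    \<comment> \<open>Cutting along the middle third of (X n, b) keeps the distance to
      \<open>b\<close> at most twice the length of the interval.\<close>
    define \<delta> where "\<delta> = (b - X n) / 3"
    have \<delta>: "\<delta> > 0" "X n < b - 2 * \<delta>" using X(3)[of n] real by (auto simp: \<delta>_def field_simps)
    have "(F x)\<^sup>2 \<le> \<epsilon> * ((b - \<delta>) - (b - 2 * \<delta>))" if "x \<in> {b - 2 * \<delta>..b - \<delta>}" for x
    proof -
      have "(F b - F x)\<^sup>2 \<le> (b - x) * T n" using that \<delta> real by (intro inc) auto
      also have "\<dots> \<le> (2 * \<delta>) * (\<epsilon> / 8)" using that \<delta> n Tnn by (intro mult_mono) auto
      also have "\<dots> \<le> \<epsilon> * \<delta>" using \<delta> \<open>\<epsilon> > 0\<close> by simp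
      finally show ?thesis using end0[OF real] by simp
    qed
    then show ?thesis using \<delta> Xx real by (intro exI[of _ "b - 2 * \<delta>"] exI[of _ "b - \<delta>"]) auto
  next
    case PInf
    define y where "y = X n"
    \<comment> \<open>Long enough that the fixed value \<open>F y\<close> uses at most half of the
      allowance \<open>\<epsilon> * L\<close>; the increment from \<open>y\<close> uses at most a
      quarter.\<close>
    define L where "L = 4 * (F y)\<^sup>2 / \<epsilon> + 1"
    have L: "L > 0" "2 * (F y)\<^sup>2 \<le> \<epsilon> / 2 * L" 
    proof -
      show "L > 0" unfolding L_def using \<open>\<epsilon> > 0\<close> by (intro add_nonneg_pos) auto
      show "2 * (F y)\<^sup>2 \<le> \<epsilon> / 2 * L" unfolding L_def using \<open>\<epsilon> > 0\<close> by (simp add: field_simps)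
    qed
    have "(F x)\<^sup>2 \<le> \<epsilon> * ((y + L) - y)" if "x \<in> {y..y + L}" for x
    proof -
      have "(F x)\<^sup>2 = ((F x - F y) + F y)\<^sup>2" by simp
      also have "\<dots> \<le> 2 * (F x - F y)\<^sup>2 + 2 * (F y)\<^sup>2" by (rule square_add_le)
      also have "(F x - F y)\<^sup>2 \<le> (x - y) * T n" using that PInf by (intro inc) (auto simp: y_def)
      also have "\<dots> \<le> L * (\<epsilon> / 8)" using that n Tnn L by (intro mult_mono) auto
      finally have "(F x)\<^sup>2 \<le> L * \<epsilon> / 4 + 2 * (F y)\<^sup>2" by simp
      moreover have "0 < L * \<epsilon>" using L \<open>\<epsilon> > 0\<close> by simp
      ultimately have "(F x)\<^sup>2 \<le> L * \<epsilon>" using L(2) by (simp add: mult.commute)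
      then show ?thesis by (simp add: mult.commute)
    qed
    then show ?thesis using L Xx PInf by (intro exI[of _ y] exI[of _ "y + L"]) (auto simp: y_def)
  qed (use x1 in auto)
qed

text \<open>Carries the estimate at the right end over to the left end.\<close>

lemma H1_on_reflect:
  assumes "H1_on l r F h"
  shows "H1_on (- r) (- l) (\<lambda>x. F (- x)) (\<lambda>x. - h (- x))"
  unfolding H1_on_def
proof (intro conjI allI impI)
  note H = H1_onD[OF assms]
  have [measurable]: "h \<in> borel_measurable borel" by (rule H)
  show "(\<lambda>x. - h (- x)) \<in> borel_measurable borel" by measurable
  show "integrable lborel (\<lambda>x. (- h (- x))\<^sup>2)"
    using lborel_integrable_real_affine[OF H(3), of "-1" 0] by simp
  show "- h (- x) = 0" if "x \<notin> open_lr (- r) (- l)" for x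
    using that H(2)[of "- x"] by (auto simp: open_lr_def ereal_uminus_less_reorder ereal_less_uminus_reorder simp flip: uminus_ereal.simps)
  fix x y assume xy: "- r \<le> ereal x" "x \<le> y" "ereal y \<le> - l"
  then have "l \<le> ereal (- y)" "- y \<le> - x" "ereal (- x) \<le> r"
    by (cases l; cases r; auto)+
  then have "F (- x) - F (- y) = (LINT t:{- y..- x}|lborel. h t)" by (rule H(4))
  also have "\<dots> = (\<integral>t. indicator {- y..- x} (0 + (- 1) * t) *\<^sub>R h (0 + (- 1) * t) \<partial>lborel)"
    unfolding set_lebesgue_integral_def by (subst lborel_integral_real_affine[of "-1" _ 0]) auto
  also have "\<dots> = (LINT t:{x..y}|lborel. h (- t))"
    unfolding set_lebesgue_integral_def by (intro Bochner_Integration.integral_cong) (auto simp: indicator_def)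
  finally show "F (- y) - F (- x) = (LINT t:{x..y}|lborel. - h (- t))" by (simp add: set_lebesgue_integral_def)
qed

lemma exists_left_cut_interval:
  assumes F: "H1_on l r F h" and end0: "\<And>a. l = ereal a \<Longrightarrow> F a = 0" and "\<epsilon> > 0" and x1: "l < ereal x1" "ereal x1 < r"
  shows "\<exists>c d. d < x1 \<and> c < d \<and> l < ereal c \<and> (\<forall>x\<in>{c..d}. (F x)\<^sup>2 \<le> \<epsilon> * (d - c))"
proof -
  have "\<exists>c d. - x1 < c \<and> c < d \<and> ereal d < - l \<and> (\<forall>x\<in>{c..d}. (F (- x))\<^sup>2 \<le> \<epsilon> * (d - c))"
  proof (rule exists_right_cut_interval[OF H1_on_reflect[OF F] _ \<open>\<epsilon> > 0\<close>])
    show "F (- b) = 0" if "- l = ereal b" for b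
      using end0[of "- b"] that by (metis ereal_uminus_uminus uminus_ereal.simps(1))
  qed (use x1 in \<open>auto simp: ereal_uminus_less_reorder ereal_less_uminus_reorder simp flip: uminus_ereal.simps\<close>)
  then obtain c d where cd: "- x1 < c" "c < d" "ereal d < - l" "\<forall>x\<in>{c..d}. (F (- x))\<^sup>2 \<le> \<epsilon> * (d - c)" by blast
  have "l < ereal (- d)" using cd(3) by (simp add: ereal_less_uminus_reorder flip: uminus_ereal.simps)
  moreover have "(F x)\<^sup>2 \<le> \<epsilon> * (- c - - d)" if "x \<in> {- d..- c}" for x
    using cd(4)[rule_format, of "- x"] that by simp
  ultimately show ?thesis using cd by (intro exI[of _ "- d"] exI[of _ "- c"]) auto
qed

section \<open>Structure of the state space\<close>

locale quasidiffusion =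
  fixes E :: "real set" and \<mu> :: "real measure"
  assumes K: "class_K E" and radon: "radon_on E \<mu>" and full: "full_support E \<mu>"
begin

abbreviation "l \<equiv> lft E"
abbreviation "r \<equiv> rgt E"
abbreviation "I \<equiv> open_lr l r"
text \<open>The real points of [l, r]. Finite endpoints are included whether or not they belong to
  \<open>E\<close>, so that boundary values of representatives make sense.\<close>

abbreviation "J \<equiv> {x. l \<le> ereal x \<and> ereal x \<le> r}"

lemma l_less_r: "l < r" using K by (simp add: class_K_def)

lemma E_subset_J: "E \<subseteq> J"
  by (auto simp: lft_def rgt_def intro: Inf_lower Sup_upper)

lemma E_bounds: "x \<in> E \<Longrightarrow> l \<le> ereal x" "x \<in> E \<Longrightarrow> ereal x \<le> r"
  using E_subset_J by auto

text \<open>\<open>E\<close> may lack a finite endpoint, so closedness in the extended line pulls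
  back to the real line only after the finite endpoints are added.\<close>

lemma closed_E_ends: "closed (E \<union> {x. ereal x = l \<or> ereal x = r})"
proof -
  have "closed (ereal -` (ereal ` E \<union> {l, r}))"
    using K by (intro continuous_closed_vimage) (auto simp: class_K_def continuous_at_ereal)
  moreover have "ereal -` (ereal ` E \<union> {l, r}) = E \<union> {x. ereal x = l \<or> ereal x = r}" by auto
  ultimately show ?thesis by simp
qed

lemma finite_ends: "finite {x. ereal x = l \<or> ereal x = r}"
proof -
  have "finite {x. ereal x = c}" for c by (cases c) auto
  then show ?thesis by (simp add: Collect_disj_eq)
qed

lemma E_borel [measurable]: "E \<in> sets borel"
proof -
  let ?X = "{x. ereal x = l \<or> ereal x = r}"
  have "finite (?X - E)" using finite_ends by simp
  then have "?X - E \<in> sets borel" by (intro borel_closed finite_imp_closed)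
  then have "(E \<union> ?X) - (?X - E) \<in> sets borel" by (rule sets.Diff[OF borel_closed[OF closed_E_ends]])
  moreover have "(E \<union> ?X) - (?X - E) = E" by blast
  ultimately show ?thesis by (rule back_subst[of "\<lambda>S. S \<in> sets borel"])
qed

lemma J_borel [measurable]: "J \<in> sets borel"
proof -
  have "J = I \<union> {x. ereal x = l \<or> ereal x = r}" using l_less_r by (auto simp: open_lr_def)
  then show ?thesis using finite_ends by (simp add: finite_imp_closed borel_closed)
qed

lemma compact_E_Icc:
  assumes "\<And>x. x \<in> {a..b} \<Longrightarrow> ereal x = l \<or> ereal x = r \<Longrightarrow> x \<in> E"
  shows "compact (E \<inter> {a..b})"
proof -
  have "E \<inter> {a..b} = (E \<union> {x. ereal x = l \<or> ereal x = r}) \<inter> {a..b}" using assms by auto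
  then show ?thesis using closed_E_ends by (simp add: closed_Int_compact)
qed

lemma exists_E_near_l: "l < c \<Longrightarrow> \<exists>x\<in>E. ereal x < c"
  unfolding lft_def by (auto simp: Inf_less_iff)

lemma exists_E_near_r: "c < r \<Longrightarrow> \<exists>x\<in>E. c < ereal x"
  unfolding rgt_def by (auto simp: less_Sup_iff)

text \<open>Since \<open>l\<close> is the infimum, some \<open>e\<close> in \<open>E\<close> lies
  below \<open>x\<close>, and the largest point of \<open>E\<close> in [e, x] is the neighbour.
  Compactness of that set could fail only at a missing endpoint; [e, x] stays below
  \<open>r\<close>, and it contains \<open>l\<close> only if \<open>e\<close> is \<open>l\<close>,
  which is then in \<open>E\<close>.\<close>

lemma left_E_neighbour:
  assumes "x \<in> I - E"
  obtains a where "a \<in> E" "a < x" "{a<..x} \<inter> E = {}"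
proof -
  obtain e where e: "e \<in> E" "e < x" using exists_E_near_l[of "ereal x"] assms by (auto simp: open_lr_def)
  have "compact (E \<inter> {e..x})"
  proof (rule compact_E_Icc)
    fix y assume y: "y \<in> {e..x}" "ereal y = l \<or> ereal y = r"
    then have "ereal y \<le> ereal x" "ereal x < r" using assms by (auto simp: open_lr_def)
    then have "ereal y < r" by (rule le_less_trans)
    then have "ereal y = l" using y(2) by fastforce
    then have "y \<le> e" using E_bounds(1)[OF e(1)] by (metis ereal_less_eq(3))
    then show "y \<in> E" using y e by simp
  qed
  then obtain a where a: "a \<in> E \<inter> {e..x}" "\<forall>t\<in>E \<inter> {e..x}. t \<le> a"
    using compact_attains_sup[of "E \<inter> {e..x}"] e by fastforce
  then have "a < x" using assms by (metis DiffD2 IntD1 IntD2 atLeastAtMost_iff order_le_less)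
  moreover have "y \<notin> E" if "y \<in> {a<..x}" for y
  proof
    assume "y \<in> E"
    then have "y \<in> E \<inter> {e..x}" using a(1) that by auto
    then show False using a(2) that by force
  qed
  ultimately show ?thesis using that a by blast
qed

lemma right_E_neighbour:
  assumes "x \<in> I - E"
  obtains b where "b \<in> E" "x < b" "{x..<b} \<inter> E = {}"
proof -
  obtain e where e: "e \<in> E" "x < e" using exists_E_near_r[of "ereal x"] assms by (auto simp: open_lr_def)
  have "compact (E \<inter> {x..e})"
  proof (rule compact_E_Icc)
    fix y assume y: "y \<in> {x..e}" "ereal y = l \<or> ereal y = r"
    then have "ereal x \<le> ereal y" "l < ereal x" using assms by (auto simp: open_lr_def)
    then have "l < ereal y" by (rule order.strict_trans2[rotated])
    then have "ereal y = r" using y(2) by fastforce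
    then have "e \<le> y" using E_bounds(2)[OF e(1)] by (metis ereal_less_eq(3))
    then show "y \<in> E" using y e by simp
  qed
  then obtain b where b: "b \<in> E \<inter> {x..e}" "\<forall>t\<in>E \<inter> {x..e}. b \<le> t"
    using compact_attains_inf[of "E \<inter> {x..e}"] e by fastforce
  then have "x < b" using assms by (metis DiffD2 IntD1 IntD2 atLeastAtMost_iff order_le_less)
  moreover have "y \<notin> E" if "y \<in> {x..<b}" for y
  proof
    assume "y \<in> E"
    then have "y \<in> E \<inter> {x..e}" using b(1) that by auto
    then show False using b(2) that by force
  qed
  ultimately show ?thesis using that b by blast
qed

section \<open>The gaps described by the order\<close>

lemma Ival_Diff_E: "Ival E - E = I - E"
  by (auto simp: Ival_def open_lr_def)

lemma Ioo_subset_I: "a \<in> E \<Longrightarrow> b \<in> E \<Longrightarrow> {a<..<b} \<subseteq> I"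
  using E_bounds by (fastforce simp: open_lr_def intro: le_less_trans[of l "ereal a"] less_le_trans[of _ "ereal b" r])

lemma component_of_gap:
  assumes ab: "a < b" "a \<in> E" "b \<in> E" "{a<..<b} \<inter> E = {}" and x: "x \<in> {a<..<b}"
  shows "connected_component_set (I - E) x = {a<..<b}"
proof
  have "{a<..<b} \<subseteq> I - E" using ab Ioo_subset_I by blast
  then show "{a<..<b} \<subseteq> connected_component_set (I - E) x"
    using x by (intro connected_component_maximal) auto
  show "connected_component_set (I - E) x \<subseteq> {a<..<b}"
  proof
    fix y assume y: "y \<in> connected_component_set (I - E) x"
    have conn: "connected (connected_component_set (I - E) x)" by simp
    have xin: "x \<in> connected_component_set (I - E) x"
      using \<open>{a<..<b} \<subseteq> connected_component_set (I - E) x\<close> x by blast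
    have sub: "connected_component_set (I - E) x \<subseteq> I - E" by (rule connected_component_subset)
    show "y \<in> {a<..<b}"
    proof (rule ccontr)
      assume "y \<notin> {a<..<b}"
      then have "y \<le> a \<or> b \<le> y" by auto
      then have "a \<in> connected_component_set (I - E) x \<or> b \<in> connected_component_set (I - E) x"
        using connectedD_interval[OF conn y xin, of a] connectedD_interval[OF conn xin y, of b] x by auto
      then show False using sub ab by blast
    qed
  qed
qed

lemma gap_exists:
  assumes "x \<in> I - E"
  obtains a b where "a < x" "x < b" "a \<in> E" "b \<in> E" "{a<..<b} \<inter> E = {}"
proof -
  obtain a where a: "a \<in> E" "a < x" "{a<..x} \<inter> E = {}" by (rule left_E_neighbour[OF assms])
  obtain b where b: "b \<in> E" "x < b" "{x..<b} \<inter> E = {}" by (rule right_E_neighbour[OF assms])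
  have "{a<..<b} = {a<..x} \<union> {x..<b}" using a b by auto
  then show ?thesis using that a b by blast
qed

text \<open>Replaces connected components by an order condition. In particular both endpoints of a
  gap lie in \<open>E\<close>, so the jump terms of the form depend only on values on
  \<open>E\<close>.\<close>

lemma gaps_eq: "gaps E = {(a, b). a < b \<and> a \<in> E \<and> b \<in> E \<and> {a<..<b} \<inter> E = {}}"
proof (intro set_eqI iffI; clarify)
  fix a b assume "(a, b) \<in> gaps E"
  then have ab: "a < b" "{a<..<b} \<in> components (I - E)" by (auto simp: gaps_def Ival_Diff_E)
  define x where "x = (a + b) / 2"
  have x: "x \<in> {a<..<b}" using ab by (simp add: x_def)
  have "x \<in> I - E" using x ab(2) in_components_subset by blast
  then obtain a' b' where *: "a' < x" "x < b'" "a' \<in> E" "b' \<in> E" "{a'<..<b'} \<inter> E = {}" by (rule gap_exists)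
  have "connected_component_set (I - E) x = {a<..<b}"
    using ab(2) x by (metis components_iff connected_component_eq)
  then have "{a<..<b} = {a'<..<b'}" using component_of_gap[of a' b' x] * by auto
  then have "a = a'" "b = b'" using ab * by (auto simp: greaterThanLessThan_eq_iff)
  then show "a < b \<and> a \<in> E \<and> b \<in> E \<and> {a<..<b} \<inter> E = {}" using * ab by simp
next
  fix a b assume ab: "a < b" "a \<in> E" "b \<in> E" "{a<..<b} \<inter> E = {}"
  define x where "x = (a + b) / 2"
  have x: "x \<in> {a<..<b}" using ab by (simp add: x_def)
  then have "x \<in> I - E" using Ioo_subset_I ab by blast
  then have "connected_component_set (I - E) x \<in> components (I - E)" by (auto simp: components_def)
  then show "(a, b) \<in> gaps E" using component_of_gap[OF ab x] ab by (simp add: gaps_def Ival_Diff_E)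
qed

abbreviation gap :: "real \<times> real \<Rightarrow> real set" where "gap p \<equiv> {fst p<..<snd p}"

lemma gapD:
  assumes "p \<in> gaps E"
  shows "fst p < snd p" "fst p \<in> E" "snd p \<in> E" "gap p \<inter> E = {}" "gap p \<subseteq> I"
proof -
  show "fst p < snd p" and E: "fst p \<in> E" "snd p \<in> E" and "gap p \<inter> E = {}" using assms by (auto simp: gaps_eq)
  show "gap p \<subseteq> I" using E by (rule Ioo_subset_I)
qed

lemma gaps_disjoint: "disjoint_family_on gap (gaps E)"
  unfolding disjoint_family_on_def
proof (intro ballI impI)
  fix p q assume pq: "p \<in> gaps E" "q \<in> gaps E" "p \<noteq> q"
  show "gap p \<inter> gap q = {}"
  proof (rule ccontr)
    assume "gap p \<inter> gap q \<noteq> {}"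
    then obtain x where x: "x \<in> gap p" "x \<in> gap q" by blast
    have "gap p = gap q"
      using component_of_gap[OF gapD(1-4)[OF pq(1)] x(1)] component_of_gap[OF gapD(1-4)[OF pq(2)] x(2)] by simp
    then show False using pq gapD(1)[OF pq(1)] gapD(1)[OF pq(2)] by (auto simp: greaterThanLessThan_eq_iff prod_eq_iff)
  qed
qed

lemma UN_gaps: "(\<Union>p\<in>gaps E. gap p) = I - E"
proof
  show "(\<Union>p\<in>gaps E. gap p) \<subseteq> I - E" using gapD by blast
  show "I - E \<subseteq> (\<Union>p\<in>gaps E. gap p)"
  proof
    fix x assume "x \<in> I - E"
    then obtain a b where "a < x" "x < b" "a \<in> E" "b \<in> E" "{a<..<b} \<inter> E = {}" by (rule gap_exists)
    then have "(a, b) \<in> gaps E" "x \<in> gap (a, b)" by (auto simp: gaps_eq)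
    then show "x \<in> (\<Union>p\<in>gaps E. gap p)" by blast
  qed
qed

lemma countable_gaps: "countable (gaps E)"
proof -
  have "countable (gap ` gaps E)"
  proof (rule countable_disjoint_open_subsets)
    show "disjoint (gap ` gaps E)" using gaps_disjoint by (rule disjoint_family_on_disjoint_image)
  qed auto
  moreover have "inj_on gap (gaps E)"
  proof (rule inj_onI)
    fix p q assume pq: "p \<in> gaps E" "q \<in> gaps E" "gap p = gap q"
    then show "p = q" using gapD(1)[OF pq(1)] gapD(1)[OF pq(2)] by (auto simp: greaterThanLessThan_eq_iff prod_eq_iff)
  qed
  ultimately show ?thesis by (rule countable_image_inj_on)
qed

lemma gap_inside_or_outside:
  assumes "p \<in> gaps E" "x \<in> E" "y \<in> E"
  shows "(x \<le> fst p \<and> snd p \<le> y) \<or> gap p \<inter> {x<..<y} = {}"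
proof -
  have "x \<notin> gap p" "y \<notin> gap p" using gapD(4)[OF assms(1)] assms by auto
  then show ?thesis using gapD(1)[OF assms(1)] by auto
qed

section \<open>Representatives\<close>

definition rep :: "(real \<Rightarrow> real) \<Rightarrow> (real \<Rightarrow> real) \<Rightarrow> (real \<Rightarrow> real) \<Rightarrow> bool" where
  "rep f F h \<longleftrightarrow> H1_on l r F h \<and> (AE x in \<mu>. f x = F x)"

lemma sets_mu [measurable_cong, simp]: "sets \<mu> = sets borel" using radon by (simp add: radon_on_def)

lemma space_mu [simp]: "space \<mu> = UNIV" using sets_eq_imp_space_eq[OF sets_mu] by simp

lemma AE_mu_E: "AE x in \<mu>. x \<in> E"
proof (rule AE_I)
  show "emeasure \<mu> (UNIV - E) = 0" using radon by (simp add: radon_on_def)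
qed auto

text \<open>A difference at \<open>x\<close> would persist on the part of \<open>E\<close> in a ball
  around \<open>x\<close>, to which full support gives positive mass.\<close>

lemma eq_on_E_of_AE:
  assumes "AE x in \<mu>. F x = G x" "continuous_on E F" "continuous_on E G" "x \<in> E"
  shows "F x = (G x :: real)"
proof (rule ccontr)
  assume ne: "F x \<noteq> G x"
  have "continuous_on E (\<lambda>z. F z - G z)" using assms by (intro continuous_intros)
  then obtain d where d: "d > 0" "\<And>y. y \<in> E \<Longrightarrow> dist y x < d \<Longrightarrow> dist (F y - G y) (F x - G x) < \<bar>F x - G x\<bar>"
    using \<open>x \<in> E\<close> ne unfolding continuous_on_iff by (metis zero_less_abs_iff right_minus_eq)
  have "F y \<noteq> G y" if "y \<in> ball x d \<inter> E" for y
    using d(2)[of y] that by (auto simp: dist_commute dist_real_def)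
  then have "AE y in \<mu>. y \<notin> ball x d \<inter> E" using assms(1) by (auto elim!: eventually_mono)
  then have "emeasure \<mu> (ball x d \<inter> E) = 0"
    using AE_iff_null_sets[of "ball x d \<inter> E" \<mu>] by (simp add: null_setsD1)
  moreover have "open (ball x d) \<and> x \<in> ball x d" using d by simp
  ultimately show False using full \<open>x \<in> E\<close> unfolding full_support_def by (metis less_irrefl)
qed

lemma rep_eq_on_E:
  assumes "rep f F h" "rep g G k" "AE x in \<mu>. f x = g x" "x \<in> E"
  shows "F x = G x"
proof (rule eq_on_E_of_AE[of F G x])
  have "AE x in \<mu>. f x = F x" "AE x in \<mu>. g x = G x" using assms by (auto simp: rep_def)
  then show "AE x in \<mu>. F x = G x" using assms(3) by eventually_elim auto
  show "continuous_on E F" "continuous_on E G"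
    using assms(1,2) continuous_on_subset[OF H1_on_continuous E_subset_J] by (auto simp: rep_def)
qed fact

text \<open>\<open>E\<close> lies in the zero level of \<open>F - G\<close>, where the derivative
  vanishes almost everywhere.\<close>

lemma H1_deriv_eq_on_E:
  assumes F: "H1_on l r F h" and G: "H1_on l r G k" and eq: "\<And>x. x \<in> E \<Longrightarrow> F x = G x"
  shows "AE x in lborel. x \<in> E \<longrightarrow> h x = k x"
proof -
  have D: "H1_on l r (\<lambda>x. F x - G x) (\<lambda>x. h x - k x)" using F G by (rule H1_on_diff)
  have "AE x in lborel. x \<in> I \<longrightarrow> F x - G x = 0 \<longrightarrow> h x - k x = 0"
    by (rule AE_derivative_zero_at_level[OF H1_on_has_real_derivative[OF D]])
  then show ?thesis
  proof eventually_elim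
    case (elim x)
    then show ?case using eq[of x] H1_onD(2)[OF F, of x] H1_onD(2)[OF G, of x] by (cases "x \<in> I") auto
  qed
qed

section \<open>Averaging derivatives over the gaps\<close>

definition slope :: "(real \<Rightarrow> real) \<Rightarrow> real \<times> real \<Rightarrow> real" where
  "slope F p = (F (snd p) - F (fst p)) / (snd p - fst p)"

text \<open>The mean of the derivative over a gap is the slope of \<open>F\<close> across it, so the
  primitive interpolates \<open>F\<close> affinely between consecutive points of
  \<open>E\<close>.\<close>

definition gap_average :: "(real \<Rightarrow> real) \<Rightarrow> (real \<Rightarrow> real) \<Rightarrow> real \<Rightarrow> real" where
  "gap_average F h x = (if x \<in> I - E then slope F (THE p. p \<in> gaps E \<and> x \<in> gap p) else h x)"

lemma gap_average_gap:
  assumes "p \<in> gaps E" "x \<in> gap p"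
  shows "gap_average F h x = slope F p"
proof -
  have "(THE p. p \<in> gaps E \<and> x \<in> gap p) = p"
    using assms gaps_disjoint unfolding disjoint_family_on_def by (intro the_equality) blast+
  moreover have "x \<in> I - E" using gapD[OF assms(1)] assms(2) by blast
  ultimately show ?thesis by (simp only: gap_average_def if_True)
qed

lemma gap_average_off: "x \<notin> I - E \<Longrightarrow> gap_average F h x = h x"
  by (simp only: gap_average_def if_False)

lemma gap_average_measurable:
  assumes [measurable]: "h \<in> borel_measurable borel"
  shows "gap_average F h \<in> borel_measurable borel"
proof (rule measurable_piecewise_restrict[of "insert (- (I - E)) (gap ` gaps E)"])
  show "countable (insert (- (I - E)) (gap ` gaps E))" using countable_gaps by simp
  show "space borel \<subseteq> \<Union>(insert (- (I - E)) (gap ` gaps E))" using UN_gaps by blast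
  fix \<Omega> assume \<Omega>: "\<Omega> \<in> insert (- (I - E)) (gap ` gaps E)"
  then show "\<Omega> \<inter> space borel \<in> sets borel" by (auto intro: borel_comp)
  show "gap_average F h \<in> borel_measurable (restrict_space borel \<Omega>)"
  proof (cases "\<Omega> = - (I - E)")
    case True
    have "h \<in> borel_measurable (restrict_space borel \<Omega>)" by (intro measurable_restrict_space1) simp
    then show ?thesis
      by (rule measurable_cong[THEN iffD2, rotated]) (simp add: space_restrict_space True gap_average_off)
  next
    case False
    then obtain p where p: "p \<in> gaps E" "\<Omega> = gap p" using \<Omega> by auto
    have "(\<lambda>_. slope F p) \<in> borel_measurable (restrict_space borel \<Omega>)" by simp
    then show ?thesis
      by (rule measurable_cong[THEN iffD2, rotated]) (simp add: space_restrict_space p gap_average_gap)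
  qed
qed

lemma emeasure_density_UN_gaps:
  fixes h :: "real \<Rightarrow> real"
  assumes [measurable]: "h \<in> borel_measurable borel"
  shows "(\<integral>\<^sup>+x. ennreal ((h x)\<^sup>2) * indicator (I - E) x \<partial>lborel)
    = (\<integral>\<^sup>+p. (\<integral>\<^sup>+x. ennreal ((h x)\<^sup>2) * indicator (gap p) x \<partial>lborel) \<partial>count_space (gaps E))"
proof -
  let ?N = "density lborel (\<lambda>x. ennreal ((h x)\<^sup>2))"
  have "(\<integral>\<^sup>+x. ennreal ((h x)\<^sup>2) * indicator (I - E) x \<partial>lborel) = emeasure ?N (I - E)"
    by (simp add: emeasure_density)
  also have "\<dots> = (\<integral>\<^sup>+p. emeasure ?N (gap p) \<partial>count_space (gaps E))"
    unfolding UN_gaps[symmetric] using countable_gaps gaps_disjoint by (subst emeasure_UN_countable) auto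
  finally show ?thesis by (simp add: emeasure_density)
qed

lemma slope_square_le:
  assumes "H1_on l r F h" "p \<in> gaps E"
  shows "(slope F p)\<^sup>2 * (snd p - fst p) \<le> (LINT t:gap p|lborel. (h t)\<^sup>2)"
proof -
  note p = gapD[OF assms(2)]
  have "(F (snd p) - F (fst p))\<^sup>2 \<le> (snd p - fst p) * (LINT t:{fst p..snd p}|lborel. (h t)\<^sup>2)"
    using H1_on_increment_le[OF assms(1), of "fst p" "snd p"] p E_bounds by auto
  also have "(LINT t:{fst p..snd p}|lborel. (h t)\<^sup>2) = (LINT t:gap p|lborel. (h t)\<^sup>2)"
    using H1_onD(1)[OF assms(1)] by (intro set_integral_Icc_eq_Ioo) auto
  finally have *: "(F (snd p) - F (fst p))\<^sup>2 \<le> (snd p - fst p) * (LINT t:gap p|lborel. (h t)\<^sup>2)" .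
  have "F (snd p) - F (fst p) = slope F p * (snd p - fst p)" using p(1) by (simp add: slope_def)
  with * have "(snd p - fst p) * ((slope F p)\<^sup>2 * (snd p - fst p)) \<le> (snd p - fst p) * (LINT t:gap p|lborel. (h t)\<^sup>2)"
    by (simp add: power_mult_distrib power2_eq_square algebra_simps)
  then show ?thesis using p(1) by simp
qed

text \<open>Cauchy-Schwarz on each gap, summed over all gaps, with nothing changed elsewhere.
  Nonnegative integrals are used so that finiteness of the averaged energy comes out of the
  comparison.\<close>

lemma gap_average_square:
  assumes F: "H1_on l r F h"
  shows "integrable lborel (\<lambda>x. (gap_average F h x)\<^sup>2)" (is ?A)
    and "(\<integral>x. (gap_average F h x)\<^sup>2 \<partial>lborel) \<le> (\<integral>x. (h x)\<^sup>2 \<partial>lborel)" (is ?B)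
proof -
  note H1 = H1_onD[OF F]
  let ?k = "gap_average F h"
  have [measurable]: "h \<in> borel_measurable borel" "?k \<in> borel_measurable borel" using H1(1) gap_average_measurable by auto
  have split: "(\<integral>\<^sup>+x. ennreal ((g x)\<^sup>2) \<partial>lborel) = (\<integral>\<^sup>+x. ennreal ((g x)\<^sup>2) * indicator (I - E) x \<partial>lborel)
     + (\<integral>\<^sup>+x. ennreal ((g x)\<^sup>2) * indicator (- (I - E)) x \<partial>lborel)" if [measurable]: "g \<in> borel_measurable borel" for g :: "real \<Rightarrow> real"
    by (subst nn_integral_add[symmetric]) (auto intro!: nn_integral_cong simp: indicator_def)
  have "(\<integral>\<^sup>+x. ennreal ((?k x)\<^sup>2) * indicator (- (I - E)) x \<partial>lborel) = (\<integral>\<^sup>+x. ennreal ((h x)\<^sup>2) * indicator (- (I - E)) x \<partial>lborel)"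
    by (intro nn_integral_cong) (auto simp: indicator_def gap_average_off)
  moreover have "(\<integral>\<^sup>+x. ennreal ((?k x)\<^sup>2) * indicator (I - E) x \<partial>lborel) \<le> (\<integral>\<^sup>+x. ennreal ((h x)\<^sup>2) * indicator (I - E) x \<partial>lborel)"
    unfolding emeasure_density_UN_gaps[OF \<open>h \<in> borel_measurable borel\<close>] emeasure_density_UN_gaps[OF \<open>?k \<in> borel_measurable borel\<close>]
  proof (rule nn_integral_mono)
    fix p assume "p \<in> space (count_space (gaps E))"
    then have p: "p \<in> gaps E" by simp
    have "(\<integral>\<^sup>+x. ennreal ((?k x)\<^sup>2) * indicator (gap p) x \<partial>lborel) = (\<integral>\<^sup>+x. ennreal ((slope F p)\<^sup>2) * indicator (gap p) x \<partial>lborel)"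
      by (intro nn_integral_cong) (auto simp: indicator_def gap_average_gap[OF p])
    also have "\<dots> = ennreal ((slope F p)\<^sup>2 * (snd p - fst p))"
      using gapD(1)[OF p] by (subst nn_integral_cmult_indicator) (auto simp: ennreal_mult)
    also have "\<dots> \<le> ennreal (LINT t:gap p|lborel. (h t)\<^sup>2)" by (intro ennreal_leI slope_square_le[OF F p])
    also have "\<dots> = (\<integral>\<^sup>+x. ennreal ((h x)\<^sup>2) * indicator (gap p) x \<partial>lborel)"
      using H1(3) by (intro nn_integral_set_square[symmetric]) auto
    finally show "(\<integral>\<^sup>+x. ennreal ((?k x)\<^sup>2) * indicator (gap p) x \<partial>lborel) \<le> (\<integral>\<^sup>+x. ennreal ((h x)\<^sup>2) * indicator (gap p) x \<partial>lborel)" .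
  qed
  ultimately have le: "(\<integral>\<^sup>+x. ennreal ((?k x)\<^sup>2) \<partial>lborel) \<le> (\<integral>\<^sup>+x. ennreal ((h x)\<^sup>2) \<partial>lborel)"
    unfolding split[OF \<open>h \<in> borel_measurable borel\<close>] split[OF \<open>?k \<in> borel_measurable borel\<close>] by (intro add_mono) simp_all
  also have eq: "\<dots> = ennreal (\<integral>x. (h x)\<^sup>2 \<partial>lborel)" using H1(3) by (intro nn_integral_eq_integral) auto
  finally have "(\<integral>\<^sup>+x. ennreal ((?k x)\<^sup>2) \<partial>lborel) < \<infinity>" by (rule le_less_trans) simp
  then show A: ?A by (intro integrableI_bounded) auto
  have "ennreal (\<integral>x. (?k x)\<^sup>2 \<partial>lborel) \<le> ennreal (\<integral>x. (h x)\<^sup>2 \<partial>lborel)"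
    using le unfolding eq nn_integral_eq_integral[OF A AE_I2[OF zero_le_power2]] .
  then show ?B by (simp add: ennreal_le_iff)
qed

lemma set_integral_const_on_gap:
  assumes "p \<in> gaps E" "\<And>x. x \<in> gap p \<Longrightarrow> h x = (c::real)"
  shows "(LINT t:gap p|lborel. h t) = c * (snd p - fst p)"
proof -
  have "(LINT t:gap p|lborel. h t) = (LINT t:gap p|lborel. c)" using assms(2) by (intro set_lebesgue_integral_cong) auto
  then show ?thesis using gapD(1)[OF assms(1)] by (simp add: set_integral_const)
qed

lemma gap_increment:
  assumes "H1_on l r F h" "p \<in> gaps E"
  shows "F (snd p) - F (fst p) = (LINT t:gap p|lborel. h t)"
  using H1_onD(4)[OF assms(1), of "fst p" "snd p"] gapD(1-3)[OF assms(2)] E_bounds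
    set_integral_Icc_eq_Ioo[OF H1_onD(1)[OF assms(1)], of "fst p" "snd p"] by auto

text \<open>Between points of \<open>E\<close> the change of derivative is supported in complete
  gaps, and over each of them it integrates to 0.\<close>

lemma gap_average_increment:
  assumes F: "H1_on l r F h" and xy: "x \<in> E" "y \<in> E" "x \<le> y"
  shows "(LINT t:{x..y}|lborel. gap_average F h t) = (LINT t:{x..y}|lborel. h t)"
proof -
  note H1 = H1_onD[OF F]
  let ?k = "gap_average F h"
  have k: "?k \<in> borel_measurable borel" using H1(1) gap_average_measurable by auto
  have ki: "set_integrable lborel {u..v} ?k" for u v by (rule set_integrable_Icc_of_square[OF k gap_average_square(1)[OF F]])
  define d where "d t = ?k t - h t" for t
  have d: "set_integrable lborel {u..v} d" for u v unfolding d_def using ki H1(5) by (rule set_integral_diff)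
  define P where "P = {p\<in>gaps E. x \<le> fst p \<and> snd p \<le> y}"
  have P: "p \<in> P" if "p \<in> gaps E" "t \<in> gap p" "t \<in> {x..y}" for p t
  proof -
    have "t \<noteq> x" "t \<noteq> y" using that gapD(4)[OF that(1)] xy by auto
    then have "t \<in> gap p \<inter> {x<..<y}" using that by auto
    then show ?thesis using gap_inside_or_outside[OF that(1) xy(1,2)] that(1) unfolding P_def by blast
  qed
  have "indicator {x..y} t *\<^sub>R d t = indicator (\<Union>p\<in>P. gap p) t *\<^sub>R d t" for t
  proof (cases "t \<in> {x..y} \<and> t \<in> I - E")
    case True
    then obtain p where "p \<in> gaps E" "t \<in> gap p" using UN_gaps by blast
    then have "t \<in> (\<Union>p\<in>P. gap p)" using P True by blast
    then show ?thesis using True by (simp only: indicator_simps)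
  next
    case False
    show ?thesis
    proof (cases "t \<in> I - E")
      case True
      then have "t \<notin> (\<Union>p\<in>P. gap p)" "t \<notin> {x..y}" using False unfolding P_def by auto
      then show ?thesis by (simp only: indicator_simps not_False_eq_True)
    qed (simp add: d_def gap_average_off)
  qed
  then have "(LINT t:{x..y}|lborel. d t) = (LINT t:(\<Union>p\<in>P. gap p)|lborel. d t)"
    unfolding set_lebesgue_integral_def by (intro Bochner_Integration.integral_cong refl)
  also have "\<dots> = 0"
  proof -
    have "countable P" using countable_gaps unfolding P_def by (rule countable_subset[rotated]) auto
    moreover have "disjoint_family_on gap P"
      using gaps_disjoint unfolding P_def disjoint_family_on_def by simp
    moreover have "set_integrable lborel (\<Union>p\<in>P. gap p) d"
      by (rule set_integrable_subset[OF d[of x y]]) (use \<open>countable P\<close> in \<open>auto simp: P_def\<close>)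
    ultimately have "((\<lambda>p. LINT t:gap p|lborel. d t) has_sum (LINT t:(\<Union>p\<in>P. gap p)|lborel. d t)) P"
      by (intro set_integral_countable_has_sum) auto
    moreover have "(LINT t:gap p|lborel. d t) = 0" if "p \<in> P" for p
    proof -
      have p: "p \<in> gaps E" using that by (simp add: P_def)
      have i: "set_integrable lborel (gap p) ?k" "set_integrable lborel (gap p) h"
        using set_integrable_subset[OF ki[of "fst p" "snd p"], of "gap p"] set_integrable_subset[OF H1(5)[of "fst p" "snd p"], of "gap p"]
        by (auto simp: subset_eq)
      have "(LINT t:gap p|lborel. d t) = slope F p * (snd p - fst p) - (F (snd p) - F (fst p))"
        unfolding d_def set_integral_diff(2)[OF i] gap_increment[OF F p, symmetric]
        using set_integral_const_on_gap[OF p, of ?k "slope F p"] gap_average_gap[OF p] by simp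
      then show ?thesis using gapD(1)[OF p] by (simp add: slope_def)
    qed
    ultimately have "((\<lambda>p. 0) has_sum (LINT t:(\<Union>p\<in>P. gap p)|lborel. d t)) P"
      by (rule has_sum_cong[THEN iffD1, rotated])
    then show ?thesis using has_sum_0[of P "\<lambda>_. 0::real"] has_sum_unique by blast
  qed
  finally show ?thesis unfolding d_def set_integral_diff(2)[OF ki H1(5)] by simp
qed

text \<open>A representative that is affine on the gaps turns the form into a single integral
  over \<open>(l, r)\<close>: each jump term is the integral of the product of the two slopes over the gap.\<close>

definition gap_const :: "(real \<Rightarrow> real) \<Rightarrow> bool" where
  "gap_const h \<longleftrightarrow> (\<forall>p\<in>gaps E. \<exists>c. \<forall>x\<in>gap p. h x = c)"

lemma gap_const_add: "gap_const h \<Longrightarrow> gap_const k \<Longrightarrow> gap_const (\<lambda>x. h x + k x)"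
  and gap_const_diff: "gap_const h \<Longrightarrow> gap_const k \<Longrightarrow> gap_const (\<lambda>x. h x - k x)"
  and gap_const_cmult: "gap_const h \<Longrightarrow> gap_const (\<lambda>x. c * h x)"
  unfolding gap_const_def by (metis, metis, metis)

lemma E_nonempty: "E \<noteq> {}"
  using l_less_r exists_E_near_l by blast

theorem exists_gap_const:
  assumes F: "H1_on l r F h"
  obtains G k where "H1_on l r G k" "gap_const k" "\<And>x. x \<in> E \<Longrightarrow> G x = F x" "\<And>x. x \<in> E \<Longrightarrow> k x = h x"
    "(\<integral>x. (k x)\<^sup>2 \<partial>lborel) \<le> (\<integral>x. (h x)\<^sup>2 \<partial>lborel)"
proof -
  note H1 = H1_onD[OF F]
  let ?k = "gap_average F h"
  obtain x0 where x0: "x0 \<in> E" using E_nonempty by blast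
  let ?G = "\<lambda>x. F x0 + primitive x0 ?k x"
  have G: "H1_on l r ?G ?k"
    by (rule H1_on_primitive[OF gap_average_measurable[OF H1(1)] _ gap_average_square(1)[OF F]]) (simp add: gap_average_off H1(2))
  show ?thesis
  proof (rule that[OF G])
    show "gap_const ?k" unfolding gap_const_def using gap_average_gap by blast
    show "?G x = F x" if "x \<in> E" for x
      using gap_average_increment[OF F x0 that] gap_average_increment[OF F that x0] H1(4)[of x0 x] H1(4)[of x x0] E_bounds x0 that
      by (cases "x0 \<le> x") (auto simp: primitive_def)
    show "?k x = h x" if "x \<in> E" for x using that by (simp add: gap_average_off)
  qed (rule gap_average_square(2)[OF F])
qed

section \<open>The form in terms of representatives\<close>

text \<open>The chosen pair is a genuine representative once one exists. The indicator normalises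
  its derivative, which \<open>ac_L2\<close> leaves free outside (l, r).\<close>

lemma qd_rep_H1:
  assumes "rep f F h"
  defines "F0 \<equiv> fst (qd_rep E \<mu> f)" and "h0 \<equiv> snd (qd_rep E \<mu> f)"
  shows "rep f F0 (\<lambda>x. indicator I x * h0 x)"
proof -
  have "ac_L2 l r F h \<and> (AE x in \<mu>. f x = F x)"
    using assms(1) H1_on_imp_ac_L2 l_less_r by (auto simp: rep_def)
  then have "case (F, h) of (F, h) \<Rightarrow> ac_L2 l r F h \<and> (AE x in \<mu>. f x = F x)" by simp
  then have "case qd_rep E \<mu> f of (F, h) \<Rightarrow> ac_L2 l r F h \<and> (AE x in \<mu>. f x = F x)"
    unfolding qd_rep_def by (rule someI)
  then show ?thesis using ac_L2_imp_H1_on by (auto simp: rep_def F0_def h0_def case_prod_unfold)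
qed

lemma rep_deriv_eq_on_E:
  assumes "rep f F h" "rep f G k"
  shows "AE x in lborel. x \<in> E \<longrightarrow> h x = k x"
  using H1_deriv_eq_on_E[of F h G k] rep_eq_on_E[OF assms] assms by (auto simp: rep_def)

text \<open>The choice in \<open>qd_rep\<close> is immaterial: representatives agree on
  \<open>E\<close>, which contains all gap endpoints, and their derivatives agree almost everywhere
  on \<open>E\<close>.\<close>

lemma qd_form_eq:
  assumes f: "rep f F h" and g: "rep g G k"
  shows "qd_form E \<mu> f g = 1/2 * (LINT x:E|lborel. h x * k x) +
     1/2 * (\<Sum>\<^sub>\<infinity>p\<in>gaps E. (F (snd p) - F (fst p)) * (G (snd p) - G (fst p)) / (snd p - fst p))"
proof -
  define F0 h0 G0 k0 where d: "F0 = fst (qd_rep E \<mu> f)" "h0 = snd (qd_rep E \<mu> f)" "G0 = fst (qd_rep E \<mu> g)" "k0 = snd (qd_rep E \<mu> g)"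
  have f0: "rep f F0 (\<lambda>x. indicator I x * h0 x)" and g0: "rep g G0 (\<lambda>x. indicator I x * k0 x)"
    using qd_rep_H1[OF f] qd_rep_H1[OF g] by (simp_all add: d)
  have [measurable]: "(\<lambda>x. indicator I x * h0 x) \<in> borel_measurable borel" "(\<lambda>x. indicator I x * k0 x) \<in> borel_measurable borel"
    "h \<in> borel_measurable borel" "k \<in> borel_measurable borel"
    using f0 g0 f g H1_onD(1) by (auto simp: rep_def)
  \<comment> \<open>\<open>E\<close> may contain \<open>l\<close> or \<open>r\<close>, where the
    unnormalised \<open>h0\<close> and \<open>k0\<close> are arbitrary; these are at most two
    points.\<close>
  have "(LINT x:E|lborel. h0 x * k0 x) = (LINT x:E|lborel. (indicator I x * h0 x) * (indicator I x * k0 x))"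
    unfolding set_lebesgue_integral_def
  proof (rule integral_discrete_difference[of "{x. ereal x = l \<or> ereal x = r}"])
    show "countable {x. ereal x = l \<or> ereal x = r}" using finite_ends by (rule countable_finite)
    fix x assume "x \<notin> {x. ereal x = l \<or> ereal x = r}"
    then have "x \<in> E \<Longrightarrow> x \<in> I" using E_bounds[of x] by (auto simp: open_lr_def order_less_le)
    then show "indicat_real E x *\<^sub>R (h0 x * k0 x) = indicat_real E x *\<^sub>R (indicat_real I x * h0 x * (indicat_real I x * k0 x))"
      by (auto simp: indicator_def)
  qed auto
  also have "\<dots> = (LINT x:E|lborel. h x * k x)"
    unfolding set_lebesgue_integral_def
  proof (rule integral_cong_AE)
    show "AE x in lborel. indicat_real E x *\<^sub>R (indicat_real I x * h0 x * (indicat_real I x * k0 x)) = indicat_real E x *\<^sub>R (h x * k x)"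
      using rep_deriv_eq_on_E[OF f0 f] rep_deriv_eq_on_E[OF g0 g] by eventually_elim (auto simp: indicator_def)
  qed measurable
  finally have 1: "(LINT x:E|lborel. h0 x * k0 x) = (LINT x:E|lborel. h x * k x)" .
  have "(\<Sum>\<^sub>\<infinity>p\<in>gaps E. (F0 (snd p) - F0 (fst p)) * (G0 (snd p) - G0 (fst p)) / (snd p - fst p))
    = (\<Sum>\<^sub>\<infinity>p\<in>gaps E. (F (snd p) - F (fst p)) * (G (snd p) - G (fst p)) / (snd p - fst p))"
    using gapD(2,3) rep_eq_on_E[OF f0 f] rep_eq_on_E[OF g0 g] by (intro infsum_cong) simp
  then show ?thesis unfolding qd_form_def Let_def using 1 by (simp add: d)
qed

lemma qd_form_gap_const:
  assumes f: "rep f F h" "gap_const h" and g: "rep g G k" "gap_const k"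
  shows "qd_form E \<mu> f g = 1/2 * (\<integral>x. h x * k x \<partial>lborel)"
proof -
  have F: "H1_on l r F h" and G: "H1_on l r G k" using f g by (auto simp: rep_def)
  note H = H1_onD[OF F] and K = H1_onD[OF G]
  have int: "integrable lborel (\<lambda>x. h x * k x)" using H K by (intro integrable_square_mult) auto
  have "((\<lambda>p. LINT x:gap p|lborel. h x * k x) has_sum (LINT x:I - E|lborel. h x * k x)) (gaps E)"
    unfolding UN_gaps[symmetric] using countable_gaps gaps_disjoint int UN_gaps
    by (intro set_integral_countable_has_sum set_integrable_of_integrable) auto
  moreover have "(LINT x:gap p|lborel. h x * k x) = (F (snd p) - F (fst p)) * (G (snd p) - G (fst p)) / (snd p - fst p)" if p: "p \<in> gaps E" for p
  proof -
    obtain c d where cd: "\<And>x. x \<in> gap p \<Longrightarrow> h x = c" "\<And>x. x \<in> gap p \<Longrightarrow> k x = d"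
      using f(2) g(2) p unfolding gap_const_def by metis
    have "(LINT x:gap p|lborel. h x * k x) = c * d * (snd p - fst p)"
      using cd by (intro set_integral_const_on_gap[OF p]) simp
    then show ?thesis
      using gap_increment[OF F p] gap_increment[OF G p] set_integral_const_on_gap[OF p cd(1)] set_integral_const_on_gap[OF p cd(2)] gapD(1)[OF p]
      by simp
  qed
  ultimately have "((\<lambda>p. (F (snd p) - F (fst p)) * (G (snd p) - G (fst p)) / (snd p - fst p)) has_sum (LINT x:I - E|lborel. h x * k x)) (gaps E)"
    by (rule has_sum_cong[THEN iffD1, rotated])
  then have 2: "(\<Sum>\<^sub>\<infinity>p\<in>gaps E. (F (snd p) - F (fst p)) * (G (snd p) - G (fst p)) / (snd p - fst p)) = (LINT x:I - E|lborel. h x * k x)"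
    by (rule infsumI)
  have "(LINT x:E|lborel. h x * k x) + (LINT x:I - E|lborel. h x * k x) = (LINT x:E \<union> (I - E)|lborel. h x * k x)"
    using int by (intro set_integral_Un[symmetric] set_integrable_of_integrable) auto
  also have "\<dots> = (\<integral>x. h x * k x \<partial>lborel)"
    unfolding set_lebesgue_integral_def using H(2) by (intro Bochner_Integration.integral_cong) (auto simp: indicator_def)
  finally show ?thesis unfolding qd_form_eq[OF f(1) g(1)] 2 by (simp add: algebra_simps)
qed

lemma rep_exists_gap_const:
  assumes "rep f F h"
  obtains G k where "rep f G k" "gap_const k" "\<And>x. x \<in> E \<Longrightarrow> G x = F x" "\<And>x. x \<in> E \<Longrightarrow> k x = h x"
    "(\<integral>x. (k x)\<^sup>2 \<partial>lborel) \<le> (\<integral>x. (h x)\<^sup>2 \<partial>lborel)"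
proof (rule exists_gap_const[of F h])
  show "H1_on l r F h" using assms by (simp add: rep_def)
  fix G k
  assume G: "H1_on l r G k" "gap_const k" "\<And>x. x \<in> E \<Longrightarrow> G x = F x" "\<And>x. x \<in> E \<Longrightarrow> k x = h x"
    "(\<integral>x. (k x)\<^sup>2 \<partial>lborel) \<le> (\<integral>x. (h x)\<^sup>2 \<partial>lborel)"
  have "AE x in \<mu>. f x = F x" using assms by (simp add: rep_def)
  then have "AE x in \<mu>. f x = G x" using AE_mu_E by eventually_elim (simp add: G(3))
  then have "rep f G k" using G(1) by (simp add: rep_def)
  then show ?thesis using G(2-) by (rule that)
qed

text \<open>Averaging over gaps only lowers the energy, so any representative gives an upper bound.
  This is what makes contractions and cutoffs usable, whose derivatives are not constant on
  gaps.\<close>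

lemma qd_form_bounds:
  assumes "rep f F h"
  shows "0 \<le> qd_form E \<mu> f f" "qd_form E \<mu> f f \<le> 1/2 * (\<integral>x. (h x)\<^sup>2 \<partial>lborel)"
proof -
  obtain G k where "rep f G k" "gap_const k" "(\<integral>x. (k x)\<^sup>2 \<partial>lborel) \<le> (\<integral>x. (h x)\<^sup>2 \<partial>lborel)"
    by (rule rep_exists_gap_const[OF assms])
  then have "qd_form E \<mu> f f = 1/2 * (\<integral>x. (k x)\<^sup>2 \<partial>lborel)" "(\<integral>x. (k x)\<^sup>2 \<partial>lborel) \<le> (\<integral>x. (h x)\<^sup>2 \<partial>lborel)"
    using qd_form_gap_const[of f G k f G k] by (simp_all add: power2_eq_square[symmetric])
  moreover have "0 \<le> (\<integral>x. (k x)\<^sup>2 \<partial>lborel)" by simp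
  ultimately show "0 \<le> qd_form E \<mu> f f" "qd_form E \<mu> f f \<le> 1/2 * (\<integral>x. (h x)\<^sup>2 \<partial>lborel)" by linarith+
qed

abbreviation "energy \<equiv> E1 \<mu> (qd_form E \<mu>)"

section \<open>Subspaces defined by vanishing derivatives\<close>

definition vanishes_at_ends :: "(real \<Rightarrow> real) \<Rightarrow> bool" where
  "vanishes_at_ends F \<longleftrightarrow> (\<forall>a. (ereal a = l \<or> ereal a = r) \<and> a \<notin> E \<longrightarrow> F a = 0)"

text \<open>For \<open>B \<subseteq> E\<close> the condition on the derivative does not depend on
  the representative, because derivatives of representatives agree almost everywhere on
  \<open>E\<close>.\<close>

definition dom :: "real set \<Rightarrow> (real \<Rightarrow> real) set" where
  "dom B = {f \<in> L2 \<mu>. \<exists>F h. rep f F h \<and> vanishes_at_ends F \<and> (AE x in lborel. x \<in> B \<longrightarrow> h x = 0)}"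

lemma qd_domain_eq: "qd_domain E \<mu> = dom {}"
proof (intro set_eqI iffI)
  fix f assume "f \<in> qd_domain E \<mu>"
  then obtain F h where "f \<in> L2 \<mu>" "ac_L2 l r F h" "AE x in \<mu>. f x = F x" "vanishes_at_ends F"
    unfolding qd_domain_def vanishes_at_ends_def by force
  then have "rep f F (\<lambda>x. indicator I x * h x)" using ac_L2_imp_H1_on unfolding rep_def by blast
  moreover have "AE x in lborel. x \<in> {} \<longrightarrow> indicator I x * h x = (0::real)" by simp
  ultimately show "f \<in> dom {}" using \<open>f \<in> L2 \<mu>\<close> \<open>vanishes_at_ends F\<close> unfolding dom_def by blast
next
  fix f assume "f \<in> dom {}"
  then obtain F h where "f \<in> L2 \<mu>" "rep f F h" "vanishes_at_ends F" unfolding dom_def by auto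
  then have "f \<in> L2 \<mu>" "ac_L2 l r F h" "AE x in \<mu>. f x = F x"
    "\<forall>a. l = ereal a \<and> a \<notin> E \<longrightarrow> F a = 0" "\<forall>b. r = ereal b \<and> b \<notin> E \<longrightarrow> F b = 0"
    using H1_on_imp_ac_L2[OF _ l_less_r] unfolding vanishes_at_ends_def rep_def by auto
  then show "f \<in> qd_domain E \<mu>" unfolding qd_domain_def by blast
qed

lemma dom_mono: "B \<subseteq> C \<Longrightarrow> dom C \<subseteq> dom B"
proof
  fix f assume "B \<subseteq> C" "f \<in> dom C"
  then obtain F h where f: "f \<in> L2 \<mu>" "rep f F h" "vanishes_at_ends F" and h: "AE x in lborel. x \<in> C \<longrightarrow> h x = 0"
    unfolding dom_def by auto
  have "AE x in lborel. x \<in> B \<longrightarrow> h x = 0" using h by eventually_elim (use \<open>B \<subseteq> C\<close> in auto)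
  then show "f \<in> dom B" using f unfolding dom_def by blast
qed

lemma closed_J: "closed J"
proof -
  have "J = ereal -` {l..r}" by auto
  then show ?thesis by (simp add: continuous_closed_vimage continuous_at_ereal)
qed

lemma end_in_closure:
  assumes "ereal a = l \<or> ereal a = r"
  shows "a \<in> closure E"
  unfolding closure_approachable
proof (intro allI impI)
  fix e :: real assume "e > 0"
  show "\<exists>y\<in>E. dist y a < e"
  proof (cases "ereal a = l")
    case True
    then have "l < ereal (a + e)" using \<open>e > 0\<close> by (simp flip: True)
    then obtain y where "y \<in> E" "y < a + e" using exists_E_near_l by force
    moreover have "a \<le> y" using E_bounds(1)[OF \<open>y \<in> E\<close>] by (simp flip: True)
    ultimately show ?thesis by (intro bexI[of _ y]) (auto simp: dist_real_def)
  next
    case False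
    then have r: "ereal a = r" using assms by simp
    then have "ereal (a - e) < r" using \<open>e > 0\<close> by (simp flip: r)
    then obtain y where "y \<in> E" "a - e < y" using exists_E_near_r by force
    moreover have "y \<le> a" using E_bounds(2)[OF \<open>y \<in> E\<close>] by (simp flip: r)
    ultimately show ?thesis by (intro bexI[of _ y]) (auto simp: dist_real_def)
  qed
qed

text \<open>A finite endpoint outside \<open>E\<close> is still a limit of points of
  \<open>E\<close>. Hence modifying a representative inside the gaps preserves its boundary
  values.\<close>

lemma eq_at_ends:
  assumes "continuous_on J F" "continuous_on J G" "\<And>x. x \<in> E \<Longrightarrow> F x = (G x :: real)" "ereal a = l \<or> ereal a = r"
  shows "F a = G a"
proof -
  have "continuous_on J (\<lambda>x. F x - G x)" using assms by (intro continuous_intros)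
  then have "closed {x\<in>J. F x - G x = 0}" by (intro continuous_closed_preimage_constant closed_J)
  moreover have "E \<subseteq> {x\<in>J. F x - G x = 0}" using assms(3) E_subset_J by auto
  ultimately have "closure E \<subseteq> {x\<in>J. F x - G x = 0}" by (rule closure_minimal[rotated])
  then show ?thesis using end_in_closure[OF assms(4)] by auto
qed

lemma dom_gap_const:
  assumes "f \<in> dom B" "B \<subseteq> E"
  obtains F h where "f \<in> L2 \<mu>" "rep f F h" "vanishes_at_ends F" "AE x in lborel. x \<in> B \<longrightarrow> h x = 0" "gap_const h"
proof -
  obtain F h where f: "f \<in> L2 \<mu>" "rep f F h" "vanishes_at_ends F" "AE x in lborel. x \<in> B \<longrightarrow> h x = 0"
    using assms unfolding dom_def by auto
  show ?thesis
  proof (rule rep_exists_gap_const[OF f(2)])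
    fix G k assume G: "rep f G k" "gap_const k" "\<And>x. x \<in> E \<Longrightarrow> G x = F x" "\<And>x. x \<in> E \<Longrightarrow> k x = h x"
    have "G a = F a" if "ereal a = l \<or> ereal a = r" for a
      using G(1) f(2) by (intro eq_at_ends[OF _ _ G(3) that] H1_on_continuous) (auto simp: rep_def)
    then have "vanishes_at_ends G" using f(3) by (auto simp: vanishes_at_ends_def)
    moreover have "AE x in lborel. x \<in> B \<longrightarrow> k x = 0"
      using f(4) by eventually_elim (use G(4) \<open>B \<subseteq> E\<close> in auto)
    ultimately show thesis using that f(1) G(1,2) by blast
  qed
qed

section \<open>The spaces \<open>dom B\<close> as Dirichlet forms\<close>

lemma rep_add: "rep f F h \<Longrightarrow> rep g G k \<Longrightarrow> rep (\<lambda>x. f x + g x) (\<lambda>x. F x + G x) (\<lambda>x. h x + k x)"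
  unfolding rep_def by (auto intro: H1_on_add)

lemma rep_diff: "rep f F h \<Longrightarrow> rep g G k \<Longrightarrow> rep (\<lambda>x. f x - g x) (\<lambda>x. F x - G x) (\<lambda>x. h x - k x)"
  unfolding rep_def by (auto intro: H1_on_diff)

lemma rep_cmult: "rep f F h \<Longrightarrow> rep (\<lambda>x. c * f x) (\<lambda>x. c * F x) (\<lambda>x. c * h x)"
  unfolding rep_def by (auto intro: H1_on_cmult)

lemma rep_contraction: "rep f F h \<Longrightarrow> rep (\<lambda>x. min 1 (max 0 (f x))) (\<lambda>x. min 1 (max 0 (F x)))
    (\<lambda>x. if x \<in> I \<and> 0 < F x \<and> F x < 1 then h x else 0)"
  unfolding rep_def by (auto intro: H1_on_contraction l_less_r)

lemma L2D: assumes "f \<in> L2 \<mu>" shows "f \<in> borel_measurable \<mu>" "f \<in> borel_measurable borel" "integrable \<mu> (\<lambda>x. (f x)\<^sup>2)"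
  using assms by (auto simp: L2_def cong: measurable_cong_sets)

lemma L2_add: "f \<in> L2 \<mu> \<Longrightarrow> g \<in> L2 \<mu> \<Longrightarrow> (\<lambda>x. f x + g x) \<in> L2 \<mu>"
  and L2_diff: "f \<in> L2 \<mu> \<Longrightarrow> g \<in> L2 \<mu> \<Longrightarrow> (\<lambda>x. f x - g x) \<in> L2 \<mu>"
  and L2_cmult: "f \<in> L2 \<mu> \<Longrightarrow> (\<lambda>x. c * f x) \<in> L2 \<mu>"
  by (auto simp: L2_def power_mult_distrib intro!: integrable_square_add integrable_square_diff)

lemma L2_bound:
  assumes f: "f \<in> L2 \<mu>" and g: "g \<in> borel_measurable borel" "\<And>x. \<bar>g x\<bar> \<le> \<bar>f x\<bar>"
  shows "g \<in> L2 \<mu>"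
  unfolding L2_def
proof (intro CollectI conjI)
  show [measurable]: "g \<in> borel_measurable \<mu>" using g(1) by (simp cong: measurable_cong_sets)
  show "integrable \<mu> (\<lambda>x. (g x)\<^sup>2)"
    by (rule Bochner_Integration.integrable_bound[OF L2D(3)[OF f]]) (use g(2) in \<open>auto simp: abs_le_square_iff\<close>)
qed

lemma dom_add: "f \<in> dom B \<Longrightarrow> g \<in> dom B \<Longrightarrow> (\<lambda>x. f x + g x) \<in> dom B"
proof -
  assume "f \<in> dom B" "g \<in> dom B"
  then obtain F h G k where f: "f \<in> L2 \<mu>" "rep f F h" "vanishes_at_ends F" "AE x in lborel. x \<in> B \<longrightarrow> h x = 0"
    and g: "g \<in> L2 \<mu>" "rep g G k" "vanishes_at_ends G" "AE x in lborel. x \<in> B \<longrightarrow> k x = 0"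
    unfolding dom_def by auto
  have "vanishes_at_ends (\<lambda>x. F x + G x)" using f g by (simp add: vanishes_at_ends_def)
  moreover have "AE x in lborel. x \<in> B \<longrightarrow> h x + k x = 0" using f(4) g(4) by eventually_elim auto
  ultimately show ?thesis using rep_add[OF f(2) g(2)] L2_add[OF f(1) g(1)] unfolding dom_def by blast
qed

lemma dom_cmult: "f \<in> dom B \<Longrightarrow> (\<lambda>x. c * f x) \<in> dom B"
proof -
  assume "f \<in> dom B"
  then obtain F h where f: "f \<in> L2 \<mu>" "rep f F h" "vanishes_at_ends F" "AE x in lborel. x \<in> B \<longrightarrow> h x = 0"
    unfolding dom_def by auto
  have "vanishes_at_ends (\<lambda>x. c * F x)" using f by (simp add: vanishes_at_ends_def)
  moreover have "AE x in lborel. x \<in> B \<longrightarrow> c * h x = 0" using f(4) by eventually_elim auto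
  ultimately show ?thesis using rep_cmult[OF f(2)] L2_cmult[OF f(1)] unfolding dom_def by blast
qed

lemma dom_diff: "f \<in> dom B \<Longrightarrow> g \<in> dom B \<Longrightarrow> (\<lambda>x. f x - g x) \<in> dom B"
  using dom_add[of f B "\<lambda>x. -1 * g x"] dom_cmult[of g B "-1"] by simp

lemma dom_L2: "f \<in> dom B \<Longrightarrow> f \<in> L2 \<mu>" by (simp add: dom_def)

lemma dom_AE_cong:
  assumes "f \<in> dom B" "g \<in> L2 \<mu>" "AE x in \<mu>. f x = g x"
  shows "g \<in> dom B"
proof -
  obtain F h where f: "rep f F h" "vanishes_at_ends F" "AE x in lborel. x \<in> B \<longrightarrow> h x = 0" using assms unfolding dom_def by auto
  have "AE x in \<mu>. f x = F x" using f by (simp add: rep_def)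
  then have "AE x in \<mu>. g x = F x" using assms(3) by eventually_elim auto
  then have "rep g F h" using f by (simp add: rep_def)
  then show ?thesis using f assms(2) unfolding dom_def by blast
qed

text \<open>The form of \<open>f\<close> is computed exactly from a gap-constant derivative. The
  truncated derivative is pointwise smaller but usually not gap-constant, so its form is only
  bounded from above, which is the direction needed.\<close>

lemma dom_contraction:
  assumes "f \<in> dom B" "B \<subseteq> E"
  shows "(\<lambda>x. min 1 (max 0 (f x))) \<in> dom B"
    and "qd_form E \<mu> (\<lambda>x. min 1 (max 0 (f x))) (\<lambda>x. min 1 (max 0 (f x))) \<le> qd_form E \<mu> f f"
proof -
  let ?g = "\<lambda>x. min 1 (max 0 (f x))"
  obtain F h where f: "f \<in> L2 \<mu>" "rep f F h" "vanishes_at_ends F" "AE x in lborel. x \<in> B \<longrightarrow> h x = 0" "gap_const h"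
    by (rule dom_gap_const[OF assms])
  let ?k = "\<lambda>x. if x \<in> I \<and> 0 < F x \<and> F x < 1 then h x else 0"
  have g: "rep ?g (\<lambda>x. min 1 (max 0 (F x))) ?k" by (rule rep_contraction[OF f(2)])
  have "?g \<in> L2 \<mu>" by (rule L2_bound[OF f(1)]) (use L2D[OF f(1)] in auto)
  moreover have "vanishes_at_ends (\<lambda>x. min 1 (max 0 (F x)))" using f(3) by (simp add: vanishes_at_ends_def)
  moreover have "AE x in lborel. x \<in> B \<longrightarrow> ?k x = 0" using f(4) by eventually_elim auto
  ultimately show "?g \<in> dom B" using g unfolding dom_def by blast
  have "qd_form E \<mu> ?g ?g \<le> 1/2 * (\<integral>x. (?k x)\<^sup>2 \<partial>lborel)" by (rule qd_form_bounds(2)[OF g])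
  also have "(\<integral>x. (?k x)\<^sup>2 \<partial>lborel) \<le> (\<integral>x. (h x)\<^sup>2 \<partial>lborel)"
    by (intro integral_mono) (use g f(2) H1_onD(3) in \<open>auto simp: rep_def\<close>)
  also have "1/2 * \<dots> = qd_form E \<mu> f f"
    using qd_form_gap_const[OF f(2,5) f(2,5)] by (simp add: power2_eq_square)
  finally show "qd_form E \<mu> ?g ?g \<le> qd_form E \<mu> f f" by simp
qed

lemma dom_gap_const0:
  assumes "f \<in> dom {}"
  obtains F h where "rep f F h" "gap_const h" "vanishes_at_ends F"
  by (rule dom_gap_const[OF assms]) auto

lemma qd_form_sym:
  assumes "f \<in> dom {}" "g \<in> dom {}"
  shows "qd_form E \<mu> f g = qd_form E \<mu> g f"
proof -
  obtain F h where f: "rep f F h" "gap_const h" by (rule dom_gap_const0[OF assms(1)])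
  obtain G k where g: "rep g G k" "gap_const k" by (rule dom_gap_const0[OF assms(2)])
  show ?thesis using qd_form_gap_const[OF f g] qd_form_gap_const[OF g f] by (simp add: mult.commute)
qed

lemma rep_integrable_mult:
  assumes "rep f F h" "rep g G k"
  shows "integrable lborel (\<lambda>x. h x * k x)"
  using assms H1_onD(1,3) by (intro integrable_square_mult) (auto simp: rep_def)

lemma qd_form_add:
  assumes "f \<in> dom {}" "g \<in> dom {}" "u \<in> dom {}"
  shows "qd_form E \<mu> (\<lambda>x. f x + g x) u = qd_form E \<mu> f u + qd_form E \<mu> g u"
proof -
  obtain F h where f: "rep f F h" "gap_const h" by (rule dom_gap_const0[OF assms(1)])
  obtain G k where g: "rep g G k" "gap_const k" by (rule dom_gap_const0[OF assms(2)])
  obtain U w where u: "rep u U w" "gap_const w" by (rule dom_gap_const0[OF assms(3)])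
  show ?thesis
    using rep_integrable_mult[OF f(1) u(1)] rep_integrable_mult[OF g(1) u(1)]
    by (simp add: qd_form_gap_const[OF f u] qd_form_gap_const[OF g u] 
         qd_form_gap_const[OF rep_add[OF f(1) g(1)] gap_const_add[OF f(2) g(2)] u] algebra_simps)
qed

lemma qd_form_cmult:
  assumes "f \<in> dom {}" "u \<in> dom {}"
  shows "qd_form E \<mu> (\<lambda>x. c * f x) u = c * qd_form E \<mu> f u"
proof -
  obtain F h where f: "rep f F h" "gap_const h" by (rule dom_gap_const0[OF assms(1)])
  obtain U w where u: "rep u U w" "gap_const w" by (rule dom_gap_const0[OF assms(2)])
  show ?thesis
    by (simp add: qd_form_gap_const[OF f u] qd_form_gap_const[OF rep_cmult[OF f(1)] gap_const_cmult[OF f(2)] u] mult.assoc)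
qed

lemma qd_form_nonneg:
  assumes "f \<in> dom {}"
  shows "0 \<le> qd_form E \<mu> f f"
  using assms qd_form_bounds(1) unfolding dom_def by blast

lemma qd_form_AE_cong:
  assumes "f \<in> dom {}" "f' \<in> dom {}" "g \<in> dom {}" "AE x in \<mu>. f x = f' x"
  shows "qd_form E \<mu> f g = qd_form E \<mu> f' g"
proof -
  obtain F h where f: "rep f F h" "gap_const h" by (rule dom_gap_const0[OF assms(1)])
  obtain G k where g: "rep g G k" "gap_const k" by (rule dom_gap_const0[OF assms(3)])
  have "AE x in \<mu>. f x = F x" using f by (simp add: rep_def)
  then have "AE x in \<mu>. f' x = F x" using assms(4) by eventually_elim auto
  then have "rep f' F h" using f by (simp add: rep_def)
  then show ?thesis by (simp only: qd_form_gap_const[OF f g] qd_form_gap_const[OF _ f(2) g])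
qed

text \<open>Replaces the triangle inequality: \<open>energy\<close> is a squared norm, whence the
  factors 2.\<close>

lemma E1_diff_le:
  assumes "f \<in> dom {}" "g \<in> dom {}" "u \<in> dom {}"
  shows "energy (\<lambda>x. f x - g x) \<le> 2 * energy (\<lambda>x. f x - u x) + 2 * energy (\<lambda>x. g x - u x)"
proof -
  obtain F h where f: "rep f F h" "gap_const h" by (rule dom_gap_const0[OF assms(1)])
  obtain G k where g: "rep g G k" "gap_const k" by (rule dom_gap_const0[OF assms(2)])
  obtain U w where u: "rep u U w" "gap_const w" by (rule dom_gap_const0[OF assms(3)])
  have form: "qd_form E \<mu> (\<lambda>x. p x - q x) (\<lambda>x. p x - q x) = 1/2 * (\<integral>x. (a x - b x)\<^sup>2 \<partial>lborel)"
    if "rep p P a" "gap_const a" "rep q Q b" "gap_const b" for p q P Q a b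
    using qd_form_gap_const[OF rep_diff[OF that(1,3)] gap_const_diff[OF that(2,4)] rep_diff[OF that(1,3)] gap_const_diff[OF that(2,4)]]
    by (simp add: power2_eq_square)
  have sq: "integrable lborel (\<lambda>x. (a x - b x)\<^sup>2)" if "rep p P a" "rep q Q b" for p q P Q a b
    using that H1_onD(1,3) by (intro integrable_square_diff) (auto simp: rep_def)
  have L: "integrable \<mu> (\<lambda>x. (p x - q x)\<^sup>2)" if "p \<in> dom {}" "q \<in> dom {}" for p q
    using L2D(3)[OF L2_diff[OF dom_L2[OF that(1)] dom_L2[OF that(2)]]] .
  have "(\<integral>x. (h x - k x)\<^sup>2 \<partial>lborel) \<le> (\<integral>x. 2 * (h x - w x)\<^sup>2 + 2 * (k x - w x)\<^sup>2 \<partial>lborel)"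
    using sq[OF f(1) g(1)] sq[OF f(1) u(1)] sq[OF g(1) u(1)] square_diff_le[of "h x - w x" "k x - w x" for x]
    by (intro integral_mono) auto
  moreover have "(\<integral>x. (f x - g x)\<^sup>2 \<partial>\<mu>) \<le> (\<integral>x. 2 * (f x - u x)\<^sup>2 + 2 * (g x - u x)\<^sup>2 \<partial>\<mu>)"
    using L assms square_diff_le[of "f x - u x" "g x - u x" for x] by (intro integral_mono) auto
  ultimately show ?thesis unfolding E1_def form[OF f g] form[OF f u] form[OF g u]
    using sq[OF f(1) u(1)] sq[OF g(1) u(1)] L assms by simp
qed

lemma mu_not_null: "emeasure \<mu> UNIV \<noteq> 0"
proof -
  obtain x where "x \<in> E" using E_nonempty by blast
  then have "emeasure \<mu> (UNIV \<inter> E) > 0" using full unfolding full_support_def by blast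
  also have "emeasure \<mu> (UNIV \<inter> E) \<le> emeasure \<mu> UNIV" by (rule emeasure_mono) auto
  finally show ?thesis by simp
qed

text \<open>The functions and their gap-constant derivatives converge in two L2 spaces separately. A
  point where the functions converge along a subsequence fixes the constant of integration, and the
  primitive of the limiting derivative then represents the limit. Pointwise convergence on
  \<open>J\<close> preserves the end conditions, L2 convergence preserves vanishing on
  \<open>B\<close>.\<close>

theorem dom_closed:
  assumes B: "B \<subseteq> E" "B \<in> sets borel" and u: "\<And>n::nat. u n \<in> dom B"
    and cauchy: "\<And>\<epsilon>. \<epsilon> > 0 \<Longrightarrow> \<exists>N. \<forall>n\<ge>N. \<forall>m\<ge>N. energy (\<lambda>x. u n x - u m x) < \<epsilon>"
  shows "\<exists>v\<in>dom B. (\<lambda>n. energy (\<lambda>x. u n x - v x)) \<longlonglongrightarrow> 0"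
proof -
  have "\<exists>F h. rep (u n) F h \<and> vanishes_at_ends F \<and> (AE x in lborel. x \<in> B \<longrightarrow> h x = 0) \<and> gap_const h" for n
    by (rule dom_gap_const[OF u B(1)]) blast
  then obtain F h where Fh: "\<And>n. rep (u n) (F n) (h n)" "\<And>n. vanishes_at_ends (F n)"
      "\<And>n. AE x in lborel. x \<in> B \<longrightarrow> h n x = 0" "\<And>n. gap_const (h n)" by metis
  have H: "H1_on l r (F n) (h n)" for n using Fh(1) by (simp add: rep_def)
  note H1 = H1_onD[OF H]
  note uL = L2D[OF dom_L2[OF u]]
  have form: "qd_form E \<mu> (\<lambda>x. u n x - u m x) (\<lambda>x. u n x - u m x) = 1/2 * (\<integral>x. (h n x - h m x)\<^sup>2 \<partial>lborel)" for n m
    using qd_form_gap_const[OF rep_diff[OF Fh(1) Fh(1)] gap_const_diff[OF Fh(4) Fh(4)] rep_diff[OF Fh(1) Fh(1)] gap_const_diff[OF Fh(4) Fh(4)]]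
    by (simp add: power2_eq_square)
  obtain v \<phi> where v: "v \<in> borel_measurable \<mu>" "integrable \<mu> (\<lambda>x. (v x)\<^sup>2)"
    "(\<lambda>n. \<integral>x. (u n x - v x)\<^sup>2 \<partial>\<mu>) \<longlonglongrightarrow> 0" "strict_mono (\<phi> :: nat \<Rightarrow> nat)" "AE x in \<mu>. (\<lambda>j. u (\<phi> j) x) \<longlonglongrightarrow> v x"
  proof (rule L2_complete[OF uL(1) uL(3)])
    fix \<epsilon> :: real assume "\<epsilon> > 0"
    then obtain N where N: "\<forall>n\<ge>N. \<forall>m\<ge>N. energy (\<lambda>x. u n x - u m x) < \<epsilon>" using cauchy by blast
    have "(\<integral>x. (u n x - u m x)\<^sup>2 \<partial>\<mu>) \<le> energy (\<lambda>x. u n x - u m x)" for n m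
      by (simp add: E1_def form)
    then show "\<exists>N. \<forall>n\<ge>N. \<forall>m\<ge>N. (\<integral>x. (u n x - u m x)\<^sup>2 \<partial>\<mu>) < \<epsilon>" using N by (meson le_less_trans)
  qed blast
  obtain k0 \<psi> where k0: "k0 \<in> borel_measurable lborel" "integrable lborel (\<lambda>x. (k0 x)\<^sup>2)"
    "(\<lambda>n. \<integral>x. (h n x - k0 x)\<^sup>2 \<partial>lborel) \<longlonglongrightarrow> 0" "strict_mono (\<psi> :: nat \<Rightarrow> nat)" "AE x in lborel. (\<lambda>j. h (\<psi> j) x) \<longlonglongrightarrow> k0 x"
  proof (rule L2_complete[of h lborel])
    fix \<epsilon> :: real assume "\<epsilon> > 0"
    then obtain N where N: "\<forall>n\<ge>N. \<forall>m\<ge>N. energy (\<lambda>x. u n x - u m x) < \<epsilon> / 2" using cauchy[of "\<epsilon>/2"] by auto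
    have "1/2 * (\<integral>x. (h n x - h m x)\<^sup>2 \<partial>lborel) \<le> energy (\<lambda>x. u n x - u m x)" for n m
      by (simp add: E1_def form)
    then have "1/2 * (\<integral>x. (h n x - h m x)\<^sup>2 \<partial>lborel) < \<epsilon> / 2" if "n \<ge> N" "m \<ge> N" for n m
      using N that by (meson le_less_trans)
    then show "\<exists>N. \<forall>n\<ge>N. \<forall>m\<ge>N. (\<integral>x. (h n x - h m x)\<^sup>2 \<partial>lborel) < \<epsilon>" by (intro exI[of _ N]) simp
  qed (use H1(1,3) in auto)
  \<comment> \<open>The L2 limit is determined only almost everywhere; the normalisation off (l, r)
    has to be imposed.\<close>
  define k where "k x = indicator I x * k0 x" for x
  have k: "k \<in> borel_measurable borel" using k0(1) unfolding k_def by measurable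
  have k2: "integrable lborel (\<lambda>x. (k x)\<^sup>2)"
  proof (rule Bochner_Integration.integrable_bound[OF k0(2)])
    show "(\<lambda>x. (k x)\<^sup>2) \<in> borel_measurable lborel" using k by simp
  qed (simp add: k_def indicator_def)
  have hk: "integrable lborel (\<lambda>x. (h n x - k x)\<^sup>2)" for n using H1 k k2 by (intro integrable_square_diff) auto
  have hk_le: "(\<integral>x. (h n x - k x)\<^sup>2 \<partial>lborel) \<le> (\<integral>x. (h n x - k0 x)\<^sup>2 \<partial>lborel)" for n
  proof (rule integral_mono[OF hk])
    show "integrable lborel (\<lambda>x. (h n x - k0 x)\<^sup>2)" using H1 k0 by (intro integrable_square_diff) auto
    show "(h n x - k x)\<^sup>2 \<le> (h n x - k0 x)\<^sup>2" for x using H1(2)[of x n] by (cases "x \<in> I") (auto simp: k_def)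
  qed
  have hk_lim: "(\<lambda>n. \<integral>x. (h n x - k x)\<^sup>2 \<partial>lborel) \<longlonglongrightarrow> 0"
    by (rule tendsto_sandwich[OF _ _ tendsto_const k0(3)]) (use hk_le in auto)
  have "AE x in \<mu>. \<forall>n. u n x = F n x" using Fh(1) by (simp add: rep_def AE_all_countable)
  then have good: "AE x in \<mu>. x \<in> E \<and> (\<forall>n. u n x = F n x) \<and> (\<lambda>j. u (\<phi> j) x) \<longlonglongrightarrow> v x"
    using v(5) AE_mu_E by eventually_elim auto
  \<comment> \<open>\<open>\<mu>\<close> is not the zero measure, so a property that holds almost
    everywhere holds at some point.\<close>
  have "ae_filter \<mu> \<noteq> bot" using mu_not_null by (simp add: ae_filter_eq_bot_iff)
  then obtain x0 where x0: "x0 \<in> E" "\<And>n. u n x0 = F n x0" "(\<lambda>j. u (\<phi> j) x0) \<longlonglongrightarrow> v x0"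
    using eventually_happens[OF good] by auto
  let ?V = "\<lambda>x. v x0 + primitive x0 k x"
  have V: "H1_on l r ?V k" by (rule H1_on_primitive[OF k _ k2]) (simp add: k_def)
  have conv: "(\<lambda>j. F (\<phi> j) x) \<longlonglongrightarrow> ?V x" if "x \<in> J" for x
  proof -
    have "F n x = F n x0 + primitive x0 (h n) x" for n
      using H1(4)[of x0 x n] H1(4)[of x x0 n] that x0(1) E_bounds by (cases "x0 \<le> x") (auto simp: primitive_def)
    moreover have "(\<lambda>j. primitive x0 (h (\<phi> j)) x) \<longlonglongrightarrow> primitive x0 k x"
    proof (rule tendsto_of_square_le)
      show "(primitive x0 (h (\<phi> j)) x - primitive x0 k x)\<^sup>2 \<le> \<bar>x - x0\<bar> * (\<integral>t. (h (\<phi> j) t - k t)\<^sup>2 \<partial>lborel)" for j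
        using H1 k k2 by (intro primitive_diff_square_le) auto
      show "(\<lambda>j. \<bar>x - x0\<bar> * (\<integral>t. (h (\<phi> j) t - k t)\<^sup>2 \<partial>lborel)) \<longlonglongrightarrow> 0"
        using LIMSEQ_subseq_LIMSEQ[OF hk_lim v(4)] by (auto intro!: tendsto_mult_right_zero simp: o_def)
    qed
    ultimately show ?thesis using tendsto_add[of "\<lambda>j. F (\<phi> j) x0"] x0(2,3) by simp
  qed
  have "AE x in \<mu>. v x = ?V x"
    using good
  proof eventually_elim
    case (elim x)
    then have "(\<lambda>j. F (\<phi> j) x) \<longlonglongrightarrow> ?V x" "(\<lambda>j. F (\<phi> j) x) \<longlonglongrightarrow> v x" using conv E_bounds by auto
    then show ?case by (rule LIMSEQ_unique[rotated])
  qed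
  then have rv: "rep v ?V k" using V by (simp add: rep_def)
  have "vanishes_at_ends ?V"
    unfolding vanishes_at_ends_def
  proof (intro allI impI)
    fix a assume a: "(ereal a = l \<or> ereal a = r) \<and> a \<notin> E"
    then have "a \<in> J" using l_less_r by auto
    then have "(\<lambda>j. F (\<phi> j) a) \<longlonglongrightarrow> ?V a" by (rule conv)
    moreover have "F n a = 0" for n using Fh(2)[of n] a by (simp add: vanishes_at_ends_def)
    ultimately show "?V a = 0" by (simp add: LIMSEQ_const_iff)
  qed
  moreover have "AE x in lborel. x \<in> B \<longrightarrow> k x = 0"
  proof -
    have Bk: "integrable lborel (\<lambda>x. indicator B x * (k x)\<^sup>2)"
      using set_integrable_of_integrable[OF k2, of B] B by (simp add: set_integrable_def)
    have "(\<integral>x. indicator B x * (k x)\<^sup>2 \<partial>lborel) \<le> (\<integral>x. (h n x - k x)\<^sup>2 \<partial>lborel)" for n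
    proof (rule integral_mono_AE[OF Bk hk])
      show "AE x in lborel. indicator B x * (k x)\<^sup>2 \<le> (h n x - k x)\<^sup>2"
        using Fh(3)[of n] by eventually_elim (auto simp: indicator_def)
    qed
    then have "(\<integral>x. indicator B x * (k x)\<^sup>2 \<partial>lborel) \<le> 0"
      by (intro LIMSEQ_le_const[OF hk_lim]) auto
    moreover have "0 \<le> (\<integral>x. indicator B x * (k x)\<^sup>2 \<partial>lborel)" by simp
    ultimately have "(\<integral>x. indicator B x * (k x)\<^sup>2 \<partial>lborel) = 0" by simp
    then have "AE x in lborel. indicator B x * (k x)\<^sup>2 = 0"
      using integral_nonneg_eq_0_iff_AE[OF Bk] by simp
    then show ?thesis by eventually_elim (auto simp: indicator_def)
  qed
  ultimately have vB: "v \<in> dom B" using rv v(1,2) unfolding dom_def L2_def by blast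
  have "(\<lambda>n. energy (\<lambda>x. u n x - v x)) \<longlonglongrightarrow> 0"
  proof (rule tendsto_sandwich[OF _ _ tendsto_const])
    have n: "rep (\<lambda>x. u n x - v x) (\<lambda>x. F n x - ?V x) (\<lambda>x. h n x - k x)" for n by (rule rep_diff[OF Fh(1) rv])
    show "\<forall>\<^sub>F n in sequentially. 0 \<le> energy (\<lambda>x. u n x - v x)"
      using qd_form_bounds(1)[OF n] by (auto simp: E1_def)
    show "\<forall>\<^sub>F n in sequentially. energy (\<lambda>x. u n x - v x) \<le> 1/2 * (\<integral>x. (h n x - k x)\<^sup>2 \<partial>lborel) + (\<integral>x. (u n x - v x)\<^sup>2 \<partial>\<mu>)"
      using qd_form_bounds(2)[OF n] by (auto simp: E1_def)
    show "(\<lambda>n. 1/2 * (\<integral>x. (h n x - k x)\<^sup>2 \<partial>lborel) + (\<integral>x. (u n x - v x)\<^sup>2 \<partial>\<mu>)) \<longlonglongrightarrow> 0"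
      using tendsto_add[OF tendsto_mult_right_zero[OF hk_lim, of "1/2"] v(3)] by simp
  qed
  then show ?thesis using vB by blast
qed

lemma zero_in_dom: "(\<lambda>x. 0) \<in> dom B"
  unfolding dom_def L2_def rep_def vanishes_at_ends_def using H1_on_const by force

theorem dirichlet_form_dom:
  assumes B: "B \<subseteq> E" "B \<in> sets borel"
    and dense: "\<And>f \<epsilon>. f \<in> L2 \<mu> \<Longrightarrow> \<epsilon> > 0 \<Longrightarrow> \<exists>g\<in>dom B. (\<integral>x. (f x - g x)\<^sup>2 \<partial>\<mu>) < \<epsilon>"
  shows "dirichlet_form \<mu> (qd_form E \<mu>) (dom B)"
proof -
  have sub: "f \<in> dom {}" if "f \<in> dom B" for f using that dom_mono[of "{}" B] by auto
  show ?thesis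
    unfolding dirichlet_form_def
  proof (intro conjI ballI allI impI)
    show "dom B \<subseteq> L2 \<mu>" using dom_L2 by blast
    show "g \<in> dom B" if "f \<in> dom B" "g \<in> L2 \<mu>" "AE x in \<mu>. f x = g x" for f g using dom_AE_cong that by blast
    show "qd_form E \<mu> f g = qd_form E \<mu> f' g" if "f \<in> dom B" "f' \<in> dom B" "g \<in> dom B" "AE x in \<mu>. f x = f' x" for f f' g
      using qd_form_AE_cong sub that by blast
    show "\<exists>g\<in>dom B. (\<integral>x. (f x - g x)\<^sup>2 \<partial>\<mu>) < \<epsilon>" if "f \<in> L2 \<mu>" "\<epsilon> > 0" for f \<epsilon> using dense that by blast
    show "\<exists>v\<in>dom B. (\<lambda>n. energy (\<lambda>x. u n x - v x)) \<longlonglongrightarrow> 0"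
      if "(\<forall>n. u n \<in> dom B) \<and> (\<forall>\<epsilon>>0. \<exists>N. \<forall>n\<ge>N. \<forall>m\<ge>N. energy (\<lambda>x. u n x - u m x) < \<epsilon>)" for u
      using that by (intro dom_closed[OF B]) auto
  qed (use sub zero_in_dom dom_add dom_cmult qd_form_sym qd_form_add qd_form_cmult qd_form_nonneg dom_contraction[OF _ B(1)] in auto)
qed

section \<open>Cutting functions off near the ends\<close>

definition dom_rep :: "real set \<Rightarrow> (real \<Rightarrow> real) \<Rightarrow> (real \<Rightarrow> real) \<Rightarrow> (real \<Rightarrow> real) \<Rightarrow> bool" where
  "dom_rep B f F h \<longleftrightarrow> f \<in> L2 \<mu> \<and> rep f F h \<and> vanishes_at_ends F \<and> (AE x in lborel. x \<in> B \<longrightarrow> h x = 0)"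

lemma dom_iff_rep: "f \<in> dom B \<longleftrightarrow> (\<exists>F h. dom_rep B f F h)"
  by (auto simp: dom_def dom_rep_def)

lemma borel_measurable_mult_of_continuous:
  assumes F: "continuous_on J F" and g: "g \<in> borel_measurable borel" "\<And>x. x \<notin> I \<Longrightarrow> g x = (0::real)"
  shows "(\<lambda>x. F x * g x) \<in> borel_measurable borel"
proof -
  have "continuous_on I F" using F by (rule continuous_on_subset) (auto simp: open_lr_def)
  then have [measurable]: "(\<lambda>x. indicator I x * F x) \<in> borel_measurable borel"
    using borel_measurable_continuous_on_indicator[of I F] by simp
  have "(\<lambda>x. F x * g x) = (\<lambda>x. (indicator I x * F x) * g x)" 
  proof
    show "F x * g x = (indicator I x * F x) * g x" for x using g(2)[of x] by (cases "x \<in> I") auto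
  qed
  then show ?thesis using g(1) by simp
qed

text \<open>The error has derivative \<open>h * (1 - \<eta>) - F * \<theta>\<close>. The factor 2
  from squaring a difference cancels the 1/2 in the form, leaving three error terms that can be made
  small independently.\<close>

lemma dom_rep_cut:
  assumes f: "dom_rep B f F h" and \<eta>: "H1_on l r \<eta> \<theta>" "\<eta> \<in> borel_measurable borel" "\<And>x. 0 \<le> \<eta> x" "\<And>x. \<eta> x \<le> 1"
    and \<theta>B: "AE x in lborel. x \<in> B \<longrightarrow> \<theta> x = 0" and F\<theta>: "integrable lborel (\<lambda>x. (F x * \<theta> x)\<^sup>2)"
  shows "dom_rep B (\<lambda>x. f x * \<eta> x) (\<lambda>x. F x * \<eta> x) (\<lambda>x. h x * \<eta> x + F x * \<theta> x)" (is ?A)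
    and "energy (\<lambda>x. f x - f x * \<eta> x) \<le> (\<integral>x. (h x * (1 - \<eta> x))\<^sup>2 \<partial>lborel) + (\<integral>x. (F x * \<theta> x)\<^sup>2 \<partial>lborel)
      + (\<integral>x. (f x * (1 - \<eta> x))\<^sup>2 \<partial>\<mu>)" (is ?B)
proof -
  have F: "H1_on l r F h" and fF: "AE x in \<mu>. f x = F x" "f \<in> L2 \<mu>" "vanishes_at_ends F" "AE x in lborel. x \<in> B \<longrightarrow> h x = 0"
    using f by (auto simp: dom_rep_def rep_def)
  note H = H1_onD[OF F] and T = H1_onD[OF \<eta>(1)]
  have [measurable]: "h \<in> borel_measurable borel" "\<eta> \<in> borel_measurable borel" by (rule H, rule \<eta>)
  have [measurable]: "(\<lambda>x. F x * \<theta> x) \<in> borel_measurable borel"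
    by (rule borel_measurable_mult_of_continuous[OF H1_on_continuous[OF F] T(1) T(2)])
  have le1: "(h x * \<eta> x)\<^sup>2 \<le> (h x)\<^sup>2" "(h x * (1 - \<eta> x))\<^sup>2 \<le> (h x)\<^sup>2" for x
    using \<eta>(3,4)[of x] by (auto simp: power_mult_distrib intro!: mult_left_le power_le_one)
  have h1: "integrable lborel (\<lambda>x. (h x * \<eta> x)\<^sup>2)"
    by (rule Bochner_Integration.integrable_bound[OF H(3)]) (use le1 in auto)
  have h2: "integrable lborel (\<lambda>x. (h x * (1 - \<eta> x))\<^sup>2)"
    by (rule Bochner_Integration.integrable_bound[OF H(3)]) (use le1 in auto)
  have P: "H1_on l r (\<lambda>x. F x * \<eta> x) (\<lambda>x. h x * \<eta> x + F x * \<theta> x)"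
    using h1 F\<theta> by (intro H1_on_mult[OF F \<eta>(1) l_less_r] integrable_square_add) auto
  have g: "rep (\<lambda>x. f x * \<eta> x) (\<lambda>x. F x * \<eta> x) (\<lambda>x. h x * \<eta> x + F x * \<theta> x)"
    using P fF(1) by (auto simp: rep_def)
  have "\<bar>f x * \<eta> x\<bar> \<le> \<bar>f x\<bar>" for x using \<eta>(3,4)[of x] by (simp add: abs_mult mult_left_le)
  then have "(\<lambda>x. f x * \<eta> x) \<in> L2 \<mu>"
    using L2D(2)[OF fF(2)] by (intro L2_bound[OF fF(2)]) auto
  moreover have "vanishes_at_ends (\<lambda>x. F x * \<eta> x)" using fF(3) by (simp add: vanishes_at_ends_def)
  moreover have "AE x in lborel. x \<in> B \<longrightarrow> h x * \<eta> x + F x * \<theta> x = 0" using fF(4) \<theta>B by eventually_elim auto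
  ultimately show ?A using g by (simp add: dom_rep_def)
  have d: "rep (\<lambda>x. f x - f x * \<eta> x) (\<lambda>x. F x - F x * \<eta> x) (\<lambda>x. h x - (h x * \<eta> x + F x * \<theta> x))"
    using f g by (intro rep_diff) (auto simp: dom_rep_def)
  have "1/2 * (\<integral>x. (h x - (h x * \<eta> x + F x * \<theta> x))\<^sup>2 \<partial>lborel) \<le> 1/2 * (\<integral>x. 2 * (h x * (1 - \<eta> x))\<^sup>2 + 2 * (F x * \<theta> x)\<^sup>2 \<partial>lborel)"
  proof (intro mult_left_mono integral_mono)
    show "integrable lborel (\<lambda>x. (h x - (h x * \<eta> x + F x * \<theta> x))\<^sup>2)" using d H1_onD(3) by (auto simp: rep_def)
    show "integrable lborel (\<lambda>x. 2 * (h x * (1 - \<eta> x))\<^sup>2 + 2 * (F x * \<theta> x)\<^sup>2)" using h2 F\<theta> by simp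
    show "(h x - (h x * \<eta> x + F x * \<theta> x))\<^sup>2 \<le> 2 * (h x * (1 - \<eta> x))\<^sup>2 + 2 * (F x * \<theta> x)\<^sup>2" for x
      using square_diff_le[of "h x * (1 - \<eta> x)" "F x * \<theta> x"] by (simp add: algebra_simps)
  qed simp
  also have "\<dots> = (\<integral>x. (h x * (1 - \<eta> x))\<^sup>2 \<partial>lborel) + (\<integral>x. (F x * \<theta> x)\<^sup>2 \<partial>lborel)"
    using h2 F\<theta> by simp
  finally show ?B using qd_form_bounds(2)[OF d] unfolding E1_def by (simp add: right_diff_distrib)
qed

lemma square_integral_cut_slope:
  assumes "H1_on l r F h" "c < d" "{c..d} \<subseteq> I" "\<And>x. x \<in> {c..d} \<Longrightarrow> (F x)\<^sup>2 \<le> \<epsilon> * (d - c)"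
  shows "integrable lborel (\<lambda>x. (F x * (s * indicator {c..d} x / (d - c)))\<^sup>2)"
    and "(\<integral>x. (F x * (s * indicator {c..d} x / (d - c)))\<^sup>2 \<partial>lborel) \<le> s\<^sup>2 * \<epsilon>"
proof -
  let ?u = "\<lambda>x. (F x * (s * indicator {c..d} x / (d - c)))\<^sup>2"
  let ?v = "\<lambda>x. indicator {c..d} x * (s\<^sup>2 * \<epsilon> / (d - c)) :: real"
  have m: "(\<lambda>x. F x * (s * indicator {c..d} x / (d - c))) \<in> borel_measurable borel"
    using assms(3) by (intro borel_measurable_mult_of_continuous H1_on_continuous[OF assms(1)]) (auto simp: indicator_def)
  have le: "?u x \<le> ?v x" for x
  proof (cases "x \<in> {c..d}")
    case True
    have "?u x = (F x)\<^sup>2 * (s\<^sup>2 / (d - c)\<^sup>2)" using True by (simp add: power_mult_distrib power_divide)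
    also have "\<dots> \<le> (\<epsilon> * (d - c)) * (s\<^sup>2 / (d - c)\<^sup>2)" using assms(4)[OF True] by (intro mult_right_mono) auto
    also have "\<dots> = ?v x" using True assms(2) by (simp add: power2_eq_square)
    finally show ?thesis .
  qed simp
  have v: "integrable lborel ?v"
    using integrable_real_indicator[of "{c..d}" lborel] by (intro integrable_mult_left) (auto simp: emeasure_lborel_Icc_eq)
  show u: "integrable lborel ?u"
  proof (rule Bochner_Integration.integrable_bound[OF v])
    show "?u \<in> borel_measurable lborel" using m by simp
    have "norm (?u x) \<le> norm (?v x)" for x
      unfolding real_norm_def using le[of x] by (smt (verit) zero_le_power2)
    then show "AE x in lborel. norm (?u x) \<le> norm (?v x)" by simp
  qed
  have "(\<integral>x. ?u x \<partial>lborel) \<le> (\<integral>x. ?v x \<partial>lborel)" by (intro integral_mono u v le)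
  also have "\<dots> = s\<^sup>2 * \<epsilon>" using assms(2) by simp
  finally show "(\<integral>x. ?u x \<partial>lborel) \<le> s\<^sup>2 * \<epsilon>" .
qed

text \<open>The two errors away from the slope depend only on where \<open>\<eta>\<close> differs
  from 1. The index is fixed before \<open>\<eta>\<close> because the slope interval is chosen
  beyond it afterwards. Points of \<open>I\<close> matter for Lebesgue measure, points of
  \<open>E\<close> for \<open>\<mu>\<close>.\<close>

lemma cut_integrals_small:
  fixes A :: "nat \<Rightarrow> real set"
  assumes f: "dom_rep B f F h" and A: "\<And>n. A n \<in> sets borel" and out: "\<And>x. x \<in> I \<union> E \<Longrightarrow> \<forall>\<^sub>F n in sequentially. x \<notin> A n" and "\<epsilon> > 0"
  shows "\<exists>n. \<forall>\<eta> :: real \<Rightarrow> real. \<eta> \<in> borel_measurable borel \<and> (\<forall>x. 0 \<le> \<eta> x) \<and> (\<forall>x. \<eta> x \<le> 1) \<and> (\<forall>x. x \<notin> A n \<longrightarrow> \<eta> x = 1) \<longrightarrow>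
     (\<integral>x. (h x * (1 - \<eta> x))\<^sup>2 \<partial>lborel) < \<epsilon> \<and> (\<integral>x. (f x * (1 - \<eta> x))\<^sup>2 \<partial>\<mu>) < \<epsilon>"
proof -
  have F: "H1_on l r F h" and fL: "f \<in> L2 \<mu>" using f by (auto simp: dom_rep_def rep_def)
  note H = H1_onD[OF F]
  have "(\<lambda>n. LINT x:A n \<inter> I|lborel. (h x)\<^sup>2) \<longlonglongrightarrow> 0"
  proof (rule set_integral_tendsto_0[OF H(3)])
    show "AE x in lborel. \<forall>\<^sub>F n in sequentially. x \<notin> A n \<inter> I"
    proof (intro AE_I2)
      fix x show "\<forall>\<^sub>F n in sequentially. x \<notin> A n \<inter> I"
        using out[of x] by (cases "x \<in> I") (auto elim: eventually_mono)
    qed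
  qed (use A in auto)
  then have 1: "\<forall>\<^sub>F n in sequentially. (LINT x:A n \<inter> I|lborel. (h x)\<^sup>2) < \<epsilon>" using \<open>\<epsilon> > 0\<close> by (rule order_tendstoD(2))
  have "(\<lambda>n. LINT x:A n|\<mu>. (f x)\<^sup>2) \<longlonglongrightarrow> 0"
    by (rule set_integral_tendsto_0[OF L2D(3)[OF fL]]) (use A AE_mu_E out in \<open>auto elim!: eventually_mono\<close>)
  then have 2: "\<forall>\<^sub>F n in sequentially. (LINT x:A n|\<mu>. (f x)\<^sup>2) < \<epsilon>" using \<open>\<epsilon> > 0\<close> by (rule order_tendstoD(2))
  obtain n where n: "(LINT x:A n \<inter> I|lborel. (h x)\<^sup>2) < \<epsilon>" "(LINT x:A n|\<mu>. (f x)\<^sup>2) < \<epsilon>"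
    using eventually_conj[OF 1 2] by (auto simp: eventually_sequentially)
  show ?thesis
  proof (intro exI[of _ n] allI impI)
    fix \<eta> :: "real \<Rightarrow> real"
    assume "\<eta> \<in> borel_measurable borel \<and> (\<forall>x. 0 \<le> \<eta> x) \<and> (\<forall>x. \<eta> x \<le> 1) \<and> (\<forall>x. x \<notin> A n \<longrightarrow> \<eta> x = 1)"
    then have \<eta>: "\<eta> \<in> borel_measurable borel" "\<And>x. 0 \<le> \<eta> x" "\<And>x. \<eta> x \<le> 1" "\<And>x. x \<notin> A n \<Longrightarrow> \<eta> x = 1" by auto
    have le: "(g x * (1 - \<eta> x))\<^sup>2 \<le> indicator (A n) x *\<^sub>R (g x)\<^sup>2" for g :: "real \<Rightarrow> real" and x
      using \<eta>(2,3)[of x] \<eta>(4)[of x] by (auto simp: indicator_def power_mult_distrib intro!: mult_left_le power_le_one)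
    have le': "(h x * (1 - \<eta> x))\<^sup>2 \<le> indicator (A n \<inter> I) x *\<^sub>R (h x)\<^sup>2" for x
      using le[of h x] H(2)[of x] by (auto simp: indicator_def)
    have "A n \<inter> I \<in> sets lborel" "A n \<in> sets \<mu>" using A[of n] by auto
    then have i: "integrable lborel (\<lambda>x. indicator (A n \<inter> I) x *\<^sub>R (h x)\<^sup>2)" "integrable \<mu> (\<lambda>x. indicator (A n) x *\<^sub>R (f x)\<^sup>2)"
      using integrable_mult_indicator[OF _ H(3)] integrable_mult_indicator[OF _ L2D(3)[OF fL]] by blast+
    have [measurable]: "h \<in> borel_measurable borel" "\<eta> \<in> borel_measurable borel" "f \<in> borel_measurable borel" by (rule H, rule \<eta>, rule L2D[OF fL])
    have "integrable lborel (\<lambda>x. (h x * (1 - \<eta> x))\<^sup>2)"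
      by (rule Bochner_Integration.integrable_bound[OF i(1)]) (use le' in \<open>auto intro!: AE_I2 order_trans[OF le' abs_ge_self]\<close>)
    then have "(\<integral>x. (h x * (1 - \<eta> x))\<^sup>2 \<partial>lborel) \<le> (LINT x:A n \<inter> I|lborel. (h x)\<^sup>2)"
      unfolding set_lebesgue_integral_def by (rule integral_mono[OF _ i(1) le'])
    then have 1: "(\<integral>x. (h x * (1 - \<eta> x))\<^sup>2 \<partial>lborel) < \<epsilon>" using n(1) by simp
    have "(\<lambda>x. (f x * (1 - \<eta> x))\<^sup>2) \<in> borel_measurable \<mu>" by (simp cong: measurable_cong_sets)
    then have "integrable \<mu> (\<lambda>x. (f x * (1 - \<eta> x))\<^sup>2)"
      by (rule Bochner_Integration.integrable_bound[OF i(2)]) (use le[of f] in auto)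
    then have "(\<integral>x. (f x * (1 - \<eta> x))\<^sup>2 \<partial>\<mu>) \<le> (LINT x:A n|\<mu>. (f x)\<^sup>2)"
      unfolding set_lebesgue_integral_def by (rule integral_mono[OF _ i(2) le[of f]])
    then show "(\<integral>x. (h x * (1 - \<eta> x))\<^sup>2 \<partial>lborel) < \<epsilon> \<and> (\<integral>x. (f x * (1 - \<eta> x))\<^sup>2 \<partial>\<mu>) < \<epsilon>"
      using 1 n(2) by simp
  qed
qed

text \<open>\<open>lo c\<close> and \<open>hi d\<close> say that \<open>[c, d]\<close> avoids the endpoints missing from \<open>E\<close>,
  which makes \<open>E \<inter> [c, d]\<close> compact.\<close>

definition lo :: "real \<Rightarrow> bool" where "lo c \<longleftrightarrow> (\<forall>x\<ge>c. ereal x = l \<longrightarrow> x \<in> E)"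
definition hi :: "real \<Rightarrow> bool" where "hi d \<longleftrightarrow> (\<forall>x\<le>d. ereal x = r \<longrightarrow> x \<in> E)"

lemma lo_of_less: "l < ereal c \<Longrightarrow> lo c"
  and hi_of_less: "ereal d < r \<Longrightarrow> hi d"
  unfolding lo_def hi_def by (metis ereal_less_eq(3) not_less)+

lemma lo_attained: "a \<in> E \<Longrightarrow> ereal a = l \<Longrightarrow> lo c"
  and hi_attained: "b \<in> E \<Longrightarrow> ereal b = r \<Longrightarrow> hi d"
  unfolding lo_def hi_def by (metis ereal.inject)+

lemma compact_E_lo_hi: "lo c \<Longrightarrow> hi d \<Longrightarrow> compact (E \<inter> {c..d})"
  by (rule compact_E_Icc) (auto simp: lo_def hi_def)

lemma sub_dom0: "f \<in> dom B \<Longrightarrow> f \<in> dom {}"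
  using dom_mono[of "{}" B] by auto

lemma E1_AE_cong:
  assumes "f \<in> dom {}" "g \<in> dom {}" "AE x in \<mu>. f x = g x"
  shows "energy f = energy g"
proof -
  have "qd_form E \<mu> f f = qd_form E \<mu> g f" by (rule qd_form_AE_cong[OF assms(1,2,1,3)])
  also have "\<dots> = qd_form E \<mu> f g" by (rule qd_form_sym[OF assms(2,1)])
  also have "\<dots> = qd_form E \<mu> g g" by (rule qd_form_AE_cong[OF assms(1,2,2,3)])
  finally have 1: "qd_form E \<mu> f f = qd_form E \<mu> g g" .
  have "(\<integral>x. (f x)\<^sup>2 \<partial>\<mu>) = (\<integral>x. (g x)\<^sup>2 \<partial>\<mu>)"
    by (rule integral_cong_AE)
      (use L2D(1)[OF dom_L2[OF assms(1)]] L2D(1)[OF dom_L2[OF assms(2)]] assms(3) in \<open>auto elim!: eventually_mono\<close>)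
  with 1 show ?thesis by (simp add: E1_def)
qed

lemma E1_swap:
  assumes "f \<in> dom {}" "g \<in> dom {}"
  shows "energy (\<lambda>x. f x - g x) = energy (\<lambda>x. g x - f x)"
proof -
  have d: "(\<lambda>x. g x - f x) \<in> dom {}" by (rule dom_diff[OF assms(2,1)])
  have eq: "(\<lambda>x. f x - g x) = (\<lambda>x. - 1 * (g x - f x))" by auto
  have "qd_form E \<mu> (\<lambda>x. - 1 * (g x - f x)) (\<lambda>x. - 1 * (g x - f x)) = - 1 * qd_form E \<mu> (\<lambda>x. g x - f x) (\<lambda>x. - 1 * (g x - f x))"
    by (rule qd_form_cmult[OF d dom_cmult[OF d]])
  also have "\<dots> = - 1 * qd_form E \<mu> (\<lambda>x. - 1 * (g x - f x)) (\<lambda>x. g x - f x)"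
    by (simp only: qd_form_sym[OF d dom_cmult[OF d]])
  also have "\<dots> = qd_form E \<mu> (\<lambda>x. g x - f x) (\<lambda>x. g x - f x)"
    by (subst qd_form_cmult[OF d d]) simp
  finally have "qd_form E \<mu> (\<lambda>x. f x - g x) (\<lambda>x. f x - g x) = qd_form E \<mu> (\<lambda>x. g x - f x) (\<lambda>x. g x - f x)"
    unfolding eq .
  moreover have "(\<integral>x. (f x - g x)\<^sup>2 \<partial>\<mu>) = (\<integral>x. (g x - f x)\<^sup>2 \<partial>\<mu>)" by (simp add: power2_commute)
  ultimately show ?thesis unfolding E1_def by (rule arg_cong2)
qed

text \<open>An end that belongs to \<open>E\<close> needs no cutting. Otherwise the slope lies to
  the right of \<open>\<beta>\<close>, hence off \<open>B\<close>. Zeros of \<open>F\<close> are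
  recorded as preserved, and the mirrored clause in \<open>left_cut\<close> lets the second cut keep
  the effect of the first.\<close>

lemma right_cut:
  assumes f: "dom_rep B f F h" and B: "B \<subseteq> {\<alpha>..\<beta>}" "l < ereal \<beta>" "ereal \<beta> < r" and "\<epsilon> > 0"
  shows "\<exists>g G k d. dom_rep B g G k \<and> hi d \<and> (\<forall>x\<in>E. d < x \<longrightarrow> G x = 0) \<and> (\<forall>x. F x = 0 \<longrightarrow> G x = 0) \<and>
    energy (\<lambda>x. f x - g x) < \<epsilon>"
proof (cases "\<exists>b\<in>E. ereal b = r")
  case True
  then obtain b where b: "b \<in> E" "ereal b = r" by blast
  have "hi b" by (rule hi_attained[OF b])
  moreover have "\<forall>x\<in>E. b < x \<longrightarrow> F x = 0" using E_bounds(2) by (force simp flip: b(2))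
  moreover have "energy (\<lambda>x. f x - f x) < \<epsilon>"
    using \<open>\<epsilon> > 0\<close> qd_form_cmult[OF zero_in_dom zero_in_dom, of 0] by (simp add: E1_def)
  ultimately show ?thesis using f by blast
next
  case False
  have F: "H1_on l r F h" using f by (auto simp: dom_rep_def rep_def)
  obtain X where X: "incseq X" "\<And>i. ereal \<beta> < ereal (X i)" "\<And>i. ereal (X i) < r" "(\<lambda>i. ereal (X i)) \<longlonglongrightarrow> r"
    using ereal_incseq_approx[OF B(3)] by metis
  have out: "\<forall>\<^sub>F n in sequentially. x \<notin> {X n<..}" if "x \<in> I \<union> E" for x
  proof -
    have "ereal x < r" using that False E_bounds(2)[of x] by (auto simp: open_lr_def order_less_le)
    then have "\<forall>\<^sub>F n in sequentially. ereal x < ereal (X n)" using X(4) by (rule order_tendstoD(1)[rotated])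
    then show ?thesis by eventually_elim auto
  qed
  have e4: "\<epsilon> / 4 > 0" using \<open>\<epsilon> > 0\<close> by simp
  obtain n where n: "\<forall>\<eta> :: real \<Rightarrow> real. \<eta> \<in> borel_measurable borel \<and> (\<forall>x. 0 \<le> \<eta> x) \<and> (\<forall>x. \<eta> x \<le> 1) \<and> (\<forall>x. x \<notin> {X n<..} \<longrightarrow> \<eta> x = 1) \<longrightarrow>
     (\<integral>x. (h x * (1 - \<eta> x))\<^sup>2 \<partial>lborel) < \<epsilon> / 4 \<and> (\<integral>x. (f x * (1 - \<eta> x))\<^sup>2 \<partial>\<mu>) < \<epsilon> / 4"
    using cut_integrals_small[OF f _ out e4] by auto
  have Xl: "l < ereal (X n)" using B(2) X(2)[of n] by (rule less_trans)
  have "F b = 0" if "r = ereal b" for b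
    using f False that unfolding dom_rep_def vanishes_at_ends_def by metis
  then obtain c d where cd: "X n < c" "c < d" "ereal d < r" "\<forall>x\<in>{c..d}. (F x)\<^sup>2 \<le> \<epsilon> / 4 * (d - c)"
    using exists_right_cut_interval[OF F _ e4 Xl X(3)] by blast
  have sub: "{c..d} \<subseteq> I"
    using cd Xl by (auto simp: open_lr_def intro: less_trans[of l "ereal (X n)"] le_less_trans[of _ "ereal d" r])
  define \<eta> where "\<eta> x = (d - max c (min d x)) / (d - c)" for x
  define \<theta> where "\<theta> x = - 1 * indicator {c..d} x / (d - c)" for x :: real
  have \<eta>: "H1_on l r \<eta> \<theta>"
    using H1_on_add[OF H1_on_const[of l r "d / (d - c)"] H1_on_cmult[OF H1_on_clip[OF less_imp_le[OF cd(2)] sub], of "- 1 / (d - c)"]]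
    by (simp add: \<eta>_def[abs_def] \<theta>_def[abs_def] diff_divide_distrib)
  have \<eta>': "\<eta> \<in> borel_measurable borel" "\<And>x. 0 \<le> \<eta> x" "\<And>x. \<eta> x \<le> 1" "\<And>x. x \<le> c \<Longrightarrow> \<eta> x = 1" "\<And>x. d \<le> x \<Longrightarrow> \<eta> x = 0"
    using cd(2) by (auto simp: \<eta>_def[abs_def] min_def max_def)
  have \<theta>B: "AE x in lborel. x \<in> B \<longrightarrow> \<theta> x = 0"
    using B(1) X(2)[of n] cd(1) by (intro AE_I2) (auto simp: \<theta>_def indicator_def)
  note slope = square_integral_cut_slope[OF F cd(2) sub, of "\<epsilon> / 4" "- 1"]
  have s1: "integrable lborel (\<lambda>x. (F x * \<theta> x)\<^sup>2)" and s2: "(\<integral>x. (F x * \<theta> x)\<^sup>2 \<partial>lborel) \<le> \<epsilon> / 4"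
    using slope cd(4) unfolding \<theta>_def by auto
  note cut = dom_rep_cut[OF f \<eta> \<eta>'(1-3) \<theta>B s1]
  have small: "(\<integral>x. (h x * (1 - \<eta> x))\<^sup>2 \<partial>lborel) < \<epsilon> / 4 \<and> (\<integral>x. (f x * (1 - \<eta> x))\<^sup>2 \<partial>\<mu>) < \<epsilon> / 4"
    by (rule n[rule_format]) (use \<eta>' cd(1) in auto)
  have "hi d" by (rule hi_of_less[OF cd(3)])
  moreover have "energy (\<lambda>x. f x - f x * \<eta> x) < \<epsilon>"
    using cut(2) small s2 \<open>\<epsilon> > 0\<close> by linarith
  ultimately show ?thesis using cut(1) \<eta>'(5)
    by (intro exI[of _ "\<lambda>x. f x * \<eta> x"] exI[of _ "\<lambda>x. F x * \<eta> x"] exI[of _ "\<lambda>x. h x * \<eta> x + F x * \<theta> x"] exI[of _ d]) auto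
qed

lemma left_cut:
  assumes f: "dom_rep B f F h" and B: "B \<subseteq> {\<alpha>..\<beta>}" "l < ereal \<alpha>" "ereal \<alpha> < r" and "\<epsilon> > 0"
  shows "\<exists>g G k c. dom_rep B g G k \<and> lo c \<and> (\<forall>x\<in>E. x < c \<longrightarrow> G x = 0) \<and> (\<forall>x. F x = 0 \<longrightarrow> G x = 0) \<and>
    energy (\<lambda>x. f x - g x) < \<epsilon>"
proof (cases "\<exists>a\<in>E. ereal a = l")
  case True
  then obtain a where a: "a \<in> E" "ereal a = l" by blast
  have "lo a" by (rule lo_attained[OF a])
  moreover have "\<forall>x\<in>E. x < a \<longrightarrow> F x = 0" using E_bounds(1) by (force simp flip: a(2))
  moreover have "energy (\<lambda>x. f x - f x) < \<epsilon>"
    using \<open>\<epsilon> > 0\<close> qd_form_cmult[OF zero_in_dom zero_in_dom, of 0] by (simp add: E1_def)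
  ultimately show ?thesis using f by blast
next
  case False
  have F: "H1_on l r F h" using f by (auto simp: dom_rep_def rep_def)
  obtain X where X: "decseq X" "\<And>i. l < ereal (X i)" "\<And>i. ereal (X i) < ereal \<alpha>" "(\<lambda>i. ereal (X i)) \<longlonglongrightarrow> l"
    using ereal_decseq_approx[OF B(2)] by metis
  have out: "\<forall>\<^sub>F n in sequentially. x \<notin> {..<X n}" if "x \<in> I \<union> E" for x
  proof -
    have "l < ereal x" using that False E_bounds(1)[of x] by (auto simp: open_lr_def order_less_le)
    then have "\<forall>\<^sub>F n in sequentially. ereal (X n) < ereal x" using X(4) by (rule order_tendstoD(2)[rotated])
    then show ?thesis by eventually_elim auto
  qed
  have e4: "\<epsilon> / 4 > 0" using \<open>\<epsilon> > 0\<close> by simp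
  obtain n where n: "\<forall>\<eta> :: real \<Rightarrow> real. \<eta> \<in> borel_measurable borel \<and> (\<forall>x. 0 \<le> \<eta> x) \<and> (\<forall>x. \<eta> x \<le> 1) \<and> (\<forall>x. x \<notin> {..<X n} \<longrightarrow> \<eta> x = 1) \<longrightarrow>
     (\<integral>x. (h x * (1 - \<eta> x))\<^sup>2 \<partial>lborel) < \<epsilon> / 4 \<and> (\<integral>x. (f x * (1 - \<eta> x))\<^sup>2 \<partial>\<mu>) < \<epsilon> / 4"
    using cut_integrals_small[OF f _ out e4] by auto
  have Xr: "ereal (X n) < r" using X(3)[of n] B(3) by (rule less_trans)
  have "F a = 0" if "l = ereal a" for a
    using f False that unfolding dom_rep_def vanishes_at_ends_def by metis
  then obtain c d where cd: "d < X n" "c < d" "l < ereal c" "\<forall>x\<in>{c..d}. (F x)\<^sup>2 \<le> \<epsilon> / 4 * (d - c)"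
    using exists_left_cut_interval[OF F _ e4 X(2) Xr] by blast
  have sub: "{c..d} \<subseteq> I"
    using cd Xr by (auto simp: open_lr_def intro: less_trans[of _ "ereal (X n)" r] less_le_trans[of l "ereal c"])
  define \<eta> where "\<eta> x = (max c (min d x) - c) / (d - c)" for x
  define \<theta> where "\<theta> x = 1 * indicator {c..d} x / (d - c)" for x :: real
  have \<eta>: "H1_on l r \<eta> \<theta>"
    using H1_on_add[OF H1_on_const[of l r "- c / (d - c)"] H1_on_cmult[OF H1_on_clip[OF less_imp_le[OF cd(2)] sub], of "1 / (d - c)"]]
    by (simp add: \<eta>_def[abs_def] \<theta>_def[abs_def] diff_divide_distrib)
  have \<eta>': "\<eta> \<in> borel_measurable borel" "\<And>x. 0 \<le> \<eta> x" "\<And>x. \<eta> x \<le> 1" "\<And>x. d \<le> x \<Longrightarrow> \<eta> x = 1" "\<And>x. x \<le> c \<Longrightarrow> \<eta> x = 0"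
    using cd(2) by (auto simp: \<eta>_def[abs_def] min_def max_def)
  have \<theta>B: "AE x in lborel. x \<in> B \<longrightarrow> \<theta> x = 0"
    using B(1) X(3)[of n] cd(1) by (intro AE_I2) (auto simp: \<theta>_def indicator_def)
  note slope = square_integral_cut_slope[OF F cd(2) sub, of "\<epsilon> / 4" 1]
  have s1: "integrable lborel (\<lambda>x. (F x * \<theta> x)\<^sup>2)" and s2: "(\<integral>x. (F x * \<theta> x)\<^sup>2 \<partial>lborel) \<le> \<epsilon> / 4"
    using slope cd(4) unfolding \<theta>_def by auto
  note cut = dom_rep_cut[OF f \<eta> \<eta>'(1-3) \<theta>B s1]
  have small: "(\<integral>x. (h x * (1 - \<eta> x))\<^sup>2 \<partial>lborel) < \<epsilon> / 4 \<and> (\<integral>x. (f x * (1 - \<eta> x))\<^sup>2 \<partial>\<mu>) < \<epsilon> / 4"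
    by (rule n[rule_format]) (use \<eta>' cd(1) in auto)
  have "lo c" by (rule lo_of_less[OF cd(3)])
  moreover have "energy (\<lambda>x. f x - f x * \<eta> x) < \<epsilon>"
    using cut(2) small s2 \<open>\<epsilon> > 0\<close> by linarith
  ultimately show ?thesis using cut(1) \<eta>'(5)
    by (intro exI[of _ "\<lambda>x. f x * \<eta> x"] exI[of _ "\<lambda>x. F x * \<eta> x"] exI[of _ "\<lambda>x. h x * \<eta> x + F x * \<theta> x"] exI[of _ c]) auto
qed

lemma indicator_J_measurable:
  assumes "continuous_on J F"
  shows "(\<lambda>x. indicator J x * F x :: real) \<in> borel_measurable borel"
  using borel_measurable_continuous_on_indicator[OF J_borel assms] by (simp only: real_scaleR_def)

text \<open>Nothing is known about \<open>F\<close> outside \<open>J\<close>, not even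
  measurability. Setting it to 0 there gives a Borel function that is continuous on \<open>E\<close>
  and still represents \<open>f\<close>.\<close>

lemma dom_rep_indicator_J:
  assumes "dom_rep B f F h"
  shows "dom_rep B (\<lambda>x. indicator J x * F x) F h" and "AE x in \<mu>. f x = indicator J x * F x"
proof -
  have "AE x in \<mu>. f x = F x" "H1_on l r F h" "f \<in> L2 \<mu>" using assms by (auto simp: dom_rep_def rep_def)
  show 1: "AE x in \<mu>. f x = indicator J x * F x"
    using \<open>AE x in \<mu>. f x = F x\<close> AE_mu_E by eventually_elim (use E_bounds in auto)
  have m: "(\<lambda>x. indicator J x * F x) \<in> borel_measurable \<mu>"
    using indicator_J_measurable[OF H1_on_continuous[OF \<open>H1_on l r F h\<close>]] by (simp cong: measurable_cong_sets)
  have "integrable \<mu> (\<lambda>x. (indicator J x * F x)\<^sup>2)"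
    by (rule integrable_cong_AE_imp[OF L2D(3)[OF \<open>f \<in> L2 \<mu>\<close>]]) (use m 1 in \<open>auto elim!: eventually_mono\<close>)
  then have "(\<lambda>x. indicator J x * F x) \<in> L2 \<mu>" using m by (simp add: L2_def)
  moreover have "AE x in \<mu>. indicator J x * F x = F x"
    using AE_mu_E by eventually_elim (use E_bounds in auto)
  ultimately show "dom_rep B (\<lambda>x. indicator J x * F x) F h" using assms by (simp add: dom_rep_def rep_def)
qed

text \<open>Two cuts with error \<open>\<epsilon> / 4\<close> each, joined by the inequality with
  factors 2. Taking \<open>B\<close> empty and \<open>\<alpha> = \<beta>\<close> covers the full
  domain.\<close>

theorem dom_core_dense:
  assumes f: "f \<in> dom B" and B: "B \<subseteq> {\<alpha>..\<beta>}" "\<alpha> \<le> \<beta>" "l < ereal \<alpha>" "ereal \<beta> < r" and "\<epsilon> > 0"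
  shows "\<exists>g\<in>dom B. \<exists>c d. lo c \<and> hi d \<and> continuous_on E g \<and> (\<forall>x\<in>E - {c..d}. g x = 0) \<and> energy (\<lambda>x. f x - g x) < \<epsilon>"
proof -
  have \<alpha>\<beta>: "l < ereal \<beta>" "ereal \<alpha> < r"
    using less_le_trans[OF B(3), of "ereal \<beta>"] le_less_trans[OF _ B(4), of "ereal \<alpha>"] B(2) by auto
  have e4: "\<epsilon> / 4 > 0" using \<open>\<epsilon> > 0\<close> by simp
  obtain F h where F: "dom_rep B f F h" using f dom_iff_rep by blast
  obtain g1 G1 k1 d where 1: "dom_rep B g1 G1 k1" "hi d" "\<forall>x\<in>E. d < x \<longrightarrow> G1 x = 0"
    "energy (\<lambda>x. f x - g1 x) < \<epsilon> / 4"
    using right_cut[OF F B(1) \<alpha>\<beta>(1) B(4) e4] by blast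
  obtain g2 G2 k2 c where 2: "dom_rep B g2 G2 k2" "lo c" "\<forall>x\<in>E. x < c \<longrightarrow> G2 x = 0" "\<forall>x. G1 x = 0 \<longrightarrow> G2 x = 0"
    "energy (\<lambda>x. g1 x - g2 x) < \<epsilon> / 4"
    using left_cut[OF 1(1) B(1,3) \<alpha>\<beta>(2) e4] by blast
  \<comment> \<open>The cut function is known only up to \<open>\<mu>\<close>-null sets; this
    version is continuous on \<open>E\<close> and vanishes there off [c, d].\<close>
  define g where "g x = indicator J x * G2 x" for x
  have g: "dom_rep B g G2 k2" "AE x in \<mu>. g2 x = g x" using dom_rep_indicator_J[OF 2(1)] by (simp_all add: g_def[abs_def])
  have D: "f \<in> dom {}" "g1 \<in> dom {}" "g2 \<in> dom {}" "g \<in> dom {}" "g \<in> dom B"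
    using f 1(1) 2(1) g(1) dom_iff_rep sub_dom0 by blast+
  have "energy (\<lambda>x. f x - g2 x) \<le> 2 * energy (\<lambda>x. f x - g1 x) + 2 * energy (\<lambda>x. g2 x - g1 x)"
    by (rule E1_diff_le[OF D(1,3,2)])
  also have "energy (\<lambda>x. g2 x - g1 x) = energy (\<lambda>x. g1 x - g2 x)" by (rule E1_swap[OF D(3,2)])
  finally have "energy (\<lambda>x. f x - g2 x) < \<epsilon>" using 1(4) 2(5) by linarith
  moreover have "energy (\<lambda>x. f x - g2 x) = energy (\<lambda>x. f x - g x)"
    by (rule E1_AE_cong[OF dom_diff[OF D(1,3)] dom_diff[OF D(1,4)]]) (use g(2) in \<open>auto elim!: eventually_mono\<close>)
  moreover have "continuous_on E g"
  proof -
    have "continuous_on E G2"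
      using 2(1) by (intro continuous_on_subset[OF H1_on_continuous[of l r G2 k2] E_subset_J]) (auto simp: dom_rep_def rep_def)
    then show ?thesis by (rule continuous_on_eq) (use E_bounds in \<open>auto simp: g_def\<close>)
  qed
  moreover have "g x = 0" if "x \<in> E - {c..d}" for x
    using that 1(3) 2(3,4) by (cases "x < c") (auto simp: g_def)
  ultimately show ?thesis using D(5) 2(2) 1(2)
    by (intro bexI[of _ g] exI[of _ c] exI[of _ d] conjI ballI) simp_all
qed

section \<open>Uniform density in the compactly supported continuous functions\<close>

text \<open>Boundedness makes the product-rule derivative square integrable. Neither end conditions
  nor membership in \<open>L2 \<mu>\<close> are imposed, so that constants belong and
  Stone-Weierstrass applies.\<close>

definition bounded_algebra :: "real set \<Rightarrow> (real \<Rightarrow> real) set" where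
  "bounded_algebra B = {F. (\<exists>M. \<forall>x\<in>J. \<bar>F x\<bar> \<le> M) \<and> (\<exists>h. H1_on l r F h \<and> (AE x in lborel. x \<in> B \<longrightarrow> h x = 0))}"

lemma bounded_algebra_const: "(\<lambda>x. c) \<in> bounded_algebra B"
  unfolding bounded_algebra_def using H1_on_const[of l r c] by auto

lemma bounded_algebra_add:
  assumes "F \<in> bounded_algebra B" "G \<in> bounded_algebra B"
  shows "(\<lambda>x. F x + G x) \<in> bounded_algebra B"
proof -
  obtain M h where F: "\<forall>x\<in>J. \<bar>F x\<bar> \<le> M" "H1_on l r F h" "AE x in lborel. x \<in> B \<longrightarrow> h x = 0"
    using assms(1) unfolding bounded_algebra_def by blast
  obtain N k where G: "\<forall>x\<in>J. \<bar>G x\<bar> \<le> N" "H1_on l r G k" "AE x in lborel. x \<in> B \<longrightarrow> k x = 0"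
    using assms(2) unfolding bounded_algebra_def by blast
  have "\<forall>x\<in>J. \<bar>F x + G x\<bar> \<le> M + N"
  proof
    fix x assume "x \<in> J"
    then show "\<bar>F x + G x\<bar> \<le> M + N" using bspec[OF F(1)] bspec[OF G(1)] abs_triangle_ineq[of "F x" "G x"] by fastforce
  qed
  moreover have "AE x in lborel. x \<in> B \<longrightarrow> h x + k x = 0" using F(3) G(3) by eventually_elim auto
  ultimately show ?thesis using H1_on_add[OF F(2) G(2)] unfolding bounded_algebra_def by blast
qed

lemma bounded_algebra_mult:
  assumes "F \<in> bounded_algebra B" "G \<in> bounded_algebra B"
  shows "(\<lambda>x. F x * G x) \<in> bounded_algebra B"
proof -
  obtain M h where F: "\<forall>x\<in>J. \<bar>F x\<bar> \<le> M" "H1_on l r F h" "AE x in lborel. x \<in> B \<longrightarrow> h x = 0"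
    using assms(1) unfolding bounded_algebra_def by blast
  obtain N k where G: "\<forall>x\<in>J. \<bar>G x\<bar> \<le> N" "H1_on l r G k" "AE x in lborel. x \<in> B \<longrightarrow> k x = 0"
    using assms(2) unfolding bounded_algebra_def by blast
  have sq: "(\<lambda>x. P x * q x) \<in> borel_measurable borel" "integrable lborel (\<lambda>x. (P x * q x)\<^sup>2)"
    if P: "H1_on l r P p" "\<forall>x\<in>J. \<bar>P x\<bar> \<le> C" and Q: "H1_on l r Q q" for P p Q q C
  proof -
    note q = H1_onD[OF Q]
    show m: "(\<lambda>x. P x * q x) \<in> borel_measurable borel"
      by (rule borel_measurable_mult_of_continuous[OF H1_on_continuous[OF P(1)] q(1,2)])
    have "(P x * q x)\<^sup>2 \<le> C\<^sup>2 * (q x)\<^sup>2" for x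
    proof (cases "x \<in> I")
      case True
      then have "x \<in> J" by (auto simp: open_lr_def less_imp_le)
      then have "\<bar>P x\<bar> \<le> C" using P(2) by blast
      then have "(P x)\<^sup>2 \<le> C\<^sup>2" by (metis abs_ge_zero power2_abs power_mono)
      then show ?thesis by (simp add: power_mult_distrib mult_right_mono)
    next
      case False
      then show ?thesis using q(2) by simp
    qed
    then have le: "AE x in lborel. norm ((P x * q x)\<^sup>2) \<le> norm (C\<^sup>2 * (q x)\<^sup>2)" by (intro AE_I2) simp
    show "integrable lborel (\<lambda>x. (P x * q x)\<^sup>2)"
    proof (rule Bochner_Integration.integrable_bound[OF _ _ le])
      show "integrable lborel (\<lambda>x. C\<^sup>2 * (q x)\<^sup>2)" using q(3) by (rule integrable_mult_right)
      show "(\<lambda>x. (P x * q x)\<^sup>2) \<in> borel_measurable lborel" using borel_measurable_power[OF m, of 2] by simp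
    qed
  qed
  have "integrable lborel (\<lambda>x. (h x * G x + F x * k x)\<^sup>2)"
    using sq[OF G(2,1) F(2)] sq[OF F(2,1) G(2)] by (intro integrable_square_add) (auto simp: mult.commute)
  then have P: "H1_on l r (\<lambda>x. F x * G x) (\<lambda>x. h x * G x + F x * k x)" by (rule H1_on_mult[OF F(2) G(2) l_less_r])
  have "\<forall>x\<in>J. \<bar>F x * G x\<bar> \<le> M * N"
  proof
    fix x assume x: "x \<in> J"
    then show "\<bar>F x * G x\<bar> \<le> M * N"
      unfolding abs_mult using bspec[OF F(1) x] bspec[OF G(1) x] by (intro mult_mono) auto
  qed
  moreover have "AE x in lborel. x \<in> B \<longrightarrow> h x * G x + F x * k x = 0" using F(3) G(3) by eventually_elim auto
  ultimately show ?thesis using P unfolding bounded_algebra_def by blast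
qed

lemma bounded_algebra_contraction:
  assumes "F \<in> bounded_algebra B"
  shows "(\<lambda>x. min 1 (max 0 (F x))) \<in> bounded_algebra B"
proof -
  obtain h where F: "H1_on l r F h" "AE x in lborel. x \<in> B \<longrightarrow> h x = 0"
    using assms unfolding bounded_algebra_def by blast
  have "\<forall>x\<in>J. \<bar>min 1 (max 0 (F x))\<bar> \<le> 1" by auto
  moreover have "AE x in lborel. x \<in> B \<longrightarrow> (if x \<in> I \<and> 0 < F x \<and> F x < 1 then h x else 0) = 0"
    using F(2) by eventually_elim auto
  ultimately show ?thesis using H1_on_contraction[OF F(1) l_less_r] unfolding bounded_algebra_def by blast
qed

lemma bounded_algebra_affine:
  assumes "F \<in> bounded_algebra B"
  shows "(\<lambda>x. a + b * F x) \<in> bounded_algebra B"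
  by (intro bounded_algebra_add bounded_algebra_mult bounded_algebra_const assms)

lemma bounded_algebra_continuous: "F \<in> bounded_algebra B \<Longrightarrow> continuous_on J F"
  unfolding bounded_algebra_def using H1_on_continuous by blast

text \<open>The primitive of the indicator of [c, d] minus \<open>B\<close> inside (l, r). Its
  increments are the measures of what \<open>B\<close> leaves over, positive on every interval
  within [c, d], and its total variation is at most \<open>d - c\<close>.\<close>

lemma exists_scale:
  assumes B: "B \<in> sets borel" and thick: "\<And>x y. x < y \<Longrightarrow> emeasure lborel ({x<..<y} - B) > 0" and "c \<le> d"
  obtains s where "s \<in> bounded_algebra B" "\<And>x y. x \<in> J \<Longrightarrow> y \<in> J \<Longrightarrow> x \<le> y \<Longrightarrow> s x \<le> s y"
    "\<And>x y. x \<in> J \<Longrightarrow> y \<in> J \<Longrightarrow> c \<le> x \<Longrightarrow> x < y \<Longrightarrow> y \<le> d \<Longrightarrow> s x < s y"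
proof -
  define A where "A = {c..d} \<inter> I - B"
  have A[measurable]: "A \<in> sets borel" using B by (simp add: A_def)
  have fin: "emeasure lborel A < \<infinity>"
    by (rule le_less_trans[OF emeasure_mono[of A "{c..d}"]]) (auto simp: A_def emeasure_lborel_Icc_eq)
  let ?h = "indicator A :: real \<Rightarrow> real"
  have sq: "(\<lambda>x. (?h x)\<^sup>2) = ?h" by (auto simp: indicator_def)
  have h: "?h \<in> borel_measurable borel" "\<And>x. x \<notin> I \<Longrightarrow> ?h x = 0" "integrable lborel (\<lambda>x. (?h x)\<^sup>2)"
    unfolding sq using A fin by (simp_all add: borel_measurable_indicator integrable_real_indicator) (simp add: A_def)
  obtain e where e: "e \<in> E" using E_nonempty by blast
  define s where "s x = 0 + primitive e ?h x" for x
  have s: "H1_on l r s ?h" unfolding s_def[abs_def] by (rule H1_on_primitive[OF h])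
  have inc: "s y - s x = measure lborel ({x..y} \<inter> A)" if "x \<in> J" "y \<in> J" "x \<le> y" for x y
  proof -
    have "s y - s x = (LINT t:{x..y}|lborel. ?h t)" using H1_onD(4)[OF s, of x y] that by auto
    also have "\<dots> = (\<integral>t. indicator ({x..y} \<inter> A) t \<partial>lborel)"
      unfolding set_lebesgue_integral_def by (simp add: indicator_inter_arith)
    finally show ?thesis by simp
  qed
  show ?thesis
  proof (rule that[of s])
    have "\<bar>s x\<bar> \<le> measure lborel A" if "x \<in> J" for x
    proof -
      have eJ: "e \<in> J" using e E_subset_J by blast
      have "s e = 0" by (simp add: s_def)
      moreover have le: "measure lborel (S \<inter> A) \<le> measure lborel A" if "S \<in> sets borel" for S
        using fin that by (intro measure_mono_fmeasurable) (auto simp: fmeasurable_def)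
      moreover have "measure lborel ({e..x} \<inter> A) \<le> measure lborel A" "measure lborel ({x..e} \<inter> A) \<le> measure lborel A"
        by (auto intro: le)
      moreover have "0 \<le> measure lborel ({e..x} \<inter> A)" "0 \<le> measure lborel ({x..e} \<inter> A)" by simp_all
      moreover have "e \<le> x \<or> x \<le> e" by auto
      ultimately show ?thesis using inc[OF eJ \<open>x \<in> J\<close>] inc[OF \<open>x \<in> J\<close> eJ] by linarith
    qed
    moreover have "AE x in lborel. x \<in> B \<longrightarrow> ?h x = 0" by (simp add: A_def)
    ultimately show "s \<in> bounded_algebra B" using s unfolding bounded_algebra_def by blast
    show "s x \<le> s y" if "x \<in> J" "y \<in> J" "x \<le> y" for x y using inc[OF that] measure_nonneg[of lborel "{x..y} \<inter> A"] by linarith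
    show "s x < s y" if xy: "x \<in> J" "y \<in> J" "c \<le> x" "x < y" "y \<le> d" for x y
    proof -
      have "{x<..<y} - B \<subseteq> {x..y} \<inter> A"
        using xy by (auto simp: A_def open_lr_def intro: le_less_trans[of l "ereal x"] less_le_trans[of _ "ereal y" r])
      then have "emeasure lborel ({x<..<y} - B) \<le> emeasure lborel ({x..y} \<inter> A)" by (intro emeasure_mono) auto
      then have "emeasure lborel ({x..y} \<inter> A) > 0" using thick[OF xy(4)] by (rule less_le_trans[rotated])
      moreover have "emeasure lborel ({x..y} \<inter> A) < \<infinity>"
        by (rule le_less_trans[OF emeasure_mono[of _ A] fin]) auto
      ultimately have "measure lborel ({x..y} \<inter> A) > 0" unfolding measure_def by (simp add: enn2real_positive_iff)
      then show ?thesis using inc[OF xy(1,2)] xy(4) by simp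
    qed
  qed
qed

lemma L2_of_bounded_support:
  assumes g: "g \<in> borel_measurable borel" and K: "compact K" "K \<subseteq> E" and "\<And>x. x \<in> E \<Longrightarrow> \<bar>g x\<bar> \<le> M * indicator K x"
  shows "g \<in> L2 \<mu>"
proof -
  have [measurable]: "g \<in> borel_measurable \<mu>" using g by (simp cong: measurable_cong_sets)
  have "K \<in> sets \<mu>" using K by (simp add: borel_compact)
  moreover have "emeasure \<mu> K < \<infinity>" using radon K by (simp add: radon_on_def)
  ultimately have i: "integrable \<mu> (\<lambda>x. M\<^sup>2 * indicator K x)" by (intro integrable_mult_right integrable_real_indicator) auto
  have "integrable \<mu> (\<lambda>x. (g x)\<^sup>2)"
  proof (rule Bochner_Integration.integrable_bound[OF i])
    show "AE x in \<mu>. norm ((g x)\<^sup>2) \<le> norm (M\<^sup>2 * indicat_real K x)"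
      using AE_mu_E
    proof eventually_elim
      case (elim x)
      then have "\<bar>g x\<bar> \<le> M * indicator K x" by (rule assms(4))
      then have "(g x)\<^sup>2 \<le> (M * indicator K x)\<^sup>2" by (metis abs_ge_zero power2_abs power_mono)
      then show ?case by (auto simp: indicator_def split: if_splits)
    qed
  qed simp
  then show ?thesis by (simp add: L2_def)
qed

lemma dom_of_bounded_algebra:
  assumes G: "G \<in> bounded_algebra B" and cd: "lo c" "hi d"
    and zero: "\<And>x. x \<in> J \<Longrightarrow> x \<notin> {c..d} \<Longrightarrow> G x = 0"
  shows "(\<lambda>x. indicator J x * G x) \<in> dom B"
proof -
  obtain M h where M: "\<forall>x\<in>J. \<bar>G x\<bar> \<le> M" and h: "H1_on l r G h" "AE x in lborel. x \<in> B \<longrightarrow> h x = 0"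
    using G unfolding bounded_algebra_def by blast
  have "(\<lambda>x. indicator J x * G x) \<in> L2 \<mu>"
  proof (rule L2_of_bounded_support[OF indicator_J_measurable[OF bounded_algebra_continuous[OF G]] compact_E_lo_hi[OF cd]])
    show "\<bar>indicator J x * G x\<bar> \<le> M * indicator (E \<inter> {c..d}) x" if "x \<in> E" for x
    proof -
      have xJ: "x \<in> J" using that E_subset_J by blast
      then have "indicator J x = (1::real)" by (rule indicator_simps(1))
      then show ?thesis using that zero[OF xJ] bspec[OF M xJ] by (cases "x \<in> {c..d}") auto
    qed
  qed auto
  moreover have "AE x in \<mu>. indicator J x * G x = G x"
    using AE_mu_E by eventually_elim (use E_bounds in auto)
  moreover have "vanishes_at_ends G"
    unfolding vanishes_at_ends_def
  proof (intro allI impI)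
    fix a assume a: "(ereal a = l \<or> ereal a = r) \<and> a \<notin> E"
    then have "a \<in> J" using l_less_r by auto
    moreover have "a \<notin> {c..d}" using a cd unfolding lo_def hi_def by auto
    ultimately show "G a = 0" by (rule zero)
  qed
  ultimately show ?thesis using h unfolding dom_def rep_def by blast
qed

text \<open>Stone-Weierstrass on the compact set \<open>E \<inter> {c..d}\<close> gives an element
  of the algebra, which is then multiplied by a cutoff equal to 1 on the hull [p, q] of the support
  and 0 outside [c, d]. Cutting does no harm where \<open>f\<close> vanishes, since there the
  approximant is already below \<open>\<epsilon>\<close>.\<close>

theorem uniform_approximation:
  assumes B: "B \<in> sets borel" and thick: "\<And>x y. x < y \<Longrightarrow> emeasure lborel ({x<..<y} - B) > 0" and f: "f \<in> Cc E"
  obtains c d where "lo c" "hi d" "\<And>x. x \<in> E - {c..d} \<Longrightarrow> f x = 0"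
    "\<And>\<epsilon>. \<epsilon> > 0 \<Longrightarrow> \<exists>g\<in>dom B. continuous_on E g \<and> (\<forall>x\<in>E - {c..d}. g x = 0) \<and> (\<forall>x\<in>E. \<bar>f x - g x\<bar> < \<epsilon>)"
proof -
  obtain K0 where K0: "compact K0" "K0 \<subseteq> E" "\<forall>x\<in>E - K0. f x = 0" using f unfolding Cc_def by blast
  obtain e where e: "e \<in> E" using E_nonempty by blast
  \<comment> \<open>Adding a point of \<open>E\<close> guarantees a nonempty set, so that
    \<open>p\<close> and \<open>q\<close> exist.\<close>
  define K where "K = insert e K0"
  have K: "compact K" "K \<subseteq> E" "\<forall>x\<in>E - K. f x = 0" "K \<noteq> {}" using K0 e by (auto simp: K_def)
  obtain p where p: "p \<in> K" "\<forall>x\<in>K. p \<le> x" using compact_attains_inf[OF K(1,4)] by blast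
  obtain q where q: "q \<in> K" "\<forall>x\<in>K. x \<le> q" using compact_attains_sup[OF K(1,4)] by blast
  have pJ: "p \<in> E" "p \<in> J" "q \<in> E" "q \<in> J" "p \<le> q" using p q K E_subset_J by auto
  \<comment> \<open>Leaves room to the left of \<open>p\<close> for a cutoff, except when
    \<open>p\<close> is the left end itself and no cutoff is required.\<close>
  have "\<exists>c. (c \<in> E \<and> ereal c = l) \<or> (l < ereal c \<and> c < p)"
  proof (cases "ereal p = l")
    case False
    then have "l < ereal p" using pJ(2) by auto
    then show ?thesis using ereal_dense2[of l "ereal p"] by force
  qed (use pJ in blast)
  then obtain c where c: "(c \<in> E \<and> ereal c = l) \<or> (l < ereal c \<and> c < p)" by blast
  have "\<exists>d. (d \<in> E \<and> ereal d = r) \<or> (ereal d < r \<and> q < d)"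
  proof (cases "ereal q = r")
    case False
    then have "ereal q < r" using pJ(4) by auto
    then show ?thesis using ereal_dense2[of "ereal q" r] by force
  qed (use pJ in blast)
  then obtain d where d: "(d \<in> E \<and> ereal d = r) \<or> (ereal d < r \<and> q < d)" by blast
  have cp: "c \<le> p"
    using c
  proof
    assume "c \<in> E \<and> ereal c = l"
    then have "ereal c \<le> ereal p" using E_bounds(1)[OF pJ(1)] by simp
    then show ?thesis by simp
  qed simp
  have qd: "q \<le> d"
    using d
  proof
    assume "d \<in> E \<and> ereal d = r"
    then have "ereal q \<le> ereal d" using E_bounds(2)[OF pJ(3)] by simp
    then show ?thesis by simp
  qed simp
  have cJ: "c \<in> J" 
  proof -
    have "l \<le> ereal c" using c by auto
    moreover have "ereal c \<le> r" using order_trans[of "ereal c" "ereal p" r] cp pJ(2) by simp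
    ultimately show ?thesis by simp
  qed
  have dJ: "d \<in> J"
  proof -
    have "ereal d \<le> r" using d by auto
    moreover have "l \<le> ereal d" using order_trans[of l "ereal q" "ereal d"] qd pJ(4) by simp
    ultimately show ?thesis by simp
  qed
  have lo: "lo c"
    unfolding lo_def
  proof (intro allI impI)
    fix x assume x: "c \<le> x" "ereal x = l"
    then have "ereal c \<le> l" by (metis ereal_less_eq(3))
    then have "c \<in> E \<and> ereal c = l" using c by (auto simp: not_less[symmetric])
    then show "x \<in> E" using x(2) by (metis ereal.inject)
  qed
  have hi: "hi d"
    unfolding hi_def
  proof (intro allI impI)
    fix x assume x: "x \<le> d" "ereal x = r"
    then have "r \<le> ereal d" by (metis ereal_less_eq(3))
    then have "d \<in> E \<and> ereal d = r" using d by (auto simp: not_less[symmetric])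
    then show "x \<in> E" using x(2) by (metis ereal.inject)
  qed
  have "c \<le> d" using cp qd pJ(5) by simp
  obtain s where s: "s \<in> bounded_algebra B" and mono: "\<And>x y. x \<in> J \<Longrightarrow> y \<in> J \<Longrightarrow> x \<le> y \<Longrightarrow> s x \<le> s y"
    and strict: "\<And>x y. x \<in> J \<Longrightarrow> y \<in> J \<Longrightarrow> c \<le> x \<Longrightarrow> x < y \<Longrightarrow> y \<le> d \<Longrightarrow> s x < s y"
    using exists_scale[OF B thick \<open>c \<le> d\<close>] by blast
  obtain \<eta>1 where \<eta>1: "\<eta>1 \<in> bounded_algebra B" "\<And>x. \<bar>\<eta>1 x\<bar> \<le> 1" "\<And>x. x \<in> J \<Longrightarrow> p \<le> x \<Longrightarrow> \<eta>1 x = 1" "\<And>x. x \<in> J \<Longrightarrow> x < c \<Longrightarrow> \<eta>1 x = 0"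
  proof (cases "ereal c = l")
    case True
    have "\<not> x < c" if "x \<in> J" for x
    proof
      assume "x < c"
      then have "ereal x < l" using True by (metis less_ereal.simps(1))
      then show False using that by auto
    qed
    then show thesis using that[of "\<lambda>x. 1"] bounded_algebra_const by fastforce
  next
    case False
    then have "c < p" using c by auto
    then have pos: "s c < s p" using strict[OF cJ pJ(2)] qd pJ(5) by simp
    \<comment> \<open>The scale \<open>s\<close> renormalised to rise from 0 at \<open>c\<close> to
      1 at \<open>p\<close>. Being affine in \<open>s\<close>, it has derivative 0 on
      \<open>B\<close>, unlike a cutoff affine in \<open>x\<close>.\<close>
    let ?u = "\<lambda>x. (- s c / (s p - s c)) + (1 / (s p - s c)) * s x"
    have u: "?u x = (s x - s c) / (s p - s c)" for x by (simp add: diff_divide_distrib)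
    show thesis
    proof (rule that[of "\<lambda>x. min 1 (max 0 (?u x))"])
      show "(\<lambda>x. min 1 (max 0 (?u x))) \<in> bounded_algebra B" by (intro bounded_algebra_contraction bounded_algebra_affine s)
      show "min 1 (max 0 (?u x)) = 1" if "x \<in> J" "p \<le> x" for x
        unfolding u using mono[OF pJ(2) that] pos by simp
      show "min 1 (max 0 (?u x)) = 0" if "x \<in> J" "x < c" for x
        unfolding u using mono[OF that(1) cJ] that(2) pos by (simp add: divide_nonpos_pos)
    qed auto
  qed
  obtain \<eta>2 where \<eta>2: "\<eta>2 \<in> bounded_algebra B" "\<And>x. \<bar>\<eta>2 x\<bar> \<le> 1" "\<And>x. x \<in> J \<Longrightarrow> x \<le> q \<Longrightarrow> \<eta>2 x = 1" "\<And>x. x \<in> J \<Longrightarrow> d < x \<Longrightarrow> \<eta>2 x = 0"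
  proof (cases "ereal d = r")
    case True
    have "\<not> d < x" if "x \<in> J" for x
    proof
      assume "d < x"
      then have "r < ereal x" using True by (metis less_ereal.simps(1))
      then show False using that by auto
    qed
    then show thesis using that[of "\<lambda>x. 1"] bounded_algebra_const by fastforce
  next
    case False
    then have "q < d" using d by auto
    then have pos: "s q < s d" using strict[OF pJ(4) dJ] cp pJ(5) by simp
    let ?u = "\<lambda>x. (s d / (s d - s q)) + (- 1 / (s d - s q)) * s x"
    have u: "?u x = (s d - s x) / (s d - s q)" for x by (simp add: diff_divide_distrib)
    show thesis
    proof (rule that[of "\<lambda>x. min 1 (max 0 (?u x))"])
      show "(\<lambda>x. min 1 (max 0 (?u x))) \<in> bounded_algebra B" by (intro bounded_algebra_contraction bounded_algebra_affine s)
      show "min 1 (max 0 (?u x)) = 1" if "x \<in> J" "x \<le> q" for x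
        unfolding u using mono[OF that(1) pJ(4) that(2)] pos by simp
      show "min 1 (max 0 (?u x)) = 0" if "x \<in> J" "d < x" for x
        unfolding u using mono[OF dJ that(1)] that(2) pos by (simp add: divide_nonpos_pos)
    qed auto
  qed
  interpret function_ring_on "bounded_algebra B" "E \<inter> {c..d}"
  proof
    show "compact (E \<inter> {c..d})" by (rule compact_E_lo_hi[OF lo hi])
    show "continuous_on (E \<inter> {c..d}) F" if "F \<in> bounded_algebra B" for F
      by (rule continuous_on_subset[OF bounded_algebra_continuous[OF that]]) (use E_subset_J in blast)
    fix x y assume xy: "x \<in> E \<inter> {c..d}" "y \<in> E \<inter> {c..d}" "x \<noteq> y"
    then have "x \<in> J" "y \<in> J" using E_subset_J by blast+
    then have "s x \<noteq> s y" using strict[of x y] strict[of y x] xy by (cases "x < y") auto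
    then show "\<exists>f\<in>bounded_algebra B. f x \<noteq> f y" using s by blast
  qed (use bounded_algebra_add bounded_algebra_mult bounded_algebra_const in auto)
  have fK: "f x = 0" if "x \<in> E" "\<not> (p \<le> x \<and> x \<le> q)" for x using K(3) p(2) q(2) that by blast
  show ?thesis
  proof (rule that[OF lo hi])
    show "f x = 0" if "x \<in> E - {c..d}" for x using fK[of x] that cp qd by auto
    fix \<epsilon> :: real assume "\<epsilon> > 0"
    have "continuous_on (E \<inter> {c..d}) f" using f unfolding Cc_def by (auto intro: continuous_on_subset)
    then obtain G where G: "G \<in> bounded_algebra B" "\<forall>x\<in>E \<inter> {c..d}. \<bar>f x - G x\<bar> < \<epsilon>"
      using Stone_Weierstrass_basic \<open>\<epsilon> > 0\<close> by blast
    let ?g = "\<lambda>x. G x * (\<eta>1 x * \<eta>2 x)"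
    have g: "?g \<in> bounded_algebra B" using G(1) \<eta>1(1) \<eta>2(1) by (intro bounded_algebra_mult)
    have g0: "?g x = 0" if "x \<in> J" "x \<notin> {c..d}" for x
      using \<eta>1(4)[OF that(1)] \<eta>2(4)[OF that(1)] that(2) by (cases "x < c") auto
    have gE: "indicator J x * ?g x = ?g x" if "x \<in> E" for x using E_bounds[OF that] by simp
    show "\<exists>g\<in>dom B. continuous_on E g \<and> (\<forall>x\<in>E - {c..d}. g x = 0) \<and> (\<forall>x\<in>E. \<bar>f x - g x\<bar> < \<epsilon>)"
    proof (intro bexI[of _ "\<lambda>x. indicator J x * ?g x"] conjI ballI)
      show "(\<lambda>x. indicator J x * ?g x) \<in> dom B" by (rule dom_of_bounded_algebra[OF g lo hi g0])
      have "continuous_on E ?g" by (rule continuous_on_subset[OF bounded_algebra_continuous[OF g] E_subset_J])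
      then show "continuous_on E (\<lambda>x. indicator J x * ?g x)" by (rule continuous_on_eq) (simp only: gE)
      show "indicator J x * ?g x = 0" if x: "x \<in> E - {c..d}" for x
      proof -
        have "x \<in> J" using x E_subset_J by blast
        then show ?thesis using g0[of x] x by simp
      qed
      fix x assume xE: "x \<in> E"
      then have xJ: "x \<in> J" using E_subset_J by blast
      show "\<bar>f x - indicator J x * ?g x\<bar> < \<epsilon>"
        unfolding gE[OF xE]
      proof (cases "x \<in> {c..d}")
        case True
        then have Gx: "\<bar>f x - G x\<bar> < \<epsilon>" using G(2) xE by blast
        show "\<bar>f x - ?g x\<bar> < \<epsilon>"
        proof (cases "p \<le> x \<and> x \<le> q")
          case True
          then show ?thesis using Gx \<eta>1(3)[OF xJ] \<eta>2(3)[OF xJ] by simp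
        next
          case False
          then have "f x = 0" by (rule fK[OF xE])
          \<comment> \<open>Off [p, q] the function \<open>f\<close> is 0, so
            \<open>\<bar>G x\<bar>\<close> is below \<open>\<epsilon>\<close>, and the cutoff
            factors have modulus at most 1.\<close>
          have "\<bar>?g x\<bar> \<le> \<bar>G x\<bar> * (1 * 1)"
            unfolding abs_mult using \<eta>1(2)[of x] \<eta>2(2)[of x] by (intro mult_mono) auto
          then show ?thesis using Gx \<open>f x = 0\<close> by simp
        qed
      next
        case False
        then have "f x = 0" using fK[OF xE] cp qd by auto
        moreover have "?g x = 0" by (rule g0[OF xJ False])
        ultimately show "\<bar>f x - ?g x\<bar> < \<epsilon>" using \<open>\<epsilon> > 0\<close> by (simp only: diff_self abs_zero)
      qed
    qed
  qed
qed

section \<open>Density in L2\<close>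

text \<open>Density is climbed step by step: continuous functions of compact support, indicators of
  compact sets, indicators of Borel sets of finite measure, nonnegative functions, all of
  L2.\<close>

definition L2_closure :: "real set \<Rightarrow> (real \<Rightarrow> real) set" where
  "L2_closure B = {f \<in> L2 \<mu>. \<forall>\<epsilon>>0. \<exists>g\<in>dom B. (\<integral>x. (f x - g x)\<^sup>2 \<partial>\<mu>) < \<epsilon>}"

lemma L2_closure_zero: "(\<lambda>x. 0) \<in> L2_closure B"
  unfolding L2_closure_def using zero_in_dom dom_L2 by (auto intro!: bexI[of _ "\<lambda>x. 0"])

lemma L2_closure_limit:
  assumes f: "f \<in> L2 \<mu>" and u: "\<And>n::nat. u n \<in> L2_closure B" and lim: "(\<lambda>n. \<integral>x. (f x - u n x)\<^sup>2 \<partial>\<mu>) \<longlonglongrightarrow> 0"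
  shows "f \<in> L2_closure B"
  unfolding L2_closure_def
proof (intro CollectI conjI allI impI f)
  fix \<epsilon> :: real assume "\<epsilon> > 0"
  then have e: "\<epsilon> / 4 > 0" by simp
  obtain n where n: "(\<integral>x. (f x - u n x)\<^sup>2 \<partial>\<mu>) < \<epsilon> / 4"
    using order_tendstoD(2)[OF lim e] by (auto simp: eventually_sequentially)
  obtain g where g: "g \<in> dom B" "(\<integral>x. (u n x - g x)\<^sup>2 \<partial>\<mu>) < \<epsilon> / 4" using u[of n] e unfolding L2_closure_def by blast
  have un: "u n \<in> L2 \<mu>" using u unfolding L2_closure_def by blast
  have i: "integrable \<mu> (\<lambda>x. (f x - u n x)\<^sup>2)" "integrable \<mu> (\<lambda>x. (u n x - g x)\<^sup>2)" "integrable \<mu> (\<lambda>x. (f x - g x)\<^sup>2)"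
    using L2D(3)[OF L2_diff[OF f un]] L2D(3)[OF L2_diff[OF un dom_L2[OF g(1)]]] L2D(3)[OF L2_diff[OF f dom_L2[OF g(1)]]] .
  have "(\<integral>x. (f x - g x)\<^sup>2 \<partial>\<mu>) \<le> (\<integral>x. 2 * (f x - u n x)\<^sup>2 + 2 * (u n x - g x)\<^sup>2 \<partial>\<mu>)"
    using i square_add_le[of "f x - u n x" "u n x - g x" for x] by (intro integral_mono) auto
  also have "\<dots> = 2 * (\<integral>x. (f x - u n x)\<^sup>2 \<partial>\<mu>) + 2 * (\<integral>x. (u n x - g x)\<^sup>2 \<partial>\<mu>)" using i by simp
  also have "\<dots> < \<epsilon>" using n g(2) by linarith
  finally show "\<exists>g\<in>dom B. (\<integral>x. (f x - g x)\<^sup>2 \<partial>\<mu>) < \<epsilon>" using g(1) by blast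
qed

lemma L2_closure_dominated:
  assumes f: "f \<in> L2 \<mu>" and u: "\<And>n::nat. u n \<in> L2_closure B" and lim: "AE x in \<mu>. (\<lambda>n. u n x) \<longlonglongrightarrow> f x"
    and w: "w \<in> L2 \<mu>" "\<And>n. AE x in \<mu>. \<bar>f x - u n x\<bar> \<le> \<bar>w x\<bar>"
  shows "f \<in> L2_closure B"
proof (rule L2_closure_limit[OF f u])
  have uL: "u n \<in> L2 \<mu>" for n using u unfolding L2_closure_def by blast
  have "(\<lambda>n. \<integral>x. (f x - u n x)\<^sup>2 \<partial>\<mu>) \<longlonglongrightarrow> (\<integral>x. 0 \<partial>\<mu>)"
  proof (rule integral_dominated_convergence[where w = "\<lambda>x. (w x)\<^sup>2"])
    show "AE x in \<mu>. (\<lambda>n. (f x - u n x)\<^sup>2) \<longlonglongrightarrow> 0"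
      using lim
    proof eventually_elim
      case (elim x)
      then have "(\<lambda>n. (f x - u n x)\<^sup>2) \<longlonglongrightarrow> (f x - f x)\<^sup>2" by (intro tendsto_intros)
      then show ?case by simp
    qed
    show "AE x in \<mu>. norm ((f x - u n x)\<^sup>2) \<le> (w x)\<^sup>2" for n
      using w(2)[of n] by eventually_elim (simp add: abs_le_square_iff)
    show "(\<lambda>x. (f x - u n x)\<^sup>2) \<in> borel_measurable \<mu>" for n using L2D(3)[OF L2_diff[OF f uL]] by (rule borel_measurable_integrable)
  qed (use L2D(3)[OF w(1)] in auto)
  then show "(\<lambda>n. \<integral>x. (f x - u n x)\<^sup>2 \<partial>\<mu>) \<longlonglongrightarrow> 0" by simp
qed

lemma L2_closure_linear:
  assumes f: "f \<in> L2_closure B" and g: "g \<in> L2_closure B"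
  shows "(\<lambda>x. a * f x + b * g x) \<in> L2_closure B"
  unfolding L2_closure_def
proof (intro CollectI conjI allI impI)
  have L: "f \<in> L2 \<mu>" "g \<in> L2 \<mu>" using f g unfolding L2_closure_def by blast+
  show fg: "(\<lambda>x. a * f x + b * g x) \<in> L2 \<mu>" by (intro L2_add L2_cmult L)
  fix \<epsilon> :: real assume "\<epsilon> > 0"
  define \<delta> where "\<delta> = \<epsilon> / (2 * (a\<^sup>2 + b\<^sup>2 + 1))"
  have pos: "a\<^sup>2 + b\<^sup>2 + 1 > 0" by (intro add_nonneg_pos) auto
  have "\<delta> > 0" using \<open>\<epsilon> > 0\<close> pos by (simp add: \<delta>_def)
  then obtain u v where u: "u \<in> dom B" "(\<integral>x. (f x - u x)\<^sup>2 \<partial>\<mu>) < \<delta>" and v: "v \<in> dom B" "(\<integral>x. (g x - v x)\<^sup>2 \<partial>\<mu>) < \<delta>"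
    using f g unfolding L2_closure_def by blast
  have D: "(\<lambda>x. a * u x + b * v x) \<in> dom B" by (intro dom_add dom_cmult u v)
  have i: "integrable \<mu> (\<lambda>x. (f x - u x)\<^sup>2)" "integrable \<mu> (\<lambda>x. (g x - v x)\<^sup>2)"
    using L2D(3)[OF L2_diff[OF L(1) dom_L2[OF u(1)]]] L2D(3)[OF L2_diff[OF L(2) dom_L2[OF v(1)]]] .
  have "(\<integral>x. ((a * f x + b * g x) - (a * u x + b * v x))\<^sup>2 \<partial>\<mu>) \<le> (\<integral>x. 2 * a\<^sup>2 * (f x - u x)\<^sup>2 + 2 * b\<^sup>2 * (g x - v x)\<^sup>2 \<partial>\<mu>)"
  proof (rule integral_mono)
    show "integrable \<mu> (\<lambda>x. ((a * f x + b * g x) - (a * u x + b * v x))\<^sup>2)"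
      by (rule L2D(3)[OF L2_diff[OF fg dom_L2[OF D]]])
    show "integrable \<mu> (\<lambda>x. 2 * a\<^sup>2 * (f x - u x)\<^sup>2 + 2 * b\<^sup>2 * (g x - v x)\<^sup>2)" using i by simp
    show "((a * f x + b * g x) - (a * u x + b * v x))\<^sup>2 \<le> 2 * a\<^sup>2 * (f x - u x)\<^sup>2 + 2 * b\<^sup>2 * (g x - v x)\<^sup>2" for x
    proof -
      have "(a * f x + b * g x) - (a * u x + b * v x) = a * (f x - u x) + b * (g x - v x)" by (simp add: algebra_simps)
      then show ?thesis
        using square_add_le[of "a * (f x - u x)" "b * (g x - v x)"] by (simp only: power_mult_distrib mult.assoc)
    qed
  qed
  also have "\<dots> = 2 * a\<^sup>2 * (\<integral>x. (f x - u x)\<^sup>2 \<partial>\<mu>) + 2 * b\<^sup>2 * (\<integral>x. (g x - v x)\<^sup>2 \<partial>\<mu>)" using i by simp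
  also have "\<dots> \<le> 2 * a\<^sup>2 * \<delta> + 2 * b\<^sup>2 * \<delta>" using u(2) v(2) by (intro add_mono mult_left_mono) auto
  also have "\<dots> < 2 * (a\<^sup>2 + b\<^sup>2 + 1) * \<delta>" using \<open>\<delta> > 0\<close> by (simp add: algebra_simps)
  also have "\<dots> = \<epsilon>" using pos by (simp add: \<delta>_def)
  finally show "\<exists>w\<in>dom B. (\<integral>x. ((a * f x + b * g x) - w x)\<^sup>2 \<partial>\<mu>) < \<epsilon>"
    by (intro bexI[OF _ D])
qed

lemma L2_closure_Cc:
  assumes B: "B \<in> sets borel" and thick: "\<And>x y. x < y \<Longrightarrow> emeasure lborel ({x<..<y} - B) > 0"
    and f: "f \<in> Cc E" "f \<in> L2 \<mu>"
  shows "f \<in> L2_closure B"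
proof -
  obtain c d where cd: "lo c" "hi d" "\<And>x. x \<in> E - {c..d} \<Longrightarrow> f x = 0"
    "\<And>\<epsilon>. \<epsilon> > 0 \<Longrightarrow> \<exists>g\<in>dom B. continuous_on E g \<and> (\<forall>x\<in>E - {c..d}. g x = 0) \<and> (\<forall>x\<in>E. \<bar>f x - g x\<bar> < \<epsilon>)"
    by (rule uniform_approximation[OF B thick f(1)]) blast+
  have "\<exists>g. g \<in> dom B \<and> (\<forall>x\<in>E - {c..d}. g x = 0) \<and> (\<forall>x\<in>E. \<bar>f x - g x\<bar> < inverse (Suc n))" for n
    using cd(4)[of "inverse (Suc n)"] by auto
  then obtain g where g: "\<And>n. g n \<in> dom B" "\<And>n x. x \<in> E - {c..d} \<Longrightarrow> g n x = 0" "\<And>n x. x \<in> E \<Longrightarrow> \<bar>f x - g n x\<bar> < inverse (Suc n)"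
    by metis
  have gB: "g n \<in> L2_closure B" for n
    unfolding L2_closure_def using dom_L2[OF g(1)] g(1)[of n] by (auto intro!: bexI[of _ "g n"])
  have w: "indicator (E \<inter> {c..d}) \<in> L2 \<mu>"
    by (rule L2_of_bounded_support[OF _ compact_E_lo_hi[OF cd(1,2)], of _ 1]) (auto intro!: borel_measurable_indicator)
  show ?thesis
  proof (rule L2_closure_dominated[OF f(2) gB _ w])
    show "AE x in \<mu>. (\<lambda>n. g n x) \<longlonglongrightarrow> f x"
      using AE_mu_E
    proof eventually_elim
      case (elim x)
      have "(\<lambda>n. f x - g n x) \<longlonglongrightarrow> 0"
        by (rule Lim_null_comparison[OF _ LIMSEQ_inverse_real_of_nat]) (use g(3)[OF elim] in \<open>auto intro!: always_eventually less_imp_le\<close>)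
      then have "(\<lambda>n. f x - (f x - g n x)) \<longlonglongrightarrow> f x - 0" by (intro tendsto_intros)
      then show ?case by simp
    qed
    show "AE x in \<mu>. \<bar>f x - g n x\<bar> \<le> \<bar>indicator (E \<inter> {c..d}) x\<bar>" for n
      using AE_mu_E
    proof eventually_elim
      case (elim x)
      have "inverse (real (Suc n)) \<le> 1" by (simp add: inverse_eq_divide)
      then have "\<bar>f x - g n x\<bar> \<le> 1" using g(3)[OF elim, of n] by linarith
      then show ?case using elim cd(3)[of x] g(2)[of x n] by (cases "x \<in> {c..d}") auto
    qed
  qed
qed

lemma lo_hi_exhaustion:
  obtains c d :: "nat \<Rightarrow> real" where "\<And>n. lo (c n)" "\<And>n. hi (d n)" "\<And>x. x \<in> E \<Longrightarrow> \<forall>\<^sub>F n in sequentially. x \<in> {c n..d n}"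
proof -
  have "\<exists>c :: nat \<Rightarrow> real. (\<forall>n. lo (c n)) \<and> (\<forall>x\<in>E. \<forall>\<^sub>F n in sequentially. c n \<le> x)"
  proof (cases "\<exists>a\<in>E. ereal a = l")
    case True
    then obtain a where a: "a \<in> E" "ereal a = l" by blast
    have "lo a" by (rule lo_attained[OF a])
    moreover have "a \<le> x" if "x \<in> E" for x using E_bounds(1)[OF that] by (simp flip: a(2))
    ultimately show ?thesis by (intro exI[of _ "\<lambda>_. a"]) auto
  next
    case False
    obtain X where X: "\<And>i. l < ereal (X i)" "(\<lambda>i. ereal (X i)) \<longlonglongrightarrow> l"
      using ereal_decseq_approx[OF l_less_r] by metis
    have "lo (X n)" for n by (rule lo_of_less[OF X(1)])
    moreover have "\<forall>\<^sub>F n in sequentially. X n \<le> x" if "x \<in> E" for x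
    proof -
      have "l < ereal x" using E_bounds(1)[OF that] False that by (auto simp: order_less_le)
      then have "\<forall>\<^sub>F n in sequentially. ereal (X n) < ereal x" using X(2) by (rule order_tendstoD(2)[rotated])
      then show ?thesis by eventually_elim auto
    qed
    ultimately show ?thesis by blast
  qed
  moreover have "\<exists>d :: nat \<Rightarrow> real. (\<forall>n. hi (d n)) \<and> (\<forall>x\<in>E. \<forall>\<^sub>F n in sequentially. x \<le> d n)"
  proof (cases "\<exists>b\<in>E. ereal b = r")
    case True
    then obtain b where b: "b \<in> E" "ereal b = r" by blast
    have "hi b" by (rule hi_attained[OF b])
    moreover have "x \<le> b" if "x \<in> E" for x using E_bounds(2)[OF that] by (simp flip: b(2))
    ultimately show ?thesis by (intro exI[of _ "\<lambda>_. b"]) auto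
  next
    case False
    obtain X where X: "\<And>i. ereal (X i) < r" "(\<lambda>i. ereal (X i)) \<longlonglongrightarrow> r"
      using ereal_incseq_approx[OF l_less_r] by metis
    have "hi (X n)" for n by (rule hi_of_less[OF X(1)])
    moreover have "\<forall>\<^sub>F n in sequentially. x \<le> X n" if "x \<in> E" for x
    proof -
      have "ereal x < r" using E_bounds(2)[OF that] False that by (auto simp: order_less_le)
      then have "\<forall>\<^sub>F n in sequentially. ereal x < ereal (X n)" using X(2) by (rule order_tendstoD(1)[rotated])
      then show ?thesis by eventually_elim auto
    qed
    ultimately show ?thesis by blast
  qed
  ultimately obtain c d :: "nat \<Rightarrow> real" where cd: "\<And>n. lo (c n)" "\<And>x. x \<in> E \<Longrightarrow> \<forall>\<^sub>F n in sequentially. c n \<le> x"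
     "\<And>n. hi (d n)" "\<And>x. x \<in> E \<Longrightarrow> \<forall>\<^sub>F n in sequentially. x \<le> d n" by blast
  show ?thesis
  proof (rule that[OF cd(1,3)])
    show "\<forall>\<^sub>F n in sequentially. x \<in> {c n..d n}" if "x \<in> E" for x
      using cd(2,4)[OF that] by eventually_elim auto
  qed
qed

lemma indicator_L2:
  assumes "A \<in> sets borel" "emeasure \<mu> A < \<infinity>"
  shows "indicator A \<in> L2 \<mu>"
proof -
  have "(\<lambda>x. (indicator A x :: real)\<^sup>2) = indicator A" by (auto simp: indicator_def)
  moreover have "integrable \<mu> (indicator A :: real \<Rightarrow> real)" using assms by (intro integrable_real_indicator) auto
  ultimately show ?thesis using assms by (simp add: L2_def borel_measurable_indicator)
qed

lemma emeasure_compact_finite: "compact C \<Longrightarrow> C \<subseteq> E \<Longrightarrow> emeasure \<mu> C < \<infinity>"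
  using radon by (simp add: radon_on_def)

text \<open>Tents of increasing steepness over the distance to \<open>C\<close> decrease to its
  indicator. All of them are supported in one compact subset of \<open>E\<close>, whose indicator
  dominates the errors.\<close>

lemma L2_closure_compact:
  assumes B: "B \<in> sets borel" and thick: "\<And>x y. x < y \<Longrightarrow> emeasure lborel ({x<..<y} - B) > 0"
    and C: "compact C" "C \<subseteq> E" "C \<noteq> {}"
  shows "indicator C \<in> L2_closure B"
proof -
  obtain p where p: "p \<in> C" "\<forall>x\<in>C. p \<le> x" using compact_attains_inf[OF C(1,3)] by blast
  obtain q where q: "q \<in> C" "\<forall>x\<in>C. x \<le> q" using compact_attains_sup[OF C(1,3)] by blast
  have pq: "p \<in> E" "q \<in> E" using p q C by auto
  have "\<exists>\<delta>>0. lo (p - \<delta>)"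
  proof (cases "ereal p = l")
    case True
    then show ?thesis using lo_attained[OF pq(1)] zero_less_one by blast
  next
    case False
    then have "l < ereal p" using E_bounds(1)[OF pq(1)] by auto
    then obtain a where a: "l < ereal a" "ereal a < ereal p" using ereal_dense2 by blast
    then show ?thesis using lo_of_less[OF a(1)] by (intro exI[of _ "p - a"]) simp
  qed
  then obtain \<delta>1 where \<delta>1: "\<delta>1 > 0" "lo (p - \<delta>1)" by blast
  have "\<exists>\<delta>>0. hi (q + \<delta>)"
  proof (cases "ereal q = r")
    case True
    then show ?thesis using hi_attained[OF pq(2)] zero_less_one by blast
  next
    case False
    then have "ereal q < r" using E_bounds(2)[OF pq(2)] by auto
    then obtain b where b: "ereal q < ereal b" "ereal b < r" using ereal_dense2 by blast
    then show ?thesis using hi_of_less[OF b(2)] by (intro exI[of _ "b - q"]) simp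
  qed
  then obtain \<delta>2 where \<delta>2: "\<delta>2 > 0" "hi (q + \<delta>2)" by blast
  define \<delta> where "\<delta> = min \<delta>1 \<delta>2"
  define K where "K = E \<inter> {p - \<delta>1..q + \<delta>2}"
  have K: "compact K" "K \<subseteq> E" unfolding K_def using compact_E_lo_hi[OF \<delta>1(2) \<delta>2(2)] by auto
  have "\<delta> > 0" using \<delta>1 \<delta>2 by (simp add: \<delta>_def)
  \<comment> \<open>Starting with steepness above \<open>1/\<delta>\<close> makes every tent vanish
    at distance \<open>\<delta>\<close> from \<open>C\<close>, hence off \<open>K\<close>.\<close>
  then obtain N :: nat where N: "inverse (Suc N) < \<delta>" using reals_Archimedean by blast
  define u where "u n x = max 0 (1 - real (Suc (N + n)) * infdist x C)" for n x
  have cont: "continuous_on UNIV (u n)" for n unfolding u_def[abs_def] by (intro continuous_intros)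
  have u_zero: "u n x = 0" if "x \<in> E - K" for n x
  proof -
    have "\<not> (p - \<delta>1 \<le> x \<and> x \<le> q + \<delta>2)" using that unfolding K_def by auto
    have "\<delta> \<le> infdist x C"
      unfolding infdist_notempty[OF C(3)]
    proof (rule cINF_greatest[OF C(3)])
      fix y assume "y \<in> C"
      then have "p \<le> y" "y \<le> q" using p q by auto
      then show "\<delta> \<le> dist x y" using \<open>\<not> (p - \<delta>1 \<le> x \<and> x \<le> q + \<delta>2)\<close> by (auto simp: dist_real_def \<delta>_def)
    qed
    moreover have "1 \<le> real (Suc (N + n)) * \<delta>"
    proof -
      have "1 = real (Suc N) * inverse (Suc N)" by simp
      also have "\<dots> \<le> real (Suc (N + n)) * \<delta>" using N by (intro mult_mono) auto
      finally show ?thesis .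
    qed
    ultimately have "1 \<le> real (Suc (N + n)) * infdist x C"
      by (meson mult_left_mono of_nat_0_le_iff order_trans)
    then show ?thesis by (simp add: u_def)
  qed
  have u_le: "0 \<le> u n x" "u n x \<le> 1" for n x using infdist_nonneg[of x C] by (auto simp: u_def)
  have uL: "u n \<in> L2 \<mu>" for n
  proof (rule L2_of_bounded_support[OF borel_measurable_continuous_onI[OF cont] K, of _ 1])
    show "\<bar>u n x\<bar> \<le> 1 * indicator K x" if "x \<in> E" for x using u_zero[of x n] u_le[of n x] that by (cases "x \<in> K") auto
  qed
  have uC: "u n \<in> Cc E" for n
    unfolding Cc_def using K u_zero continuous_on_subset[OF cont] by blast
  have uB: "u n \<in> L2_closure B" for n by (rule L2_closure_Cc[OF B thick uC uL])
  have Cm: "C \<in> sets borel" using C by (simp add: borel_compact)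
  have Km: "K \<in> sets borel" using K by (simp add: borel_compact)
  show ?thesis
  proof (rule L2_closure_dominated[OF indicator_L2[OF Cm emeasure_compact_finite[OF C(1,2)]] uB _ indicator_L2[OF Km emeasure_compact_finite[OF K]]])
    show "AE x in \<mu>. (\<lambda>n. u n x) \<longlonglongrightarrow> indicator C x"
    proof (intro AE_I2)
      fix x
      show "(\<lambda>n. u n x) \<longlonglongrightarrow> indicator C x"
      proof (cases "x \<in> C")
        case True
        then show ?thesis by (simp add: u_def)
      next
        case False
        then have "infdist x C > 0" using infdist_pos_not_in_closed[OF compact_imp_closed[OF C(1)] C(3)] by simp
        then obtain m :: nat where m: "inverse (Suc m) < infdist x C" using reals_Archimedean by blast
        have "u n x = 0" if "n \<ge> m" for n
        proof -
          have "1 = real (Suc m) * inverse (Suc m)" by simp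
          also have "\<dots> \<le> real (Suc (N + n)) * infdist x C" using m that by (intro mult_mono) auto
          finally show ?thesis by (simp add: u_def)
        qed
        then have "\<forall>\<^sub>F n in sequentially. u n x = 0" by (auto simp: eventually_sequentially)
        then show ?thesis using False by (simp add: tendsto_eventually)
      qed
    qed
    show "AE x in \<mu>. \<bar>indicator C x - u n x\<bar> \<le> \<bar>indicator K x\<bar>" for n
      using AE_mu_E
    proof eventually_elim
      case (elim x)
      have "x \<in> K" if "x \<in> C" using that p q elim \<delta>1 \<delta>2 unfolding K_def by force
      then show ?case using u_zero[of x n] u_le[of n x] elim by (cases "x \<in> K"; cases "x \<in> C") auto
    qed
  qed
qed

text \<open>\<open>\<mu>\<close> may be infinite. Its restriction to the compact set
  \<open>K\<close> is a finite Borel measure on the line, hence inner regular, and compact subsets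
  of \<open>A\<close> approximate it in measure.\<close>

lemma L2_closure_indicator_bounded:
  assumes B: "B \<in> sets borel" and thick: "\<And>x y. x < y \<Longrightarrow> emeasure lborel ({x<..<y} - B) > 0"
    and A: "A \<in> sets borel" "A \<subseteq> K" and K: "compact K" "K \<subseteq> E"
  shows "indicator A \<in> L2_closure B"
proof -
  note zero = L2_closure_zero[of B]
  have Km: "K \<in> sets borel" using K by (simp add: borel_compact)
  define N where "N = density \<mu> (indicator K)"
  have N: "sets N = sets borel" by (simp add: N_def)
  have emN: "emeasure N S = emeasure \<mu> (S \<inter> K)" if "S \<in> sets borel" for S
    using that Km by (simp add: N_def emeasure_density flip: indicator_inter_arith) (simp add: Int_commute)
  have "emeasure N (space N) \<noteq> \<infinity>"
    using emN[of UNIV] emeasure_compact_finite[OF K] by (simp add: N_def)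
  note inner = inner_regular[OF N this A(1)]
  have fin: "emeasure N A < \<infinity>"
    using emN[OF A(1)] emeasure_mono[of "A \<inter> K" K \<mu>] Km emeasure_compact_finite[OF K] by (simp add: le_less_trans)
  have AL: "indicator A \<in> L2 \<mu>"
    using emN[OF A(1)] fin A by (intro indicator_L2) (simp_all add: Int_absorb2)
  have "\<exists>C. C \<subseteq> A \<and> compact C \<and> emeasure N A \<le> emeasure N C + ennreal (inverse (Suc n))" for n
  proof (cases "emeasure N A = 0")
    case True
    then show ?thesis by (intro exI[of _ "{}"]) simp
  next
    case False
    have "emeasure N A - ennreal (inverse (Suc n)) < emeasure N A"
      using fin False by (intro ennreal_between) (auto simp: zero_less_iff_neq_zero)
    then obtain C where "C \<subseteq> A" "compact C" "emeasure N A - ennreal (inverse (Suc n)) < emeasure N C"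
      unfolding inner less_SUP_iff by blast
    then show ?thesis using ennreal_minus_le_iff by (metis less_imp_le add.commute)
  qed
  then obtain C where C: "\<And>n. C n \<subseteq> A" "\<And>n. compact (C n)" "\<And>n. emeasure N A \<le> emeasure N (C n) + ennreal (inverse (Suc n))" by metis
  have CE: "C n \<subseteq> E" for n using C(1) A K by blast
  have CB: "indicator (C n) \<in> L2_closure B" for n
  proof (cases "C n = {}")
    case True
    then have "indicator (C n) = (\<lambda>x. 0::real)" by auto
    then show ?thesis using zero by simp
  qed (rule L2_closure_compact[OF B thick C(2) CE])
  have Cm: "C n \<in> sets borel" for n using C(2) by (simp add: borel_compact)
  have eq: "(\<integral>x. (indicat_real A x - indicat_real (C n) x)\<^sup>2 \<partial>\<mu>) = measure \<mu> (A - C n)" for n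
  proof -
    have "(\<integral>x. (indicat_real A x - indicat_real (C n) x)\<^sup>2 \<partial>\<mu>) = (\<integral>x. indicator (A - C n) x \<partial>\<mu>)"
      using C(1)[of n] by (intro Bochner_Integration.integral_cong) (auto simp: indicator_def)
    then show ?thesis by simp
  qed
  have "measure \<mu> (A - C n) \<le> inverse (Suc n)" for n
  proof -
    have muA: "emeasure \<mu> A = emeasure N A" "emeasure \<mu> (C n) = emeasure N (C n)"
      using emN[OF A(1)] emN[OF Cm[of n]] A C(1)[of n] by (simp_all add: Int_absorb2 subset_trans)
    have "emeasure \<mu> (C n) \<noteq> \<infinity>" using emeasure_compact_finite[OF C(2) CE] by (simp add: less_top)
    then have "emeasure \<mu> (A - C n) = emeasure \<mu> A - emeasure \<mu> (C n)"
      using Cm A C(1) by (intro emeasure_Diff) auto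
    also have "\<dots> \<le> ennreal (inverse (Suc n))"
      using C(3)[of n] fin unfolding muA by (auto simp: ennreal_minus_le_iff add.commute)
    finally show ?thesis unfolding measure_def by (intro enn2real_leI) auto
  qed
  then have "(\<lambda>n. \<integral>x. (indicat_real A x - indicat_real (C n) x)\<^sup>2 \<partial>\<mu>) \<longlonglongrightarrow> 0"
    unfolding eq by (intro tendsto_sandwich[OF _ _ tendsto_const LIMSEQ_inverse_real_of_nat]) auto
  then show ?thesis by (rule L2_closure_limit[OF AL CB])
qed

lemma L2_closure_indicator:
  assumes B: "B \<in> sets borel" and thick: "\<And>x y. x < y \<Longrightarrow> emeasure lborel ({x<..<y} - B) > 0"
    and A: "A \<in> sets borel" "emeasure \<mu> A < \<infinity>"
  shows "indicator A \<in> L2_closure B"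
proof -
  obtain c d :: "nat \<Rightarrow> real" where cd: "\<And>n. lo (c n)" "\<And>n. hi (d n)" "\<And>x. x \<in> E \<Longrightarrow> \<forall>\<^sub>F n in sequentially. x \<in> {c n..d n}"
    by (rule lo_hi_exhaustion) blast
  let ?K = "\<lambda>n. E \<inter> {c n..d n}"
  have K: "compact (?K n)" for n by (rule compact_E_lo_hi[OF cd(1,2)])
  have AK: "indicator (A \<inter> ?K n) \<in> L2_closure B" for n
    by (rule L2_closure_indicator_bounded[OF B thick _ _ K]) (use A in auto)
  show ?thesis
  proof (rule L2_closure_dominated[OF indicator_L2[OF A] AK _ indicator_L2[OF A]])
    show "AE x in \<mu>. (\<lambda>n. indicat_real (A \<inter> ?K n) x) \<longlonglongrightarrow> indicator A x"
      using AE_mu_E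
    proof eventually_elim
      case (elim x)
      have "\<forall>\<^sub>F n in sequentially. indicat_real (A \<inter> ?K n) x = indicator A x"
        using cd(3)[OF elim] by eventually_elim (use elim in \<open>auto simp: indicator_def\<close>)
      then show ?case by (rule tendsto_eventually)
    qed
    show "AE x in \<mu>. \<bar>indicat_real A x - indicator (A \<inter> ?K n) x\<bar> \<le> \<bar>indicat_real A x\<bar>" for n
      by (intro AE_I2) (auto simp: indicator_def)
  qed
qed

lemma L2_closure_nonneg:
  assumes B: "B \<in> sets borel" and thick: "\<And>x y. x < y \<Longrightarrow> emeasure lborel ({x<..<y} - B) > 0"
    and "f \<in> borel_measurable \<mu>" "\<And>x. 0 \<le> f x"
  shows "f \<in> L2 \<mu> \<longrightarrow> f \<in> L2_closure B"
  using assms(3,4)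
proof (induction f rule: borel_measurable_induct_real)
  case (set A)
  show ?case
  proof
    assume "indicator A \<in> L2 \<mu>"
    then have "integrable \<mu> (\<lambda>x. (indicator A x :: real)\<^sup>2)" by (rule L2D)
    moreover have "(\<lambda>x. (indicator A x :: real)\<^sup>2) = indicator A" by (auto simp: indicator_def)
    ultimately have "emeasure \<mu> A < \<infinity>" using set by (simp add: integrable_indicator_iff)
    then show "indicator A \<in> L2_closure B" using set by (intro L2_closure_indicator[OF B thick]) auto
  qed
next
  case (mult u c)
  show ?case
  proof
    assume cu: "(\<lambda>x. c * u x) \<in> L2 \<mu>"
    show "(\<lambda>x. c * u x) \<in> L2_closure B"
    proof (cases "c = 0")
      \<comment> \<open>For \<open>c = 0\<close> the product is square integrable whatever
        \<open>u\<close> is, so nothing can be inferred about \<open>u\<close>.\<close>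
      case True
      then show ?thesis using L2_closure_zero by simp
    next
      case False
      then have "(\<lambda>x. inverse c * (c * u x)) = u" by auto
      then have "u \<in> L2 \<mu>" using L2_cmult[OF cu, of "inverse c"] by simp
      then have "u \<in> L2_closure B" using mult by blast
      then show ?thesis using L2_closure_linear[of u B u c 0] by simp
    qed
  qed
next
  case (add u v)
  show ?case
  proof
    assume uv: "(\<lambda>x. v x + u x) \<in> L2 \<mu>"
    have "u \<in> L2 \<mu>" "v \<in> L2 \<mu>"
      using add by (intro L2_bound[OF uv]; simp cong: measurable_cong_sets)+
    then have "u \<in> L2_closure B" "v \<in> L2_closure B" using add by blast+
    then show "(\<lambda>x. v x + u x) \<in> L2_closure B" using L2_closure_linear[of v B u 1 1] by simp
  qed
next
  case (seq U)
  show ?case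
  proof
    assume f: "f \<in> L2 \<mu>"
    have lim: "(\<lambda>n. U n x) \<longlonglongrightarrow> f x" for x using seq by simp
    have nonneg: "0 \<le> U n x" for n x using seq by simp
    have le: "U n x \<le> f x" for n x
      using \<open>incseq U\<close> lim by (intro incseq_le[of "\<lambda>n. U n x"]) (auto simp: incseq_def le_fun_def)
    have UL: "U n \<in> L2 \<mu>" for n
    proof (rule L2_bound[OF f])
      show "U n \<in> borel_measurable borel" using seq by (simp cong: measurable_cong_sets)
      show "\<bar>U n x\<bar> \<le> \<bar>f x\<bar>" for x using le[of n x] nonneg[of n x] by simp
    qed
    then have "U n \<in> L2_closure B" for n using seq by blast
    then show "f \<in> L2_closure B"
    proof (rule L2_closure_dominated[OF f _ _ f])
      show "AE x in \<mu>. (\<lambda>n. U n x) \<longlonglongrightarrow> f x" using lim by simp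
      show "AE x in \<mu>. \<bar>f x - U n x\<bar> \<le> \<bar>f x\<bar>" for n
      proof (intro AE_I2)
        fix x show "\<bar>f x - U n x\<bar> \<le> \<bar>f x\<bar>" using le[of n x] nonneg[of n x] by simp
      qed
    qed
  qed
qed

theorem dom_dense_L2:
  assumes B: "B \<in> sets borel" and thick: "\<And>x y. x < y \<Longrightarrow> emeasure lborel ({x<..<y} - B) > 0"
    and f: "f \<in> L2 \<mu>" and "\<epsilon> > 0"
  shows "\<exists>g\<in>dom B. (\<integral>x. (f x - g x)\<^sup>2 \<partial>\<mu>) < \<epsilon>"
proof -
  have [measurable]: "f \<in> borel_measurable borel" by (rule L2D[OF f])
  have p: "(\<lambda>x. max 0 (f x)) \<in> L2 \<mu>" "(\<lambda>x. max 0 (- f x)) \<in> L2 \<mu>" by (rule L2_bound[OF f]; auto)+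
  then have "(\<lambda>x. max 0 (f x)) \<in> L2_closure B" "(\<lambda>x. max 0 (- f x)) \<in> L2_closure B"
    using L2_closure_nonneg[OF B thick L2D(1)[OF p(1)]] L2_closure_nonneg[OF B thick L2D(1)[OF p(2)]] by auto
  then have "(\<lambda>x. 1 * max 0 (f x) + (- 1) * max 0 (- f x)) \<in> L2_closure B" by (rule L2_closure_linear)
  moreover have "(\<lambda>x. 1 * max 0 (f x) + (- 1) * max 0 (- f x)) = f" by (auto simp: max_def)
  ultimately have "f \<in> L2_closure B" by simp
  then show ?thesis using \<open>\<epsilon> > 0\<close> unfolding L2_closure_def by blast
qed

section \<open>A proper subspace for a state space of positive measure\<close>

theorem regular_dom:
  assumes B: "B \<subseteq> E" "B \<in> sets borel" "B \<subseteq> {\<alpha>..\<beta>}" "\<alpha> \<le> \<beta>" "l < ereal \<alpha>" "ereal \<beta> < r"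
    and thick: "\<And>x y. x < y \<Longrightarrow> emeasure lborel ({x<..<y} - B) > 0"
  shows "regular_dirichlet_form E \<mu> (qd_form E \<mu>) (dom B)"
  unfolding regular_dirichlet_form_def
proof (intro conjI ballI allI impI)
  have Cc: "g \<in> Cc E" if "lo c" "hi d" "continuous_on E g" "\<forall>x\<in>E - {c..d}. g x = 0" for g c d
    unfolding Cc_def using that compact_E_lo_hi[of c d] by (intro CollectI conjI exI[of _ "E \<inter> {c..d}"]) auto
  show "dirichlet_form \<mu> (qd_form E \<mu>) (dom B)"
    by (rule dirichlet_form_dom[OF B(1,2) dom_dense_L2[OF B(2) thick]])
  show "\<exists>g\<in>dom B \<inter> Cc E. energy (\<lambda>x. f x - g x) < \<epsilon>" if "f \<in> dom B" "\<epsilon> > 0" for f \<epsilon>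
    using dom_core_dense[OF that(1) B(3-6) that(2)] Cc by blast
  show "\<exists>g\<in>dom B \<inter> Cc E. \<forall>x\<in>E. \<bar>f x - g x\<bar> < \<epsilon>" if fC: "f \<in> Cc E" and \<epsilon>: "\<epsilon> > 0" for f \<epsilon>
  proof -
    obtain c d where cd: "lo c" "hi d"
      "\<And>\<epsilon>. \<epsilon> > 0 \<Longrightarrow> \<exists>g\<in>dom B. continuous_on E g \<and> (\<forall>x\<in>E - {c..d}. g x = 0) \<and> (\<forall>x\<in>E. \<bar>f x - g x\<bar> < \<epsilon>)"
      by (rule uniform_approximation[OF B(2) thick fC]) blast+
    show ?thesis using cd(3)[OF \<epsilon>] Cc[OF cd(1,2)] by blast
  qed
qed

text \<open>The witness is the tent function over [\<alpha>, \<beta>], whose slope is 1 or -1 almost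
  everywhere there and so does not vanish on \<open>B\<close>. No other representative can do
  better, because derivatives are determined almost everywhere on \<open>E\<close>.\<close>

lemma dom_proper:
  assumes B: "B \<subseteq> E" "B \<in> sets borel" "B \<subseteq> {\<alpha>..\<beta>}" "\<alpha> < \<beta>" "l < ereal \<alpha>" "ereal \<beta> < r"
    and pos: "emeasure lborel B > 0"
  shows "dom B \<noteq> dom {}"
proof
  assume eq: "dom B = dom {}"
  define m where "m = (\<alpha> + \<beta>) / 2"
  have m: "\<alpha> < m" "m < \<beta>" using B(4) by (auto simp: m_def)
  have sub: "{\<alpha>..\<beta>} \<subseteq> I"
    using B(5,6) by (auto simp: open_lr_def intro: less_le_trans[of l "ereal \<alpha>"] le_less_trans[of _ "ereal \<beta>" r])
  define T where "T x = (m - \<alpha>) + (max \<alpha> (min m x) - max m (min \<beta> x))" for x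
  define \<theta> :: "real \<Rightarrow> real" where "\<theta> x = 0 + (indicator {\<alpha>..m} x - indicator {m..\<beta>} x)" for x :: real
  have "{\<alpha>..m} \<subseteq> I" "{m..\<beta>} \<subseteq> I" using sub m by auto
  then have T: "H1_on l r T \<theta>"
    unfolding T_def[abs_def] \<theta>_def[abs_def] using m by (intro H1_on_add H1_on_const H1_on_diff H1_on_clip) auto
  have T0: "T x = 0" if "x \<notin> {\<alpha>..\<beta>}" for x
    using that m by (auto simp: T_def m_def min_def max_def field_simps)
  have Tb: "\<bar>T x\<bar> \<le> \<beta> - \<alpha>" for x using m by (auto simp: T_def m_def min_def max_def field_simps)
  have Tm: "T \<in> borel_measurable borel" unfolding T_def[abs_def] by measurable
  have lo: "lo \<alpha>" by (rule lo_of_less[OF B(5)])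
  have hi: "hi \<beta>" by (rule hi_of_less[OF B(6)])
  have "T \<in> L2 \<mu>"
  proof (rule L2_of_bounded_support[OF Tm compact_E_lo_hi[OF lo hi], of "\<beta> - \<alpha>"])
    show "\<bar>T x\<bar> \<le> (\<beta> - \<alpha>) * indicator (E \<inter> {\<alpha>..\<beta>}) x" if "x \<in> E" for x
      using T0[of x] Tb[of x] that by (cases "x \<in> {\<alpha>..\<beta>}") auto
  qed simp
  moreover have rT: "rep T T \<theta>" using T by (simp add: rep_def)
  moreover have "vanishes_at_ends T"
    unfolding vanishes_at_ends_def
  proof (intro allI impI)
    fix a assume a: "(ereal a = l \<or> ereal a = r) \<and> a \<notin> E"
    then have "a \<notin> {\<alpha>..\<beta>}" using lo hi unfolding lo_def hi_def by auto
    then show "T a = 0" by (rule T0)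
  qed
  ultimately have "T \<in> dom {}" unfolding dom_def by fastforce
  then have "T \<in> dom B" using eq by simp
  then obtain F h where F: "rep T F h" "AE x in lborel. x \<in> B \<longrightarrow> h x = 0" unfolding dom_def by blast
  have "AE x in lborel. x \<notin> B"
    \<comment> \<open>At the peak \<open>m\<close> both indicators contribute and
      \<open>\<theta> m = 0\<close>, hence the exclusion of that single point.\<close>
    using F(2) rep_deriv_eq_on_E[OF F(1) rT] AE_lborel_singleton[of m]
  proof eventually_elim
    case (elim x)
    show ?case
    proof
      assume x: "x \<in> B"
      then have "\<theta> x = 0" "x \<in> {\<alpha>..\<beta>}" using elim B(1,3) by auto
      then show False using elim(3) by (cases "x < m") (auto simp: \<theta>_def indicator_def)
    qed
  qed
  then have "emeasure lborel B = 0" using AE_iff_null_sets[of B lborel] B(2) by (simp add: null_setsD1)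
  then show False using pos by simp
qed

text \<open>The open dense set is a neighbourhood of the rationals with measure below that of
  \<open>E \<inter> {\<alpha>..\<beta>}\<close>. Every interval contains a rational and with it a
  ball that \<open>B\<close> avoids.\<close>

lemma exists_thin_subset:
  assumes "E \<notin> null_sets lborel"
  obtains B \<alpha> \<beta> where "B \<subseteq> E" "B \<in> sets borel" "B \<subseteq> {\<alpha>..\<beta>}" "\<alpha> < \<beta>" "l < ereal \<alpha>" "ereal \<beta> < r"
    "emeasure lborel B > 0" "\<And>x y. x < y \<Longrightarrow> emeasure lborel ({x<..<y} - B) > 0"
proof -
  obtain m where m: "l < ereal m" "ereal m < r" using ereal_dense2[OF l_less_r] by blast
  obtain X where X: "\<And>i. l < ereal (X i)" "\<And>i. ereal (X i) < ereal m" "(\<lambda>i. ereal (X i)) \<longlonglongrightarrow> l"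
    using ereal_decseq_approx[OF m(1)] by metis
  obtain Y where Y: "\<And>i. ereal m < ereal (Y i)" "\<And>i. ereal (Y i) < r" "(\<lambda>i. ereal (Y i)) \<longlonglongrightarrow> r"
    using ereal_incseq_approx[OF m(2)] by metis
  \<comment> \<open>The truncations exhaust \<open>E\<close> up to its finite endpoints, of which
    there are at most two.\<close>
  have "\<exists>n. emeasure lborel (E \<inter> {X n..Y n}) > 0"
  proof (rule ccontr)
    assume "\<not> ?thesis"
    then have "E \<inter> {X n..Y n} \<in> null_sets lborel" for n by (auto simp: null_sets_def not_less)
    then have "(\<Union>n. E \<inter> {X n..Y n}) \<in> null_sets lborel" by (intro null_sets_UN)
    moreover have "{x. ereal x = l \<or> ereal x = r} \<in> null_sets lborel"
      by (rule countable_imp_null_set_lborel[OF countable_finite[OF finite_ends]])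
    ultimately have "(\<Union>n. E \<inter> {X n..Y n}) \<union> {x. ereal x = l \<or> ereal x = r} \<in> null_sets lborel" by (rule null_sets.Un)
    moreover have "E \<subseteq> (\<Union>n. E \<inter> {X n..Y n}) \<union> {x. ereal x = l \<or> ereal x = r}"
    proof
      fix x assume x: "x \<in> E"
      show "x \<in> (\<Union>n. E \<inter> {X n..Y n}) \<union> {x. ereal x = l \<or> ereal x = r}"
      proof (cases "ereal x = l \<or> ereal x = r")
        case False
        then have "l < ereal x" "ereal x < r" using E_bounds[OF x] by (auto simp: order_less_le)
        then have "\<forall>\<^sub>F n in sequentially. ereal (X n) < ereal x" "\<forall>\<^sub>F n in sequentially. ereal x < ereal (Y n)"
          using order_tendstoD(2)[OF X(3)] order_tendstoD(1)[OF Y(3)] by blast+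
        then have "\<forall>\<^sub>F n in sequentially. x \<in> {X n..Y n}" by eventually_elim auto
        then obtain n where "x \<in> {X n..Y n}" by (auto simp: eventually_sequentially)
        then show ?thesis using x by blast
      qed auto
    qed
    moreover have "E \<in> sets lborel" by simp
    ultimately have "E \<in> null_sets lborel" using null_sets_subset by blast
    then show False using assms by simp
  qed
  then obtain n where n: "emeasure lborel (E \<inter> {X n..Y n}) > 0" by blast
  define \<alpha> \<beta> where "\<alpha> = X n" "\<beta> = Y n"
  have ab: "\<alpha> < \<beta>" using X(2)[of n] Y(1)[of n] by (simp add: \<alpha>_\<beta>_def)
  have fin: "emeasure lborel (E \<inter> {\<alpha>..\<beta>}) < \<infinity>"
    by (rule le_less_trans[OF emeasure_mono[of _ "{\<alpha>..\<beta>}"]]) (auto simp: emeasure_lborel_Icc_eq)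
  define e where "e = measure lborel (E \<inter> {\<alpha>..\<beta>})"
  have em: "emeasure lborel (E \<inter> {\<alpha>..\<beta>}) = ennreal e" using fin by (simp add: e_def emeasure_eq_ennreal_measure)
  then have "e > 0" using n by (simp add: \<alpha>_\<beta>_def)
  have Q: "(\<rat> :: real set) \<in> null_sets lebesgue" by (simp add: countable_rat countable_imp_null_set_lborel null_sets_completionI)
  obtain U :: "real set" where U: "open U" "\<rat> \<subseteq> U" "emeasure lebesgue (U - \<rat>) < ennreal e"
    by (rule sets_lebesgue_outer_open[OF null_setsD2[OF Q] \<open>e > 0\<close>]) (rule that)
  have Um: "U \<in> sets borel" using U(1) by simp
  have "emeasure lebesgue (U - \<rat>) = emeasure lebesgue U" by (rule emeasure_Diff_null_set[OF Q]) (use Um in simp)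
  then have Ue: "emeasure lborel U < ennreal e" using U(3) Um by simp
  define B where "B = E \<inter> {\<alpha>..\<beta>} - U"
  have Bm: "B \<in> sets borel" using Um by (simp add: B_def)
  have "ennreal e \<le> emeasure lborel (B \<union> U)" unfolding em[symmetric] using Bm Um by (intro emeasure_mono) (auto simp: B_def)
  also have "\<dots> \<le> emeasure lborel B + emeasure lborel U" using Bm Um by (intro emeasure_subadditive) auto
  finally have "emeasure lborel B \<noteq> 0" using Ue by auto
  then have Bpos: "emeasure lborel B > 0" by (simp add: zero_less_iff_neq_zero)
  have thick: "emeasure lborel ({x<..<y} - B) > 0" if xy: "x < y" for x y
  proof -
    obtain q where q: "q \<in> \<rat>" "x < q" "q < y" using Rats_dense_in_real[OF xy] by blast
    then have "q \<in> {x<..<y} \<inter> U" using U(2) by auto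
    moreover have op: "open ({x<..<y} \<inter> U)" using U(1) by auto
    ultimately obtain \<rho> where \<rho>: "\<rho> > 0" "ball q \<rho> \<subseteq> {x<..<y} \<inter> U" using openE[OF op] by metis
    have "0 < emeasure lborel {q - \<rho><..<q + \<rho>}" using \<rho>(1) by (simp add: emeasure_lborel_Ioo)
    also have "\<dots> = emeasure lborel (ball q \<rho>)" by (simp add: ball_eq_greaterThanLessThan)
    also have "\<dots> \<le> emeasure lborel ({x<..<y} - B)"
    proof (rule emeasure_mono)
      show "ball q \<rho> \<subseteq> {x<..<y} - B" using \<rho>(2) unfolding B_def by blast
    qed (use Bm in auto)
    finally show ?thesis .
  qed
  show ?thesis
  proof (rule that[of B \<alpha> \<beta>])
    show "l < ereal \<alpha>" "ereal \<beta> < r" using X(1)[of n] Y(2)[of n] by (simp_all add: \<alpha>_\<beta>_def)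
  qed (use Bm Bpos thick ab in \<open>auto simp: B_def\<close>)
qed

theorem proper_subspace_of_not_null:
  assumes "E \<notin> null_sets lborel"
  shows "\<exists>\<E>' \<F>'. proper_fukushima_subspace E \<mu> (qd_form E \<mu>) (qd_domain E \<mu>) \<E>' \<F>'"
proof -
  obtain B \<alpha> \<beta> where B: "B \<subseteq> E" "B \<in> sets borel" "B \<subseteq> {\<alpha>..\<beta>}" "\<alpha> < \<beta>" "l < ereal \<alpha>" "ereal \<beta> < r"
    "emeasure lborel B > 0" "\<And>x y. x < y \<Longrightarrow> emeasure lborel ({x<..<y} - B) > 0"
    by (rule exists_thin_subset[OF assms]) blast
  have "regular_dirichlet_form E \<mu> (qd_form E \<mu>) (dom B)"
    by (rule regular_dom[OF B(1-3) less_imp_le[OF B(4)] B(5,6,8)])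
  moreover have "dom B \<subseteq> dom {}" by (rule dom_mono) simp
  moreover have "dom B \<noteq> dom {}" by (rule dom_proper[OF B(1-7)])
  ultimately show ?thesis
    unfolding proper_fukushima_subspace_def fukushima_subspace_def qd_domain_eq by blast
qed

section \<open>Step functions exhaust the domain of a null state space\<close>

text \<open>A null set contains no interval, so there are points off \<open>E\<close> between
  \<open>l\<close> and \<open>c\<close>; if \<open>l\<close> itself is in \<open>E\<close>, any
  point below \<open>l\<close> will do. Cutting off \<open>E\<close> is what makes indicators
  continuous on \<open>E\<close>.\<close>

lemma exists_cut_below:
  assumes null: "E \<in> null_sets lborel" and c: "lo c"
  obtains c' where "c' \<le> c" "c' \<notin> E" "lo c'"
proof (cases "\<exists>a\<in>E. ereal a = l")
  case True
  then obtain a where a: "a \<in> E" "ereal a = l" by blast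
  have "min a c - 1 \<notin> E" using E_bounds(1)[of "min a c - 1"] by (auto simp flip: a(2))
  moreover have "lo (min a c - 1)" by (rule lo_attained[OF a])
  ultimately show ?thesis using that[of "min a c - 1"] by simp
next
  case False
  have "l < ereal c"
  proof (rule ccontr)
    assume "\<not> l < ereal c"
    then have le: "ereal c \<le> l" by simp
    then obtain a where a: "l = ereal a" using l_less_r by (cases l) auto
    then have "a \<in> E" using c le unfolding lo_def by auto
    then show False using False a by auto
  qed
  then obtain x where x: "l < ereal x" "ereal x < ereal c" using ereal_dense2 by blast
  have "\<not> {x<..<c} \<subseteq> E"
  proof
    assume "{x<..<c} \<subseteq> E"
    then have "{x<..<c} \<in> null_sets lborel" by (rule null_sets_subset[OF null, rotated]) simp
    then show False using x(2) by (simp add: null_sets_def)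
  qed
  then obtain c' where "c' \<in> {x<..<c}" and "c' \<notin> E" by blast
  then have c': "x < c'" "c' < c" "c' \<notin> E" by simp_all
  have "lo c'" by (rule lo_of_less[OF less_trans[OF x(1)]]) (use c'(1) in simp)
  then show ?thesis by (intro that[of c']) (use c' in auto)
qed

lemma exists_cut_above:
  assumes null: "E \<in> null_sets lborel" and d: "hi d"
  obtains d' where "d \<le> d'" "d' \<notin> E" "hi d'"
proof (cases "\<exists>b\<in>E. ereal b = r")
  case True
  then obtain b where b: "b \<in> E" "ereal b = r" by blast
  have "max b d + 1 \<notin> E" using E_bounds(2)[of "max b d + 1"] by (auto simp flip: b(2))
  moreover have "hi (max b d + 1)" by (rule hi_attained[OF b])
  ultimately show ?thesis using that[of "max b d + 1"] by simp
next
  case False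
  have "ereal d < r"
  proof (rule ccontr)
    assume "\<not> ereal d < r"
    then have le: "r \<le> ereal d" by simp
    then obtain b where b: "r = ereal b" using l_less_r by (cases r) auto
    then have "b \<in> E" using d le unfolding hi_def by auto
    then show False using False b by auto
  qed
  then obtain x where x: "ereal d < ereal x" "ereal x < r" using ereal_dense2 by blast
  have "\<not> {d<..<x} \<subseteq> E"
  proof
    assume "{d<..<x} \<subseteq> E"
    then have "{d<..<x} \<in> null_sets lborel" by (rule null_sets_subset[OF null, rotated]) simp
    then show False using x(1) by (simp add: null_sets_def)
  qed
  then obtain d' where "d' \<in> {d<..<x}" and "d' \<notin> E" by blast
  then have d': "d < d'" "d' < x" "d' \<notin> E" by simp_all
  have "hi d'" by (rule hi_of_less[OF less_trans[OF _ x(2)]]) (use d'(2) in simp)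
  then show ?thesis by (intro that[of d']) (use d' in auto)
qed

lemma gap_const_slope:
  assumes "H1_on l r W k" "gap_const k" "q \<in> gaps E" "x \<in> gap q"
  shows "k x = slope W q"
proof -
  obtain c where c: "\<And>x. x \<in> gap q \<Longrightarrow> k x = c" using assms(2,3) unfolding gap_const_def by blast
  have "W (snd q) - W (fst q) = c * (snd q - fst q)"
    using gap_increment[OF assms(1,3)] set_integral_const_on_gap[OF assms(3) c] by simp
  then show ?thesis using c[OF assms(4)] gapD(1)[OF assms(3)] by (simp add: slope_def)
qed

lemma continuous_on_E_indicator:
  assumes "c \<notin> E" "d \<notin> E"
  shows "continuous_on E (indicator {c..d} :: real \<Rightarrow> real)"
proof (rule continuous_at_imp_continuous_on, rule ballI)
  fix x assume "x \<in> E"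
  then have "x \<noteq> c" "x \<noteq> d" using assms by auto
  then have "x \<notin> frontier {c..d}" by (cases "c \<le> d") (auto simp: frontier_def)
  then show "isCont (indicator {c..d} :: real \<Rightarrow> real) x" by (simp add: isCont_indicator)
qed

text \<open>The place where a step function jumps. Any point of the gap would serve, since the gap
  misses \<open>E\<close>.\<close>

definition mid :: "real \<times> real \<Rightarrow> real" where "mid q = (fst q + snd q) / 2"

lemma mid_in_gap: "q \<in> gaps E \<Longrightarrow> mid q \<in> gap q"
  using gapD(1)[of q] by (simp add: mid_def field_simps)

text \<open>A step located at \<open>mid p\<close> has an increment over the gap \<open>p\<close>
  and over no other gap.\<close>

lemma mid_le_iff:
  assumes q: "q \<in> gaps E" and p: "p \<in> gaps E"
  shows "mid p \<le> snd q \<longleftrightarrow> mid p \<le> fst q \<or> p = q"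
proof (cases "p = q")
  case True
  then show ?thesis using mid_in_gap[OF q] by simp
next
  case False
  have "mid p \<notin> gap q" using False gaps_disjoint mid_in_gap[OF p] p q unfolding disjoint_family_on_def by blast
  moreover have "mid p \<noteq> snd q" using mid_in_gap[OF p] gapD(3)[OF q] gapD(4)[OF p] by auto
  ultimately show ?thesis using False gapD(1)[OF q] by auto
qed

text \<open>The energy over the gaps is a convergent unordered sum, so finitely many of them carry
  all but \<open>\<delta>\<close> of it.\<close>

lemma finite_gap_tail_small:
  fixes h :: "real \<Rightarrow> real"
  assumes Q: "Q \<subseteq> gaps E" and h: "integrable lborel (\<lambda>x. (h x)\<^sup>2)" and "\<delta> > 0"
  obtains P where "finite P" "P \<subseteq> Q" "(LINT x:(\<Union>q\<in>Q - P. gap q)|lborel. (h x)\<^sup>2) \<le> \<delta>"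
proof -
  have cQ: "countable Q" using Q countable_gaps by (rule countable_subset)
  have disj: "disjoint_family_on gap S" if "S \<subseteq> Q" for S
    using gaps_disjoint Q that unfolding disjoint_family_on_def by blast
  have meas: "(\<Union>q\<in>S. gap q) \<in> sets borel" for S by (intro borel_open open_UN) auto
  have hs: "set_integrable lborel (\<Union>q\<in>S. gap q) (\<lambda>x. (h x)\<^sup>2)" for S
    using h meas by (intro set_integrable_of_integrable) auto
  have sum: "((\<lambda>q. LINT x:gap q|lborel. (h x)\<^sup>2) has_sum (LINT x:(\<Union>q\<in>Q. gap q)|lborel. (h x)\<^sup>2)) Q"
    using cQ disj[OF order_refl] hs by (intro set_integral_countable_has_sum) auto
  obtain P where P: "finite P" "P \<subseteq> Q"
    "dist (\<Sum>q\<in>P. LINT x:gap q|lborel. (h x)\<^sup>2) (LINT x:(\<Union>q\<in>Q. gap q)|lborel. (h x)\<^sup>2) \<le> \<delta>"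
    using has_sum_finite_approximation[OF sum \<open>\<delta> > 0\<close>] by (elim exE conjE) (rule that)
  have "(\<Sum>q\<in>P. LINT x:gap q|lborel. (h x)\<^sup>2) = (LINT x:(\<Union>q\<in>P. gap q)|lborel. (h x)\<^sup>2)"
  proof (rule set_integral_finite_UN_AE[symmetric, OF P(1)])
    show "set_integrable lborel (gap q) (\<lambda>x. (h x)\<^sup>2)" for q using h by (intro set_integrable_of_integrable) auto
    show "AE x in lborel. (x \<in> gap p \<and> x \<in> gap q) \<longrightarrow> p = q" if "p \<in> P" "q \<in> P" for p q
    proof (intro AE_I2 impI)
      fix x assume x: "x \<in> gap p \<and> x \<in> gap q"
      show "p = q"
      proof (rule ccontr)
        assume "p \<noteq> q"
        then have "gap p \<inter> gap q = {}" using disjoint_family_onD[OF disj[OF P(2)] that] by blast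
        then show False using x by blast
      qed
    qed
  qed simp
  moreover have "(LINT x:(\<Union>q\<in>Q. gap q)|lborel. (h x)\<^sup>2) = (LINT x:(\<Union>q\<in>P. gap q)|lborel. (h x)\<^sup>2) + (LINT x:(\<Union>q\<in>Q - P. gap q)|lborel. (h x)\<^sup>2)"
  proof -
    have eq: "(\<Union>q\<in>Q. gap q) = (\<Union>q\<in>P. gap q) \<union> (\<Union>q\<in>Q - P. gap q)" using P(2) by blast
    have "(\<Union>q\<in>P. gap q) \<inter> (\<Union>q\<in>Q - P. gap q) = {}"
    proof (rule equals0I)
      fix x assume "x \<in> (\<Union>q\<in>P. gap q) \<inter> (\<Union>q\<in>Q - P. gap q)"
      then obtain p q where pq: "p \<in> P" "x \<in> gap p" "q \<in> Q - P" "x \<in> gap q" by blast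
      then have "p \<in> Q" "q \<in> Q" "p \<noteq> q" using P(2) by auto
      then have "gap p \<inter> gap q = {}" by (rule disjoint_family_onD[OF disj[OF order_refl]])
      then show False using pq by blast
    qed
    then show ?thesis unfolding eq by (rule set_integral_Un) (rule hs)+
  qed
  ultimately have "(LINT x:(\<Union>q\<in>Q - P. gap q)|lborel. (h x)\<^sup>2) \<le> \<delta>" using P(3) by (simp add: dist_real_def)
  then show ?thesis using that P by blast
qed

lemma AE_I_cases_null:
  assumes null: "E \<in> null_sets lborel"
  shows "AE x in lborel. x \<in> I \<longrightarrow> (\<exists>q\<in>gaps E. x \<in> gap q)"
  using AE_not_in[OF null]
proof eventually_elim
  case (elim x)
  then show ?case using UN_gaps by blast
qed

text \<open>The step function jumps like \<open>f\<close> over the gaps in \<open>P\<close>. As \<open>E\<close> is null, the error is carried by the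
  remaining gaps inside \<open>[c, d]\<close>, apart from the gap around \<open>d\<close>, where the accumulated small
  error drops to \<open>0\<close>.\<close>

lemma step_approximation:
  assumes null: "E \<in> null_sets lborel"
    and X: "X \<subseteq> dom {}" "\<And>f g. f \<in> X \<Longrightarrow> g \<in> X \<Longrightarrow> (\<lambda>x. f x + g x) \<in> X" "\<And>f c. f \<in> X \<Longrightarrow> (\<lambda>x. c * f x) \<in> X"
      "\<And>c d. c \<notin> E \<Longrightarrow> d \<notin> E \<Longrightarrow> lo c \<Longrightarrow> hi d \<Longrightarrow> indicator {c..d} \<in> X"
    and f: "f \<in> dom {}" "continuous_on E f" and cd: "c \<notin> E" "d \<notin> E" "lo c" "hi d"
    and f0: "\<And>x. x \<in> E - {c..d} \<Longrightarrow> f x = 0" and p: "p \<in> E" "p \<in> {c..d}" "\<And>x. x \<in> E \<Longrightarrow> x \<in> {c..d} \<Longrightarrow> p \<le> x"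
    and "\<epsilon> > 0"
  shows "\<exists>u\<in>X. energy (\<lambda>x. f x - u x) < \<epsilon>"
proof -
  obtain F h where F: "rep f F h" "gap_const h" by (rule dom_gap_const0[OF f(1)])
  have FH: "H1_on l r F h" and fF_AE: "AE x in \<mu>. f x = F x" using F by (auto simp: rep_def)
  note H = H1_onD[OF FH]
  have fF: "f x = F x" if "x \<in> E" for x
    using eq_on_E_of_AE[OF fF_AE f(2) _ that] continuous_on_subset[OF H1_on_continuous[OF FH] E_subset_J] by blast
  define Q where "Q = {q\<in>gaps E. c < fst q \<and> snd q < d}"
  have Qg: "Q \<subseteq> gaps E" by (auto simp: Q_def)
  \<comment> \<open>At most one gap contains \<open>d\<close>. \<open>G0\<close> is that gap and
    \<open>\<kappa>\<close> a lower bound for its length, or the empty set and 1 if there is none.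
    Both are fixed before \<open>\<delta>\<close>.\<close>
  have "\<exists>\<kappa>>0. \<exists>G0. G0 \<in> sets lborel \<and> emeasure lborel G0 < \<infinity> \<and> (\<forall>q\<in>gaps E. d \<in> gap q \<longrightarrow> gap q = G0 \<and> \<kappa> \<le> snd q - fst q)"
  proof (cases "\<exists>q\<in>gaps E. d \<in> gap q")
    case True
    then obtain q0 where q0: "q0 \<in> gaps E" "d \<in> gap q0" by blast
    have "q = q0" if "q \<in> gaps E" "d \<in> gap q" for q
      using gaps_disjoint q0 that unfolding disjoint_family_on_def by blast
    then show ?thesis using gapD(1)[OF q0(1)]
      by (intro exI[of _ "snd q0 - fst q0"] conjI exI[of _ "gap q0"]) auto
  next
    case False
    then show ?thesis by (intro exI[of _ 1] conjI exI[of _ "{}"]) auto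
  qed
  then obtain \<kappa> G0 where \<kappa>: "\<kappa> > 0" and G0: "G0 \<in> sets lborel" "emeasure lborel G0 < \<infinity>"
    "\<And>q. q \<in> gaps E \<Longrightarrow> d \<in> gap q \<Longrightarrow> gap q = G0 \<and> \<kappa> \<le> snd q - fst q" by blast
  let ?K = "E \<inter> {c..d}"
  have K: "compact ?K" by (rule compact_E_lo_hi[OF cd(3,4)])
  have Kb: "?K \<in> sets borel" by simp
  have "c \<le> d" using p(2) by simp
  define C where "C = (d - c) / \<kappa>\<^sup>2"
  have "C \<ge> 0" using \<open>c \<le> d\<close> by (simp add: C_def)
  \<comment> \<open>Collects the errors per unit of \<open>\<delta>\<close>: 1 for the gaps left
    out, \<open>C\<close> times the length of the gap at \<open>d\<close> for the final drop, and
    \<open>(d - c)\<close> times the mass of \<open>E \<inter> {c..d}\<close> for the L2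
    part.\<close>
  define const where "const = 1 + C * measure lborel G0 + (d - c) * measure \<mu> ?K"
  have const: "const > 0" using \<open>C \<ge> 0\<close> \<open>c \<le> d\<close> unfolding const_def by (intro add_pos_nonneg mult_nonneg_nonneg) auto
  define \<delta> where "\<delta> = \<epsilon> / (2 * const)"
  have \<delta>: "\<delta> > 0" "\<delta> * const < \<epsilon>" using const \<open>\<epsilon> > 0\<close> by (auto simp: \<delta>_def)
  obtain P where P: "finite P" "P \<subseteq> Q" and tail: "(LINT x:(\<Union>q\<in>Q - P. gap q)|lborel. (h x)\<^sup>2) \<le> \<delta>"
    by (rule finite_gap_tail_small[OF Qg H(3) \<delta>(1)])
  define R where "R = (\<Union>q\<in>Q - P. gap q)"
  have R: "R \<in> sets borel" unfolding R_def by (intro borel_open open_UN) auto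
  \<comment> \<open>Starts from the value at \<open>p\<close>, the first point of \<open>E\<close>
    in [c, d], and adds the jumps of \<open>f\<close> over the gaps in \<open>P\<close>. All steps
    end at the common cut \<open>d\<close>.\<close>
  define u where "u x = f p * indicator {c..d} x + (\<Sum>q\<in>P. (f (snd q) - f (fst q)) * indicator {mid q..d} x)" for x
  have midE: "mid q \<notin> E" if "q \<in> gaps E" for q using mid_in_gap[OF that] gapD(4)[OF that] by blast
  have mid_lo: "lo (mid q)" if "q \<in> gaps E" for q
    by (rule lo_of_less) (use mid_in_gap[OF that] gapD(5)[OF that] in \<open>auto simp: open_lr_def\<close>)
  have uX: "u \<in> X"
  proof -
    have zero: "(\<lambda>x. 0) \<in> X" using X(3)[OF X(4)[OF cd], of 0] by simp
    have "(\<lambda>x. \<Sum>q\<in>S. (f (snd q) - f (fst q)) * indicator {mid q..d} x) \<in> X" if "S \<subseteq> P" for S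
      using finite_subset[OF that P(1)] that
    proof (induction S rule: finite_induct)
      case empty
      then show ?case using zero by simp
    next
      case (insert q S)
      then have "q \<in> gaps E" using P(2) Qg by auto
      then have "(\<lambda>x. (f (snd q) - f (fst q)) * indicator {mid q..d} x) \<in> X"
        using midE mid_lo cd by (intro X(3,4)) auto
      moreover have "(\<lambda>x. \<Sum>q\<in>S. (f (snd q) - f (fst q)) * indicator {mid q..d} x) \<in> X" using insert by simp
      ultimately show ?case unfolding sum.insert[OF insert(1,2)] by (rule X(2))
    qed
    then show ?thesis unfolding u_def[abs_def] using X(2)[OF X(3)[OF X(4)[OF cd], of "f p"]] by blast
  qed
  have contu: "continuous_on E u"
    unfolding u_def[abs_def] using midE P(2) Qg cd
    by (intro continuous_intros continuous_on_E_indicator) auto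
  have mid_gt: "p < mid q" "c < mid q" if "q \<in> Q" for q
  proof -
    have q: "q \<in> gaps E" "c < fst q" "snd q < d" using that by (auto simp: Q_def)
    then have "p \<le> fst q" using p(3)[of "fst q"] gapD(1,2)[OF q(1)] by auto
    then show "p < mid q" "c < mid q" using mid_in_gap[OF q(1)] q(2) by auto
  qed
  have u0: "u x = 0" if "x \<in> E - {c..d}" for x
    using that mid_gt(2) P(2) unfolding u_def by (auto intro!: sum.neutral simp: indicator_def) (meson less_le_trans not_less order_less_imp_le subsetD)
  have uD: "u \<in> dom {}" using uX X(1) by blast
  have wD: "(\<lambda>x. f x - u x) \<in> dom {}" by (rule dom_diff[OF f(1) uD])
  obtain W k where W: "rep (\<lambda>x. f x - u x) W k" "gap_const k" by (rule dom_gap_const0[OF wD])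
  have WH: "H1_on l r W k" and wW: "AE x in \<mu>. f x - u x = W x" using W by (auto simp: rep_def)
  note KH = H1_onD[OF WH]
  have Wv: "W x = f x - u x" if "x \<in> E" for x
    using eq_on_E_of_AE[OF wW _ _ that] continuous_on_diff[OF f(2) contu] continuous_on_subset[OF H1_on_continuous[OF WH] E_subset_J] by simp
  have Wout: "W x = 0" if "x \<in> E - {c..d}" for x using Wv[of x] f0[OF that] u0[OF that] that by simp
  have Wp: "W p = 0"
  proof -
    have "(\<Sum>q\<in>P. (f (snd q) - f (fst q)) * indicator {mid q..d} p) = 0"
      using mid_gt(1) P(2) by (intro sum.neutral) (auto simp: indicator_def not_le[symmetric] dest: subsetD)
    then show ?thesis using Wv[OF p(1)] p(2) by (simp add: u_def)
  qed
  \<comment> \<open>Over a gap inside (c, d) the step function reproduces the jump of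
    \<open>f\<close> if the gap is in \<open>P\<close> and is flat otherwise, so the error has slope
    0 or that of \<open>F\<close>.\<close>
  have kQ: "k x = (if q \<in> P then 0 else h x)" if q: "q \<in> Q" "x \<in> gap q" for q x
  proof -
    have g: "q \<in> gaps E" "c < fst q" "snd q < d" using q by (auto simp: Q_def)
    have lt: "fst q < snd q" by (rule gapD(1)[OF g(1)])
    have "indicator {mid p..d} (snd q) - indicator {mid p..d} (fst q) = (if p = q then 1 else 0 :: real)" if "p \<in> P" for p
    proof -
      have "p \<in> gaps E" using that P(2) Qg by blast
      then have "mid p \<le> snd q \<longleftrightarrow> mid p \<le> fst q \<or> p = q" "p = q \<Longrightarrow> \<not> mid p \<le> fst q"
        using mid_le_iff[OF g(1)] mid_in_gap[OF g(1)] by auto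
      then show ?thesis using g lt by (auto simp: indicator_def)
    qed
    then have "(f (snd p) - f (fst p)) * indicator {mid p..d} (snd q) - (f (snd p) - f (fst p)) * indicator {mid p..d} (fst q)
        = (if p = q then f (snd q) - f (fst q) else 0)" if "p \<in> P" for p
      using that by (simp flip: right_diff_distrib)
    then have "u (snd q) - u (fst q) = (\<Sum>p\<in>P. if p = q then f (snd q) - f (fst q) else 0)"
      using g lt by (simp add: u_def flip: sum_subtractf)
    also have "\<dots> = (if q \<in> P then f (snd q) - f (fst q) else 0)" using P(1) by simp
    finally have du: "u (snd q) - u (fst q) = (if q \<in> P then f (snd q) - f (fst q) else 0)" .
    have E: "fst q \<in> E" "snd q \<in> E" using gapD[OF g(1)] by auto
    have "slope W q = (if q \<in> P then 0 else slope F q)"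
      using du lt Wv[OF E(1)] Wv[OF E(2)] fF[OF E(1)] fF[OF E(2)] by (auto simp: slope_def)
    then show ?thesis
      using gap_const_slope[OF WH W(2) g(1) q(2)] gap_const_slope[OF FH F(2) g(1) q(2)] by simp
  qed
  have kR: "(k x)\<^sup>2 \<le> indicator R x * (h x)\<^sup>2" if "q \<in> Q" "x \<in> gap q" for q x
    using kQ[OF that] that by (auto simp: R_def indicator_def)
  have IR: "integrable lborel (\<lambda>x. indicator R x * (h x)\<^sup>2)"
    using set_integrable_of_integrable[OF H(3), of R] R by (simp add: set_integrable_def)
  have tailR: "(\<integral>x. indicator R x * (h x)\<^sup>2 \<partial>lborel) \<le> \<delta>"
    using tail unfolding R_def[symmetric] set_lebesgue_integral_def by simp
  have Wbound: "(W x)\<^sup>2 \<le> (d - c) * \<delta>" if x: "x \<in> E" "x \<in> {c..d}" for x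
  proof -
    have px: "p \<le> x" by (rule p(3)[OF x])
    have "(W x - W p)\<^sup>2 \<le> (x - p) * (LINT t:{p..x}|lborel. (k t)\<^sup>2)"
      using H1_on_increment_le[OF WH _ px] E_bounds[OF p(1)] E_bounds[OF x(1)] by simp
    also have "(LINT t:{p..x}|lborel. (k t)\<^sup>2) \<le> (\<integral>x. indicator R x * (h x)\<^sup>2 \<partial>lborel)"
      unfolding set_lebesgue_integral_def
    proof (rule integral_mono_AE)
      show "integrable lborel (\<lambda>t. indicat_real {p..x} t *\<^sub>R (k t)\<^sup>2)"
        using set_integrable_of_integrable[OF KH(3), of "{p..x}"] by (simp add: set_integrable_def)
      show "AE t in lborel. indicat_real {p..x} t *\<^sub>R (k t)\<^sup>2 \<le> indicat_real R t * (h t)\<^sup>2"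
        using AE_I_cases_null[OF null]
      proof eventually_elim
        case (elim t)
        show ?case
        proof (cases "t \<in> {p..x} \<and> t \<in> I")
          case True
          then obtain q where q: "q \<in> gaps E" "t \<in> gap q" using elim by blast
          have "t \<noteq> p" "t \<noteq> x" using q gapD(4)[OF q(1)] p(1) x(1) by auto
          then have "t \<in> gap q \<inter> {p<..<x}" using True q by auto
          then have "p \<le> fst q" "snd q \<le> x" using gap_inside_or_outside[OF q(1) p(1) x(1)] by blast+
          moreover have "c < p" "x < d" using p x cd by (auto simp: order_less_le)
          ultimately have "q \<in> Q" using q(1) by (auto simp: Q_def)
          then show ?thesis using kR[OF _ q(2)] True by simp
        next
          case False
          then show ?thesis using KH(2)[of t] by (cases "t \<in> {p..x}") auto
        qed
      qed
    qed (rule IR)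
    also have "(x - p) * (\<integral>x. indicator R x * (h x)\<^sup>2 \<partial>lborel) \<le> (d - c) * \<delta>"
      using tailR x p(2) px \<delta>(1) by (intro mult_mono) auto
    finally show ?thesis using Wp px by (simp add: mult_left_mono)
  qed
  \<comment> \<open>A gap not inside (c, d) lies off [c, d], or contains \<open>c\<close>, or
    contains \<open>d\<close>. In the second case its right end is \<open>p\<close>, where the error
    is 0 as it is at the left end. In the third the error falls from at most the square root of
    \<open>(d - c) * \<delta>\<close> to 0 across a length of at least
    \<open>\<kappa>\<close>.\<close>
  have kout: "k x = 0 \<or> (d \<in> gap q \<and> (k x)\<^sup>2 \<le> C * \<delta>)" if q: "q \<in> gaps E" "q \<notin> Q" "x \<in> gap q" for q x
  proof -
    note g = gapD(1-3)[OF q(1)]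
    have kx: "k x = (W (snd q) - W (fst q)) / (snd q - fst q)"
      using gap_const_slope[OF WH W(2) q(1,3)] by (simp add: slope_def)
    have ne: "fst q \<noteq> c" "fst q \<noteq> d" "snd q \<noteq> c" "snd q \<noteq> d" using g cd by auto
    show ?thesis
    proof (cases "snd q < c \<or> d < fst q")
      case True
      then have "W (fst q) = 0" "W (snd q) = 0" using g by (auto intro!: Wout)
      then show ?thesis using kx by simp
    next
      case False
      then have cs: "c < snd q" "fst q < d" using ne by auto
      show ?thesis
      proof (cases "c < fst q")
        case True
        then have dg: "d \<in> gap q" using q cs ne by (auto simp: Q_def)
        then have "W (snd q) = 0" using g by (auto intro!: Wout)
        moreover have "(W (fst q))\<^sup>2 \<le> (d - c) * \<delta>" using True cs g by (intro Wbound) auto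
        moreover have len: "\<kappa> \<le> snd q - fst q" using G0(3)[OF q(1) dg] by simp
        ultimately have "(k x)\<^sup>2 \<le> ((d - c) * \<delta>) / (snd q - fst q)\<^sup>2"
          unfolding kx by (simp add: power_divide divide_right_mono)
        also have "\<dots> \<le> ((d - c) * \<delta>) / \<kappa>\<^sup>2"
          using len \<kappa> \<open>c \<le> d\<close> \<delta>(1) by (intro divide_left_mono power_mono mult_pos_pos) auto
        also have "\<dots> = C * \<delta>" by (simp add: C_def)
        finally show ?thesis using dg by blast
      next
        case cf: False
        then have fc: "fst q < c" using ne by auto
        have pq: "p \<notin> gap q" using p(1) gapD(4)[OF q(1)] by auto
        then have sp: "snd q \<le> p" using fc p(2) by auto
        then have "p \<le> snd q" using p(2) cs g by (intro p(3)) auto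
        then have "W (snd q) = 0" using sp Wp by simp
        moreover have "W (fst q) = 0" using fc g by (intro Wout) auto
        ultimately show ?thesis using kx by simp
      qed
    qed
  qed
  have IG: "integrable lborel (\<lambda>x. C * \<delta> * indicator G0 x)"
    using G0(1,2) by (intro integrable_mult_right integrable_real_indicator)
  have "(\<integral>x. (k x)\<^sup>2 \<partial>lborel) \<le> (\<integral>x. indicator R x * (h x)\<^sup>2 + C * \<delta> * indicator G0 x \<partial>lborel)"
  proof (rule integral_mono_AE[OF KH(3)])
    show "AE x in lborel. (k x)\<^sup>2 \<le> indicat_real R x * (h x)\<^sup>2 + C * \<delta> * indicat_real G0 x"
      using AE_I_cases_null[OF null]
    proof eventually_elim
      case (elim x)
      have nn: "0 \<le> indicat_real R x * (h x)\<^sup>2" "0 \<le> C * \<delta> * indicat_real G0 x"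
        using \<open>C \<ge> 0\<close> \<delta>(1) by auto
      show ?case
      proof (cases "x \<in> I")
        case True
        then obtain q where q: "q \<in> gaps E" "x \<in> gap q" using elim by blast
        show ?thesis
        proof (cases "q \<in> Q")
          case True
          then show ?thesis using kR[OF True q(2)] nn by linarith
        next
          case False
          consider "k x = 0" | "d \<in> gap q" "(k x)\<^sup>2 \<le> C * \<delta>" using kout[OF q(1) False q(2)] by blast
          then show ?thesis
          proof cases
            case 2
            then have "x \<in> G0" using G0(3)[OF q(1)] q(2) by blast
            then have "C * \<delta> * indicat_real G0 x = C * \<delta>" by simp
            then show ?thesis using 2(2) nn(1) by linarith
          qed (use nn in simp)
        qed
      next
        case False
        then show ?thesis using KH(2)[of x] nn by simp
      qed
    qed
  qed (intro Bochner_Integration.integrable_add IR IG)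
  also have "\<dots> = (\<integral>x. indicator R x * (h x)\<^sup>2 \<partial>lborel) + C * \<delta> * measure lborel G0"
    using IR IG by (subst Bochner_Integration.integral_add) auto
  also have "\<dots> \<le> \<delta> + C * \<delta> * measure lborel G0" using tailR by simp
  finally have 1: "(\<integral>x. (k x)\<^sup>2 \<partial>lborel) \<le> \<delta> + C * \<delta> * measure lborel G0" .
  have nonneg: "0 \<le> (\<integral>x. (k x)\<^sup>2 \<partial>lborel)" by simp
  have fin: "emeasure \<mu> ?K < \<infinity>" using emeasure_compact_finite[OF K] by simp
  have iK: "integrable \<mu> (\<lambda>x. (d - c) * \<delta> * indicator ?K x)"
    using fin Kb by (intro integrable_mult_right integrable_real_indicator) auto
  have "(\<integral>x. (f x - u x)\<^sup>2 \<partial>\<mu>) \<le> (\<integral>x. (d - c) * \<delta> * indicator ?K x \<partial>\<mu>)"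
  proof (rule integral_mono_AE[OF L2D(3)[OF dom_L2[OF wD]] iK])
    show "AE x in \<mu>. (f x - u x)\<^sup>2 \<le> (d - c) * \<delta> * indicat_real ?K x"
      using AE_mu_E
    proof eventually_elim
      case (elim x)
      show ?case
      proof (cases "x \<in> {c..d}")
        case True
        then show ?thesis using Wbound[OF elim True] Wv[OF elim] elim by simp
      next
        case False
        then show ?thesis using Wout[of x] Wv[OF elim] elim by simp
      qed
    qed
  qed
  also have "\<dots> = (d - c) * \<delta> * measure \<mu> ?K" by simp
  finally have 2: "(\<integral>x. (f x - u x)\<^sup>2 \<partial>\<mu>) \<le> (d - c) * \<delta> * measure \<mu> ?K" .
  have "energy (\<lambda>x. f x - u x) \<le> (\<delta> + C * \<delta> * measure lborel G0) + (d - c) * \<delta> * measure \<mu> ?K"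
    using qd_form_bounds(2)[OF W(1)] 1 2 nonneg unfolding E1_def by linarith
  also have "\<dots> = \<delta> * const" by (simp add: const_def algebra_simps)
  finally show ?thesis using \<delta>(2) uX by (intro bexI[of _ u]) auto
qed

section \<open>Fukushima subspaces: closedness and step functions\<close>

lemma dirichlet_form_minus:
  assumes D: "dirichlet_form \<mu> \<E>' \<F>'" and "f \<in> \<F>'" "g \<in> \<F>'"
  shows "(\<lambda>x. f x - g x) \<in> \<F>'"
proof -
  have add: "\<forall>f\<in>\<F>'. \<forall>g\<in>\<F>'. (\<lambda>x. f x + g x) \<in> \<F>'" and cmult: "\<forall>f\<in>\<F>'. \<forall>c. (\<lambda>x. c * f x) \<in> \<F>'"
    using D unfolding dirichlet_form_def by simp_all
  have "(\<lambda>x. - 1 * g x) \<in> \<F>'" by (rule spec[OF bspec[OF cmult assms(3)]])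
  then have "(\<lambda>x. f x + - 1 * g x) \<in> \<F>'" by (rule bspec[OF bspec[OF add assms(2)]])
  then show ?thesis by simp
qed

text \<open>An approximating sequence is Cauchy in the inner form, which agrees with the outer one
  on differences of members. Closedness yields a limit \<open>v\<close> in the subspace; uniqueness
  of limits gives \<open>v = f\<close> almost everywhere, and saturation under null sets does the
  rest.\<close>

lemma fukushima_closed:
  assumes D: "dirichlet_form \<mu> \<E>' \<F>'" and sub: "\<F>' \<subseteq> dom {}" and eq: "\<And>f g. f \<in> \<F>' \<Longrightarrow> g \<in> \<F>' \<Longrightarrow> \<E>' f g = qd_form E \<mu> f g"
    and f: "f \<in> dom {}" and approx: "\<And>\<epsilon>. \<epsilon> > 0 \<Longrightarrow> \<exists>g\<in>\<F>'. energy (\<lambda>x. f x - g x) < \<epsilon>"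
  shows "f \<in> \<F>'"
proof -
  have sat: "\<forall>f\<in>\<F>'. \<forall>g\<in>L2 \<mu>. (AE x in \<mu>. f x = g x) \<longrightarrow> g \<in> \<F>'"
    and closed: "\<forall>u::nat \<Rightarrow> real \<Rightarrow> real. (\<forall>n. u n \<in> \<F>') \<and>
        (\<forall>\<epsilon>>0. \<exists>N. \<forall>n\<ge>N. \<forall>m\<ge>N. E1 \<mu> \<E>' (\<lambda>x. u n x - u m x) < \<epsilon>)
        \<longrightarrow> (\<exists>v\<in>\<F>'. (\<lambda>n. E1 \<mu> \<E>' (\<lambda>x. u n x - v x)) \<longlonglongrightarrow> 0)"
    using D unfolding dirichlet_form_def by simp_all
  have E1_eq: "E1 \<mu> \<E>' (\<lambda>x. p x - q x) = energy (\<lambda>x. p x - q x)" if "p \<in> \<F>'" "q \<in> \<F>'" for p q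
    using eq dirichlet_form_minus[OF D that] by (simp add: E1_def)
  have "\<exists>g\<in>\<F>'. energy (\<lambda>x. f x - g x) < inverse (Suc n)" for n by (rule approx) simp
  then obtain u where u: "\<And>n. u n \<in> \<F>'" "\<And>n. energy (\<lambda>x. f x - u n x) < inverse (Suc n)" by metis
  have uD: "u n \<in> dom {}" for n using u sub by blast
  have u2: "energy (\<lambda>x. u n x - f x) < inverse (Suc n)" for n using u(2) E1_swap[OF f uD] by simp
  have "\<exists>N. \<forall>n\<ge>N. \<forall>m\<ge>N. E1 \<mu> \<E>' (\<lambda>x. u n x - u m x) < \<epsilon>" if "\<epsilon> > 0" for \<epsilon>
  proof -
    have "\<epsilon> / 4 > 0" using that by simp
    then obtain N :: nat where N: "inverse (Suc N) < \<epsilon> / 4" using reals_Archimedean by blast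
    have small: "energy (\<lambda>x. u n x - f x) < \<epsilon> / 4" if "n \<ge> N" for n
    proof -
      have "inverse (real (Suc n)) \<le> inverse (Suc N)" using that by (intro le_imp_inverse_le) auto
      then show ?thesis using u2[of n] N by linarith
    qed
    have "E1 \<mu> \<E>' (\<lambda>x. u n x - u m x) < \<epsilon>" if "n \<ge> N" "m \<ge> N" for n m
      unfolding E1_eq[OF u(1) u(1)]
      using E1_diff_le[OF uD uD f, of n m] small[OF that(1)] small[OF that(2)] by linarith
    then show ?thesis by blast
  qed
  then obtain v where v: "v \<in> \<F>'" "(\<lambda>n. E1 \<mu> \<E>' (\<lambda>x. u n x - v x)) \<longlonglongrightarrow> 0"
    using closed u(1) by blast
  have vD: "v \<in> dom {}" using v(1) sub by blast
  have fvD: "(\<lambda>x. f x - v x) \<in> dom {}" by (rule dom_diff[OF f vD])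
  have "(\<lambda>n. 2 * inverse (Suc n) + 2 * E1 \<mu> \<E>' (\<lambda>x. u n x - v x)) \<longlonglongrightarrow> 2 * 0 + 2 * 0"
    by (intro tendsto_intros v(2) LIMSEQ_inverse_real_of_nat)
  moreover have "energy (\<lambda>x. f x - v x) \<le> 2 * inverse (Suc n) + 2 * E1 \<mu> \<E>' (\<lambda>x. u n x - v x)" for n
  proof -
    have "energy (\<lambda>x. v x - u n x) = E1 \<mu> \<E>' (\<lambda>x. u n x - v x)"
      using E1_swap[OF vD uD] E1_eq[OF u(1) v(1)] by simp
    then show ?thesis using E1_diff_le[OF f vD uD, of n] u(2)[of n] by linarith
  qed
  ultimately have "energy (\<lambda>x. f x - v x) \<le> 2 * 0 + 2 * 0"
    by (intro LIMSEQ_le_const[of _ "2 * 0 + 2 * 0 :: real"]) auto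
  then have "(\<integral>x. (f x - v x)\<^sup>2 \<partial>\<mu>) \<le> 0" using qd_form_nonneg[OF fvD] by (simp add: E1_def)
  moreover have "0 \<le> (\<integral>x. (f x - v x)\<^sup>2 \<partial>\<mu>)" by simp
  ultimately have "(\<integral>x. (f x - v x)\<^sup>2 \<partial>\<mu>) = 0" by linarith
  then have "AE x in \<mu>. (f x - v x)\<^sup>2 = 0"
    using integral_nonneg_eq_0_iff_AE[OF L2D(3)[OF dom_L2[OF fvD]]] by simp
  then have "AE x in \<mu>. v x = f x" by eventually_elim simp
  then show ?thesis using sat v(1) dom_L2[OF f] by blast
qed

text \<open>A function within \<open>1/4\<close> of an indicator becomes that indicator under the difference
  quotient of the truncations at the levels \<open>3/4\<close> and \<open>1/4\<close>.\<close>

lemma fukushima_indicator: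
  assumes D: "regular_dirichlet_form E \<mu> \<E>' \<F>'" and cd: "c \<notin> E" "d \<notin> E" "lo c" "hi d"
  shows "indicator {c..d} \<in> \<F>'"
proof -
  define \<phi> where "\<phi> = (indicator {c..d} :: real \<Rightarrow> real)"
  have sat: "\<forall>f\<in>\<F>'. \<forall>g\<in>L2 \<mu>. (AE x in \<mu>. f x = g x) \<longrightarrow> g \<in> \<F>'"
    and cmult: "\<forall>f\<in>\<F>'. \<forall>c. (\<lambda>x. c * f x) \<in> \<F>'"
    and unit: "\<forall>f\<in>\<F>'. (\<lambda>x. min 1 (max 0 (f x))) \<in> \<F>'"
    and uniform: "\<forall>f\<in>Cc E. \<forall>\<epsilon>>0. \<exists>g\<in>\<F>' \<inter> Cc E. \<forall>x\<in>E. \<bar>f x - g x\<bar> < \<epsilon>"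
    using D unfolding regular_dirichlet_form_def dirichlet_form_def by simp_all
  have K: "compact (E \<inter> {c..d})" by (rule compact_E_lo_hi[OF cd(3,4)])
  have "\<phi> \<in> Cc E"
    unfolding Cc_def \<phi>_def using continuous_on_E_indicator[OF cd(1,2)] K
    by (intro CollectI conjI exI[of _ "E \<inter> {c..d}"]) auto
  then obtain g where g: "g \<in> \<F>'" "\<forall>x\<in>E. \<bar>\<phi> x - g x\<bar> < 1/4"
    using uniform[rule_format, of \<phi> "1/4"] by auto
  \<comment> \<open>Truncation at a level \<open>a\<close> is \<open>a\<close> times the unit
    contraction of \<open>g / a\<close>; dividing the difference for 3/4 and 1/4 by 1/2 gives the
    factors 3/2 and 1/2. Below 1/4 the two terms cancel, above 3/4 they give 1.\<close>
  define w where "w x = 3/2 * min 1 (max 0 (4/3 * g x)) - 1/2 * min 1 (max 0 (4 * g x))" for x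
  have "w \<in> \<F>'"
    unfolding w_def[abs_def]
    using D by (intro dirichlet_form_minus[of \<E>'] cmult[rule_format] unit[rule_format] g(1)) (simp add: regular_dirichlet_form_def)
  moreover have "\<phi> \<in> L2 \<mu>"
    unfolding \<phi>_def
    by (rule L2_of_bounded_support[OF borel_measurable_indicator K, of _ 1]) (auto simp: indicator_def)
  moreover have "w x = \<phi> x" if "x \<in> E" for x
  proof -
    have "\<phi> x - 1/4 < g x" "g x < \<phi> x + 1/4" using g(2)[rule_format, OF that] by linarith+
    then show ?thesis by (cases "x \<in> {c..d}") (auto simp: \<phi>_def w_def min_def max_def)
  qed
  then have "AE x in \<mu>. w x = \<phi> x" using AE_mu_E by (auto elim!: eventually_mono)
  ultimately have "\<phi> \<in> \<F>'" using sat by blast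
  then show ?thesis by (simp add: \<phi>_def)
qed

theorem no_proper_subspace_of_null:
  assumes null: "E \<in> null_sets lborel" and F: "fukushima_subspace E \<mu> (qd_form E \<mu>) (qd_domain E \<mu>) \<E>' \<F>'"
  shows "\<F>' = qd_domain E \<mu>"
proof
  have reg: "regular_dirichlet_form E \<mu> \<E>' \<F>'" and sub: "\<F>' \<subseteq> dom {}"
    and eq: "\<And>f g. f \<in> \<F>' \<Longrightarrow> g \<in> \<F>' \<Longrightarrow> \<E>' f g = qd_form E \<mu> f g"
    using F unfolding fukushima_subspace_def qd_domain_eq by blast+
  have D: "dirichlet_form \<mu> \<E>' \<F>'" using reg by (simp add: regular_dirichlet_form_def)
  have lin: "\<And>f g. f \<in> \<F>' \<Longrightarrow> g \<in> \<F>' \<Longrightarrow> (\<lambda>x. f x + g x) \<in> \<F>'" "\<And>f c. f \<in> \<F>' \<Longrightarrow> (\<lambda>x. c * f x) \<in> \<F>'"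
    and zero: "(\<lambda>x. 0) \<in> \<F>'" and sat: "\<forall>f\<in>\<F>'. \<forall>g\<in>L2 \<mu>. (AE x in \<mu>. f x = g x) \<longrightarrow> g \<in> \<F>'"
    using D unfolding dirichlet_form_def by simp_all
  have compact_case: "g \<in> \<F>'"
    if g: "g \<in> dom {}" "continuous_on E g" and cd: "lo c" "hi d" "\<forall>x\<in>E - {c..d}. g x = 0" for g c d
  proof -
    obtain c' where c': "c' \<le> c" "c' \<notin> E" "lo c'" by (rule exists_cut_below[OF null cd(1)])
    obtain d' where d': "d \<le> d'" "d' \<notin> E" "hi d'" by (rule exists_cut_above[OF null cd(2)])
    have g0: "g x = 0" if "x \<in> E - {c'..d'}" for x using cd(3) that c'(1) d'(1) by auto
    show ?thesis
    proof (cases "E \<inter> {c'..d'} = {}")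
      case True
      \<comment> \<open>With no point of \<open>E\<close> between the cuts, \<open>g\<close>
        vanishes on \<open>E\<close> and belongs to the subspace by saturation.\<close>
      then have "0 = g x" if "x \<in> E" for x by (intro g0[symmetric]) (use that in auto)
      then have "AE x in \<mu>. 0 = g x" by (rule eventually_mono[OF AE_mu_E])
      then show ?thesis by (rule sat[rule_format, OF zero dom_L2[OF g(1)]])
    next
      case False
      then obtain p where p: "p \<in> E \<inter> {c'..d'}" "\<forall>x\<in>E \<inter> {c'..d'}. p \<le> x"
        using compact_attains_inf[OF compact_E_lo_hi[OF c'(3) d'(3)]] by blast
      show ?thesis
      proof (rule fukushima_closed[OF D sub eq g(1)])
        show "\<exists>u\<in>\<F>'. energy (\<lambda>x. g x - u x) < \<epsilon>" if "\<epsilon> > 0" for \<epsilon>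
          by (rule step_approximation[OF null sub lin fukushima_indicator[OF reg] g c'(2) d'(2) c'(3) d'(3) g0 _ _ _ that, of p])
             (use p in auto)
      qed
    qed
  qed
  obtain m where m: "l < ereal m" "ereal m < r" using ereal_dense2[OF l_less_r] by blast
  show "qd_domain E \<mu> \<subseteq> \<F>'"
    unfolding qd_domain_eq
  proof
    fix f assume f: "f \<in> dom {}"
    show "f \<in> \<F>'"
    proof (rule fukushima_closed[OF D sub eq f])
      \<comment> \<open>Here \<open>B\<close> is empty and the interval degenerates to the point
        \<open>m\<close>, so the cuts may lie anywhere on either side of it.\<close>
      show "\<exists>g\<in>\<F>'. energy (\<lambda>x. f x - g x) < \<epsilon>" if "\<epsilon> > 0" for \<epsilon>
        using dom_core_dense[OF f empty_subsetI order_refl m that] compact_case by blast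
    qed
  qed
  show "\<F>' \<subseteq> qd_domain E \<mu>" using sub by (simp add: qd_domain_eq)
qed

end

theorem theorem5p4:
  fixes E :: "real set" and \<mu> :: "real measure"
  assumes "class_K E" and "radon_on E \<mu>" and "full_support E \<mu>"
  shows "(\<not> (\<exists>\<E>' \<F>'. proper_fukushima_subspace E \<mu> (qd_form E \<mu>) (qd_domain E \<mu>) \<E>' \<F>'))
         \<longleftrightarrow> E \<in> null_sets lborel"
proof -
  interpret quasidiffusion E \<mu> by (rule quasidiffusion.intro[OF assms])
  show ?thesis
    using proper_subspace_of_not_null no_proper_subspace_of_null
    unfolding proper_fukushima_subspace_def by blast
qed
end
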